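(* Let $u\in V$ be the solution of the frictional contact problem $$a(u,v-u)+j(v)-j(u)\ge (f,v-u)\qquad\forall\, v\in V,$$ and let $u_h\in V_h$ be the solution of the local discontinuous Galerkin (LDG) scheme $$B_h(u_h,v_h-u_h)+j(v_h)-j(u_h)\ge (f,v_h-u_h)\qquad\forall\, v_h\in V_h .$$ Let $\lambda,\lambda_h\in L^\infty(\Gamma_2)$ be the corresponding Lagrange multipliers. For $K\in\mathcal T_h$ let $$\eta_K=\Big(h_K^2\|R_K\|_K^2+\tfrac12\sum_{e\in\partial K\cap\mathcal E_h^i}h_e\|R_e\|_e^2+\sum_{e\in\partial K\cap\mathcal E_h^2}h_e\|R_e\|_e^2\Big)^{1/2},$$ with $R_K=\Delta u_h-u_h+f$ on $K\in\mathcal T_h$, $R_e=[\nabla_h u_h]$ on $e\in\mathcal E_h^i$, and $R_e=\nabla_h u_h\cdot\boldsymbol n+g\lambda_h$ on $e\in\mathcal E_h^2$. Then, for every $K\in\mathcal T_h$, $$\eta_K\le C\left(\|u-u_h\|_{1,\omega_K,h}+\sum_{e\in\mathcal E(K)\cap\mathcal E_h^2}|\lambda-\lambda_h|_{*,e}+h_K\|f-\overline f\|_{\omega_K}+\sum_{e\in\mathcal E(K)\cap\mathcal E_h^2}h_e^{1/2}\|\lambda_h-\overline\lambda_h\|_e\right),$$ where the constant $C$ depends on the minimal angle condition and is independent of $h_K$.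
   Context: **Continuous problem.** $\Omega\subset\mathbb R^2$ is an open bounded domain with Lipschitz boundary $\Gamma=\Gamma_1\cup\Gamma_2$, where $\Gamma_1$ is a relatively closed subset of $\Gamma$ and $\Gamma_2=\Gamma\setminus\Gamma_1$; $\boldsymbol n$ is the outward unit normal. Given are $f\in L^2(\Omega)$ and a constant $g>0$. $(\cdot,\cdot)$ is the $L^2(\Omega)$ inner product and $(\cdot,\cdot)_K$ the $L^2(K)$ inner product, $V=H^1_{\Gamma_1}(\Omega)=\{v\in H^1(\Omega): v=0\text{ a.e. on }\Gamma_1\}$, $$a(u,v)=\int_\Omega\nabla u\cdot\nabla v\,dx+\int_\Omega uv\,dx,\qquad j(v)=\int_{\Gamma_2}g|v|\,ds.$$ The frictional contact problem has a unique solution $u\in V$. Its Lagrange multiplier is the unique $\lambda\in L^\infty(\Gamma_2)$ with $a(u,v)+\int_{\Gamma_2}g\lambda v\,ds=(f,v)$ for all $v\in V$, and $|\lambda|\le1$, $\lambda u=|u|$ a.e. on $\Gamma_2$. **Meshes.** $\{\mathcal T_h\}$ is a family of triangulations of $\overline\Omega$ satisfying the minimal angle condition; every boundary edge lies either in $\overline{\Gamma_1}$ or in $\overline{\Gamma_2}$. $\mathcal E_h$ is the set of all edges, $\mathcal E_h^i$ the interior edges, $\mathcal E_h^b=\mathcal E_h\setminus\mathcal E_h^i$ the boundary edges, $\mathcal E_h^0$ the edges not lying on $\Gamma_2$, $\mathcal E_h^2=\mathcal E_h\setminus\mathcal E_h^0$ (edges on $\Gamma_2$), and $\mathcal E(K)$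 is the set of sides of $K$. $h_K=\mathrm{diam}(K)$, $h_e=\mathrm{length}(e)$. The patch of $K$ is $\omega_K=\bigcup\{T\in\mathcal T_h: T\cap K\ne\emptyset\}$. For a boundary edge $e$, $\omega_e$ is the element having $e$ as a side. The notation $e\in\partial K\cap\mathcal E$ means that $e\in\mathcal E$ is an edge of $K$. An integral over a set of edges means the sum of the integrals over these edges. **Averages and jumps.** On an interior edge shared by $K^+,K^-$ with exterior unit normals $\boldsymbol n^\pm$: $\{v\}=\frac12(v^++v^-)$, $[v]=v^+\boldsymbol n^++v^-\boldsymbol n^-$ for scalar $v$; $\{\boldsymbol q\}=\frac12(\boldsymbol q^++\boldsymbol q^-)$, $[\boldsymbol q]=\boldsymbol q^+\cdot\boldsymbol n^++\boldsymbol q^-\cdot\boldsymbol n^-$ for vector-valued $\boldsymbol q$. On a boundary edge, $[v]=v\boldsymbol n$ and $\{\boldsymbol q\}=\boldsymbol q$. **Spaces and norms.** $V_h=\{v_h\in L^2(\Omega): v_h|_K\in P_1(K)\ \forall K\in\mathcal T_h\}$, $W_h=\{\boldsymbol w_h\in[L^2(\Omega)]^2:\boldsymbol w_h|_K\in[P_1(K)]^2\ \forall K\in\mathcal T_h\}$. $\nabla_h$ is the elementwise gradient. $\|\cdot\|_K$, $\|\cdot\|_e$, $\|\cdot\|_{\omega_K}$ are the $L^2$ norms on $K$, $e$, $\omega_K$. For a Lipschitz subdomain $\omega\subset\Omega$, $\|v\|_{1,\omega,h}^2=\sum_{K\in\mathcal T_h}\int_{\omega\cap K}(|\nabla v|^2+v^2)\,dx$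 and $H^1_h(\omega)=\{v\in L^2(\omega): v|_{K\cap\omega}\in H^1(K\cap\omega)\ \forall K\in\mathcal T_h\}$. **LDG bilinear form.** $$\begin{aligned}B_h(u,v)=&\int_\Omega(\nabla_hu\cdot\nabla_hv+uv)\,dx-\int_{\mathcal E_h^0}[u]\cdot\{\nabla_hv\}\,ds-\int_{\mathcal E_h^0}\{\nabla_hu\}\cdot[v]\,ds\\&-\int_{\mathcal E_h^i}\beta\cdot[u]\,[\nabla_hv]\,ds-\int_{\mathcal E_h^i}[\nabla_hu]\,\beta\cdot[v]\,ds\\&+\big(r_0([u])+l(\beta\cdot[u]),\,r_0([v])+l(\beta\cdot[v])\big)+\int_{\mathcal E_h^0}\eta\,[u]\cdot[v]\,ds,\end{aligned}$$ where $\beta\in[L^2(\mathcal E_h^i)]^2$ is constant on each interior edge, $\eta=\eta_eh_e^{-1}$ on each $e\in\mathcal E_h^0$ with a positive number $\eta_e$, and the lifting operators $r_0:[L^2(\mathcal E_h^0)]^2\to W_h$, $l:L^2(\mathcal E_h^i)\to W_h$ are defined by $$\int_\Omega r_0(\boldsymbol q)\cdot\boldsymbol w_h\,dx=-\int_{\mathcal E_h^0}\boldsymbol q\cdot\{\boldsymbol w_h\}\,ds,\qquad\int_\Omega l(v)\cdot\boldsymbol w_h\,dx=-\int_{\mathcal E_h^i}v[\boldsymbol w_h]\,ds\qquad\forall\,\boldsymbol w_h\in W_h.$$ The LDG scheme has a unique solution $u_h\in V_h$. Its Lagrange multiplier $\lambda_h\in L^\infty(\Gamma_2)$ satisfies $B_h(u_h,v_h)+\int_{\Gamma_2}g\lambda_hv_h\,ds=(f,v_h)$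 for all $v_h\in V_h$, and $|\lambda_h|\le1$, $\lambda_hu_h=|u_h|$ a.e. on $\Gamma_2$. **Local dual norm.** For $e\in\mathcal E_h^2$ and $\mu\in L^\infty(\Gamma_2)$, $$|\mu|_{*,e}=\sup\Big\{\int_e g\,\mu\,v\,ds:\ v\in H^1_h(\omega_e),\ \|v\|_{1,\omega_e,h}=1\Big\}.$$ **Approximations of data.** On each $K\in\mathcal T_h$, with $\phi_K^{(1)},\phi_K^{(2)},\phi_K^{(3)}$ the linear nodal basis functions of the three vertices of $K$, $\overline f=\sum_{i=1}^3f^i\phi_K^{(i)}$ with $f^i=(f,\phi_K^{(i)})_K/(1,\phi_K^{(i)})_K$. $\overline\lambda_h$ is a discontinuous piecewise polynomial approximation of $\lambda_h$ on the edges in $\mathcal E_h^2$, taken on each edge from a fixed finite-dimensional polynomial space (fixed degree, independent of the mesh). *)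

theory Defs
  imports "HOL-Analysis.Analysis"
begin

section \<open>Arc length\<close>

text \<open>
  The measure \<open>ds\<close> on boundaries and edges is the one-dimensional Hausdorff measure, taken on
  its Caratheodory-measurable sets; in particular it is complete.
\<close>

definition hausdorff1_pre :: "real \<Rightarrow> 'a::metric_space set \<Rightarrow> ennreal" where
  "hausdorff1_pre \<delta> A =
     (INF U \<in> {U :: nat \<Rightarrow> 'a set. A \<subseteq> (\<Union>n. U n) \<and> (\<forall>n. bounded (U n) \<and> diameter (U n) \<le> \<delta>)}.
        \<Sum>n. ennreal (diameter (U n)))"

definition hausdorff1_outer :: "'a::metric_space set \<Rightarrow> ennreal" where
  "hausdorff1_outer A = (SUP \<delta> \<in> {0<..}. hausdorff1_pre \<delta> A)"

definition arclength :: "'a::metric_space measure" where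
  "arclength = measure_of UNIV (lambda_system UNIV UNIV hausdorff1_outer) hausdorff1_outer"

text \<open>The Caratheodory sets form a measure space on which the outer measure is the measure, and they
  include the Borel sets.\<close>

lemma hausdorff1_pre_antimono: "\<delta> \<le> \<delta>' \<Longrightarrow> hausdorff1_pre \<delta>' A \<le> hausdorff1_pre \<delta> A"
  unfolding hausdorff1_pre_def by (rule INF_superset_mono) (auto intro: order_trans)

lemma hausdorff1_pre_mono: "A \<subseteq> B \<Longrightarrow> hausdorff1_pre \<delta> A \<le> hausdorff1_pre \<delta> B"
  unfolding hausdorff1_pre_def by (rule INF_superset_mono) auto

lemma hausdorff1_pre_le_outer: "\<delta> > 0 \<Longrightarrow> hausdorff1_pre \<delta> A \<le> hausdorff1_outer A"
  unfolding hausdorff1_outer_def by (rule SUP_upper) simp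

lemma hausdorff1_outer_mono: "A \<subseteq> B \<Longrightarrow> hausdorff1_outer A \<le> hausdorff1_outer B"
  unfolding hausdorff1_outer_def by (intro SUP_mono) (auto intro: hausdorff1_pre_mono)

lemma hausdorff1_outer_empty: "hausdorff1_outer {} = 0"
proof -
  have "hausdorff1_pre \<delta> ({} :: 'a set) \<le> 0" if "\<delta> > 0" for \<delta>
    unfolding hausdorff1_pre_def
    by (rule INF_lower2[of "\<lambda>_. {}"]) (use that in auto)
  then have "hausdorff1_outer ({} :: 'a set) \<le> 0"
    unfolding hausdorff1_outer_def by (intro SUP_least) auto
  then show ?thesis by simp
qed

lemma hausdorff1_pre_UN: "hausdorff1_pre \<delta> (\<Union>i::nat. A i) \<le> (\<Sum>i. hausdorff1_pre \<delta> (A i))"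
proof (rule ennreal_le_epsilon)
  fix e :: real assume e: "0 < e" and fin: "(\<Sum>n. hausdorff1_pre \<delta> (A n)) < top"
  have "hausdorff1_pre \<delta> (A n) < hausdorff1_pre \<delta> (A n) + ennreal (e * (1/2)^Suc n)" for n
    using e fin by (auto simp add: less_top dest!: ennreal_suminf_lessD)
  then have "\<exists>U. A n \<subseteq> (\<Union>i. U i) \<and> (\<forall>i. bounded (U i) \<and> diameter (U i) \<le> \<delta>) \<and>
      (\<Sum>i. ennreal (diameter (U i))) \<le> hausdorff1_pre \<delta> (A n) + ennreal (e * (1/2)^Suc n)"
    for n
    by (subst (asm) (1) hausdorff1_pre_def, unfold INF_less_iff) (blast intro: less_imp_le)
  then obtain U where U: "\<And>n. A n \<subseteq> (\<Union>i. U n i)"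
      and Ud: "\<And>n i. bounded (U n i)" "\<And>n i. diameter (U n i) \<le> \<delta>"
      and Us: "\<And>n. (\<Sum>i. ennreal (diameter (U n i)))
                    \<le> hausdorff1_pre \<delta> (A n) + ennreal (e * (1/2)^Suc n)"
    by metis
  define W where "W = case_prod U \<circ> prod_decode"
  have sub: "(\<Union>i. A i) \<subseteq> (\<Union>i. W i)"
    using U by (auto simp add: W_def subset_eq) (metis prod.case prod_encode_inverse)
  have "hausdorff1_pre \<delta> (\<Union>i. A i) \<le> (\<Sum>i. ennreal (diameter (W i)))"
    unfolding hausdorff1_pre_def
    by (rule INF_lower) (use sub Ud in \<open>auto simp: W_def split_def\<close>)
  also have "\<dots> = (\<Sum>n. \<Sum>i. ennreal (diameter (U n i)))"
  proof -
    have "(\<Sum>i. (\<lambda>(n, i). ennreal (diameter (U n i))) (prod_decode i)) =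
        (\<Sum>n. \<Sum>i. ennreal (diameter (U n i)))"
      by (rule suminf_ennreal_2dimen) simp
    then show ?thesis by (simp add: W_def split_def)
  qed
  also have "\<dots> \<le> (\<Sum>n. hausdorff1_pre \<delta> (A n) + ennreal (e * (1/2) ^ Suc n))"
    by (intro suminf_le Us) auto
  also have "... = (\<Sum>n. hausdorff1_pre \<delta> (A n)) + (\<Sum>n. ennreal e * ennreal ((1/2) ^ Suc n))"
    using \<open>0 < e\<close> by (subst suminf_add[symmetric])
                     (auto simp del: ennreal_suminf_cmult simp add: ennreal_mult[symmetric])
  also have "\<dots> = (\<Sum>n. hausdorff1_pre \<delta> (A n)) + e"
    unfolding ennreal_suminf_cmult
    by (subst suminf_ennreal_eq[OF zero_le_power power_half_series]) auto
  finally show "hausdorff1_pre \<delta> (\<Union>i. A i) \<le> (\<Sum>n. hausdorff1_pre \<delta> (A n)) + ennreal e" .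
qed

lemma hausdorff1_outer_UN: "hausdorff1_outer (\<Union>i::nat. A i) \<le> (\<Sum>i. hausdorff1_outer (A i))"
proof -
  have "hausdorff1_pre \<delta> (\<Union>i. A i) \<le> (\<Sum>i. hausdorff1_outer (A i))" if "\<delta> > 0" for \<delta>
    using that
    by (intro order_trans[OF hausdorff1_pre_UN[of \<delta> A]] suminf_le hausdorff1_pre_le_outer) auto
  then show ?thesis
    by (subst hausdorff1_outer_def) (auto intro: SUP_least)
qed

lemma hausdorff1_outer_Un: "hausdorff1_outer (A \<union> B) \<le> hausdorff1_outer A + hausdorff1_outer B"
proof -
  have "A \<union> B = (\<Union>i. (\<lambda>i::nat. if i = 0 then A else if i = 1 then B else {}) i)"
    by (auto split: if_splits)
  then have "hausdorff1_outer (A \<union> B) \<le>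
      (\<Sum>i. hausdorff1_outer ((\<lambda>i::nat. if i = 0 then A else if i = 1 then B else {}) i))"
    using hausdorff1_outer_UN by metis
  also have "\<dots> = hausdorff1_outer A + hausdorff1_outer B"
    by (subst suminf_finite[of "{0, 1}"]) (auto simp: hausdorff1_outer_empty)
  finally show ?thesis .
qed

lemma outer_measure_space_hausdorff1: "outer_measure_space UNIV hausdorff1_outer"
  unfolding outer_measure_space_def positive_def increasing_def countably_subadditive_def
  by (auto intro: hausdorff1_outer_mono hausdorff1_outer_UN simp: hausdorff1_outer_empty)

lemma measure_space_hausdorff1:
  "measure_space UNIV (lambda_system UNIV UNIV hausdorff1_outer)
     (hausdorff1_outer :: 'a::metric_space set \<Rightarrow> ennreal)"
proof -
  interpret sigma_algebra "UNIV :: 'a set" "UNIV"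
    using sigma_algebra_Pow[of "UNIV :: 'a set"] by simp
  show ?thesis
    by (rule caratheodory_lemma[OF outer_measure_space_hausdorff1])
qed

lemma sets_arclength:
  "sets (arclength :: 'a::metric_space measure) = lambda_system UNIV UNIV hausdorff1_outer"
proof -
  interpret sigma_algebra "UNIV :: 'a set" "lambda_system UNIV UNIV hausdorff1_outer"
    using measure_space_hausdorff1[where 'a = 'a] unfolding measure_space_def by blast
  show ?thesis
    unfolding arclength_def by (rule sets_measure_of_eq)
qed

lemma space_arclength [simp]: "space arclength = UNIV"
  unfolding arclength_def by (simp add: space_measure_of_conv)

lemma emeasure_arclength: "A \<in> sets arclength \<Longrightarrow> emeasure arclength A = hausdorff1_outer A"
  using measure_space_hausdorff1 unfolding sets_arclength measure_space_def
  by (subst arclength_def, intro emeasure_measure_of_sigma) blast+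

lemma hausdorff1_pre_separated:
  assumes sep: "\<And>x y. x \<in> A \<Longrightarrow> y \<in> B \<Longrightarrow> \<delta> < dist x y"
  shows "hausdorff1_pre \<delta> A + hausdorff1_pre \<delta> B \<le> hausdorff1_pre \<delta> (A \<union> B)"
  unfolding hausdorff1_pre_def[of _ "A \<union> B"]
proof (rule INF_greatest)
  fix U :: "nat \<Rightarrow> 'a set"
  assume "U \<in> {U. A \<union> B \<subseteq> (\<Union>n. U n) \<and> (\<forall>n. bounded (U n) \<and> diameter (U n) \<le> \<delta>)}"
  then have U: "A \<union> B \<subseteq> (\<Union>n. U n)" "\<And>n. bounded (U n)" "\<And>n. diameter (U n) \<le> \<delta>"
    by auto
  have d0: "0 \<le> \<delta>"
    using U(3)[of 0] diameter_ge_0[OF U(2)[of 0]] by linarith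
  define VA where "VA n = (if U n \<inter> A \<noteq> {} then U n else {})" for n
  define VB where "VB n = (if U n \<inter> B \<noteq> {} then U n else {})" for n
  have disj: "VA n = {} \<or> VB n = {}" for n
  proof (rule ccontr)
    assume "\<not> ?thesis"
    then obtain x y where "x \<in> U n" "x \<in> A" "y \<in> U n" "y \<in> B"
      by (auto simp: VA_def VB_def split: if_splits)
    then show False
      using sep[of x y] diameter_bounded_bound[OF U(2)] U(3)[of n] by fastforce
  qed
  have "hausdorff1_pre \<delta> A \<le> (\<Sum>n. ennreal (diameter (VA n)))"
    unfolding hausdorff1_pre_def
    by (rule INF_lower) (use U d0 in \<open>fastforce simp: VA_def\<close>)
  moreover have "hausdorff1_pre \<delta> B \<le> (\<Sum>n. ennreal (diameter (VB n)))"
    unfolding hausdorff1_pre_def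
    by (rule INF_lower) (use U d0 in \<open>fastforce simp: VB_def\<close>)
  ultimately have "hausdorff1_pre \<delta> A + hausdorff1_pre \<delta> B
      \<le> (\<Sum>n. ennreal (diameter (VA n))) + (\<Sum>n. ennreal (diameter (VB n)))"
    by (rule add_mono)
  also have "\<dots> = (\<Sum>n. ennreal (diameter (VA n)) + ennreal (diameter (VB n)))"
    by (rule suminf_add) auto
  also have "\<dots> \<le> (\<Sum>n. ennreal (diameter (U n)))"
  proof (rule suminf_le)
    fix n
    show "ennreal (diameter (VA n)) + ennreal (diameter (VB n)) \<le> ennreal (diameter (U n))"
      using disj[of n] by (auto simp: VA_def VB_def split: if_splits)
  qed auto
  finally show "hausdorff1_pre \<delta> A + hausdorff1_pre \<delta> B \<le> (\<Sum>n. ennreal (diameter (U n)))" .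
qed

lemma hausdorff1_outer_separated:
  assumes sep: "\<And>x y. x \<in> A \<Longrightarrow> y \<in> B \<Longrightarrow> d \<le> dist x y" and d: "0 < d"
  shows "hausdorff1_outer A + hausdorff1_outer B \<le> hausdorff1_outer (A \<union> B)"
proof -
  have *: "hausdorff1_pre \<delta> A + hausdorff1_pre \<delta>' B \<le> hausdorff1_outer (A \<union> B)"
    if "\<delta> > 0" "\<delta>' > 0" for \<delta> \<delta>'
  proof -
    define \<epsilon> where "\<epsilon> = min (min \<delta> \<delta>') (d/2)"
    have \<epsilon>: "\<epsilon> > 0" "\<epsilon> \<le> \<delta>" "\<epsilon> \<le> \<delta>'" "\<epsilon> < d" using that d by (auto simp: \<epsilon>_def)
    have "hausdorff1_pre \<delta> A + hausdorff1_pre \<delta>' B \<le> hausdorff1_pre \<epsilon> A + hausdorff1_pre \<epsilon> B"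
      using \<epsilon> by (intro add_mono hausdorff1_pre_antimono)
    also have "\<dots> \<le> hausdorff1_pre \<epsilon> (A \<union> B)"
      using sep \<epsilon>(4) by (intro hausdorff1_pre_separated) (meson less_le_trans)
    also have "\<dots> \<le> hausdorff1_outer (A \<union> B)"
      using \<epsilon>(1) by (rule hausdorff1_pre_le_outer)
    finally show ?thesis .
  qed
  have ne: "{0::real<..} \<noteq> {}" by auto
  have "hausdorff1_pre \<delta> A + hausdorff1_outer B \<le> hausdorff1_outer (A \<union> B)" if "\<delta> > 0" for \<delta>
    unfolding hausdorff1_outer_def[of B] ennreal_SUP_add_right[OF ne]
    by (rule SUP_least) (use * that in auto)
  then show ?thesis
    unfolding hausdorff1_outer_def[of A] ennreal_SUP_add_left[OF ne, symmetric]
    by (intro SUP_least) auto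
qed

lemma closed_sets_arclength:
  fixes C :: "'a::metric_space set"
  assumes C: "closed C"
  shows "C \<in> sets arclength"
proof (cases "C = {}")
  case False
  let ?H = "hausdorff1_outer :: 'a set \<Rightarrow> ennreal"
  have main: "?H (A \<inter> C) + ?H (A - C) \<le> ?H A" for A
  proof (cases "?H A = top")
    case fin: False
    define S where "S n = {x \<in> A. 1 / real (Suc n) \<le> infdist x C}" for n
    define R where "R k = S (Suc k) - S k" for k
    have S_le: "?H (A \<inter> C) + ?H (S n) \<le> ?H A" for n
    proof -
      have "?H (A \<inter> C) + ?H (S n) \<le> ?H (A \<inter> C \<union> S n)"
      proof (rule hausdorff1_outer_separated[where d = "1 / real (Suc n)"])
        fix x y assume "x \<in> A \<inter> C" "y \<in> S n"
        then show "1 / real (Suc n) \<le> dist x y"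
          using infdist_le[of x C y] by (auto simp: S_def dist_commute)
      qed auto
      also have "\<dots> \<le> ?H A"
        by (rule hausdorff1_outer_mono) (auto simp: S_def)
      finally show ?thesis .
    qed
    have sep: "?H (R j) + ?H E \<le> ?H (R j \<union> E)" if E: "E \<subseteq> S k" "Suc k \<le> j" for j k E
    proof (rule hausdorff1_outer_separated[where d = "1 / real (Suc k) - 1 / real (Suc j)"])
      fix x y assume "x \<in> R j" "y \<in> E"
      then have "infdist x C < 1 / real (Suc j)" "1 / real (Suc k) \<le> infdist y C"
        using E by (auto simp: R_def S_def)
      then show "1 / real (Suc k) - 1 / real (Suc j) \<le> dist x y"
        using infdist_triangle[of y C x] by (simp add: dist_commute)
    next
      show "0 < 1 / real (Suc k) - 1 / real (Suc j)"
        using E frac_less2[of 1 1 "real (Suc k)" "real (Suc j)"] by simp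
    qed
    have S_mono: "S m \<subseteq> S n" if "m \<le> n" for m n
    proof -
      have "1 / real (Suc n) \<le> 1 / real (Suc m)"
        using that by (simp add: field_simps)
      then show ?thesis
        by (auto simp: S_def)
    qed
    have R_sub: "R k \<subseteq> S (Suc k)" for k by (auto simp: R_def)
    have par: "(\<Sum>i<n. ?H (R (2 * i + c))) \<le> ?H (\<Union>i<n. R (2 * i + c))" for n c
    proof (induction n)
      case (Suc n)
      have sub: "(\<Union>i<n. R (2 * i + c)) \<subseteq> S (2 * n + c - 1)"
      proof
        fix x assume "x \<in> (\<Union>i<n. R (2 * i + c))"
        then obtain i where "i < n" "x \<in> R (2 * i + c)" by auto
        then show "x \<in> S (2 * n + c - 1)"
          using R_sub S_mono[of "Suc (2 * i + c)" "2 * n + c - 1"] by force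
      qed
      show ?case
      proof (cases "n = 0")
        case False
        have "(\<Sum>i<Suc n. ?H (R (2 * i + c)))
            \<le> ?H (R (2 * n + c)) + ?H (\<Union>i<n. R (2 * i + c))"
          using Suc.IH by (simp add: add.commute add_left_mono)
        also have "\<dots> \<le> ?H (R (2 * n + c) \<union> (\<Union>i<n. R (2 * i + c)))"
          using False by (intro sep[OF sub]) auto
        also have "\<dots> = ?H (\<Union>i<Suc n. R (2 * i + c))"
          by (simp add: lessThan_Suc)
        finally show ?thesis .
      qed (simp add: lessThan_Suc)
    qed (simp add: hausdorff1_outer_empty)
    have par': "(\<Sum>i<n. ?H (R (2 * i + c))) \<le> ?H A" for n c
      by (rule order_trans[OF par hausdorff1_outer_mono]) (auto simp: R_def S_def)
    have "(\<Sum>k<n. ?H (R k)) \<le> ?H A + ?H A" for n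
    proof -
      have "(\<Sum>k<n. ?H (R k)) \<le> (\<Sum>k<2 * n. ?H (R k))"
        by (intro sum_mono2) auto
      also have "\<dots> = (\<Sum>i<n. ?H (R (2 * i + 0))) + (\<Sum>i<n. ?H (R (2 * i + 1)))"
        by (induction n) (auto simp: algebra_simps)
      also have "\<dots> \<le> ?H A + ?H A"
        by (intro add_mono par')
      finally show ?thesis .
    qed
    then have "(\<Sum>k. ?H (R k)) \<le> ?H A + ?H A"
      by (intro suminf_le_const) auto
    then have sumfin: "(\<Sum>k. ?H (R k)) \<noteq> top"
      using fin by (auto simp: top_unique ennreal_add_eq_top)
    have tail: "(\<lambda>n. \<Sum>k. ?H (R (k + n))) \<longlonglongrightarrow> 0"
    proof -
      have "(\<lambda>n. \<Sum>k. ennreal (enn2real (?H (R (k + n))))) \<longlonglongrightarrow> 0"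
      proof -
        have nt: "?H (R k) \<noteq> top" for k
          using sumfin ennreal_suminf_lessD[of "\<lambda>k. ?H (R k)" top k] by (auto simp: less_top)
        have smb: "summable (\<lambda>k. enn2real (?H (R k)))"
          by (rule summable_suminf_not_top) (use sumfin nt in \<open>auto simp: less_top\<close>)
        have "(\<lambda>n. ennreal (\<Sum>k. enn2real (?H (R (k + n))))) \<longlonglongrightarrow> ennreal 0"
          by (intro tendsto_ennrealI suminf_exist_split2 smb)
        then show ?thesis
          using summable_ignore_initial_segment[OF smb] by (subst suminf_ennreal2) auto
      qed
      moreover have "?H (R k) \<noteq> top" for k
        using sumfin ennreal_suminf_lessD[of "\<lambda>k. ?H (R k)" top k] by (auto simp: less_top)
      ultimately show ?thesis
        by (simp add: ennreal_enn2real_if)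
    qed
    have cover: "A - C \<subseteq> S n \<union> (\<Union>k. R (k + n))" for n
    proof
      fix x assume x: "x \<in> A - C"
      then have "infdist x C > 0"
        using C False in_closed_iff_infdist_zero[of C x] infdist_nonneg[of x C] by fastforce
      then obtain m where "inverse (real (Suc m)) < infdist x C"
        using reals_Archimedean by blast
      then have "\<exists>m. x \<in> S m"
        using x by (auto simp: S_def inverse_eq_divide intro!: exI[of _ m])
      define l where "l = (LEAST m. x \<in> S m)"
      have l: "x \<in> S l" "\<And>m. m < l \<Longrightarrow> x \<notin> S m"
        using LeastI_ex[OF \<open>\<exists>m. x \<in> S m\<close>] not_less_Least unfolding l_def by blast+
      show "x \<in> S n \<union> (\<Union>k. R (k + n))"
      proof (cases "l \<le> n")
        case True
        then show ?thesis using l S_mono by blast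
      next
        case False
        then have "x \<in> R (l - 1)" "l - 1 = (l - 1 - n) + n"
          using l by (auto simp: R_def)
        then show ?thesis by (metis UN_I UNIV_I UnI2)
      qed
    qed
    have bd: "?H (A \<inter> C) + ?H (A - C) \<le> ?H A + (\<Sum>k. ?H (R (k + n)))" for n
    proof -
      have "?H (A - C) \<le> ?H (S n \<union> (\<Union>k. R (k + n)))"
        by (rule hausdorff1_outer_mono[OF cover])
      also have "\<dots> \<le> ?H (S n) + ?H (\<Union>k. R (k + n))"
        by (rule hausdorff1_outer_Un)
      also have "\<dots> \<le> ?H (S n) + (\<Sum>k. ?H (R (k + n)))"
        by (intro add_left_mono hausdorff1_outer_UN)
      finally have "?H (A \<inter> C) + ?H (A - C) \<le> (?H (A \<inter> C) + ?H (S n)) + (\<Sum>k. ?H (R (k + n)))"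
        by (simp add: add.assoc add_left_mono)
      also have "\<dots> \<le> ?H A + (\<Sum>k. ?H (R (k + n)))"
        by (intro add_right_mono S_le)
      finally show ?thesis .
    qed
    have "(\<lambda>n. ?H A + (\<Sum>k. ?H (R (k + n)))) \<longlonglongrightarrow> ?H A + 0"
      by (intro tendsto_add tendsto_const tail)
    then show ?thesis
      using bd by (intro LIMSEQ_le_const[where X = "\<lambda>n. ?H A + (\<Sum>k. ?H (R (k + n)))"]) auto
  qed simp
  have "?H (C \<inter> A) + ?H ((UNIV - C) \<inter> A) = ?H A" for A
  proof (rule antisym)
    show "?H (C \<inter> A) + ?H ((UNIV - C) \<inter> A) \<le> ?H A"
      using main[of A] by (simp add: Int_commute Diff_eq)
    show "?H A \<le> ?H (C \<inter> A) + ?H ((UNIV - C) \<inter> A)"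
      using hausdorff1_outer_Un[of "C \<inter> A" "(UNIV - C) \<inter> A"]
      by (simp add: Int_Un_distrib2[symmetric])
  qed
  then show ?thesis
    by (simp add: sets_arclength lambda_system_def)
qed simp

lemma borel_sets_arclength: "sets borel \<subseteq> sets arclength"
proof -
  have "sets borel = sigma_sets UNIV {C :: 'a set. closed C}"
    by (simp add: borel_eq_closed)
  also have "\<dots> \<subseteq> sets arclength"
    using sets.sigma_sets_subset[of "{C :: 'a set. closed C}" arclength] closed_sets_arclength
    by auto
  finally show ?thesis .
qed


section \<open>Lebesgue spaces\<close>

definition L2_space :: "'a measure \<Rightarrow> 'a set \<Rightarrow> ('a \<Rightarrow> 'b::euclidean_space) set" where
  "L2_space M S = {f. f \<in> borel_measurable (restrict_space M S) \<and>
                      integrable (restrict_space M S) (\<lambda>x. (norm (f x))\<^sup>2)}"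

definition L2_norm :: "'a measure \<Rightarrow> 'a set \<Rightarrow> ('a \<Rightarrow> 'b::euclidean_space) \<Rightarrow> real" where
  "L2_norm M S f = sqrt (LINT x:S|M. (norm (f x))\<^sup>2)"

definition L2_inner :: "(real^2) set \<Rightarrow> (real^2 \<Rightarrow> 'b::euclidean_space) \<Rightarrow> (real^2 \<Rightarrow> 'b) \<Rightarrow> real" where
  "L2_inner S f v = (LINT x:S|lebesgue. f x \<bullet> v x)"

definition Linf_space :: "'a measure \<Rightarrow> 'a set \<Rightarrow> ('a \<Rightarrow> real) set" where
  "Linf_space M S = {f. f \<in> borel_measurable (restrict_space M S) \<and>
                        (\<exists>B. AE x in M. x \<in> S \<longrightarrow> \<bar>f x\<bar> \<le> B)}"


section \<open>Sobolev functions and traces\<close>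

definition grad :: "(real^2 \<Rightarrow> real) \<Rightarrow> real^2 \<Rightarrow> real^2" where
  "grad v x = (\<chi> i. frechet_derivative v (at x) (axis i 1))"

definition laplacian :: "(real^2 \<Rightarrow> real) \<Rightarrow> real^2 \<Rightarrow> real" where
  "laplacian v x = (\<Sum>i\<in>UNIV. grad (\<lambda>y. grad v y $ i) x $ i)"

primrec Ck :: "nat \<Rightarrow> (real^2 \<Rightarrow> real) \<Rightarrow> bool" where
  "Ck 0 \<phi> \<longleftrightarrow> continuous_on UNIV \<phi>"
| "Ck (Suc k) \<phi> \<longleftrightarrow> \<phi> differentiable_on UNIV \<and> (\<forall>i. Ck k (\<lambda>x. grad \<phi> x $ i))"

definition test_functions :: "(real^2) set \<Rightarrow> (real^2 \<Rightarrow> real) set" where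
  "test_functions U = {\<phi>. (\<forall>k. Ck k \<phi>) \<and> (\<exists>S. compact S \<and> S \<subseteq> U \<and> (\<forall>x. x \<notin> S \<longrightarrow> \<phi> x = 0))}"

definition is_weak_grad :: "(real^2) set \<Rightarrow> (real^2 \<Rightarrow> real) \<Rightarrow> (real^2 \<Rightarrow> real^2) \<Rightarrow> bool" where
  "is_weak_grad U v G \<longleftrightarrow> (\<forall>\<phi>\<in>test_functions U.
     (LINT x:U|lebesgue. v x *\<^sub>R grad \<phi> x) = - (LINT x:U|lebesgue. \<phi> x *\<^sub>R G x))"

definition H1 :: "(real^2) set \<Rightarrow> (real^2 \<Rightarrow> real) set" where
  "H1 U = {v \<in> L2_space lebesgue U. \<exists>G\<in>L2_space lebesgue U. is_weak_grad U v G}"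

text \<open>The weak gradient is unique up to null sets.\<close>

definition weak_grad :: "(real^2) set \<Rightarrow> (real^2 \<Rightarrow> real) \<Rightarrow> real^2 \<Rightarrow> real^2" where
  "weak_grad U v = (SOME G. G \<in> L2_space lebesgue U \<and> is_weak_grad U v G)"

definition H1_norm :: "(real^2) set \<Rightarrow> (real^2 \<Rightarrow> real) \<Rightarrow> real" where
  "H1_norm U v = sqrt (LINT x:U|lebesgue. (norm (weak_grad U v x))\<^sup>2 + (v x)\<^sup>2)"

text \<open>
  For a bounded domain with Lipschitz boundary the trace operator is the continuous extension, from
  \<open>H1\<close> to \<open>L2\<close> of the boundary, of the restriction of functions that are continuous up to the
  boundary.  It determines the trace up to null sets.
\<close>

definition is_trace :: "(real^2) set \<Rightarrow> (real^2 \<Rightarrow> real) \<Rightarrow> (real^2 \<Rightarrow> real) \<Rightarrow> bool" where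
  "is_trace U v w \<longleftrightarrow> v \<in> H1 U \<and> w \<in> L2_space arclength (frontier U) \<and>
     (\<exists>s :: nat \<Rightarrow> real^2 \<Rightarrow> real.
        (\<forall>n. s n \<in> H1 U \<and> continuous_on (closure U) (s n)) \<and>
        (\<lambda>n. H1_norm U (\<lambda>x. s n x - v x)) \<longlonglongrightarrow> 0 \<and>
        (\<lambda>n. L2_norm arclength (frontier U) (\<lambda>x. s n x - w x)) \<longlonglongrightarrow> 0)"

definition tr :: "(real^2) set \<Rightarrow> (real^2 \<Rightarrow> real) \<Rightarrow> real^2 \<Rightarrow> real" where
  "tr U v = (SOME w. is_trace U v w)"

definition lipschitz_boundary :: "(real^2) set \<Rightarrow> bool" where
  "lipschitz_boundary U \<longleftrightarrow> (\<forall>p\<in>frontier U. \<exists>r>0. \<exists>R \<gamma> L.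
     orthogonal_transformation (R :: real^2 \<Rightarrow> real^2) \<and> L-lipschitz_on UNIV (\<gamma> :: real \<Rightarrow> real) \<and>
     (\<forall>x\<in>ball p r. x \<in> U \<longleftrightarrow> \<gamma> (R x $ 1) < R x $ 2))"


section \<open>The frictional contact problem\<close>

text \<open>Throughout, \<open>\<Gamma>1\<close> is the clamped part of the boundary of \<open>\<Omega>\<close>.\<close>

abbreviation Gamma2 :: "(real^2) set \<Rightarrow> (real^2) set \<Rightarrow> (real^2) set" where
  "Gamma2 \<Omega> \<Gamma>1 \<equiv> frontier \<Omega> - \<Gamma>1"

definition V_space :: "(real^2) set \<Rightarrow> (real^2) set \<Rightarrow> (real^2 \<Rightarrow> real) set" where
  "V_space \<Omega> \<Gamma>1 = {v \<in> H1 \<Omega>. AE x in arclength. x \<in> \<Gamma>1 \<longrightarrow> tr \<Omega> v x = 0}"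

definition a_form :: "(real^2) set \<Rightarrow> (real^2 \<Rightarrow> real) \<Rightarrow> (real^2 \<Rightarrow> real) \<Rightarrow> real" where
  "a_form \<Omega> u v = (LINT x:\<Omega>|lebesgue. weak_grad \<Omega> u x \<bullet> weak_grad \<Omega> v x)
                 + (LINT x:\<Omega>|lebesgue. u x * v x)"

text \<open>The argument \<open>w\<close> of the friction functional stands for the boundary values of \<open>v\<close>.\<close>

definition j_fun :: "(real^2) set \<Rightarrow> (real^2) set \<Rightarrow> real \<Rightarrow> (real^2 \<Rightarrow> real) \<Rightarrow> real" where
  "j_fun \<Omega> \<Gamma>1 g w = (LINT x:Gamma2 \<Omega> \<Gamma>1|arclength. g * \<bar>w x\<bar>)"

definition contact_solution ::
  "(real^2) set \<Rightarrow> (real^2) set \<Rightarrow> real \<Rightarrow> (real^2 \<Rightarrow> real) \<Rightarrow> (real^2 \<Rightarrow> real) \<Rightarrow> bool" where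
  "contact_solution \<Omega> \<Gamma>1 g f u \<longleftrightarrow> u \<in> V_space \<Omega> \<Gamma>1 \<and>
     (\<forall>v\<in>V_space \<Omega> \<Gamma>1.
        a_form \<Omega> u (\<lambda>x. v x - u x) + j_fun \<Omega> \<Gamma>1 g (tr \<Omega> v) - j_fun \<Omega> \<Gamma>1 g (tr \<Omega> u)
        \<ge> L2_inner \<Omega> f (\<lambda>x. v x - u x))"

definition contact_multiplier ::
  "(real^2) set \<Rightarrow> (real^2) set \<Rightarrow> real \<Rightarrow> (real^2 \<Rightarrow> real) \<Rightarrow> (real^2 \<Rightarrow> real) \<Rightarrow> (real^2 \<Rightarrow> real) \<Rightarrow> bool"
where
  "contact_multiplier \<Omega> \<Gamma>1 g f u lam \<longleftrightarrow>
     lam \<in> Linf_space arclength (Gamma2 \<Omega> \<Gamma>1) \<and>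
     (\<forall>v\<in>V_space \<Omega> \<Gamma>1.
        a_form \<Omega> u v + (LINT x:Gamma2 \<Omega> \<Gamma>1|arclength. g * lam x * tr \<Omega> v x) = L2_inner \<Omega> f v) \<and>
     (AE x in arclength. x \<in> Gamma2 \<Omega> \<Gamma>1 \<longrightarrow> \<bar>lam x\<bar> \<le> 1 \<and> lam x * tr \<Omega> u x = \<bar>tr \<Omega> u x\<bar>)"


section \<open>Meshes\<close>

definition vertices :: "(real^2) set \<Rightarrow> (real^2) set" where
  "vertices K = {p. p extreme_point_of K}"

definition sides :: "(real^2) set \<Rightarrow> (real^2) set set" where
  "sides K = {e. e edge_of K}"

definition edges :: "(real^2) set set \<Rightarrow> (real^2) set set" where
  "edges T = (\<Union>K\<in>T. sides K)"

definition elems_at :: "(real^2) set set \<Rightarrow> (real^2) set \<Rightarrow> (real^2) set set" where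
  "elems_at T e = {K \<in> T. e \<in> sides K}"

definition interior_edges :: "(real^2) set set \<Rightarrow> (real^2) set set" where
  "interior_edges T = {e \<in> edges T. card (elems_at T e) = 2}"

definition boundary_edges :: "(real^2) set set \<Rightarrow> (real^2) set set" where
  "boundary_edges T = edges T - interior_edges T"

definition edges2 :: "(real^2) set \<Rightarrow> (real^2) set \<Rightarrow> (real^2) set set \<Rightarrow> (real^2) set set" where
  "edges2 \<Omega> \<Gamma>1 T = {e \<in> boundary_edges T. e \<subseteq> closure (Gamma2 \<Omega> \<Gamma>1)}"

definition edges0 :: "(real^2) set \<Rightarrow> (real^2) set \<Rightarrow> (real^2) set set \<Rightarrow> (real^2) set set" where
  "edges0 \<Omega> \<Gamma>1 T = edges T - edges2 \<Omega> \<Gamma>1 T"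

text \<open>
  An edge in the closure of \<open>\<Gamma>2\<close> is required to lie in \<open>\<Gamma>2\<close> almost everywhere, since functions in
  \<open>L_infinity(\<Gamma>2)\<close> are integrated over it.  Inclusion in the closure alone does not give this:
  \<open>\<Gamma>1\<close> could meet the edge in a nowhere dense set of positive length.
\<close>

definition admissible_mesh :: "(real^2) set \<Rightarrow> (real^2) set \<Rightarrow> (real^2) set set \<Rightarrow> bool" where
  "admissible_mesh \<Omega> \<Gamma>1 T \<longleftrightarrow>
     triangulation T \<and> (\<forall>K\<in>T. 2 simplex K) \<and> \<Union>T = closure \<Omega> \<and>
     (\<forall>e\<in>boundary_edges T. e \<subseteq> closure \<Gamma>1 \<or>
        (e \<subseteq> closure (Gamma2 \<Omega> \<Gamma>1) \<and> e - Gamma2 \<Omega> \<Gamma>1 \<in> null_sets arclength))"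

definition vertex_angle :: "real^2 \<Rightarrow> real^2 \<Rightarrow> real^2 \<Rightarrow> real" where
  "vertex_angle p q r = arccos (((q - p) \<bullet> (r - p)) / (norm (q - p) * norm (r - p)))"

definition minimal_angle :: "real \<Rightarrow> (real^2) set set \<Rightarrow> bool" where
  "minimal_angle \<theta> T \<longleftrightarrow>
     (\<forall>K\<in>T. \<forall>p q r. vertices K = {p, q, r} \<longrightarrow> \<theta> \<le> vertex_angle p q r)"

definition edge_length :: "(real^2) set \<Rightarrow> real" where
  "edge_length e = measure arclength e"

definition patch :: "(real^2) set set \<Rightarrow> (real^2) set \<Rightarrow> (real^2) set" where
  "patch T K = \<Union>{K' \<in> T. K' \<inter> K \<noteq> {}}"

definition edge_elem :: "(real^2) set set \<Rightarrow> (real^2) set \<Rightarrow> (real^2) set" where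
  "edge_elem T e = (THE K. K \<in> elems_at T e)"

text \<open>
  The exterior unit normal of the triangle \<open>K\<close> on its side \<open>e\<close>.  The condition for the points of \<open>e\<close>
  itself makes the vector orthogonal to \<open>e\<close>.
\<close>

definition normal :: "(real^2) set \<Rightarrow> (real^2) set \<Rightarrow> real^2" where
  "normal K e = (THE \<nu>. norm \<nu> = 1 \<and> (\<forall>x\<in>e. \<forall>y\<in>K. \<nu> \<bullet> (y - x) \<le> 0))"


section \<open>Piecewise functions, jumps and averages\<close>

definition P1 :: "(real^2 \<Rightarrow> real) set" where
  "P1 = {p. \<exists>a c. p = (\<lambda>x. a \<bullet> x + c)}"

text \<open>
  Piecewise linear functions are represented so that they are affine at every interior point of
  every element; on the edges, a null set in the plane, their values are arbitrary and never used.
  Hence the elementwise gradient is \<^const>\<open>grad\<close>, evaluated in the interior of elements, and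
  one-sided values on edges are limits from the interior.
\<close>

definition Vh :: "(real^2) set \<Rightarrow> (real^2) set set \<Rightarrow> (real^2 \<Rightarrow> real) set" where
  "Vh \<Omega> T = {v \<in> L2_space lebesgue \<Omega>. \<forall>K\<in>T. \<exists>p\<in>P1. \<forall>x\<in>interior K. v x = p x}"

definition Wh :: "(real^2) set \<Rightarrow> (real^2) set set \<Rightarrow> (real^2 \<Rightarrow> real^2) set" where
  "Wh \<Omega> T = {w \<in> L2_space lebesgue \<Omega>. \<forall>K\<in>T. \<forall>i. \<exists>p\<in>P1. \<forall>x\<in>interior K. w x $ i = p x}"

definition inner_limit :: "(real^2) set \<Rightarrow> (real^2 \<Rightarrow> 'b::t2_space) \<Rightarrow> real^2 \<Rightarrow> 'b" where
  "inner_limit K v x = Lim (at x within interior K) v"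

text \<open>
  The sums over adjacent elements have two terms on an interior edge and one on a boundary edge,
  where they reduce to \<open>v n\<close>, \<open>q \<cdot> n\<close> and \<open>q\<close>.
\<close>

definition jump :: "(real^2) set set \<Rightarrow> (real^2) set \<Rightarrow> (real^2 \<Rightarrow> real) \<Rightarrow> real^2 \<Rightarrow> real^2" where
  "jump T e v x = (\<Sum>K\<in>elems_at T e. inner_limit K v x *\<^sub>R normal K e)"

definition vjump :: "(real^2) set set \<Rightarrow> (real^2) set \<Rightarrow> (real^2 \<Rightarrow> real^2) \<Rightarrow> real^2 \<Rightarrow> real" where
  "vjump T e q x = (\<Sum>K\<in>elems_at T e. inner_limit K q x \<bullet> normal K e)"

definition avg :: "(real^2) set set \<Rightarrow> (real^2) set \<Rightarrow> (real^2 \<Rightarrow> real^2) \<Rightarrow> real^2 \<Rightarrow> real^2" where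
  "avg T e q x = (\<Sum>K\<in>elems_at T e. inner_limit K q x) /\<^sub>R real (card (elems_at T e))"

definition H1h :: "(real^2) set set \<Rightarrow> (real^2) set \<Rightarrow> (real^2 \<Rightarrow> real) set" where
  "H1h T \<omega> = {v \<in> L2_space lebesgue \<omega>. \<forall>K\<in>T. v \<in> H1 (interior (K \<inter> \<omega>))}"

definition norm1h :: "(real^2) set set \<Rightarrow> (real^2) set \<Rightarrow> (real^2 \<Rightarrow> real) \<Rightarrow> real" where
  "norm1h T \<omega> v = sqrt (\<Sum>K\<in>T. LINT x:\<omega> \<inter> K|lebesgue.
      (norm (weak_grad (interior (K \<inter> \<omega>)) v x))\<^sup>2 + (v x)\<^sup>2)"


section \<open>The LDG scheme\<close>

text \<open>
  Data on edges are families indexed by the edge.  The lifting operators are determined up to null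
  sets by their defining equations.
\<close>

definition lift0 :: "(real^2) set \<Rightarrow> (real^2) set \<Rightarrow> (real^2) set set \<Rightarrow>
    ((real^2) set \<Rightarrow> real^2 \<Rightarrow> real^2) \<Rightarrow> real^2 \<Rightarrow> real^2" where
  "lift0 \<Omega> \<Gamma>1 T q = (SOME r. r \<in> Wh \<Omega> T \<and> (\<forall>w\<in>Wh \<Omega> T.
     L2_inner \<Omega> r w = - (\<Sum>e\<in>edges0 \<Omega> \<Gamma>1 T. LINT x:e|arclength. q e x \<bullet> avg T e w x)))"

definition lift1 :: "(real^2) set \<Rightarrow> (real^2) set set \<Rightarrow>
    ((real^2) set \<Rightarrow> real^2 \<Rightarrow> real) \<Rightarrow> real^2 \<Rightarrow> real^2" where
  "lift1 \<Omega> T v = (SOME r. r \<in> Wh \<Omega> T \<and> (\<forall>w\<in>Wh \<Omega> T.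
     L2_inner \<Omega> r w = - (\<Sum>e\<in>interior_edges T. LINT x:e|arclength. v e x * vjump T e w x)))"

definition B_form :: "(real^2) set \<Rightarrow> (real^2) set \<Rightarrow> (real^2) set set \<Rightarrow>
    ((real^2) set \<Rightarrow> real^2) \<Rightarrow> ((real^2) set \<Rightarrow> real) \<Rightarrow>
    (real^2 \<Rightarrow> real) \<Rightarrow> (real^2 \<Rightarrow> real) \<Rightarrow> real" where
  "B_form \<Omega> \<Gamma>1 T \<beta> \<eta> u v =
     (LINT x:\<Omega>|lebesgue. grad u x \<bullet> grad v x + u x * v x)
   - (\<Sum>e\<in>edges0 \<Omega> \<Gamma>1 T. LINT x:e|arclength. jump T e u x \<bullet> avg T e (grad v) x)
   - (\<Sum>e\<in>edges0 \<Omega> \<Gamma>1 T. LINT x:e|arclength. avg T e (grad u) x \<bullet> jump T e v x)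
   - (\<Sum>e\<in>interior_edges T. LINT x:e|arclength. (\<beta> e \<bullet> jump T e u x) * vjump T e (grad v) x)
   - (\<Sum>e\<in>interior_edges T. LINT x:e|arclength. vjump T e (grad u) x * (\<beta> e \<bullet> jump T e v x))
   + L2_inner \<Omega>
       (\<lambda>x. lift0 \<Omega> \<Gamma>1 T (\<lambda>e. jump T e u) x + lift1 \<Omega> T (\<lambda>e y. \<beta> e \<bullet> jump T e u y) x)
       (\<lambda>x. lift0 \<Omega> \<Gamma>1 T (\<lambda>e. jump T e v) x + lift1 \<Omega> T (\<lambda>e y. \<beta> e \<bullet> jump T e v y) x)
   + (\<Sum>e\<in>edges0 \<Omega> \<Gamma>1 T. LINT x:e|arclength. \<eta> e / edge_length e * (jump T e u x \<bullet> jump T e v x))"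

text \<open>
  At almost every point of the boundary, \<open>inner_limit \<Omega> v\<close> is the boundary value of \<open>v \<in> Vh \<Omega> T\<close>.
\<close>

definition ldg_solution :: "(real^2) set \<Rightarrow> (real^2) set \<Rightarrow> (real^2) set set \<Rightarrow>
    ((real^2) set \<Rightarrow> real^2) \<Rightarrow> ((real^2) set \<Rightarrow> real) \<Rightarrow>
    real \<Rightarrow> (real^2 \<Rightarrow> real) \<Rightarrow> (real^2 \<Rightarrow> real) \<Rightarrow> bool" where
  "ldg_solution \<Omega> \<Gamma>1 T \<beta> \<eta> g f uh \<longleftrightarrow> uh \<in> Vh \<Omega> T \<and>
     (\<forall>v\<in>Vh \<Omega> T.
        B_form \<Omega> \<Gamma>1 T \<beta> \<eta> uh (\<lambda>x. v x - uh x)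
          + j_fun \<Omega> \<Gamma>1 g (inner_limit \<Omega> v) - j_fun \<Omega> \<Gamma>1 g (inner_limit \<Omega> uh)
        \<ge> L2_inner \<Omega> f (\<lambda>x. v x - uh x))"

definition ldg_multiplier :: "(real^2) set \<Rightarrow> (real^2) set \<Rightarrow> (real^2) set set \<Rightarrow>
    ((real^2) set \<Rightarrow> real^2) \<Rightarrow> ((real^2) set \<Rightarrow> real) \<Rightarrow>
    real \<Rightarrow> (real^2 \<Rightarrow> real) \<Rightarrow> (real^2 \<Rightarrow> real) \<Rightarrow> (real^2 \<Rightarrow> real) \<Rightarrow> bool" where
  "ldg_multiplier \<Omega> \<Gamma>1 T \<beta> \<eta> g f uh lamh \<longleftrightarrow>
     lamh \<in> Linf_space arclength (Gamma2 \<Omega> \<Gamma>1) \<and>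
     (\<forall>v\<in>Vh \<Omega> T.
        B_form \<Omega> \<Gamma>1 T \<beta> \<eta> uh v
          + (LINT x:Gamma2 \<Omega> \<Gamma>1|arclength. g * lamh x * inner_limit \<Omega> v x) = L2_inner \<Omega> f v) \<and>
     (AE x in arclength. x \<in> Gamma2 \<Omega> \<Gamma>1 \<longrightarrow>
        \<bar>lamh x\<bar> \<le> 1 \<and> lamh x * inner_limit \<Omega> uh x = \<bar>inner_limit \<Omega> uh x\<bar>)"


section \<open>Error estimator\<close>

definition res_elem :: "(real^2 \<Rightarrow> real) \<Rightarrow> (real^2 \<Rightarrow> real) \<Rightarrow> real^2 \<Rightarrow> real" where
  "res_elem f uh x = laplacian uh x - uh x + f x"

definition res_friction :: "(real^2) set set \<Rightarrow> real \<Rightarrow> (real^2 \<Rightarrow> real) \<Rightarrow> (real^2 \<Rightarrow> real) \<Rightarrow>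
    (real^2) set \<Rightarrow> real^2 \<Rightarrow> real" where
  "res_friction T g uh lamh e x =
     inner_limit (edge_elem T e) (grad uh) x \<bullet> normal (edge_elem T e) e + g * lamh x"

definition estimator :: "(real^2) set \<Rightarrow> (real^2) set \<Rightarrow> (real^2) set set \<Rightarrow> real \<Rightarrow>
    (real^2 \<Rightarrow> real) \<Rightarrow> (real^2 \<Rightarrow> real) \<Rightarrow> (real^2 \<Rightarrow> real) \<Rightarrow> (real^2) set \<Rightarrow> real" where
  "estimator \<Omega> \<Gamma>1 T g f uh lamh K = sqrt (
     (diameter K)\<^sup>2 * (L2_norm lebesgue K (res_elem f uh))\<^sup>2
   + 1/2 * (\<Sum>e\<in>sides K \<inter> interior_edges T.
        edge_length e * (L2_norm arclength e (vjump T e (grad uh)))\<^sup>2)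
   + (\<Sum>e\<in>sides K \<inter> edges2 \<Omega> \<Gamma>1 T.
        edge_length e * (L2_norm arclength e (res_friction T g uh lamh e))\<^sup>2))"

text \<open>
  The supremum is taken in the extended reals, so that its meaning does not rest on the trace
  theorem, which makes it finite.
\<close>

definition dual_norm :: "(real^2) set set \<Rightarrow> real \<Rightarrow> (real^2) set \<Rightarrow> (real^2 \<Rightarrow> real) \<Rightarrow> ereal" where
  "dual_norm T g e \<mu> =
     (SUP v \<in> {v \<in> H1h T (edge_elem T e). norm1h T (edge_elem T e) v = 1}.
        ereal (LINT x:e|arclength. g * \<mu> x * tr (interior (edge_elem T e)) v x))"

definition nodal :: "(real^2) set \<Rightarrow> real^2 \<Rightarrow> real^2 \<Rightarrow> real" where
  "nodal K p = (THE \<phi>. \<phi> \<in> P1 \<and> \<phi> p = 1 \<and> (\<forall>q\<in>vertices K - {p}. \<phi> q = 0))"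

definition data_avg_on :: "(real^2 \<Rightarrow> real) \<Rightarrow> (real^2) set \<Rightarrow> real^2 \<Rightarrow> real" where
  "data_avg_on f K x = (\<Sum>p\<in>vertices K.
     L2_inner K f (nodal K p) / L2_inner K (\<lambda>_. 1) (nodal K p) * nodal K p x)"

definition data_avg :: "(real^2) set set \<Rightarrow> (real^2 \<Rightarrow> real) \<Rightarrow> real^2 \<Rightarrow> real" where
  "data_avg T f x = data_avg_on f (THE K. K \<in> T \<and> x \<in> interior K) x"

definition edge_poly :: "nat \<Rightarrow> (real^2) set \<Rightarrow> (real^2 \<Rightarrow> real) \<Rightarrow> bool" where
  "edge_poly m e \<phi> \<longleftrightarrow> (\<exists>a b c. e = closed_segment a b \<and>
     (\<forall>t\<in>{0..1}. \<phi> (a + t *\<^sub>R (b - a)) = (\<Sum>k\<le>m. c k * t ^ k)))"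

end

theory Submission
  imports Defs "HOL-Computational_Algebra.Polynomial"
begin

text \<open>
  On an element the residual is affine up to the oscillation of \<open>f\<close>, on an interior edge it is
  constant, and on a friction edge it is a polynomial of bounded degree up to the error in
  \<open>\<lambda>\<^sub>h\<close>.  Such a function \<open>q\<close> keeps its sign and at least a fixed fraction of its maximum on
  a ball (or a piece of the edge) of radius comparable to \<open>h\<^sub>K\<close>, so that the integral of \<open>q b\<close>
  for a radial bump function \<open>b\<close> supported there controls the norm of \<open>q\<close>.  Inserting \<open>b\<close> into the
  equation that \<open>u\<close> and \<open>\<lambda>\<close> satisfy, and integrating \<open>\<nabla> u\<^sub>h \<cdot> \<nabla> b\<close> by parts, expresses this
  integral by \<open>u - u\<^sub>h\<close> and \<open>\<lambda> - \<lambda>\<^sub>h\<close>.  Since \<open>\<parallel>b\<parallel> \<le> 2 \<rho>\<close> and \<open>\<parallel>\<nabla> b\<parallel> \<le> 4\<close> for a bump of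
  radius \<open>\<rho>\<close>, all powers of \<open>h\<^sub>K\<close> match.  A friction edge belongs to one element \<open>K\<close> only; there
  the test function is \<open>1\<^sub>K b\<close>, with a support so small that it meets no other side of \<open>K\<close>,
  hence is continuous on the closure of \<open>\<Omega>\<close> and also a competitor in the dual norm.

  Traces are defined by approximation with continuous functions.  For a continuous function in
  \<open>H\<^sup>1\<close> the trace is identified with the function on straight pieces of the boundary by Green's
  formula on half discs, proved with a cut-off in the normal direction.
\<close>

section \<open>Functions with vanishing integrals\<close>

text \<open>Smooth radial bumps take the place of the usual polynomial bubble functions. Their weak
  gradients are the classical ones and their norms are explicit in \<rho>, so all scaling happens on
  the actual triangle. In return, the centre and the radius of each bump must be chosen such that
  its disc stays away from the sides it must not meet, and this is where the minimal angle enters.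
  The constant depends on \<theta>, g, the degree m and the diameter of \<Omega>: the energy norm
  contains the function itself besides its gradient, so pairing with a bump costs 4 + 2 \<rho>, and
  \<rho> is bounded through the diameter of \<Omega>. A second difficulty is that weak gradients and
  traces are representatives selected by \<open>SOME\<close>. Every use of them rests on uniqueness
  almost everywhere, in the plane or along the boundary, and uniqueness is derived in the same way
  each time: an integrable function whose integrals over all boxes vanish is zero almost everywhere.
  At a friction edge the disc may reach other parts of \<Omega> across the edge; the indicator of K
  removes the bump there.\<close>

lemma integral_box_zero_imp_borel_zero:
  fixes w :: "'a::euclidean_space \<Rightarrow> real"
  assumes bor: "sets borel \<subseteq> sets M" and w: "integrable M w"
    and box: "\<And>a b. (LINT x:box a b|M. w x) = 0" and A: "A \<in> sets borel"
  shows "(LINT x:A|M. w x) = 0"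
proof -
  have si: "set_integrable M B w" if "B \<in> sets borel" for B
    unfolding set_integrable_def using that bor by (intro integrable_mult_indicator w) auto
  \<comment> \<open>The step for complements in the induction below needs the integral over the
    whole space; growing boxes exhaust it.\<close>
  have UNIV0: "(LINT x:UNIV|M. w x) = 0"
  proof -
    have "(\<lambda>i. LINT x:box (- real (Suc i) *\<^sub>R One) (real (Suc i) *\<^sub>R One)|M. w x)
        \<longlonglongrightarrow> (LINT x:(\<Union>i. box (- real (Suc i) *\<^sub>R One) (real (Suc i) *\<^sub>R One))|M. w x)"
    proof (rule set_integral_cont_up)
      show "box (- real (Suc i) *\<^sub>R One) (real (Suc i) *\<^sub>R (One::'a)) \<in> sets M" for i
        using bor by (auto simp: subset_iff)
      show "incseq (\<lambda>i. box (- real (Suc i) *\<^sub>R One) (real (Suc i) *\<^sub>R (One::'a)))"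
        by (auto simp: incseq_def subset_box)
      show "set_integrable M (\<Union>i. box (- real (Suc i) *\<^sub>R One) (real (Suc i) *\<^sub>R One)) w"
        by (rule si) auto
    qed
    moreover have "(\<Union>i. box (- real (Suc i) *\<^sub>R One) (real (Suc i) *\<^sub>R (One::'a))) = UNIV"
    proof -
      have "\<exists>i. x \<in> box (- real (Suc i) *\<^sub>R One) (real (Suc i) *\<^sub>R (One::'a))" for x :: 'a
      proof -
        obtain n :: nat where n: "norm x < n" using reals_Archimedean2 by blast
        have "\<bar>x \<bullet> b\<bar> < real (Suc n)" if "b \<in> Basis" for b
          using Basis_le_norm[OF that, of x] n by linarith
        then show ?thesis by (auto simp: box_def abs_less_iff intro!: exI[of _ n]) (smt (verit) of_nat_Suc)+
      qed
      then show ?thesis by blast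
    qed
    ultimately show ?thesis
      using LIMSEQ_unique[of "\<lambda>_. 0::real"] by (simp add: box)
  qed
  have stable: "Int_stable (range (\<lambda>(a, b). box a (b::'a)))"
    by (auto simp: Int_stable_def box_Int_box)
  have sub: "range (\<lambda>(a, b). box a (b::'a)) \<subseteq> Pow UNIV" by auto
  have sets_eq: "sets borel = sigma_sets UNIV (range (\<lambda>(a, b). box a (b::'a)))"
    by (simp add: borel_eq_box)
  show ?thesis
    using stable sub A[unfolded sets_eq]
  proof (induction rule: sigma_sets_induct_disjoint)
    case (basic A) then show ?case using box by auto
  next
    case empty then show ?case by (simp add: set_lebesgue_integral_def)
  next
    case (compl A)
    have Ab: "A \<in> sets borel" using compl by (simp add: sets_eq)
    have "(LINT x:UNIV|M. w x) = (LINT x:A|M. w x) + (LINT x:(UNIV-A)|M. w x)"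
      using set_integral_Un[of A "UNIV - A" M w] si Ab by auto
    then show ?case using compl UNIV0 by simp
  next
    case (union A)
    have Ab: "A i \<in> sets borel" for i using union(2) by (auto simp: sets_eq)
    have "(LINT x:(\<Union>i. A i)|M. w x) = (\<Sum>i. LINT x:A i|M. w x)"
    proof (rule lebesgue_integral_countable_add)
      show "\<And>i. A i \<in> sets M" using Ab bor by auto
      show "\<And>i j. i \<noteq> j \<Longrightarrow> A i \<inter> A j = {}" using union(1) by (auto simp: disjoint_family_on_def)
      show "set_integrable M (\<Union> (range A)) w" using Ab by (intro si) auto
    qed
    then show ?case using union(3) by simp
  qed
qed

text \<open>Boxes generate only the Borel sets, whereas Lebesgue measure and arc length live on
  larger sigma-algebras. The assumption \<open>hull\<close> replaces a measurable set by a Borel set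
  that differs from it by a null set.\<close>

lemma AE_zero_if_box_integrals_zero:
  fixes w :: "'a::euclidean_space \<Rightarrow> real"
  assumes M: "sigma_finite_measure M" and sp: "space M = UNIV" and bor: "sets borel \<subseteq> sets M"
    and hull: "\<And>A. A \<in> sets M \<Longrightarrow> \<exists>B\<in>sets borel. AE x in M. x \<in> A \<longleftrightarrow> x \<in> B"
    and w: "integrable M w" and box: "\<And>a b. (LINT x:box a b|M. w x) = 0"
  shows "AE x in M. w x = 0"
proof (rule sigma_finite_measure.density_zero[OF M w])
  fix A assume A: "A \<in> sets M"
  obtain B where B: "B \<in> sets borel" "AE x in M. x \<in> A \<longleftrightarrow> x \<in> B" using hull[OF A] by blast
  have BM: "B \<in> sets M" using B bor by auto
  have "(LINT x:A|M. w x) = (LINT x:B|M. w x)"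
    using B(2) A BM w unfolding set_lebesgue_integral_def
    by (intro integral_cong_AE) (auto simp: indicator_def)
  then show "(LINT x:A|M. w x) = 0"
    using integral_box_zero_imp_borel_zero[OF bor w box B(1)] by simp
qed

lemma AE_lebesgue_zero_if_box_integrals_zero:
  fixes w :: "'a::euclidean_space \<Rightarrow> real"
  assumes w: "integrable lebesgue w" and box: "\<And>a b. (LINT x:box a b|lebesgue. w x) = 0"
  shows "AE x in lebesgue. w x = 0"
proof (rule AE_zero_if_box_integrals_zero[OF _ _ _ _ w box])
  show "sigma_finite_measure (lebesgue :: 'a measure)"
  proof
    obtain A :: "'a set set" where "countable A" "A \<subseteq> sets lborel" "\<Union>A = space lborel" "\<forall>a\<in>A. emeasure lborel a \<noteq> \<infinity>"
      using lborel.sigma_finite_countable by blast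
    then show "\<exists>A::'a set set. countable A \<and> A \<subseteq> sets lebesgue \<and> \<Union>A = space lebesgue \<and> (\<forall>a\<in>A. emeasure lebesgue a \<noteq> \<infinity>)"
      by (intro exI[of _ A]) (auto simp: subset_iff)
  qed
  fix A :: "'a set" assume "A \<in> sets lebesgue"
  then obtain S N N' where "A = S \<union> N" "N \<subseteq> N'" "N' \<in> null_sets lborel" "S \<in> sets lborel"
    by (rule sets_completionE)
  moreover have "AE x in lebesgue. x \<notin> N'"
    using \<open>N' \<in> null_sets lborel\<close> by (intro AE_completion AE_not_in) auto
  ultimately show "\<exists>B\<in>sets borel. AE x in lebesgue. x \<in> A \<longleftrightarrow> x \<in> B"
    by (intro bexI[of _ S]) auto
qed auto

section \<open>Test functions and bumps\<close>

lemma grad_nth: "(f has_derivative f') (at x) \<Longrightarrow> grad f x $ i = f' (axis i 1)"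
  by (simp add: grad_def frechet_derivative_at[symmetric])

lemma grad_eqI: "(f has_derivative (\<lambda>h. G \<bullet> h)) (at x) \<Longrightarrow> grad f x = G"
  by (auto simp: vec_eq_iff grad_nth inner_axis)

lemma differentiable_imp_grad:
  fixes f :: "real^2 \<Rightarrow> real"
  assumes "f differentiable (at x)"
  shows "(f has_derivative (\<lambda>h. grad f x \<bullet> h)) (at x)"
proof -
  define D where "D = frechet_derivative f (at x)"
  have D: "(f has_derivative D) (at x)"
    using assms frechet_derivative_works D_def by blast
  then have lin: "linear D" using has_derivative_linear by blast
  have "D h = grad f x \<bullet> h" for h
  proof -
    have "D h = D (\<Sum>i\<in>UNIV. h $ i *\<^sub>R axis i 1)"
      using basis_expansion[of h] by (simp add: scalar_mult_eq_scaleR)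
    also have "\<dots> = (\<Sum>i\<in>UNIV. h $ i * D (axis i 1))"
      by (simp add: linear_sum[OF lin] linear_scale[OF lin])
    finally show ?thesis by (simp add: inner_vec_def grad_nth[OF D] mult.commute)
  qed
  then have "D = (\<lambda>h. grad f x \<bullet> h)" by (simp add: fun_eq_iff)
  with D show ?thesis by (rule subst[rotated])
qed

lemma differentiable_on_UNIV_grad:
  "f differentiable_on UNIV \<Longrightarrow> (f has_derivative (\<lambda>h. grad f x \<bullet> h)) (at x)"
  by (rule differentiable_imp_grad) (simp add: differentiable_on_def)

lemma differentiable_on_UNIV_I:
  "(\<And>x. (f has_derivative f' x) (at x)) \<Longrightarrow> f differentiable_on UNIV"
  by (auto simp: differentiable_on_def differentiable_def)

lemma Ck_Suc: "Ck (Suc k) f \<Longrightarrow> Ck k f"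
  by (induction k arbitrary: f) (auto intro: differentiable_imp_continuous_on)

lemma Ck_grad: "Ck (Suc k) f \<Longrightarrow> Ck k (\<lambda>x. grad f x $ i)"
  by simp

lemma Ck_const [simp]: "Ck k (\<lambda>_. c)"
proof (induction k arbitrary: c)
  case (Suc k)
  have g: "grad (\<lambda>_. c) x = 0" for x
    by (rule grad_eqI) (simp add: has_derivative_const)
  show ?case using Suc[of 0] by (simp add: g)
qed auto

lemma Ck_affine: "Ck k (\<lambda>x. a \<bullet> x + c)"
proof (cases k)
  case (Suc n)
  have g: "((\<lambda>x. a \<bullet> x + c) has_derivative (\<lambda>h. a \<bullet> h)) (at x)" for x
    by (auto intro!: derivative_eq_intros)
  have "(\<lambda>x. a \<bullet> x + c) differentiable_on UNIV"
    by (rule differentiable_on_UNIV_I[OF g])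
  then show ?thesis by (simp add: Suc grad_eqI[OF g])
qed (auto intro!: continuous_intros)

lemma grad_add:
  assumes "f differentiable_on UNIV" "g differentiable_on UNIV"
  shows "grad (\<lambda>x. f x + g x) x = grad f x + grad g x"
  by (rule grad_eqI) (use assms[THEN differentiable_on_UNIV_grad, of x] in
      \<open>auto intro!: derivative_eq_intros simp: inner_add_left\<close>)

lemma grad_mult:
  assumes "f differentiable_on UNIV" "g differentiable_on UNIV"
  shows "grad (\<lambda>x. f x * g x) x = f x *\<^sub>R grad g x + g x *\<^sub>R grad f x"
  by (rule grad_eqI) (use assms[THEN differentiable_on_UNIV_grad, of x] in
      \<open>auto intro!: derivative_eq_intros simp: inner_add_left algebra_simps\<close>)

lemma Ck_add: "Ck k f \<Longrightarrow> Ck k g \<Longrightarrow> Ck k (\<lambda>x. f x + g x)"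
  by (induction k arbitrary: f g) (auto intro!: continuous_intros differentiable_on_add simp: grad_add)

lemma Ck_mult: "Ck k f \<Longrightarrow> Ck k g \<Longrightarrow> Ck k (\<lambda>x. f x * g x)"
proof (induction k arbitrary: f g)
  case (Suc k)
  have d: "f differentiable_on UNIV" "g differentiable_on UNIV" using Suc.prems by auto
  have "Ck k (\<lambda>x. f x * grad g x $ i + g x * grad f x $ i)" for i
    using Suc.prems by (intro Ck_add Suc.IH) (auto intro: Ck_Suc)
  then show ?case using d by (auto intro!: differentiable_on_mult simp: grad_mult)
qed (auto intro!: continuous_intros)

text \<open>The derivatives of \<open>exp (- 1 / x)\<close>, extended by zero to \<open>x \<le> 0\<close>, are again of this form.\<close>

definition hp :: "real poly \<Rightarrow> real \<Rightarrow> real" where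
  "hp p x = (if x > 0 then poly p (1 / x) * exp (- (1 / x)) else 0)"

lemma poly_times_exp_minus_tendsto_0: "((\<lambda>u::real. poly p u * exp (- u)) \<longlongrightarrow> 0) at_top"
proof -
  have "((\<lambda>u::real. \<Sum>i\<le>degree p. coeff p i * (u ^ i / exp u)) \<longlongrightarrow> (\<Sum>i\<le>degree p. coeff p i * 0)) at_top"
    by (intro tendsto_sum tendsto_mult tendsto_const tendsto_power_div_exp_0)
  moreover have "poly p u * exp (- u) = (\<Sum>i\<le>degree p. coeff p i * (u ^ i / exp u))" for u
    unfolding poly_altdef sum_distrib_right by (intro sum.cong refl) (simp add: exp_minus divide_inverse)
  ultimately show ?thesis by simp
qed

text \<open>With t = 1/x the derivative of t is - t^2, so p(t) exp(- t) has the derivative (p(t) -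
  p'(t)) t^2 exp(- t), again of the form \<open>hp\<close>. At 0 the difference quotients tend to 0
  because the exponential beats every polynomial in t.\<close>

lemma hp_has_derivative: "(hp p has_real_derivative hp ((p - pderiv p) * [:0, 0, 1:]) x) (at x)"
proof -
  consider "x < 0" | "x > 0" | "x = 0" by linarith
  then show ?thesis
  proof cases
    case 1
    have "((\<lambda>_. 0) has_real_derivative 0) (at x)" by simp
    then have "(hp p has_real_derivative 0) (at x)"
      by (rule has_field_derivative_transform_within_open[of _ _ _ "{..<0}"]) (use 1 in \<open>auto simp: hp_def\<close>)
    then show ?thesis using 1 by (simp add: hp_def)
  next
    case 2
    have "((\<lambda>x. poly p (1 / x) * exp (- (1 / x))) has_real_derivative
       hp ((p - pderiv p) * [:0, 0, 1:]) x) (at x)"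
      using 2 by (auto intro!: derivative_eq_intros poly_DERIV[THEN DERIV_chain2] simp: hp_def field_simps power2_eq_square)
    then show ?thesis
      by (rule has_field_derivative_transform_within_open[of _ _ _ "{0<..}"]) (use 2 in \<open>auto simp: hp_def\<close>)
  next
    case 3
    \<comment> \<open>The difference quotient at 0 is p(1/h) exp(- 1/h) / h; the division by h is
      the additional factor [:0, 1:].\<close>
    have "((\<lambda>u::real. poly (p * [:0, 1:]) u * exp (- u)) \<longlongrightarrow> 0) at_top"
      by (rule poly_times_exp_minus_tendsto_0)
    then have "((\<lambda>h. poly (p * [:0, 1:]) (inverse h) * exp (- inverse h)) \<longlongrightarrow> 0) (at_right 0)"
      by (rule filterlim_compose[OF _ filterlim_inverse_at_top_right])
    then have r: "((\<lambda>h. hp p h / h) \<longlongrightarrow> 0) (at_right 0)"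
    proof (rule Lim_transform_eventually)
      show "\<forall>\<^sub>F h in at_right 0. poly (p * [:0, 1:]) (inverse h) * exp (- inverse h) = hp p h / h"
        using eventually_at_right_less[of 0]
        by eventually_elim (simp add: hp_def divide_inverse)
    qed
    have l: "((\<lambda>h. hp p h / h) \<longlongrightarrow> 0) (at_left 0)"
      by (rule tendsto_eventually) (auto simp: hp_def eventually_at_left_field intro!: exI[of _ "-1"])
    have "((\<lambda>h. hp p h / h) \<longlongrightarrow> 0) (at 0)"
      using l r by (rule filterlim_split_at)
    then show ?thesis using 3 by (simp add: has_field_derivative_iff hp_def)
  qed
qed

lemma hp_has_derivative_comp:
  assumes "(f has_derivative (\<lambda>h. G \<bullet> h)) (at x)"
  shows "((\<lambda>x. hp p (f x)) has_derivative (\<lambda>h. (hp ((p - pderiv p) * [:0, 0, 1:]) (f x) *\<^sub>R G) \<bullet> h)) (at x)"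
  using has_derivative_compose[OF assms hp_has_derivative[unfolded has_field_derivative_def]] by simp

lemma Ck_hp_comp: "Ck k f \<Longrightarrow> Ck k (\<lambda>x. hp p (f x))"
proof (induction k arbitrary: p)
  case 0
  have "continuous_on UNIV (hp p)"
    by (rule DERIV_continuous_on) (use hp_has_derivative in auto)
  from continuous_on_compose2[OF this, of UNIV f] 0 show ?case by simp
next
  case (Suc k)
  have d: "((\<lambda>x. hp p (f x)) has_derivative (\<lambda>h. (hp ((p - pderiv p) * [:0, 0, 1:]) (f x) *\<^sub>R grad f x) \<bullet> h)) (at x)" for x
    using Suc.prems by (intro hp_has_derivative_comp differentiable_on_UNIV_grad) auto
  have "Ck k (\<lambda>x. hp ((p - pderiv p) * [:0, 0, 1:]) (f x) * grad f x $ i)" for i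
    using Suc.prems by (intro Ck_mult Suc.IH) (auto intro: Ck_Suc simp del: Ck.simps simp: Ck_grad)
  then show ?case
    using differentiable_on_UNIV_I[OF d] by (simp add: grad_eqI[OF d])
qed

text \<open>The function exp (- 1 / x) for x > 0 and 0 elsewhere, a smooth step that tends to 1 at
  infinity without reaching it. Its derivative belongs to the polynomial [:0, 0, 1:], which is what
  (p - p') t^2 becomes for p = 1.\<close>

abbreviation cutoff :: "real \<Rightarrow> real" where "cutoff \<equiv> hp 1"
abbreviation cutoff' :: "real \<Rightarrow> real" where "cutoff' \<equiv> hp ([:0, 0, 1:])"

lemma cutoff_deriv: "(cutoff has_real_derivative cutoff' x) (at x)"
  using hp_has_derivative[of 1 x] by simp

lemma cutoff_bounds: "0 \<le> cutoff x" "cutoff x \<le> 1"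
  by (auto simp: hp_def)

lemma cutoff'_bounds: "0 \<le> cutoff' x" "cutoff' x \<le> 1"
proof -
  have "(u::real)\<^sup>2 * exp (- u) \<le> 1" if "u > 0" for u
  proof -
    have "1 + u / 2 + (u / 2)\<^sup>2 / 2 \<le> exp (u / 2)"
      by (rule exp_lower_Taylor_quadratic) (use that in auto)
    \<comment> \<open>Completing the square: 1 + u/2 + u^2/8 exceeds u by ((u - 2)^2 + 4) / 8. Hence
      u \<le> exp (u/2), and squaring gives the bound.\<close>
    moreover have "(u - 2)\<^sup>2 / 8 \<ge> 0" by simp
    moreover have "(u - 2)\<^sup>2 = u\<^sup>2 - 4 * u + 4" by (simp add: power2_diff)
    moreover have "(u / 2)\<^sup>2 / 2 = u\<^sup>2 / 8" by (simp add: power_divide)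
    ultimately have "u \<le> exp (u / 2)" by linarith
    then have "u\<^sup>2 \<le> (exp (u / 2))\<^sup>2" using that by (intro power_mono) auto
    also have "\<dots> = exp u" by (simp add: power2_eq_square exp_add[symmetric])
    finally show ?thesis by (simp add: exp_minus field_simps)
  qed
  from this[of "1 / x"] show "cutoff' x \<le> 1"
    by (simp add: hp_def power2_eq_square)
  show "0 \<le> cutoff' x" by (simp add: hp_def)
qed

lemma continuous_on_hp: "continuous_on S (hp p)"
  by (rule DERIV_continuous_on) (use hp_has_derivative has_field_derivative_at_within in blast)

text \<open>The squared distance makes the argument of \<open>cutoff\<close> a polynomial in x, so
  that the bump is smooth at its centre too. For r > 0 it is positive exactly in the open disc of
  radius r.\<close>

definition bump :: "real^2 \<Rightarrow> real \<Rightarrow> real^2 \<Rightarrow> real" where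
  "bump c r x = cutoff (1 - ((x - c) \<bullet> (x - c)) / r\<^sup>2)"

lemma Ck_inner_self: "Ck k (\<lambda>x. (x - c) \<bullet> (x - c))"
proof -
  have eq: "(\<lambda>x::real^2. (x - c) \<bullet> (x - c)) =
    (\<lambda>x. (axis 1 1 \<bullet> x + - c $ 1) * (axis 1 1 \<bullet> x + - c $ 1) + (axis 2 1 \<bullet> x + - c $ 2) * (axis 2 1 \<bullet> x + - c $ 2))"
    by (auto simp: inner_vec_def sum_2 axis_def)
  show ?thesis unfolding eq by (intro Ck_add Ck_mult Ck_affine)
qed

lemma Ck_bump: "Ck k (bump c r)"
proof -
  have "Ck k (\<lambda>x. cutoff ((- 1 / r\<^sup>2) * ((x - c) \<bullet> (x - c)) + 1))"
    by (intro Ck_hp_comp Ck_add Ck_mult Ck_const Ck_inner_self)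
  moreover have "bump c r = (\<lambda>x. cutoff ((- 1 / r\<^sup>2) * ((x - c) \<bullet> (x - c)) + 1))"
    by (auto simp: bump_def fun_eq_iff)
  ultimately show ?thesis by (simp del: Ck.simps)
qed

lemma bump_bounds: "0 \<le> bump c r x" "bump c r x \<le> 1"
  by (auto simp: bump_def cutoff_bounds)

lemma bump_eq_0: "r > 0 \<Longrightarrow> r \<le> dist c x \<Longrightarrow> bump c r x = 0"
proof -
  assume "r > 0" "r \<le> dist c x"
  then have "r\<^sup>2 \<le> (norm (x - c))\<^sup>2" by (intro power_mono) (auto simp: dist_norm norm_minus_commute)
  then have "1 - ((x - c) \<bullet> (x - c)) / r\<^sup>2 \<le> 0"
    using \<open>r > 0\<close> by (simp add: power2_norm_eq_inner field_simps)
  then show ?thesis by (simp add: bump_def hp_def)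
qed

lemma bump_ge: "r > 0 \<Longrightarrow> dist c x \<le> r / 2 \<Longrightarrow> 1/8 \<le> bump c r x"
proof -
  assume r: "r > 0" "dist c x \<le> r / 2"
  then have "(norm (x - c))\<^sup>2 \<le> (r/2)\<^sup>2" by (intro power_mono) (auto simp: dist_norm norm_minus_commute)
  then have s: "3/4 \<le> 1 - ((x - c) \<bullet> (x - c)) / r\<^sup>2"
    using \<open>r > 0\<close> by (simp add: power2_norm_eq_inner field_simps)
  define s where "s = 1 - ((x - c) \<bullet> (x - c)) / r\<^sup>2"
  have s1: "s \<ge> 3/4" using s s_def by simp
  \<comment> \<open>At distance r/2 the argument s is at least 3/4, so 1/s \<le> 4/3 \<le> 3/2, and
    exp (3/2) \<le> 2^3 = 8 because exp (1/2) \<le> 2.\<close>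
  have "exp (1/2) \<le> (2::real)" using exp_bound_half[of "1/2::real"] by simp
  then have "(exp (1/2))^3 \<le> (2::real)^3" by (intro power_mono) auto
  then have e: "exp (3/2) \<le> (8::real)" by (simp add: exp_of_nat_mult[symmetric])
  have "exp (1 / s) \<le> exp (3/2)" using s1 by (simp add: field_simps)
  then have "exp (1 / s) \<le> 8" using e by linarith
  then have "1/8 \<le> inverse (exp (1/s))" by (simp add: field_simps)
  then show ?thesis using s1 by (simp add: bump_def hp_def s_def[symmetric] exp_minus)
qed

lemma grad_bump:
  "(bump c r has_derivative (\<lambda>h. ((cutoff' (1 - ((x - c) \<bullet> (x - c)) / r\<^sup>2) * (- 2 / r\<^sup>2)) *\<^sub>R (x - c)) \<bullet> h)) (at x)"
proof -
  have "((\<lambda>x. 1 - ((x - c) \<bullet> (x - c)) / r\<^sup>2) has_derivative (\<lambda>h. ((- 2 / r\<^sup>2) *\<^sub>R (x - c)) \<bullet> h)) (at x)"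
    unfolding divide_inverse
    by (rule has_derivative_eq_rhs, (rule derivative_intros)+) (auto simp: inner_commute algebra_simps)
  from hp_has_derivative_comp[OF this, of 1] show ?thesis
    by (simp add: bump_def[abs_def])
qed

lemma norm_grad_bump: "r > 0 \<Longrightarrow> norm (grad (bump c r) x) \<le> 2 / r"
proof -
  assume r: "r > 0"
  have g: "grad (bump c r) x = (cutoff' (1 - ((x - c) \<bullet> (x - c)) / r\<^sup>2) * (- 2 / r\<^sup>2)) *\<^sub>R (x - c)"
    by (rule grad_eqI[OF grad_bump])
  show ?thesis
  proof (cases "norm (x - c) \<le> r")
    case True
    have "norm (grad (bump c r) x) = cutoff' (1 - ((x - c) \<bullet> (x - c)) / r\<^sup>2) * (2 / r\<^sup>2) * norm (x - c)"
      using cutoff'_bounds by (simp add: g abs_mult)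
    also have "\<dots> \<le> 1 * (2 / r\<^sup>2) * r"
      using cutoff'_bounds True r by (intro mult_mono) auto
    finally show ?thesis using r by (simp add: power2_eq_square)
  next
    case False
    then have "r\<^sup>2 \<le> (norm (x - c))\<^sup>2" using r by (intro power_mono) auto
    then have "1 - ((x - c) \<bullet> (x - c)) / r\<^sup>2 \<le> 0"
      using \<open>r > 0\<close> by (simp add: power2_norm_eq_inner field_simps)
    then show ?thesis using r unfolding g by (simp add: hp_def)
  qed
qed

lemma grad_bump_eq_0: "r > 0 \<Longrightarrow> r \<le> dist c x \<Longrightarrow> grad (bump c r) x = 0"
proof -
  assume "r > 0" "r \<le> dist c x"
  then have "r\<^sup>2 \<le> (norm (x - c))\<^sup>2" by (intro power_mono) (auto simp: dist_norm norm_minus_commute)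
  then have "1 - ((x - c) \<bullet> (x - c)) / r\<^sup>2 \<le> 0"
    using \<open>r > 0\<close> by (simp add: power2_norm_eq_inner field_simps)
  then show ?thesis unfolding grad_eqI[OF grad_bump] by (simp add: hp_def)
qed

lemma test_functions_I:
  assumes "\<And>k. Ck k \<phi>" "compact S" "S \<subseteq> U" "\<And>x. x \<notin> S \<Longrightarrow> \<phi> x = 0"
  shows "\<phi> \<in> test_functions U"
  using assms by (auto simp: test_functions_def simp del: Ck.simps)

text \<open>A sequence of smooth functions between 0 and 1 that vanish outside the open box and
  converge pointwise to its indicator, since \<open>cutoff\<close> (n s) tends to 1 for s > 0.
  Through dominated convergence, identities tested with smooth functions become identities for
  integrals over boxes.\<close>

definition box_cutoff :: "real^2 \<Rightarrow> real^2 \<Rightarrow> nat \<Rightarrow> real^2 \<Rightarrow> real" where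
  "box_cutoff a b n x = (\<Prod>i\<in>UNIV. cutoff (real (Suc n) * (x $ i - a $ i)) * cutoff (real (Suc n) * (b $ i - x $ i)))"

lemma Ck_box_cutoff: "Ck k (box_cutoff a b n)"
proof -
  have c: "Ck k (\<lambda>x. cutoff ((s *\<^sub>R axis i 1) \<bullet> x + t))" for s t i
    by (intro Ck_hp_comp Ck_affine)
  have eq: "box_cutoff a b n = (\<lambda>x.
      (cutoff ((real (Suc n) *\<^sub>R axis 1 1) \<bullet> x + - real (Suc n) * a $ 1) *
       cutoff (((- real (Suc n)) *\<^sub>R axis 1 1) \<bullet> x + real (Suc n) * b $ 1)) *
      (cutoff ((real (Suc n) *\<^sub>R axis 2 1) \<bullet> x + - real (Suc n) * a $ 2) *
       cutoff (((- real (Suc n)) *\<^sub>R axis 2 1) \<bullet> x + real (Suc n) * b $ 2)))"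
    by (auto simp: fun_eq_iff box_cutoff_def UNIV_2 inner_axis' algebra_simps)
  show ?thesis unfolding eq by (intro Ck_mult c)
qed

lemma box_cutoff_bounds: "0 \<le> box_cutoff a b n x" "box_cutoff a b n x \<le> 1"
  by (auto simp: box_cutoff_def UNIV_2 cutoff_bounds intro!: mult_le_one mult_nonneg_nonneg)

lemma box_cutoff_eq_0: "x \<notin> box a b \<Longrightarrow> box_cutoff a b n x = 0"
  by (auto simp: box_cutoff_def UNIV_2 mem_box_cart hp_def not_less zero_less_mult_iff forall_2)

lemma box_cutoff_tendsto: "(\<lambda>n. box_cutoff a b n x) \<longlonglongrightarrow> indicator (box a b) x"
proof (cases "x \<in> box a b")
  case True
  have t: "(\<lambda>n. cutoff (real (Suc n) * s)) \<longlonglongrightarrow> 1" if "s > 0" for s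
  proof -
    have "(\<lambda>n. exp (- (inverse (real (Suc n)) * (1/s)))) \<longlonglongrightarrow> exp (- (0 * (1/s)))"
      by (intro tendsto_intros LIMSEQ_inverse_real_of_nat)
    then show ?thesis using that by (simp add: hp_def divide_inverse mult.commute zero_less_mult_iff)
  qed
  have "(\<lambda>n. box_cutoff a b n x) \<longlonglongrightarrow> (\<Prod>i\<in>(UNIV::2 set). 1 * 1)"
    unfolding box_cutoff_def using True
    by (intro tendsto_prod tendsto_mult t) (auto simp: mem_box_cart)
  then show ?thesis using True by simp
qed (simp add: box_cutoff_eq_0)

section \<open>Square integrable functions and weak gradients\<close>

lemma integrable_cauchy_schwarz:
  fixes f g :: "'a \<Rightarrow> 'b::euclidean_space"
  assumes [measurable]: "f \<in> borel_measurable M" "g \<in> borel_measurable M"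
    and f: "integrable M (\<lambda>x. (norm (f x))\<^sup>2)" and g: "integrable M (\<lambda>x. (norm (g x))\<^sup>2)"
  shows "integrable M (\<lambda>x. f x \<bullet> g x)" "integrable M (\<lambda>x. norm (f x) * norm (g x))"
    "\<bar>\<integral>x. f x \<bullet> g x \<partial>M\<bar> \<le> sqrt (\<integral>x. (norm (f x))\<^sup>2 \<partial>M) * sqrt (\<integral>x. (norm (g x))\<^sup>2 \<partial>M)"
proof -
  have le: "norm (f x) * norm (g x) \<le> (norm (f x))\<^sup>2 + (norm (g x))\<^sup>2" for x
    using sum_squares_bound[of "norm (f x)" "norm (g x)"] mult_nonneg_nonneg[OF norm_ge_zero norm_ge_zero, of "f x" "g x"]
    by linarith
  have s: "integrable M (\<lambda>x. (norm (f x))\<^sup>2 + (norm (g x))\<^sup>2)" using f g by simp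
  show i: "integrable M (\<lambda>x. f x \<bullet> g x)"
    by (rule Bochner_Integration.integrable_bound[OF s])
       (auto intro!: AE_I2 order_trans[OF Cauchy_Schwarz_ineq2 le])
  show "integrable M (\<lambda>x. norm (f x) * norm (g x))"
    by (rule Bochner_Integration.integrable_bound[OF s]) (auto intro!: AE_I2 le)
  define A where "A = (\<integral>x. (norm (f x))\<^sup>2 \<partial>M)"
  define B where "B = (\<integral>x. (norm (g x))\<^sup>2 \<partial>M)"
  define C where "C = (\<integral>x. f x \<bullet> g x \<partial>M)"
  \<comment> \<open>The integral of |f - t g|^2 is a nonnegative quadratic in t. It is used at its
    minimum t = C / B; for B = 0 it is linear, and the t chosen below would make it equal to - 1 if
    C were not 0.\<close>
  have q: "0 \<le> A - 2 * t * C + t\<^sup>2 * B" for t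
  proof -
    have "0 \<le> (\<integral>x. (norm (f x - t *\<^sub>R g x))\<^sup>2 \<partial>M)" by simp
    also have "\<dots> = (\<integral>x. (norm (f x))\<^sup>2 - 2 * t * (f x \<bullet> g x) + t\<^sup>2 * (norm (g x))\<^sup>2 \<partial>M)"
    proof (intro Bochner_Integration.integral_cong refl)
      fix x
      show "(norm (f x - t *\<^sub>R g x))\<^sup>2 = (norm (f x))\<^sup>2 - 2 * t * (f x \<bullet> g x) + t\<^sup>2 * (norm (g x))\<^sup>2"
        unfolding power2_norm_eq_inner
        by (simp add: algebra_simps inner_commute power2_eq_square)
    qed
    also have "\<dots> = A - 2 * t * C + t\<^sup>2 * B"
      using f g i by (simp add: A_def B_def C_def)
    finally show ?thesis .
  qed
  have AB: "0 \<le> A" "0 \<le> B" by (auto simp: A_def B_def)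
  have "C\<^sup>2 \<le> A * B"
  proof (cases "B = 0")
    case True
    have "C = 0"
    proof (rule ccontr)
      assume "C \<noteq> 0"
      then show False using q[of "(A + 1) / (2 * C)"] True by (simp add: field_simps)
    qed
    then show ?thesis using AB by simp
  next
    case False
    then have "0 \<le> A - C\<^sup>2 / B" using q[of "C / B"] by (simp add: power2_eq_square field_simps)
    then show ?thesis using False AB by (simp add: field_simps)
  qed
  then show "\<bar>\<integral>x. f x \<bullet> g x \<partial>M\<bar> \<le> sqrt (\<integral>x. (norm (f x))\<^sup>2 \<partial>M) * sqrt (\<integral>x. (norm (g x))\<^sup>2 \<partial>M)"
    unfolding A_def[symmetric] B_def[symmetric] C_def[symmetric]
    using real_sqrt_le_mono by (fastforce simp: real_sqrt_mult[symmetric])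
qed

text \<open>Membership is expressed through functions cut off by the indicator of S: in this form
  measurability and integrability on subsets and unions are statements about one and the same
  measure.\<close>

lemma L2_space_iff:
  assumes "S \<inter> space M \<in> sets M"
  shows "f \<in> L2_space M S \<longleftrightarrow> set_borel_measurable M S f \<and> set_integrable M S (\<lambda>x. (norm (f x))\<^sup>2)"
  using assms by (simp add: L2_space_def borel_measurable_restrict_space_iff integrable_restrict_space
      set_borel_measurable_def set_integrable_def)

lemma L2_norm_nonneg [simp]: "0 \<le> L2_norm M S f"
  by (auto simp: L2_norm_def set_lebesgue_integral_def intro!: integral_nonneg_AE AE_I2)

lemma norm_indicator_sq: "(norm (indicator S x *\<^sub>R y))\<^sup>2 = indicator S x *\<^sub>R (norm y)\<^sup>2"
  by (simp add: indicator_def)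

lemma set_cauchy_schwarz:
  fixes f g :: "'a \<Rightarrow> 'b::euclidean_space"
  assumes S: "S \<inter> space M \<in> sets M" and f: "f \<in> L2_space M S" and g: "g \<in> L2_space M S"
  shows "set_integrable M S (\<lambda>x. f x \<bullet> g x)" "set_integrable M S (\<lambda>x. norm (f x) * norm (g x))"
    "\<bar>LINT x:S|M. f x \<bullet> g x\<bar> \<le> L2_norm M S f * L2_norm M S g"
proof -
  let ?f = "\<lambda>x. indicator S x *\<^sub>R f x" and ?g = "\<lambda>x. indicator S x *\<^sub>R g x"
  have m: "?f \<in> borel_measurable M" "?g \<in> borel_measurable M"
    and i: "integrable M (\<lambda>x. (norm (?f x))\<^sup>2)" "integrable M (\<lambda>x. (norm (?g x))\<^sup>2)"
    using f g unfolding norm_indicator_sq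
    by (simp_all add: L2_space_iff[OF S] set_borel_measurable_def set_integrable_def)
  have e: "?f x \<bullet> ?g x = indicator S x *\<^sub>R (f x \<bullet> g x)"
     "norm (?f x) * norm (?g x) = indicator S x *\<^sub>R (norm (f x) * norm (g x))" for x
    by (auto simp: indicator_def)
  from integrable_cauchy_schwarz[OF m i]
  show "set_integrable M S (\<lambda>x. f x \<bullet> g x)" "set_integrable M S (\<lambda>x. norm (f x) * norm (g x))"
    "\<bar>LINT x:S|M. f x \<bullet> g x\<bar> \<le> L2_norm M S f * L2_norm M S g"
    unfolding e norm_indicator_sq set_integrable_def L2_norm_def set_lebesgue_integral_def by simp_all
qed

lemma L2_space_scaleR:
  assumes S: "S \<inter> space M \<in> sets M" and f: "f \<in> L2_space M S"
  shows "(\<lambda>x. c *\<^sub>R f x) \<in> L2_space M S"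
proof -
  have "(\<lambda>x. c *\<^sub>R (indicator S x *\<^sub>R f x)) \<in> borel_measurable M"
    "integrable M (\<lambda>x. c\<^sup>2 * (indicator S x *\<^sub>R (norm (f x))\<^sup>2))"
    using f borel_measurable_scaleR[OF borel_measurable_const[of c], of "\<lambda>x. indicator S x *\<^sub>R f x" M]
    by (simp_all only: L2_space_iff[OF S] set_borel_measurable_def set_integrable_def integrable_mult_right)
  moreover have "(\<lambda>x. c *\<^sub>R (indicator S x *\<^sub>R f x)) = (\<lambda>x. indicator S x *\<^sub>R (c *\<^sub>R f x))"
    "(\<lambda>x. c\<^sup>2 * (indicator S x *\<^sub>R (norm (f x))\<^sup>2)) = (\<lambda>x. indicator S x *\<^sub>R (norm (c *\<^sub>R f x))\<^sup>2)"
    by (auto simp: power_mult_distrib)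
  ultimately show ?thesis unfolding L2_space_iff[OF S] set_borel_measurable_def set_integrable_def by metis
qed

lemma L2_space_add:
  assumes S: "S \<inter> space M \<in> sets M" and f: "f \<in> L2_space M S" and g: "g \<in> L2_space M S"
  shows "(\<lambda>x. f x + g x) \<in> L2_space M S"
proof -
  have m[measurable]: "(\<lambda>x. indicator S x *\<^sub>R f x) \<in> borel_measurable M" "(\<lambda>x. indicator S x *\<^sub>R g x) \<in> borel_measurable M"
    and i: "integrable M (\<lambda>x. indicator S x *\<^sub>R (norm (f x))\<^sup>2)" "integrable M (\<lambda>x. indicator S x *\<^sub>R (norm (g x))\<^sup>2)"
    using f g by (simp_all add: L2_space_iff[OF S] set_borel_measurable_def set_integrable_def)
  have mm: "(\<lambda>x. indicator S x *\<^sub>R (f x + g x)) \<in> borel_measurable M"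
    unfolding scaleR_add_right by measurable
  have "integrable M (\<lambda>x. 2 * (indicator S x *\<^sub>R (norm (f x))\<^sup>2) + 2 * (indicator S x *\<^sub>R (norm (g x))\<^sup>2))"
    using i by simp
  moreover have "(\<lambda>x. indicator S x *\<^sub>R (norm (f x + g x))\<^sup>2) \<in> borel_measurable M"
    using borel_measurable_power[OF measurable_compose[OF mm borel_measurable_norm], of 2] unfolding norm_indicator_sq .
  ultimately have "integrable M (\<lambda>x. indicator S x *\<^sub>R (norm (f x + g x))\<^sup>2)"
  proof (rule Bochner_Integration.integrable_bound)
    show "AE x in M. norm (indicator S x *\<^sub>R (norm (f x + g x))\<^sup>2)
      \<le> norm (2 * (indicator S x *\<^sub>R (norm (f x))\<^sup>2) + 2 * (indicator S x *\<^sub>R (norm (g x))\<^sup>2))"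
    proof (rule AE_I2)
      fix x
      have "(norm (f x + g x))\<^sup>2 \<le> (norm (f x) + norm (g x))\<^sup>2"
        by (intro power_mono norm_triangle_ineq) auto
      also have "\<dots> \<le> 2 * (norm (f x))\<^sup>2 + 2 * (norm (g x))\<^sup>2"
        using sum_squares_bound[of "norm (f x)" "norm (g x)"] by (simp add: power2_sum)
      finally show "norm (indicator S x *\<^sub>R (norm (f x + g x))\<^sup>2)
        \<le> norm (2 * (indicator S x *\<^sub>R (norm (f x))\<^sup>2) + 2 * (indicator S x *\<^sub>R (norm (g x))\<^sup>2))"
        by (auto simp: indicator_def)
    qed
  qed
  then show ?thesis using mm by (simp add: L2_space_iff[OF S] set_borel_measurable_def set_integrable_def)
qed

lemma L2_space_diff:
  assumes S: "S \<inter> space M \<in> sets M" and f: "f \<in> L2_space M S" and g: "g \<in> L2_space M S"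
  shows "(\<lambda>x. f x - g x) \<in> L2_space M S"
  using L2_space_add[OF S f L2_space_scaleR[OF S g, of "-1"]] by simp

lemma L2_space_mono:
  assumes T: "T \<in> sets M" and S: "S \<in> sets M" and TS: "T \<subseteq> S" and f: "f \<in> L2_space M S"
  shows "f \<in> L2_space M T"
proof -
  have S': "S \<inter> space M \<in> sets M" and T': "T \<inter> space M \<in> sets M" using S T by auto
  have "(\<lambda>x. indicator S x *\<^sub>R f x) \<in> borel_measurable M"
    using f by (simp add: L2_space_iff[OF S'] set_borel_measurable_def)
  from borel_measurable_scaleR[OF borel_measurable_indicator[OF T] this]
  have "(\<lambda>x. indicator T x *\<^sub>R (indicator S x *\<^sub>R f x)) \<in> borel_measurable M" .
  moreover have "(\<lambda>x. indicator T x *\<^sub>R (indicator S x *\<^sub>R f x)) = (\<lambda>x. indicator T x *\<^sub>R f x)"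
    using TS by (auto simp: indicator_def fun_eq_iff)
  ultimately show ?thesis
    using f set_integrable_subset[OF _ T TS, of "\<lambda>x. (norm (f x))\<^sup>2"] by (simp add: L2_space_iff[OF T'] L2_space_iff[OF S'] set_borel_measurable_def)
qed

lemma L2_space_nth:
  fixes f :: "'a \<Rightarrow> real^'n"
  assumes S: "S \<inter> space M \<in> sets M" and f: "f \<in> L2_space M S"
  shows "(\<lambda>x. f x $ i) \<in> L2_space M S"
proof -
  have m[measurable]: "(\<lambda>x. indicator S x *\<^sub>R f x) \<in> borel_measurable M"
    and i: "integrable M (\<lambda>x. indicator S x *\<^sub>R (norm (f x))\<^sup>2)"
    using f by (simp_all add: L2_space_iff[OF S] set_borel_measurable_def set_integrable_def)
  have "(\<lambda>x. (indicator S x *\<^sub>R f x) \<bullet> axis i 1) \<in> borel_measurable M" by measurable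
  then have mm[measurable]: "(\<lambda>x. indicator S x * (f x $ i)) \<in> borel_measurable M"
    by (simp add: inner_axis)
  have "(\<lambda>x. (indicator S x * (f x $ i))\<^sup>2) \<in> borel_measurable M" by measurable
  then have "(\<lambda>x. indicator S x * (f x $ i)\<^sup>2) \<in> borel_measurable M"
    by (rule measurable_cong[THEN iffD1, rotated]) (auto simp: indicator_def)
  with i have "integrable M (\<lambda>x. indicator S x * (f x $ i)\<^sup>2)"
  proof (rule Bochner_Integration.integrable_bound, intro AE_I2)
    fix x
    have "\<bar>f x $ i\<bar> \<le> norm (f x)" by (rule component_le_norm_cart)
    then have "(f x $ i)\<^sup>2 \<le> (norm (f x))\<^sup>2" by (metis norm_ge_zero abs_le_square_iff abs_of_nonneg)
    then show "norm (indicator S x * (f x $ i)\<^sup>2) \<le> norm (indicator S x *\<^sub>R (norm (f x))\<^sup>2)"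
      by (auto simp: indicator_def)
  qed
  then show ?thesis using mm by (simp add: L2_space_iff[OF S] set_borel_measurable_def set_integrable_def)
qed

lemma L2_space_bounded:
  fixes f :: "'a \<Rightarrow> 'b::euclidean_space"
  assumes S: "S \<in> sets M" "emeasure M S < \<infinity>" and f: "set_borel_measurable M S f"
    and B: "AE x in M. x \<in> S \<longrightarrow> norm (f x) \<le> B"
  shows "f \<in> L2_space M S"
proof -
  have m[measurable]: "(\<lambda>x. indicator S x *\<^sub>R f x) \<in> borel_measurable M"
    using f by (simp add: set_borel_measurable_def)
  have "integrable M (\<lambda>x. indicator S x *\<^sub>R (norm (f x))\<^sup>2)"
  proof (rule Bochner_Integration.integrable_bound)
    show "integrable M (\<lambda>x. indicator S x *\<^sub>R B\<^sup>2)" using S by (intro integrable_scaleR_left) simp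
    show "(\<lambda>x. indicator S x *\<^sub>R (norm (f x))\<^sup>2) \<in> borel_measurable M"
      using borel_measurable_power[OF measurable_compose[OF m borel_measurable_norm], of 2] unfolding norm_indicator_sq .
    show "AE x in M. norm (indicator S x *\<^sub>R (norm (f x))\<^sup>2) \<le> norm (indicator S x *\<^sub>R B\<^sup>2)"
      using B by eventually_elim (auto simp: indicator_def intro!: power_mono)
  qed
  then show ?thesis using f S by (simp add: L2_space_iff set_integrable_def)
qed

lemma L2_norm_bounded:
  fixes f :: "'a \<Rightarrow> 'b::euclidean_space"
  assumes S: "S \<in> sets M" "emeasure M S < \<infinity>" and B: "\<And>x. x \<in> S \<Longrightarrow> norm (f x) \<le> B" "0 \<le> B"
  shows "L2_norm M S f \<le> B * sqrt (measure M S)"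
proof (cases "set_integrable M S (\<lambda>x. (norm (f x))\<^sup>2)")
  case True
  have "(LINT x:S|M. (norm (f x))\<^sup>2) \<le> (LINT x:S|M. B\<^sup>2)"
    using True S B by (intro set_integral_mono) (auto simp: set_integrable_def intro!: power_mono integrable_scaleR_left)
  also have "\<dots> = B\<^sup>2 * measure M S" using S by (simp add: set_lebesgue_integral_def)
  finally show ?thesis using B real_sqrt_le_mono unfolding L2_norm_def
    by (metis real_sqrt_mult real_sqrt_abs abs_of_nonneg)
next
  case False
  then show ?thesis using B
    by (simp add: L2_norm_def set_lebesgue_integral_def set_integrable_def not_integrable_integral_eq)
qed

lemma L2_norm_mono:
  assumes T: "T \<in> sets M" and S: "S \<in> sets M" and TS: "T \<subseteq> S" and f: "f \<in> L2_space M S"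
  shows "L2_norm M T f \<le> L2_norm M S f"
proof -
  have S': "S \<inter> space M \<in> sets M" using S by auto
  have i: "set_integrable M S (\<lambda>x. (norm (f x))\<^sup>2)" using f by (simp add: L2_space_iff[OF S'])
  have "(LINT x:T|M. (norm (f x))\<^sup>2) \<le> (LINT x:S|M. (norm (f x))\<^sup>2)"
    using i set_integrable_subset[OF i T TS] TS unfolding set_lebesgue_integral_def set_integrable_def
    by (intro integral_mono) (auto simp: indicator_def)
  then show ?thesis by (simp add: L2_norm_def)
qed

lemma L2_norm_cong_AE:
  assumes S: "S \<in> sets M" and f: "f \<in> L2_space M S" and g: "g \<in> L2_space M S" and "AE x in M. x \<in> S \<longrightarrow> f x = g x"
  shows "L2_norm M S f = L2_norm M S g"
proof -
  have S': "S \<inter> space M \<in> sets M" using S by auto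
  have "(LINT x:S|M. (norm (f x))\<^sup>2) = (LINT x:S|M. (norm (g x))\<^sup>2)"
    using assms unfolding set_lebesgue_integral_def
    by (intro integral_cong_AE) (auto simp: L2_space_iff[OF S'] set_integrable_def indicator_def dest!: borel_measurable_integrable)
  then show ?thesis by (simp add: L2_norm_def)
qed

lemma L2_norm_triangle:
  fixes f g :: "'a \<Rightarrow> 'b::euclidean_space"
  assumes S: "S \<inter> space M \<in> sets M" and f: "f \<in> L2_space M S" and g: "g \<in> L2_space M S"
  shows "L2_norm M S (\<lambda>x. f x + g x) \<le> L2_norm M S f + L2_norm M S g"
proof -
  have i: "set_integrable M S (\<lambda>x. (norm (f x))\<^sup>2)" "set_integrable M S (\<lambda>x. (norm (g x))\<^sup>2)"
    using f g by (simp_all add: L2_space_iff[OF S])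
  have fg: "set_integrable M S (\<lambda>x. f x \<bullet> g x)" using set_cauchy_schwarz[OF S f g] by simp
  have "(LINT x:S|M. (norm (f x + g x))\<^sup>2) = (LINT x:S|M. (norm (f x))\<^sup>2 + (2 * (f x \<bullet> g x) + (norm (g x))\<^sup>2))"
    by (intro arg_cong2[where f = "set_lebesgue_integral M"] refl ext)
       (simp add: power2_norm_eq_inner algebra_simps inner_commute)
  also have "\<dots> = (LINT x:S|M. (norm (f x))\<^sup>2) + (2 * (LINT x:S|M. f x \<bullet> g x) + (LINT x:S|M. (norm (g x))\<^sup>2))"
    using i fg by (simp add: set_integral_add)
  also have "\<dots> \<le> (L2_norm M S f)\<^sup>2 + (2 * (L2_norm M S f * L2_norm M S g) + (L2_norm M S g)\<^sup>2)"
    using set_cauchy_schwarz(3)[OF S f g] by (simp add: L2_norm_def set_lebesgue_integral_def)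
  also have "\<dots> = (L2_norm M S f + L2_norm M S g)\<^sup>2" by (simp add: power2_sum)
  finally have "sqrt (LINT x:S|M. (norm (f x + g x))\<^sup>2) \<le> L2_norm M S f + L2_norm M S g"
    by (intro real_le_lsqrt) (auto intro!: add_nonneg_nonneg simp: set_lebesgue_integral_def)
  then show ?thesis by (simp add: L2_norm_def)
qed

section \<open>Integrals of gradients, and weak gradients\<close>

lemma continuous_compact_support_integrable:
  fixes f :: "'a::euclidean_space \<Rightarrow> 'b::euclidean_space"
  assumes f: "continuous_on UNIV f" and S: "compact S" and z: "\<And>x. x \<notin> S \<Longrightarrow> f x = 0"
  shows "integrable lborel f"
proof -
  have "set_integrable lborel S f" unfolding set_integrable_def
    by (rule borel_integrable_compact[OF S continuous_on_subset[OF f]]) simp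
  moreover have "(\<lambda>x. indicator S x *\<^sub>R f x) = f" using z by (auto simp: indicator_def)
  ultimately show ?thesis by (simp add: set_integrable_def)
qed

text \<open>The divergence theorem for functions of compact support, from translation invariance:
  difference quotients in a direction u integrate to 0, converge to G \<bullet> u, and are dominated
  because the gradient is bounded.\<close>

lemma integral_gradient_zero:
  fixes \<psi> :: "real^2 \<Rightarrow> real"
  assumes d: "\<And>x. (\<psi> has_derivative (\<lambda>h. G x \<bullet> h)) (at x)" and G: "continuous_on UNIV G"
    and S: "compact S" and z: "\<And>x. x \<notin> S \<Longrightarrow> \<psi> x = 0"
  shows "(\<integral>x. G x \<partial>lebesgue) = 0" "integrable lebesgue G"
proof -
  have Gz: "G x = 0" if "x \<notin> S" for x
  proof -
    have "((\<lambda>_. 0) has_derivative (\<lambda>h. 0)) (at x)" by simp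
    moreover have "open (- S)" using S compact_imp_closed by blast
    ultimately have "(\<psi> has_derivative (\<lambda>h. 0)) (at x)"
      using has_derivative_transform_within_open[of "\<lambda>_. 0" "\<lambda>h. 0" x UNIV "- S" \<psi>] that z by auto
    then have "(\<lambda>h. G x \<bullet> h) = (\<lambda>h. 0)" using d has_derivative_unique by blast
    then show ?thesis by (metis inner_eq_zero_iff)
  qed
  have Gi: "integrable lborel G" using continuous_compact_support_integrable[OF G S Gz] .
  then show "integrable lebesgue G" by (simp add: integrable_completion)
  have cont: "continuous_on UNIV \<psi>"
    using d by (meson continuous_at_imp_continuous_on has_derivative_continuous)
  have \<psi>i: "integrable lborel \<psi>" using continuous_compact_support_integrable[OF cont S z] .
  have "bounded (G ` S)" using S G by (meson compact_continuous_image compact_imp_bounded continuous_on_subset subset_UNIV)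
  then obtain B where B: "\<And>x. x \<in> S \<Longrightarrow> norm (G x) \<le> B" "B > 0" by (auto simp: bounded_pos)
  have B': "norm (G x) \<le> B" for x using B Gz[of x] by (cases "x \<in> S") auto
  obtain R where R: "\<And>x. x \<in> S \<Longrightarrow> norm x \<le> R" using S compact_imp_bounded bounded_iff by metis
  have u: "(\<integral>x. G x \<bullet> u \<partial>lborel) = 0" for u
  proof -
    define q where "q n x = real (Suc n) * (\<psi> (x + u /\<^sub>R real (Suc n)) - \<psi> x)" for n x
    have "(\<lambda>n. \<integral>x. q n x \<partial>lborel) \<longlonglongrightarrow> (\<integral>x. G x \<bullet> u \<partial>lborel)"
    proof (rule integral_dominated_convergence)
      \<comment> \<open>Both the support and its translates lie in this ball, since every step has
        length at most |u|; the factor B |u| comes from the mean value inequality.\<close>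
      show "integrable lborel (\<lambda>x. indicator (cball 0 (R + norm u)) x *\<^sub>R (B * norm u))"
        by (intro integrable_scaleR_left integrable_real_indicator emeasure_bounded_finite) auto
      show "(\<lambda>x. G x \<bullet> u) \<in> borel_measurable lborel"
        using G by (auto intro!: borel_measurable_continuous_onI continuous_intros)
      show "q n \<in> borel_measurable lborel" for n
        unfolding q_def using cont
        by (auto intro!: borel_measurable_continuous_onI continuous_intros intro: continuous_on_compose2[OF cont])
      show "AE x in lborel. (\<lambda>n. q n x) \<longlonglongrightarrow> G x \<bullet> u"
      proof (rule AE_I2)
        fix x
        have "((\<lambda>t. \<psi> (x + t *\<^sub>R u)) has_derivative (\<lambda>s. G x \<bullet> (s *\<^sub>R u))) (at 0)"
          by (rule has_derivative_compose[of "\<lambda>t. x + t *\<^sub>R u" "\<lambda>s. s *\<^sub>R u" 0 UNIV \<psi> "\<lambda>h. G x \<bullet> h"])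
            (use d in \<open>auto intro!: derivative_eq_intros\<close>)
        then have "((\<lambda>t. \<psi> (x + t *\<^sub>R u)) has_real_derivative (G x \<bullet> u)) (at 0)"
          by (simp add: has_field_derivative_def mult.commute[of _ "G x \<bullet> u"] mult_commute_abs)
        then have "((\<lambda>t. (\<psi> (x + t *\<^sub>R u) - \<psi> x) / t) \<longlongrightarrow> G x \<bullet> u) (at 0)"
          by (simp add: has_field_derivative_iff)
        moreover have "filterlim (\<lambda>n. inverse (real (Suc n))) (at 0) sequentially"
          using LIMSEQ_inverse_real_of_nat by (auto simp: filterlim_at)
        ultimately have "(\<lambda>n. (\<psi> (x + inverse (real (Suc n)) *\<^sub>R u) - \<psi> x) / inverse (real (Suc n))) \<longlonglongrightarrow> G x \<bullet> u"
          by (rule filterlim_compose)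
        then show "(\<lambda>n. q n x) \<longlonglongrightarrow> G x \<bullet> u" by (simp add: q_def divide_inverse mult.commute)
      qed
      show "AE x in lborel. norm (q n x) \<le> indicator (cball 0 (R + norm u)) x *\<^sub>R (B * norm u)" for n
      proof (rule AE_I2)
        fix x
        have small: "norm (u /\<^sub>R real (Suc n)) \<le> norm u"
        proof -
          have "norm u * inverse (real (Suc n)) \<le> norm u * 1"
            by (intro mult_left_mono) (auto simp: field_simps)
          then show ?thesis by (simp add: mult.commute)
        qed
        show "norm (q n x) \<le> indicator (cball 0 (R + norm u)) x *\<^sub>R (B * norm u)"
        proof (cases "x \<in> cball 0 (R + norm u)")
          case True
          have "norm (\<psi> (x + u /\<^sub>R real (Suc n)) - \<psi> x) \<le> B * norm (x + u /\<^sub>R real (Suc n) - x)"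
          proof (rule differentiable_bound[of UNIV])
            show "(\<psi> has_derivative (\<lambda>h. G y \<bullet> h)) (at y within UNIV)" for y using d by simp
            show "onorm (\<lambda>h. G y \<bullet> h) \<le> B" for y
              by (rule onorm_le) (simp add: order_trans[OF Cauchy_Schwarz_ineq2 mult_right_mono[OF B']])
          qed auto
          also have "\<dots> = B * norm u / real (Suc n)" by (simp add: divide_inverse)
          finally have "real (Suc n) * norm (\<psi> (x + u /\<^sub>R real (Suc n)) - \<psi> x) \<le> B * norm u"
            by (simp add: field_simps del: of_nat_Suc)
          then show ?thesis using True by (simp add: q_def abs_mult del: of_nat_Suc)
        next
          case False
          then have nx: "norm x > R + norm u" by simp
          have "norm x \<le> norm (x + u /\<^sub>R real (Suc n)) + norm (u /\<^sub>R real (Suc n))"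
            using norm_triangle_ineq4[of "x + u /\<^sub>R real (Suc n)" "u /\<^sub>R real (Suc n)"] by simp
          then have "R < norm (x + u /\<^sub>R real (Suc n))" using small nx by linarith
          moreover have "R < norm x" using nx norm_ge_zero[of u] by linarith
          ultimately have "x \<notin> S" "x + u /\<^sub>R real (Suc n) \<notin> S" using R by force+
          then show ?thesis using z B(2) by (simp add: q_def)
        qed
      qed
    qed
    moreover have "(\<integral>x. q n x \<partial>lborel) = 0" for n
    proof -
      have d1: "lborel = distr lborel borel ((+) (u /\<^sub>R real (Suc n)))" by (rule lborel_distr_plus[symmetric])
      have meas: "(+) (u /\<^sub>R real (Suc n)) \<in> measurable lborel borel" by simp
      have m: "\<psi> \<in> borel_measurable borel" using cont by (rule borel_measurable_continuous_onI)
      have "integrable lborel (\<lambda>x. \<psi> (u /\<^sub>R real (Suc n) + x))"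
        using \<psi>i integrable_distr[OF meas, of \<psi>] d1 m by (metis)
      moreover have "(\<integral>x. \<psi> (u /\<^sub>R real (Suc n) + x) \<partial>lborel) = (\<integral>x. \<psi> x \<partial>lborel)"
        using integral_distr[OF meas m] d1 by metis
      ultimately show ?thesis using \<psi>i by (simp add: q_def add.commute)
    qed
    ultimately show ?thesis using LIMSEQ_unique[of "\<lambda>_. 0::real"] by simp
  qed
  have "(\<integral>x. G x \<partial>lborel) \<bullet> u = 0" for u using u[of u] Gi by simp
  then have "(\<integral>x. G x \<partial>lborel) = 0" by (metis inner_eq_zero_iff)
  then show "(\<integral>x. G x \<partial>lebesgue) = 0"
    using Gi by (simp add: integral_completion)
qed

lemma test_functionD:
  assumes "\<phi> \<in> test_functions U"
  obtains S where "compact S" "S \<subseteq> U" "\<And>x. x \<notin> S \<Longrightarrow> \<phi> x = 0" "\<And>x. x \<notin> S \<Longrightarrow> grad \<phi> x = 0"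
    "\<And>x. (\<phi> has_derivative (\<lambda>h. grad \<phi> x \<bullet> h)) (at x)"
    "continuous_on UNIV \<phi>" "continuous_on UNIV (grad \<phi>)"
proof -
  obtain S where S: "compact S" "S \<subseteq> U" "\<And>x. x \<notin> S \<Longrightarrow> \<phi> x = 0" and C: "\<And>k. Ck k \<phi>"
    using assms by (auto simp: test_functions_def simp del: Ck.simps)
  have d: "(\<phi> has_derivative (\<lambda>h. grad \<phi> x \<bullet> h)) (at x)" for x
    using C[of 1] by (simp add: differentiable_on_UNIV_grad)
  have c: "continuous_on UNIV \<phi>" using C[of 0] by simp
  have "continuous_on UNIV (\<lambda>x. grad \<phi> x $ i)" for i using C[of 1] by simp
  then have cg: "continuous_on UNIV (grad \<phi>)"
    using continuous_on_vec_lambda[of UNIV "\<lambda>i x. grad \<phi> x $ i"] by simp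
  have "grad \<phi> x = 0" if "x \<notin> S" for x
  proof -
    have "open (- S)" using S compact_imp_closed by blast
    then have "(\<phi> has_derivative (\<lambda>h. 0)) (at x)"
      using has_derivative_transform_within_open[of "\<lambda>_. 0" "\<lambda>h. 0" x UNIV "- S" \<phi>] that S by auto
    then have "(\<phi> has_derivative (\<lambda>h. 0 \<bullet> h)) (at x)" by simp
    then show ?thesis by (rule grad_eqI)
  qed
  then show ?thesis using that S d c cg by blast
qed


lemma set_integral_support:
  assumes "\<And>x. x \<notin> U \<Longrightarrow> f x = 0"
  shows "(LINT x:U|M. f x) = (\<integral>x. f x \<partial>M)"
  unfolding set_lebesgue_integral_def using assms
  by (intro Bochner_Integration.integral_cong) (auto simp: indicator_def)

text \<open>For \<open>K = UNIV\<close> this says that the classical gradient is the weak gradient; a proper \<open>K\<close> allows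
  to extend a smooth function by zero where it vanishes near \<open>frontier K\<close>, as far as that lies in \<open>U\<close>.\<close>

lemma is_weak_grad_indicator:
  fixes b :: "real^2 \<Rightarrow> real"
  assumes K: "closed K"
    and d: "\<And>x. (b has_derivative (\<lambda>h. g x \<bullet> h)) (at x)" and g: "continuous_on UNIV g"
    and fr: "\<And>x. x \<in> U \<Longrightarrow> x \<in> frontier K \<Longrightarrow> \<exists>W. open W \<and> x \<in> W \<and> (\<forall>y\<in>W. b y = 0 \<and> g y = 0)"
  shows "is_weak_grad U (\<lambda>x. indicator K x * b x) (\<lambda>x. indicator K x *\<^sub>R g x)"
  unfolding is_weak_grad_def
proof
  fix \<phi> assume "\<phi> \<in> test_functions U"
  then obtain S where S: "compact S" "S \<subseteq> U" "\<And>x. x \<notin> S \<Longrightarrow> \<phi> x = 0" "\<And>x. x \<notin> S \<Longrightarrow> grad \<phi> x = 0"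
    and d\<phi>: "\<And>x. (\<phi> has_derivative (\<lambda>h. grad \<phi> x \<bullet> h)) (at x)"
    and c\<phi>: "continuous_on UNIV \<phi>" "continuous_on UNIV (grad \<phi>)"
    by (rule test_functionD) blast
  have bc: "continuous_on UNIV b"
    using d by (meson continuous_at_imp_continuous_on has_derivative_continuous)
  define p where "p x = b x * \<phi> x" for x
  define q where "q x = b x *\<^sub>R grad \<phi> x + \<phi> x *\<^sub>R g x" for x
  have pd: "(p has_derivative (\<lambda>h. q x \<bullet> h)) (at x)" for x
    unfolding p_def q_def
    by (rule has_derivative_eq_rhs, rule has_derivative_mult[OF d d\<phi>]) (simp add: inner_add_left algebra_simps)
  have qc: "continuous_on UNIV q"
    unfolding q_def by (intro continuous_intros bc c\<phi> g)
  \<comment> \<open>The indicator of K jumps only on the frontier of K. There, b and its gradient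
    vanish nearby if the point lies in U, and the test function vanishes nearby otherwise.\<close>
  have loc: "\<exists>W. open W \<and> x \<in> W \<and> ((\<forall>y\<in>W. y \<in> K) \<or> (\<forall>y\<in>W. y \<notin> K) \<or> (\<forall>y\<in>W. p y = 0 \<and> q y = 0))" for x
  proof -
    consider "x \<in> interior K" | "x \<notin> K" | "x \<in> frontier K" "x \<in> U" | "x \<notin> S"
      using S(2) K by (auto simp: frontier_def)
    then show ?thesis
    proof cases
      case 1 then show ?thesis using interior_subset by (intro exI[of _ "interior K"]) auto
    next
      case 2 then show ?thesis using K by (intro exI[of _ "- K"]) auto
    next
      case 3
      then obtain W where "open W" "x \<in> W" "\<forall>y\<in>W. b y = 0 \<and> g y = 0" using fr by blast
      then show ?thesis by (intro exI[of _ W]) (auto simp: p_def q_def)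
    next
      case 4 then show ?thesis using S compact_imp_closed[OF S(1)]
        by (intro exI[of _ "- S"]) (auto simp: p_def q_def)
    qed
  qed
  \<comment> \<open>By \<open>loc\<close> the truncated product is locally p or 0, so it is
    continuously differentiable on the whole plane and the integral of its gradient
    vanishes.\<close>
  have D: "((\<lambda>x. indicator K x * p x) has_derivative (\<lambda>h. (indicator K x *\<^sub>R q x) \<bullet> h)) (at x)
     \<and> isCont (\<lambda>x. indicator K x *\<^sub>R q x) x" for x
  proof -
    obtain W where W: "open W" "x \<in> W" "(\<forall>y\<in>W. y \<in> K) \<or> (\<forall>y\<in>W. y \<notin> K) \<or> (\<forall>y\<in>W. p y = 0 \<and> q y = 0)"
      using loc by blast
    have cq: "isCont q x" using qc by (simp add: continuous_on_eq_continuous_at)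
    have ev: "\<forall>\<^sub>F y in nhds x. y \<in> W" using W by (simp add: eventually_nhds_in_open)
    from W(3) consider "\<forall>y\<in>W. y \<in> K" | "\<forall>y\<in>W. indicator K y * p y = 0 \<and> indicator K y *\<^sub>R q y = 0" by auto
    then show ?thesis
    proof cases
      case 1
      have "((\<lambda>x. indicator K x * p x) has_derivative (\<lambda>h. q x \<bullet> h)) (at x)"
        by (rule has_derivative_transform_within_open[OF pd W(1,2)]) (use 1 in auto)
      moreover have "isCont (\<lambda>x. indicator K x *\<^sub>R q x) x"
        using cq by (rule isCont_cong[THEN iffD1, rotated]) (use ev 1 in \<open>auto elim: eventually_mono\<close>)
      ultimately show ?thesis using 1 W(2) by auto
    next
      case 2
      have "((\<lambda>_::real^2. 0::real) has_derivative (\<lambda>h. 0)) (at x)" by simp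
      then have "((\<lambda>x. indicator K x * p x) has_derivative (\<lambda>h. 0)) (at x)"
        by (rule has_derivative_transform_within_open[OF _ W(1,2)]) (use 2 in auto)
      moreover have "isCont (\<lambda>_::real^2. 0::real^2) x" by simp
      then have "isCont (\<lambda>x. indicator K x *\<^sub>R q x) x"
        by (rule isCont_cong[THEN iffD1, rotated]) (use ev 2 in \<open>auto elim: eventually_mono\<close>)
      ultimately show ?thesis using 2 W(2) by auto
    qed
  qed
  have z: "indicator K x * p x = 0" "indicator K x *\<^sub>R q x = 0" if "x \<notin> S" for x
    using S that by (auto simp: p_def q_def)
  have cont: "continuous_on UNIV (\<lambda>x. indicator K x *\<^sub>R q x)"
    using D by (simp add: continuous_on_eq_continuous_at)
  have int0: "(\<integral>x. indicator K x *\<^sub>R q x \<partial>lebesgue) = 0"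
    by (rule integral_gradient_zero(1)[OF _ cont S(1) z(1)]) (use D in auto)
  have i: "integrable lebesgue (\<lambda>x. indicator K x *\<^sub>R (b x *\<^sub>R grad \<phi> x))"
    "integrable lebesgue (\<lambda>x. indicator K x *\<^sub>R (\<phi> x *\<^sub>R g x))"
  proof -
    have "integrable lborel (\<lambda>x. b x *\<^sub>R grad \<phi> x)" "integrable lborel (\<lambda>x. \<phi> x *\<^sub>R g x)"
      using S by (intro continuous_compact_support_integrable[of _ S] continuous_intros bc c\<phi> g; simp)+
    then have "integrable lebesgue (\<lambda>x. b x *\<^sub>R grad \<phi> x)" "integrable lebesgue (\<lambda>x. \<phi> x *\<^sub>R g x)"
      by (simp_all add: integrable_completion)
    moreover have "K \<in> sets lebesgue" using K by auto
    note integrable_mult_indicator[OF this]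
    ultimately show "integrable lebesgue (\<lambda>x. indicator K x *\<^sub>R (b x *\<^sub>R grad \<phi> x))"
      "integrable lebesgue (\<lambda>x. indicator K x *\<^sub>R (\<phi> x *\<^sub>R g x))"
      by blast+
  qed
  have "(LINT x:U|lebesgue. (indicator K x * b x) *\<^sub>R grad \<phi> x) + (LINT x:U|lebesgue. \<phi> x *\<^sub>R indicator K x *\<^sub>R g x)
    = (\<integral>x. indicator K x *\<^sub>R (b x *\<^sub>R grad \<phi> x) \<partial>lebesgue) + (\<integral>x. indicator K x *\<^sub>R (\<phi> x *\<^sub>R g x) \<partial>lebesgue)"
    using S by (subst (1 2) set_integral_support) (auto simp: mult.commute)
  also have "\<dots> = (\<integral>x. indicator K x *\<^sub>R q x \<partial>lebesgue)"
    using i by (simp add: q_def scaleR_add_right)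
  finally show "(LINT x:U|lebesgue. (indicator K x * b x) *\<^sub>R grad \<phi> x) = - (LINT x:U|lebesgue. \<phi> x *\<^sub>R indicator K x *\<^sub>R g x)"
    using int0 by (simp add: eq_neg_iff_add_eq_0)
qed

lemma is_weak_grad_smooth:
  assumes "\<And>x. (b has_derivative (\<lambda>h. g x \<bullet> h)) (at x)" "continuous_on UNIV g"
  shows "is_weak_grad U b g"
  using is_weak_grad_indicator[of UNIV b g U] assms by simp

lemma is_weak_grad_cong:
  assumes "\<And>x. x \<in> U \<Longrightarrow> v x = v' x" "\<And>x. x \<in> U \<Longrightarrow> G x = G' x"
  shows "is_weak_grad U v G \<longleftrightarrow> is_weak_grad U v' G'"
proof -
  have "(LINT x:U|lebesgue. v x *\<^sub>R grad \<phi> x) = (LINT x:U|lebesgue. v' x *\<^sub>R grad \<phi> x)"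
    "(LINT x:U|lebesgue. \<phi> x *\<^sub>R G x) = (LINT x:U|lebesgue. \<phi> x *\<^sub>R G' x)" for \<phi>
    using assms unfolding set_lebesgue_integral_def
    by (intro Bochner_Integration.integral_cong; simp add: indicator_def)+
  then show ?thesis by (simp add: is_weak_grad_def)
qed

lemma test_functions_mono: "V \<subseteq> U \<Longrightarrow> test_functions V \<subseteq> test_functions U"
  by (auto simp: test_functions_def simp del: Ck.simps)

lemma is_weak_grad_subset:
  assumes "is_weak_grad U v G" "V \<subseteq> U"
  shows "is_weak_grad V v G"
  unfolding is_weak_grad_def
proof
  fix \<phi> assume \<phi>: "\<phi> \<in> test_functions V"
  then obtain S where S: "S \<subseteq> V" "\<And>x. x \<notin> S \<Longrightarrow> \<phi> x = 0" "\<And>x. x \<notin> S \<Longrightarrow> grad \<phi> x = 0"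
    by (rule test_functionD) blast
  have z: "\<phi> x = 0" "grad \<phi> x = 0" if "x \<notin> V \<or> x \<notin> U" for x using S that assms(2) by blast+
  have "(LINT x:V|lebesgue. v x *\<^sub>R grad \<phi> x) = (LINT x:U|lebesgue. v x *\<^sub>R grad \<phi> x)"
    "(LINT x:V|lebesgue. \<phi> x *\<^sub>R G x) = (LINT x:U|lebesgue. \<phi> x *\<^sub>R G x)"
    by (subst (1 2) set_integral_support; simp add: z)+
  then show "(LINT x:V|lebesgue. v x *\<^sub>R grad \<phi> x) = - (LINT x:V|lebesgue. \<phi> x *\<^sub>R G x)"
    using assms(1) \<phi> test_functions_mono[OF assms(2)] by (auto simp: is_weak_grad_def)
qed

lemma set_integrable_L2_times_test:
  fixes v :: "real^2 \<Rightarrow> 'b::euclidean_space" and p :: "real^2 \<Rightarrow> real"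
  assumes U: "U \<in> sets lebesgue" and v: "v \<in> L2_space lebesgue U" and p: "continuous_on UNIV p"
    and S: "compact S" "\<And>x. x \<notin> S \<Longrightarrow> p x = 0"
  shows "set_integrable lebesgue U (\<lambda>x. p x *\<^sub>R v x)"
proof -
  have U': "U \<inter> space lebesgue \<in> sets lebesgue" using U by auto
  have vm[measurable]: "(\<lambda>x. indicator U x *\<^sub>R v x) \<in> borel_measurable lebesgue"
    and vi: "integrable lebesgue (\<lambda>x. indicator U x *\<^sub>R (norm (v x))\<^sup>2)"
    using v by (simp_all add: L2_space_iff[OF U'] set_borel_measurable_def set_integrable_def)
  have [measurable]: "p \<in> borel_measurable lebesgue"
    using p by (intro measurable_completion) (simp add: borel_measurable_continuous_onI)
  have "integrable lborel (\<lambda>x. (p x)\<^sup>2)"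
    using p S by (intro continuous_compact_support_integrable[of _ S] continuous_intros) auto
  then have pi: "integrable lebesgue (\<lambda>x. (p x)\<^sup>2)" by (simp add: integrable_completion)
  have "integrable lebesgue (\<lambda>x. p x *\<^sub>R (indicator U x *\<^sub>R v x))"
  proof (rule Bochner_Integration.integrable_bound[OF Bochner_Integration.integrable_add[OF pi vi]])
    show "AE x in lebesgue. norm (p x *\<^sub>R (indicator U x *\<^sub>R v x)) \<le> norm ((p x)\<^sup>2 + indicator U x *\<^sub>R (norm (v x))\<^sup>2)"
    proof (rule AE_I2)
      fix x
      have "\<bar>p x\<bar> * norm (v x) \<le> \<bar>p x\<bar>\<^sup>2 + (norm (v x))\<^sup>2"
        using sum_squares_bound[of "\<bar>p x\<bar>" "norm (v x)"] mult_nonneg_nonneg[OF abs_ge_zero norm_ge_zero, of "p x" "v x"] by linarith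
      then show "norm (p x *\<^sub>R (indicator U x *\<^sub>R v x)) \<le> norm ((p x)\<^sup>2 + indicator U x *\<^sub>R (norm (v x))\<^sup>2)"
        by (auto simp: indicator_def)
    qed
  qed measurable
  then show ?thesis by (simp add: set_integrable_def scaleR_left_commute mult.commute)
qed

lemma set_integrable_L2_times_test_grad:
  fixes v :: "real^2 \<Rightarrow> real"
  assumes U: "U \<in> sets lebesgue" and v: "v \<in> L2_space lebesgue U" and p: "continuous_on UNIV (p :: real^2 \<Rightarrow> real^2)"
    and S: "compact S" "\<And>x. x \<notin> S \<Longrightarrow> p x = 0"
  shows "set_integrable lebesgue U (\<lambda>x. v x *\<^sub>R p x)"
proof -
  have U': "U \<inter> space lebesgue \<in> sets lebesgue" using U by auto
  have vm[measurable]: "(\<lambda>x. indicator U x *\<^sub>R v x) \<in> borel_measurable lebesgue"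
    and vi: "integrable lebesgue (\<lambda>x. indicator U x *\<^sub>R (norm (v x))\<^sup>2)"
    using v by (simp_all add: L2_space_iff[OF U'] set_borel_measurable_def set_integrable_def)
  have [measurable]: "p \<in> borel_measurable lebesgue"
    using p by (intro measurable_completion) (simp add: borel_measurable_continuous_onI)
  have "integrable lborel (\<lambda>x. (norm (p x))\<^sup>2)"
    using p S by (intro continuous_compact_support_integrable[of _ S] continuous_intros) auto
  then have pi: "integrable lebesgue (\<lambda>x. (norm (p x))\<^sup>2)" by (simp add: integrable_completion)
  have "integrable lebesgue (\<lambda>x. (indicator U x *\<^sub>R v x) *\<^sub>R p x)"
  proof (rule Bochner_Integration.integrable_bound[OF Bochner_Integration.integrable_add[OF pi vi]])
    show "AE x in lebesgue. norm ((indicator U x *\<^sub>R v x) *\<^sub>R p x) \<le> norm ((norm (p x))\<^sup>2 + indicator U x *\<^sub>R (norm (v x))\<^sup>2)"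
    proof (rule AE_I2)
      fix x
      have "\<bar>v x\<bar> * norm (p x) \<le> (norm (p x))\<^sup>2 + \<bar>v x\<bar>\<^sup>2"
        using sum_squares_bound[of "\<bar>v x\<bar>" "norm (p x)"] mult_nonneg_nonneg[OF abs_ge_zero norm_ge_zero, of "v x" "p x"] by linarith
      then show "norm ((indicator U x *\<^sub>R v x) *\<^sub>R p x) \<le> norm ((norm (p x))\<^sup>2 + indicator U x *\<^sub>R (norm (v x))\<^sup>2)"
        by (auto simp: indicator_def)
    qed
  qed measurable
  then show ?thesis by (simp add: set_integrable_def)
qed

lemma is_weak_grad_add:
  assumes U: "U \<in> sets lebesgue"
    and v: "v \<in> L2_space lebesgue U" "G \<in> L2_space lebesgue U" "is_weak_grad U v G"
    and w: "w \<in> L2_space lebesgue U" "H \<in> L2_space lebesgue U" "is_weak_grad U w H"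
  shows "is_weak_grad U (\<lambda>x. v x + w x) (\<lambda>x. G x + H x)"
  unfolding is_weak_grad_def
proof
  fix \<phi> assume \<phi>: "\<phi> \<in> test_functions U"
  then obtain S where S: "compact S" "\<And>x. x \<notin> S \<Longrightarrow> \<phi> x = 0" "\<And>x. x \<notin> S \<Longrightarrow> grad \<phi> x = 0"
    "continuous_on UNIV \<phi>" "continuous_on UNIV (grad \<phi>)"
    by (rule test_functionD) blast
  note i = set_integrable_L2_times_test[OF U _ S(4,1,2)] set_integrable_L2_times_test_grad[OF U _ S(5,1,3)]
  show "(LINT x:U|lebesgue. (v x + w x) *\<^sub>R grad \<phi> x) = - (LINT x:U|lebesgue. \<phi> x *\<^sub>R (G x + H x))"
    using i(1)[OF v(2)] i(1)[OF w(2)] i(2)[OF v(1)] i(2)[OF w(1)] v(3) w(3) \<phi>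
    by (simp add: scaleR_add_left scaleR_add_right set_integral_add is_weak_grad_def)
qed

lemma is_weak_grad_scaleR:
  "is_weak_grad U v G \<Longrightarrow> is_weak_grad U (\<lambda>x. c * v x) (\<lambda>x. c *\<^sub>R G x)"
  unfolding is_weak_grad_def
  by (simp add: scaleR_left_commute[of _ c] flip: scaleR_scaleR)

text \<open>The fundamental lemma of the calculus of variations: \<open>box_cutoff\<close> carries
  the hypothesis over to boxes whose closure lies in U, and U is a countable union of closed
  boxes.\<close>

lemma is_weak_grad_zero_AE:
  assumes U: "open U" and H: "H \<in> L2_space lebesgue U" and z: "\<And>\<phi>. \<phi> \<in> test_functions U \<Longrightarrow> (LINT x:U|lebesgue. \<phi> x *\<^sub>R H x) = 0"
  shows "AE x in lebesgue. x \<in> U \<longrightarrow> H x = (0 :: real^2)"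
proof -
  have Us: "U \<in> sets lebesgue" using U by auto
  then have U': "U \<inter> space lebesgue \<in> sets lebesgue" by auto
  have one: "AE x in lebesgue. x \<in> cbox a b \<longrightarrow> H x $ i = 0" if ab: "cbox a b \<subseteq> U" for a b i
  proof -
    have L: "(\<lambda>x. H x $ i) \<in> L2_space lebesgue (box a b)"
      using L2_space_nth[OF U' H] by (rule L2_space_mono[OF _ Us, rotated 2]) (use ab box_subset_cbox in auto)
    have bx: "box a b \<inter> space lebesgue \<in> sets lebesgue" by auto
    have one: "(\<lambda>x. 1 :: real) \<in> L2_space lebesgue (box a b)"
      by (rule L2_space_bounded[where B = 1]) (auto simp: emeasure_lborel_box_eq set_borel_measurable_def intro!: borel_measurable_indicator)
    have w: "integrable lebesgue (\<lambda>x. indicator (box a b) x *\<^sub>R (H x $ i))"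
      using set_cauchy_schwarz(1)[OF bx L one] by (simp add: set_integrable_def)
    have "AE x in lebesgue. indicator (box a b) x *\<^sub>R (H x $ i) = 0"
    proof (rule AE_lebesgue_zero_if_box_integrals_zero[OF w])
      fix c d
      \<comment> \<open>Boxes are stable under intersection, so integrating the function cut off to
        \<open>box a b\<close> over any box amounts to integrating over a smaller box inside
        \<open>box a b\<close>.\<close>
      obtain c' d' where cd: "box a b \<inter> box c d = box c' d'" using box_Int_box[of a b c d] by blast
      have sub: "box c' d' \<subseteq> box a b" using cd by blast
      have "(LINT x:box c d|lebesgue. indicator (box a b) x *\<^sub>R (H x $ i)) = (\<integral>x. indicator (box c' d') x *\<^sub>R (H x $ i) \<partial>lebesgue)"
        unfolding set_lebesgue_integral_def cd[symmetric]
        by (intro Bochner_Integration.integral_cong) (auto simp: indicator_def)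
      also have "\<dots> = 0"
      proof (cases "box c' d' = {}")
        case False
        have "cbox c' d' = closure (box c' d')" using closure_box[OF False] by simp
        also have "\<dots> \<subseteq> cbox a b" using sub box_subset_cbox[of a b] by (intro closure_minimal) auto
        finally have csub: "cbox c' d' \<subseteq> U" using ab by blast
        have tf: "box_cutoff c' d' n \<in> test_functions U" for n
          by (rule test_functions_I[where S = "cbox c' d'", OF Ck_box_cutoff _ csub])
            (auto intro!: box_cutoff_eq_0 dest: box_subset_cbox[THEN subsetD])
        have zero: "(\<integral>x. box_cutoff c' d' n x * (H x $ i) \<partial>lebesgue) = 0" for n
        proof -
          have bz: "box_cutoff c' d' n x = 0" if "x \<notin> cbox c' d'" for x
            using that box_cutoff_eq_0 box_subset_cbox by blast
          have "set_integrable lebesgue U (\<lambda>x. box_cutoff c' d' n x *\<^sub>R H x)"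
            by (rule set_integrable_L2_times_test[OF Us H _ compact_cbox[of c' d'] bz])
              (use Ck_box_cutoff[of 0] in auto)
          then have "(LINT x:U|lebesgue. box_cutoff c' d' n x *\<^sub>R H x) $ i = (LINT x:U|lebesgue. box_cutoff c' d' n x * (H x $ i))"
            unfolding set_lebesgue_integral_def set_integrable_def
            using integral_inner_left[of "axis i 1" lebesgue "\<lambda>x. indicator U x *\<^sub>R box_cutoff c' d' n x *\<^sub>R H x"]
            by (simp add: inner_axis mult.assoc)
          also have "(LINT x:U|lebesgue. box_cutoff c' d' n x * (H x $ i)) = (\<integral>x. box_cutoff c' d' n x * (H x $ i) \<partial>lebesgue)"
          proof (rule set_integral_support)
            fix x assume "x \<notin> U"
            then have "x \<notin> cbox c' d'" using csub by blast
            then show "box_cutoff c' d' n x * (H x $ i) = 0" using bz by simp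
          qed
          finally show ?thesis using z[OF tf] by simp
        qed
        have "(\<lambda>n. \<integral>x. box_cutoff c' d' n x * (H x $ i) \<partial>lebesgue) \<longlonglongrightarrow> (\<integral>x. indicator (box c' d') x *\<^sub>R (H x $ i) \<partial>lebesgue)"
        proof (rule integral_dominated_convergence)
          have eq: "indicator (box c' d') x *\<^sub>R (indicator (box a b) x *\<^sub>R (H x $ i)) = indicator (box c' d') x *\<^sub>R (H x $ i)"
            "box_cutoff c' d' n x * (indicator (box a b) x *\<^sub>R (H x $ i)) = box_cutoff c' d' n x * (H x $ i)" for n x
            using subsetD[OF sub, of x] box_cutoff_eq_0[of x c' d' n]
            by (cases "x \<in> box a b"; cases "x \<in> box c' d'"; simp)+
          have wm: "(\<lambda>x. indicator (box a b) x *\<^sub>R (H x $ i)) \<in> borel_measurable lebesgue" using w by auto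
          show "(\<lambda>x. indicator (box c' d') x *\<^sub>R (H x $ i)) \<in> borel_measurable lebesgue"
            using borel_measurable_scaleR[OF borel_measurable_indicator wm, of "box c' d'"] unfolding eq by auto
          have "continuous_on UNIV (box_cutoff c' d' n)" for n using Ck_box_cutoff[of 0] by auto
          then have "box_cutoff c' d' n \<in> borel_measurable lebesgue" for n
            by (intro measurable_completion) (simp add: borel_measurable_continuous_onI)
          from borel_measurable_times[OF this wm]
          show "(\<lambda>x. box_cutoff c' d' n x * (H x $ i)) \<in> borel_measurable lebesgue" for n
            unfolding eq by auto
          show "integrable lebesgue (\<lambda>x. norm (indicator (box a b) x *\<^sub>R (H x $ i)))" using w by (rule integrable_norm)
          show "AE x in lebesgue. (\<lambda>n. box_cutoff c' d' n x * (H x $ i)) \<longlonglongrightarrow> indicator (box c' d') x *\<^sub>R (H x $ i)"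
            unfolding real_scaleR_def by (intro AE_I2 tendsto_mult box_cutoff_tendsto tendsto_const)
          show "AE x in lebesgue. norm (box_cutoff c' d' n x * (H x $ i)) \<le> norm (indicator (box a b) x *\<^sub>R (H x $ i))" for n
          proof (rule AE_I2)
            fix x
            show "norm (box_cutoff c' d' n x * (H x $ i)) \<le> norm (indicator (box a b) x *\<^sub>R (H x $ i))"
              unfolding eq(2)[symmetric, of n x] norm_mult
              using box_cutoff_bounds[of c' d' n x] by (intro mult_left_le_one_le) auto
          qed
        qed
        then show ?thesis using zero LIMSEQ_unique[of "\<lambda>_. 0::real"] by simp
      qed simp
      finally show "(LINT x:box c d|lebesgue. indicator (box a b) x *\<^sub>R (H x $ i)) = 0" .
    qed
    \<comment> \<open>The argument above sees the open box only; its frontier is a null set.\<close>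
    moreover have "AE x in lebesgue. x \<notin> frontier (cbox a b)"
      by (intro AE_not_in) (simp add: negligible_iff_null_sets[symmetric] negligible_convex_frontier)
    ultimately show ?thesis
      by eventually_elim (auto simp: indicator_def frontier_cbox split: if_splits)
  qed
  obtain D where D: "countable D" "D \<subseteq> Pow U" "\<And>X. X \<in> D \<Longrightarrow> \<exists>a b. X = cbox a b" "\<Union>D = U"
    by (rule open_countable_Union_open_cbox[OF U]) blast
  have "AE x in lebesgue. \<forall>X\<in>D. x \<in> X \<longrightarrow> H x = 0"
  proof (subst AE_ball_countable[OF D(1)], intro ballI)
    fix X assume "X \<in> D"
    then obtain a b where X: "X = cbox a b" "cbox a b \<subseteq> U" using D by blast
    show "AE x in lebesgue. x \<in> X \<longrightarrow> H x = 0"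
      using one[OF X(2), of 1] one[OF X(2), of 2] unfolding X(1)
      by eventually_elim (auto simp: vec_eq_iff forall_2)
  qed
  then show ?thesis by eventually_elim (use D(4) in blast)
qed

lemma weak_grad_unique:
  assumes U: "open U" and G: "G \<in> L2_space lebesgue U" "is_weak_grad U v G"
    and H: "H \<in> L2_space lebesgue U" "is_weak_grad U v H"
  shows "AE x in lebesgue. x \<in> U \<longrightarrow> G x = H x"
proof -
  have Us: "U \<in> sets lebesgue" using U by auto
  then have U': "U \<inter> space lebesgue \<in> sets lebesgue" by auto
  have "AE x in lebesgue. x \<in> U \<longrightarrow> G x - H x = 0"
  proof (rule is_weak_grad_zero_AE[OF U L2_space_diff[OF U' G(1) H(1)]])
    fix \<phi> assume \<phi>: "\<phi> \<in> test_functions U"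
    then obtain S where S: "compact S" "\<And>x. x \<notin> S \<Longrightarrow> \<phi> x = 0" "continuous_on UNIV \<phi>"
      by (rule test_functionD) blast
    note i = set_integrable_L2_times_test[OF Us _ S(3,1,2)]
    have eq: "- (LINT x:U|lebesgue. \<phi> x *\<^sub>R G x) = - (LINT x:U|lebesgue. \<phi> x *\<^sub>R H x)"
      by (rule trans[OF sym[OF G(2)[unfolded is_weak_grad_def, rule_format, OF \<phi>]]
          H(2)[unfolded is_weak_grad_def, rule_format, OF \<phi>]])
    show "(LINT x:U|lebesgue. \<phi> x *\<^sub>R (G x - H x)) = 0"
    proof -
      have "(LINT x:U|lebesgue. \<phi> x *\<^sub>R G x - \<phi> x *\<^sub>R H x) = (LINT x:U|lebesgue. \<phi> x *\<^sub>R G x) - (LINT x:U|lebesgue. \<phi> x *\<^sub>R H x)"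
        by (rule set_integral_diff(2)[OF i[OF G(1)] i[OF H(1)]])
      then show ?thesis unfolding scaleR_diff_right using eq[unfolded neg_equal_iff_equal]
        by (simp only: diff_self)
    qed
  qed
  then show ?thesis by eventually_elim simp
qed

lemma weak_grad_someI:
  assumes "G \<in> L2_space lebesgue U" "is_weak_grad U v G"
  shows "weak_grad U v \<in> L2_space lebesgue U" "is_weak_grad U v (weak_grad U v)"
proof -
  have "weak_grad U v \<in> L2_space lebesgue U \<and> is_weak_grad U v (weak_grad U v)"
    unfolding weak_grad_def
    by (rule someI[of "\<lambda>G. G \<in> L2_space lebesgue U \<and> is_weak_grad U v G" G, OF conjI[OF assms]])
  then show "weak_grad U v \<in> L2_space lebesgue U" "is_weak_grad U v (weak_grad U v)" by simp_all
qed

lemma weak_grad_H1: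
  assumes "v \<in> H1 U"
  shows "weak_grad U v \<in> L2_space lebesgue U" "is_weak_grad U v (weak_grad U v)"
proof -
  obtain G where "G \<in> L2_space lebesgue U" "is_weak_grad U v G" using assms by (auto simp: H1_def)
  then show "weak_grad U v \<in> L2_space lebesgue U" "is_weak_grad U v (weak_grad U v)"
    using weak_grad_someI by blast+
qed

lemma weak_grad_eq_AE:
  assumes "open U" "G \<in> L2_space lebesgue U" "is_weak_grad U v G"
  shows "AE x in lebesgue. x \<in> U \<longrightarrow> weak_grad U v x = G x"
  by (rule weak_grad_unique[OF assms(1) weak_grad_someI[OF assms(2,3)] assms(2,3)])

section \<open>Arc length on segments\<close>

lemma borel_arclength: "A \<in> sets borel \<Longrightarrow> A \<in> sets arclength"
  using borel_sets_arclength by blast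

lemma measurable_arclength: "f \<in> borel_measurable borel \<Longrightarrow> f \<in> borel_measurable arclength"
proof (rule measurableI)
  fix A :: "'b set" assume "f \<in> borel_measurable borel" "A \<in> sets borel"
  then have "f -` A \<inter> space borel \<in> sets borel" by (rule measurable_sets)
  then show "f -` A \<inter> space arclength \<in> sets arclength" by (intro borel_arclength) simp
qed simp

text \<open>A set of outer measure 0 satisfies the Caratheodory condition automatically.
  Completeness lets functions that are known only almost everywhere, such as traces, inherit
  measurability.\<close>

lemma complete_measure_arclength: "complete_measure (arclength :: 'a::metric_space measure)"
proof
  fix B A :: "'a set" assume BA: "B \<subseteq> A" and A: "A \<in> null_sets arclength"
  have "hausdorff1_outer A = 0"
    using null_setsD1[OF A] emeasure_arclength[OF null_setsD2[OF A]] by simp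
  then have B0: "hausdorff1_outer B = 0" using hausdorff1_outer_mono[OF BA] by simp
  have "hausdorff1_outer (B \<inter> X) + hausdorff1_outer ((UNIV - B) \<inter> X) = hausdorff1_outer X" for X
  proof (rule antisym)
    have "hausdorff1_outer (B \<inter> X) = 0"
      using B0 hausdorff1_outer_mono[of "B \<inter> X" B] by simp
    then show "hausdorff1_outer (B \<inter> X) + hausdorff1_outer ((UNIV - B) \<inter> X) \<le> hausdorff1_outer X"
      by (auto intro: hausdorff1_outer_mono)
    show "hausdorff1_outer X \<le> hausdorff1_outer (B \<inter> X) + hausdorff1_outer ((UNIV - B) \<inter> X)"
      using hausdorff1_outer_Un[of "B \<inter> X" "(UNIV - B) \<inter> X"]
      by (simp add: Int_Un_distrib2[symmetric])
  qed
  then show "B \<in> sets arclength" by (simp add: sets_arclength lambda_system_def)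
qed

lemma measurable_complete_AE_eq:
  assumes M: "complete_measure M" and f: "f \<in> borel_measurable M" and eq: "AE x in M. f x = g x"
  shows "g \<in> borel_measurable M"
proof (rule measurableI)
  fix A :: "'b set" assume A: "A \<in> sets borel"
  obtain N where N: "N \<in> null_sets M" "{x \<in> space M. f x \<noteq> g x} \<subseteq> N"
    using eq by (auto elim: AE_E simp: null_sets_def)
  have fA: "f -` A \<inter> space M \<in> sets M" using f A by (rule measurable_sets)
  have sub: "g -` A \<inter> space M \<inter> N \<in> sets M"
    by (rule complete_measure.complete[OF M _ N(1)]) auto
  have "g -` A \<inter> space M = ((f -` A \<inter> space M) - N) \<union> (g -` A \<inter> space M \<inter> N)"
    using N(2) by auto
  also have "\<dots> \<in> sets M" by (intro sets.Un sets.Diff fA sub null_setsD2[OF N(1)])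
  finally show "g -` A \<inter> space M \<in> sets M" .
qed simp

text \<open>Closing the sets of a cover does not change their diameters. The intersection over n of
  the unions of closed covering sets is therefore a Borel set that contains A and has no larger
  measure.\<close>

lemma arclength_borel_hull:
  assumes A: "A \<in> sets arclength" "emeasure arclength A < \<infinity>"
  shows "\<exists>B\<in>sets borel. A \<subseteq> B \<and> B - A \<in> null_sets arclength"
proof -
  define H where "H = hausdorff1_outer A"
  have Hfin: "H < top" using A emeasure_arclength[OF A(1)] by (simp add: H_def)
  have "\<exists>U. A \<subseteq> (\<Union>i. U i) \<and> (\<forall>i. bounded (U i) \<and> diameter (U i) \<le> inverse (real (Suc n))) \<and>
      (\<Sum>i. ennreal (diameter (U i))) < H + ennreal (inverse (real (Suc n)))" for n
  proof -
    have "hausdorff1_pre (inverse (real (Suc n))) A \<le> H"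
      unfolding H_def by (rule hausdorff1_pre_le_outer) simp
    also have "H < H + ennreal (inverse (real (Suc n)))"
      using Hfin by (auto simp: ennreal_less_zero_iff less_top)
    finally show ?thesis unfolding hausdorff1_pre_def INF_less_iff by blast
  qed
  then obtain U where U: "\<And>n. A \<subseteq> (\<Union>i. U n i)" "\<And>n i. bounded (U n i)"
    "\<And>n i. diameter (U n i) \<le> inverse (real (Suc n))"
    "\<And>n. (\<Sum>i. ennreal (diameter (U n i))) < H + ennreal (inverse (real (Suc n)))"
    by metis
  define B where "B = (\<Inter>n. \<Union>i. closure (U n i))"
  have B: "B \<in> sets borel" unfolding B_def by auto
  have AB: "A \<subseteq> B" unfolding B_def
  proof (rule INT_greatest)
    fix n show "A \<subseteq> (\<Union>i. closure (U n i))"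
      by (rule order_trans[OF U(1)[of n] UN_mono[OF order_refl closure_subset]])
  qed
  have pre: "hausdorff1_pre (inverse (real (Suc n))) B \<le> H + ennreal (inverse (real (Suc n)))" for n
  proof -
    have "hausdorff1_pre (inverse (real (Suc n))) B \<le> (\<Sum>i. ennreal (diameter (closure (U n i))))"
      unfolding hausdorff1_pre_def
      by (rule INF_lower) (use U(2,3) in \<open>auto simp: B_def diameter_closure\<close>)
    also have "\<dots> \<le> H + ennreal (inverse (real (Suc n)))"
      using U(2,4) by (simp add: diameter_closure less_imp_le)
    finally show ?thesis .
  qed
  have "hausdorff1_pre \<delta> B \<le> H" if d: "\<delta> > 0" for \<delta>
  proof (rule LIMSEQ_le_const[where X = "\<lambda>n. H + ennreal (inverse (real (Suc n)))"])
    have "(\<lambda>n. H + ennreal (inverse (real (Suc n)))) \<longlonglongrightarrow> H + ennreal 0"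
      by (intro tendsto_add tendsto_const tendsto_ennrealI LIMSEQ_inverse_real_of_nat)
    then show "(\<lambda>n. H + ennreal (inverse (real (Suc n)))) \<longlonglongrightarrow> H" by simp
    obtain N where N: "inverse (real (Suc N)) < \<delta>" using reals_Archimedean[OF d] by blast
    have "hausdorff1_pre \<delta> B \<le> H + ennreal (inverse (real (Suc n)))" if "n \<ge> N" for n
    proof -
      have "inverse (real (Suc n)) \<le> inverse (real (Suc N))" using that by simp
      then have "inverse (real (Suc n)) \<le> \<delta>" using N by linarith
      then show ?thesis using pre[of n] hausdorff1_pre_antimono order_trans by blast
    qed
    then show "\<exists>N. \<forall>n\<ge>N. hausdorff1_pre \<delta> B \<le> H + ennreal (inverse (real (Suc n)))" by blast
  qed
  then have "hausdorff1_outer B \<le> H" unfolding hausdorff1_outer_def by (auto intro: SUP_least)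
  then have "emeasure arclength B \<le> emeasure arclength A"
    using emeasure_arclength[OF A(1)] emeasure_arclength[OF borel_arclength[OF B]] by (simp add: H_def)
  moreover have "emeasure arclength (B - A) = emeasure arclength B - emeasure arclength A"
    using A AB B by (intro emeasure_Diff) (auto intro: borel_arclength)
  ultimately have "emeasure arclength (B - A) = 0"
    using A(2) by (simp add: diff_eq_0_iff_ennreal le_less_trans[of "emeasure arclength B"])
  then show ?thesis using AB B A borel_arclength[OF B] by (auto simp: null_sets_def)
qed

text \<open>Arc length is not sigma-finite on the plane. Restricting it to e, as the density M,
  gives a finite measure, to which the criterion by box integrals applies.\<close>

lemma AE_arclength_zero:
  fixes w :: "real^2 \<Rightarrow> real"
  assumes e: "e \<in> sets arclength" "emeasure arclength e < \<infinity>" and w: "set_integrable arclength e w"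
    and box: "\<And>a b. (LINT x:e|arclength. indicator (box a b) x * w x) = 0"
  shows "AE x in arclength. x \<in> e \<longrightarrow> w x = 0"
proof -
  define M where "M = density arclength (indicator e :: real^2 \<Rightarrow> ennreal)"
  define w' where "w' x = indicator e x *\<^sub>R w x" for x
  have [measurable]: "e \<in> sets arclength" by (rule e)
  have w'm[measurable]: "w' \<in> borel_measurable arclength" and w'i: "integrable arclength w'"
    using w by (auto simp: set_integrable_def w'_def[abs_def])
  have ind: "(\<lambda>x. ennreal (indicator e x)) = (indicator e :: real^2 \<Rightarrow> ennreal)"
    by (auto simp: indicator_def fun_eq_iff)
  have Md: "M = density arclength (\<lambda>x. ennreal (indicator e x))" by (simp add: M_def ind)
  have fin: "finite_measure M"
  proof (rule finite_measureI)
    have "emeasure M UNIV = emeasure arclength e" unfolding M_def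
      using sets.top[of "arclength :: (real^2) measure"] by (subst emeasure_density) auto
    then show "emeasure M (space M) \<noteq> \<infinity>" using e by (simp add: M_def)
  qed
  have idem: "indicator e x *\<^sub>R w' x = w' x" for x by (simp add: w'_def indicator_def)
  have "AE x in M. w' x = 0"
  proof (rule AE_zero_if_box_integrals_zero)
    show "sigma_finite_measure M" using fin finite_measure.axioms(1) by blast
    show "space M = UNIV" by (simp add: M_def)
    show "sets borel \<subseteq> sets M" by (simp add: M_def borel_sets_arclength)
    show "integrable M w'" unfolding Md
    proof (subst integrable_density)
      have "(\<lambda>x. indicator e x *\<^sub>R w' x) = w'" using idem by (simp only:)
      then show "integrable arclength (\<lambda>x. indicator e x *\<^sub>R w' x)" using w'i by (simp only:)
    qed auto
    fix A assume "A \<in> sets M"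
    then have A: "A \<inter> e \<in> sets arclength" using e by (simp add: M_def)
    have "emeasure arclength (A \<inter> e) \<le> emeasure arclength e" using e by (intro emeasure_mono) auto
    then have "emeasure arclength (A \<inter> e) < \<infinity>" using e by (auto intro: le_less_trans)
    then obtain B where B: "B \<in> sets borel" "A \<inter> e \<subseteq> B" "B - (A \<inter> e) \<in> null_sets arclength"
      using arclength_borel_hull[OF A] by blast
    have "AE x in arclength. x \<notin> B - (A \<inter> e)" using B(3) by (rule AE_not_in)
    then have "AE x in arclength. 0 < (indicator e x :: ennreal) \<longrightarrow> (x \<in> A \<longleftrightarrow> x \<in> B)"
      by eventually_elim (use B(2) in \<open>auto simp: indicator_def\<close>)
    then have "AE x in M. x \<in> A \<longleftrightarrow> x \<in> B"
      unfolding M_def by (subst AE_density) auto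
    then show "\<exists>B\<in>sets borel. AE x in M. (x \<in> A) = (x \<in> B)" using B(1) by blast
  next
    fix a b :: "real^2"
    have [measurable]: "box a b \<in> sets arclength" by (rule borel_arclength) simp
    have "(LINT x:box a b|M. w' x) = (\<integral>x. indicator e x *\<^sub>R (indicator (box a b) x *\<^sub>R w' x) \<partial>arclength)"
      unfolding Md set_lebesgue_integral_def by (rule integral_density) auto
    also have "\<dots> = (LINT x:e|arclength. indicator (box a b) x * w x)"
      unfolding set_lebesgue_integral_def w'_def
      by (intro Bochner_Integration.integral_cong) (auto simp: indicator_def)
    finally show "(LINT x:box a b|M. w' x) = 0" using box by simp
  qed
  then have "AE x in arclength. 0 < (indicator e x :: ennreal) \<longrightarrow> w' x = 0"
    unfolding M_def by (subst (asm) AE_density) auto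
  then show ?thesis by eventually_elim (auto simp: w'_def indicator_def)
qed

section \<open>Arc length along a straight line\<close>

lemma arclength_singleton: "{p} \<in> null_sets arclength"
proof -
  have "hausdorff1_pre \<delta> {p} \<le> 0" if "\<delta> > 0" for \<delta>
    unfolding hausdorff1_pre_def by (rule INF_lower2[of "\<lambda>_. {p}"]) (use that in auto)
  then have "hausdorff1_outer {p} = 0" unfolding hausdorff1_outer_def
    using SUP_least[of "{0<..}" "\<lambda>\<delta>. hausdorff1_pre \<delta> {p}" 0] by (simp add: le_zero_eq[symmetric] del: le_zero_eq)
  moreover have s: "{p} \<in> sets arclength" by (rule closed_sets_arclength) simp
  ultimately show ?thesis using emeasure_arclength[OF s] by auto
qed

context
  fixes c \<tau> :: "real^2"
  assumes \<tau>: "norm \<tau> = 1"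
begin

private definition line where "line t = c + t *\<^sub>R \<tau>"

private lemma line_dist: "dist (line s) (line t) = \<bar>s - t\<bar>"
  by (simp add: line_def dist_norm scaleR_diff_left[symmetric] \<tau>)

private lemma line_proj: "\<tau> \<bullet> (line t - c) = t"
  using \<tau> by (simp add: line_def norm_eq_1)

text \<open>Since \<open>line\<close> is an isometry, the parameters of the points in a covering set
  of diameter d lie in an interval of length d, and these intervals together have at least the
  Lebesgue measure of A.\<close>

private lemma hausdorff1_line_ge:
  assumes A: "A \<in> sets borel"
  shows "emeasure lborel A \<le> hausdorff1_outer (line ` A)"
proof -
  have "emeasure lborel A \<le> hausdorff1_pre 1 (line ` A)"
    unfolding hausdorff1_pre_def
  proof (rule INF_greatest)
    fix U assume "U \<in> {U. line ` A \<subseteq> (\<Union>n. U n) \<and> (\<forall>n::nat. bounded (U n) \<and> diameter (U n) \<le> 1)}"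
    then have U: "line ` A \<subseteq> (\<Union>n. U n)" "\<And>n. bounded (U n)" by auto
    have ex: "\<exists>s. {t. line t \<in> U n} \<subseteq> {s..s + diameter (U n)}" for n
    proof (cases "{t. line t \<in> U n} = {}")
      case False
      define V where "V = {t. line t \<in> U n}"
      have d: "\<bar>s - t\<bar> \<le> diameter (U n)" if "s \<in> V" "t \<in> V" for s t
        using diameter_bounded_bound[OF U(2), of "line s" n "line t"] that by (simp add: line_dist V_def)
      obtain t0 where t0: "t0 \<in> V" using False V_def by blast
      have bb: "bdd_below V" by (rule bdd_belowI[of _ "t0 - diameter (U n)"]) (use d[OF t0] in force)
      have "t \<le> Inf V + diameter (U n)" if "t \<in> V" for t
      proof -
        have "t - diameter (U n) \<le> Inf V"
          by (rule cInf_greatest) (use t0 d[OF that] in force)+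
        then show ?thesis by simp
      qed
      moreover have "Inf V \<le> t" if "t \<in> V" for t using cInf_lower[OF that bb] .
      ultimately show ?thesis unfolding V_def[symmetric] by (intro exI[of _ "Inf V"]) auto
    qed auto
    then obtain s where s: "\<And>n. {t. line t \<in> U n} \<subseteq> {s n..s n + diameter (U n)}" by metis
    have "A \<subseteq> (\<Union>n. {s n..s n + diameter (U n)})"
    proof
      fix t assume "t \<in> A"
      then obtain n where "line t \<in> U n" using U(1) by blast
      then show "t \<in> (\<Union>n. {s n..s n + diameter (U n)})" using s by blast
    qed
    then have "emeasure lborel A \<le> emeasure lborel (\<Union>n. {s n..s n + diameter (U n)})"
      by (intro emeasure_mono) auto
    also have "\<dots> \<le> (\<Sum>n. emeasure lborel {s n..s n + diameter (U n)})"
      by (rule emeasure_subadditive_countably) auto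
    also have "\<dots> = (\<Sum>n. ennreal (diameter (U n)))"
      using diameter_ge_0[OF U(2)] by (simp add: emeasure_lborel_Icc_eq)
    finally show "emeasure lborel A \<le> (\<Sum>n. ennreal (diameter (U n)))" .
  qed
  also have "\<dots> \<le> hausdorff1_outer (line ` A)" by (rule hausdorff1_pre_le_outer) simp
  finally show ?thesis .
qed

text \<open>The pieces of a subdivision into N equal parts have diameter at most h \<le> \<delta>,
  and N h = b - a.\<close>

private lemma hausdorff1_line_le:
  assumes ab: "a \<le> b"
  shows "hausdorff1_outer (line ` {a..b}) \<le> ennreal (b - a)"
  unfolding hausdorff1_outer_def
proof (rule SUP_least)
  fix \<delta> :: real assume "\<delta> \<in> {0<..}"
  then have \<delta>: "\<delta> > 0" by simp
  obtain N :: nat where N: "(b - a) / \<delta> < N" using reals_Archimedean2 by blast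
  then have N0: "N > 0"
  proof -
    have "0 \<le> (b - a) / \<delta>" using ab \<delta> by simp
    then show ?thesis using N by linarith
  qed
  define h where "h = (b - a) / N"
  have h: "0 \<le> h" "h \<le> \<delta>" "N * h = b - a"
    using ab N N0 \<delta> by (auto simp: h_def field_simps)
  define U where "U n = (if n < N then line ` {a + real n * h..a + real (Suc n) * h} else {})" for n
  have diam: "diameter (U n) \<le> h" "bounded (U n)" for n
  proof -
    have *: "dist x y \<le> h" if "x \<in> U n" "y \<in> U n" for x y
      using that h(1) by (auto simp: U_def line_dist algebra_simps split: if_splits)
    show "diameter (U n) \<le> h"
      by (rule diameter_le) (use h * in \<open>auto simp: dist_norm\<close>)
    show "bounded (U n)" by (rule bounded_two_points[THEN iffD2]) (use * in blast)
  qed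
  have cover: "line ` {a..b} \<subseteq> (\<Union>n. U n)"
  proof
    fix x assume "x \<in> line ` {a..b}"
    then obtain t where t: "a \<le> t" "t \<le> b" "x = line t" by auto
    show "x \<in> (\<Union>n. U n)"
    \<comment> \<open>For t = b the floor used below could yield the index N, one beyond the last
      piece. The remaining case also ensures h > 0, since there a < b.\<close>
    proof (cases "t = b")
      case True
      have "real (Suc (N - 1)) * h = b - a" using h N0 by simp
      moreover have "real (N - 1) * h \<le> real (Suc (N - 1)) * h" using h by (intro mult_right_mono) auto
      ultimately have "t \<in> {a + real (N - 1) * h..a + real (Suc (N - 1)) * h}"
        using True by auto
      then have "x \<in> U (N - 1)" using t N0 by (auto simp: U_def)
      then show ?thesis by blast
    next
      case False
      then have hp: "h > 0" using t ab N0 by (auto simp: h_def)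
      define n where "n = nat \<lfloor>(t - a) / h\<rfloor>"
      have n: "real n \<le> (t - a) / h" "(t - a) / h < real n + 1"
        using t hp by (auto simp: n_def)
      have "(t - a) / h < N" using False t h hp by (simp add: field_simps)
      then have "n < N" using n by simp
      moreover have "t \<in> {a + real n * h..a + real (Suc n) * h}"
        using n hp by (auto simp: field_simps)
      ultimately have "x \<in> U n" using t by (auto simp: U_def)
      then show ?thesis by blast
    qed
  qed
  have "hausdorff1_pre \<delta> (line ` {a..b}) \<le> (\<Sum>n. ennreal (diameter (U n)))"
    unfolding hausdorff1_pre_def
    by (rule INF_lower) (use cover diam h(2) order_trans in blast)
  also have "\<dots> = (\<Sum>n<N. ennreal (diameter (U n)))"
    by (rule suminf_finite) (auto simp: U_def)
  also have "\<dots> \<le> (\<Sum>n<N. ennreal h)"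
    by (intro sum_mono ennreal_leI diam)
  also have "\<dots> = ennreal (b - a)"
    using h by (simp add: ennreal_of_nat_eq_real_of_nat ennreal_mult[symmetric])
  finally show "hausdorff1_pre \<delta> (line ` {a..b}) \<le> ennreal (b - a)" .
qed

private lemma line_image: "line ` A = range line \<inter> {x. \<tau> \<bullet> (x - c) \<in> A}"
  using line_proj by (auto simp: image_iff)

private lemma closed_range_line: "closed (range line)"
proof -
  have "range line = {x. line (\<tau> \<bullet> (x - c)) = x}"
  proof (intro equalityI subsetI)
    fix x assume "x \<in> {x. line (\<tau> \<bullet> (x - c)) = x}"
    then have "x = line (\<tau> \<bullet> (x - c))" by simp
    then show "x \<in> range line" by (rule range_eqI)
  qed (use line_proj in auto)
  moreover have "closed {x. line (\<tau> \<bullet> (x - c)) = x}"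
    unfolding line_def by (intro closed_Collect_eq continuous_intros)
  ultimately show ?thesis by simp
qed

private lemma line_image_borel: "A \<in> sets borel \<Longrightarrow> line ` A \<in> sets borel"
proof -
  assume A: "A \<in> sets borel"
  have "(\<lambda>x. \<tau> \<bullet> (x - c)) \<in> borel_measurable borel" by measurable
  then have "(\<lambda>x. \<tau> \<bullet> (x - c)) -` A \<inter> space borel \<in> sets borel" using A by (rule measurable_sets)
  moreover have "{x. \<tau> \<bullet> (x - c) \<in> A} = (\<lambda>x. \<tau> \<bullet> (x - c)) -` A \<inter> space borel" by auto
  ultimately show ?thesis using closed_range_line by (subst line_image) auto
qed

text \<open>Lebesgue measure is determined by its values on open intervals, and the two preceding
  estimates give the arc length of their images: the upper one through the closed interval, the
  lower one directly.\<close>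

private lemma lborel_line: "lborel = distr (restrict_space arclength (range line)) borel (\<lambda>x. \<tau> \<bullet> (x - c))"
proof (rule lborel_eqI)
  have m: "(\<lambda>x. \<tau> \<bullet> (x - c)) \<in> measurable (restrict_space arclength (range line)) borel"
    by (intro measurable_restrict_space1 measurable_arclength) measurable
  fix l u :: real assume lu: "\<And>b. b \<in> Basis \<Longrightarrow> l \<bullet> b \<le> u \<bullet> b"
  then have lu': "l \<le> u" by simp
  have bl: "line ` {l<..<u} \<in> sets arclength" by (intro borel_arclength line_image_borel) auto
  have "emeasure (distr (restrict_space arclength (range line)) borel (\<lambda>x. \<tau> \<bullet> (x - c))) (box l u) =
     emeasure (restrict_space arclength (range line)) (line ` {l<..<u})"
    by (subst emeasure_distr[OF m]) (auto simp: space_restrict_space line_image[of "{l<..<u}"] intro!: arg_cong2[where f = emeasure])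
  also have "\<dots> = emeasure arclength (line ` {l<..<u})"
    by (rule emeasure_restrict_space) (use closed_range_line in \<open>auto intro!: borel_arclength\<close>)
  also have "\<dots> = hausdorff1_outer (line ` {l<..<u})" using emeasure_arclength[OF bl] .
  also have "\<dots> = ennreal (u - l)"
  proof (rule antisym)
    have "hausdorff1_outer (line ` {l<..<u}) \<le> hausdorff1_outer (line ` {l..u})"
      by (intro hausdorff1_outer_mono image_mono) auto
    also have "\<dots> \<le> ennreal (u - l)" by (rule hausdorff1_line_le[OF lu'])
    finally show "hausdorff1_outer (line ` {l<..<u}) \<le> ennreal (u - l)" .
    show "ennreal (u - l) \<le> hausdorff1_outer (line ` {l<..<u})"
      using hausdorff1_line_ge[of "{l<..<u}"] lu' by simp
  qed
  finally show "emeasure (distr (restrict_space arclength (range line)) borel (\<lambda>x. \<tau> \<bullet> (x - c))) (box l u) =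
    ennreal (\<Prod>b\<in>Basis. (u - l) \<bullet> b)" by simp
qed simp

lemma integral_arclength_line:
  fixes f :: "real^2 \<Rightarrow> 'b::{banach, second_countable_topology}"
  assumes f: "f \<in> borel_measurable borel" and z: "\<And>x. x \<notin> range (\<lambda>t. c + t *\<^sub>R \<tau>) \<Longrightarrow> f x = 0"
  shows "(\<integral>x. f x \<partial>arclength) = (\<integral>t. f (c + t *\<^sub>R \<tau>) \<partial>lborel)"
    "integrable arclength f \<longleftrightarrow> integrable lborel (\<lambda>t. f (c + t *\<^sub>R \<tau>))"
    "A \<in> sets borel \<Longrightarrow> emeasure arclength ((\<lambda>t. c + t *\<^sub>R \<tau>) ` A) = emeasure lborel A"
proof -
  have lr: "range line = range (\<lambda>t. c + t *\<^sub>R \<tau>)" by (auto simp: line_def)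
  have m: "(\<lambda>x. \<tau> \<bullet> (x - c)) \<in> measurable (restrict_space arclength (range line)) borel"
    by (intro measurable_restrict_space1 measurable_arclength) measurable
  have lm: "line \<in> borel_measurable borel" unfolding line_def[abs_def] by measurable
  have fm: "(\<lambda>t. f (line t)) \<in> borel_measurable borel" using lm f by (rule measurable_compose)
  have R: "range line \<inter> space arclength \<in> sets arclength"
    using closed_range_line by (auto intro!: borel_arclength)
  have eq: "indicator (range line) x *\<^sub>R f (line (\<tau> \<bullet> (x - c))) = f x" for x
    using z[of x] line_proj by (auto simp: lr[symmetric] indicator_def)
  have "(\<integral>t. f (line t) \<partial>lborel) = (\<integral>x. f (line (\<tau> \<bullet> (x - c))) \<partial>restrict_space arclength (range line))"
    by (subst lborel_line) (rule integral_distr[OF m fm])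
  also have "\<dots> = (\<integral>x. f x \<partial>arclength)"
    by (subst integral_restrict_space[OF R]) (simp add: eq)
  finally show "(\<integral>x. f x \<partial>arclength) = (\<integral>t. f (c + t *\<^sub>R \<tau>) \<partial>lborel)" by (simp add: line_def)
  have "integrable lborel (\<lambda>t. f (line t)) \<longleftrightarrow> integrable (restrict_space arclength (range line)) (\<lambda>x. f (line (\<tau> \<bullet> (x - c))))"
    by (subst lborel_line) (rule integrable_distr_eq[OF m fm])
  also have "\<dots> \<longleftrightarrow> integrable arclength f"
    by (subst integrable_restrict_space[OF R]) (simp add: eq)
  finally show "integrable arclength f \<longleftrightarrow> integrable lborel (\<lambda>t. f (c + t *\<^sub>R \<tau>))" by (simp add: line_def)
  assume A: "A \<in> sets borel"
  have "emeasure lborel A = emeasure (restrict_space arclength (range line)) (line ` A)"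
    by (subst lborel_line, subst emeasure_distr[OF m A])
      (auto simp: space_restrict_space line_image[of A] intro!: arg_cong2[where f = emeasure])
  also have "\<dots> = emeasure arclength (line ` A)"
    by (rule emeasure_restrict_space[OF R]) auto
  finally show "emeasure arclength ((\<lambda>t. c + t *\<^sub>R \<tau>) ` A) = emeasure lborel A"
    by (simp add: line_def[abs_def])
qed

end

lemma closed_segment_unit_param:
  assumes "a \<noteq> (b :: 'a::real_normed_vector)"
  shows "closed_segment a b = (\<lambda>t. a + t *\<^sub>R ((b - a) /\<^sub>R norm (b - a))) ` {0..norm (b - a)}"
proof -
  have n: "norm (b - a) > 0" using assms by simp
  show ?thesis
  proof (intro equalityI subsetI)
    fix x assume "x \<in> closed_segment a b"
    then obtain u where u: "0 \<le> u" "u \<le> 1" "x = a + u *\<^sub>R (b - a)"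
      by (auto simp: closed_segment_def algebra_simps)
    then show "x \<in> (\<lambda>t. a + t *\<^sub>R ((b - a) /\<^sub>R norm (b - a))) ` {0..norm (b - a)}"
      using n by (intro image_eqI[of _ _ "u * norm (b - a)"]) (auto intro: mult_left_le_one_le)
  next
    fix x assume "x \<in> (\<lambda>t. a + t *\<^sub>R ((b - a) /\<^sub>R norm (b - a))) ` {0..norm (b - a)}"
    then obtain t where t: "0 \<le> t" "t \<le> norm (b - a)" "x = a + t *\<^sub>R ((b - a) /\<^sub>R norm (b - a))" by auto
    then have "x = a + (t / norm (b - a)) *\<^sub>R (b - a)" by (simp add: divide_inverse)
    then have "x = (1 - t / norm (b - a)) *\<^sub>R a + (t / norm (b - a)) *\<^sub>R b" by (simp add: algebra_simps)
    then show "x \<in> closed_segment a b" using t n unfolding closed_segment_def by fastforce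
  qed
qed

lemma emeasure_arclength_segment: "emeasure arclength (closed_segment a b) = ennreal (dist a (b :: real^2))"
proof (cases "a = b")
  case True
  then show ?thesis using arclength_singleton[of b] by auto
next
  case False
  have "norm ((b - a) /\<^sub>R norm (b - a)) = 1" using False by simp
  from integral_arclength_line(3)[OF this, of "\<lambda>_. 0::real" a "{0..norm (b - a)}"]
  show ?thesis by (simp add: closed_segment_unit_param[OF False] dist_norm norm_minus_commute)
qed

lemma edge_length_segment: "edge_length (closed_segment a b) = dist a b"
  by (simp add: edge_length_def measure_def emeasure_arclength_segment)

lemma sets_arclength_segment: "closed_segment a (b :: real^2) \<in> sets arclength"
  by (rule closed_sets_arclength) simp

section \<open>Green's formula and traces on straight edges\<close>

lemma cutoff_tendsto_1: "(cutoff \<longlongrightarrow> 1) at_top"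
proof -
  have "((\<lambda>x::real. exp (- inverse x)) \<longlongrightarrow> exp (- 0)) at_top"
    by (intro tendsto_intros tendsto_inverse_0_at_top filterlim_ident)
  then have "((\<lambda>x::real. exp (- inverse x)) \<longlongrightarrow> 1) at_top" by simp
  then show ?thesis
  proof (rule Lim_transform_eventually)
    show "\<forall>\<^sub>F x in at_top. exp (- inverse x) = cutoff x"
      using eventually_gt_at_top[of 0] by eventually_elim (simp add: hp_def inverse_eq_divide)
  qed
qed

text \<open>The total mass is the limit of \<open>cutoff\<close> at infinity. The shift by 1 belongs
  to the cut-offs in Green's formula, which must vanish on a whole strip along the edge and not just
  on the edge.\<close>

lemma integral_cutoff':
  "integrable lborel (\<lambda>s. cutoff' (s - 1))" "(\<integral>s. cutoff' (s - 1) \<partial>lborel) = 1"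
proof -
  have m: "(\<lambda>s. cutoff' (s - 1)) \<in> borel_measurable borel"
    by (intro borel_measurable_continuous_onI continuous_on_compose2[OF continuous_on_hp])
      (auto intro!: continuous_intros)
  have t: "((\<lambda>s. cutoff (s - 1)) \<longlongrightarrow> 1) at_top"
    by (rule filterlim_compose[OF cutoff_tendsto_1]) (rule filterlim_at_top_mono[OF filterlim_tendsto_add_at_top[OF tendsto_const[of "-1"] filterlim_ident]], simp)
  have "(\<integral>\<^sup>+ s. ennreal (cutoff' (s - 1)) * indicator {1..} s \<partial>lborel) = ennreal (1 - cutoff (1 - 1))"
  proof (rule nn_integral_FTC_atLeast[OF m _ _ t])
    fix s :: real
    have "((\<lambda>s. cutoff (s - 1)) has_real_derivative cutoff' (s - 1) * 1) (at s)"
      by (rule DERIV_chain2[OF cutoff_deriv]) (auto intro!: derivative_eq_intros)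
    then show "((\<lambda>s. cutoff (s - 1)) has_real_derivative cutoff' (s - 1)) (at s)" by simp
  qed (rule cutoff'_bounds)
  moreover have "ennreal (cutoff' (s - 1)) * indicator {1..} s = ennreal (cutoff' (s - 1))" for s
    by (auto simp: indicator_def hp_def)
  ultimately have "(\<integral>\<^sup>+ s. ennreal (cutoff' (s - 1)) \<partial>lborel) = ennreal 1"
    by (simp add: hp_def)
  then have "has_bochner_integral lborel (\<lambda>s. cutoff' (s - 1)) 1"
    using m by (intro has_bochner_integral_nn_integral) (auto simp: cutoff'_bounds)
  then show "integrable lborel (\<lambda>s. cutoff' (s - 1))" "(\<integral>s. cutoff' (s - 1) \<partial>lborel) = 1"
    by (auto simp: has_bochner_integral_iff)
qed

text \<open>Orthogonal maps and translations preserve Lebesgue measure. The coordinates with respect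
  to the frame (\<nu>, \<tau>) thus carry it to the product measure, and Fubini's theorem applies
  with one variable across the edge and one along it.\<close>

lemma lborel_orthonormal_frame:
  fixes c \<nu> \<tau> :: "real^2"
  assumes o: "norm \<nu> = 1" "norm \<tau> = 1" "\<nu> \<bullet> \<tau> = 0"
  shows "(lborel :: (real \<times> real) measure) = distr lborel borel (\<lambda>x. (\<nu> \<bullet> (x - c), \<tau> \<bullet> (x - c)))"
    "x = c + (\<nu> \<bullet> (x - c)) *\<^sub>R \<nu> + (\<tau> \<bullet> (x - c)) *\<^sub>R \<tau>"
proof -
  define f where "f y = (y $ 1) *\<^sub>R \<nu> + (y $ 2) *\<^sub>R \<tau>" for y :: "real^2"
  have oo: "\<nu> \<bullet> \<nu> = 1" "\<tau> \<bullet> \<tau> = 1" "\<tau> \<bullet> \<nu> = 0" using o by (auto simp: norm_eq_1 inner_commute)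
  have lin: "linear f" unfolding f_def by (rule linearI) (auto simp: algebra_simps)
  have ff: "f v \<bullet> f w = v \<bullet> w" for v w
  proof -
    have "f v \<bullet> f w = v $ 1 * w $ 1 + v $ 2 * w $ 2"
      by (simp add: f_def inner_add_left inner_add_right oo o)
    then show ?thesis by (simp add: inner_vec_def sum_2)
  qed
  have orth: "orthogonal_transformation f"
    using lin ff by (simp add: orthogonal_transformation_def)
  have surj: "surj f" using orth by (rule orthogonal_transformation_surj)
  have rep: "x = c + (\<nu> \<bullet> (x - c)) *\<^sub>R \<nu> + (\<tau> \<bullet> (x - c)) *\<^sub>R \<tau>" for x
  proof -
    obtain y where y: "x - c = f y" using surj by (metis surj_def)
    have "\<nu> \<bullet> (x - c) = y $ 1" "\<tau> \<bullet> (x - c) = y $ 2" unfolding y by (simp_all add: f_def inner_add_right oo o)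
    then show ?thesis using y by (simp add: f_def algebra_simps)
  qed
  then show "x = c + (\<nu> \<bullet> (x - c)) *\<^sub>R \<nu> + (\<tau> \<bullet> (x - c)) *\<^sub>R \<tau>" .
  have m: "(\<lambda>x. (\<nu> \<bullet> (x - c), \<tau> \<bullet> (x - c))) \<in> measurable lborel (borel :: (real \<times> real) measure)"
    by (simp add: borel_measurable_continuous_onI continuous_intros)
  show "(lborel :: (real \<times> real) measure) = distr lborel borel (\<lambda>x. (\<nu> \<bullet> (x - c), \<tau> \<bullet> (x - c)))"
  proof (rule lborel_eqI)
    fix l u :: "real \<times> real" assume lu: "\<And>b. b \<in> Basis \<Longrightarrow> l \<bullet> b \<le> u \<bullet> b"
    obtain l1 l2 where l: "l = (l1, l2)" by (cases l)
    obtain u1 u2 where u: "u = (u1, u2)" by (cases u)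
    have le: "l1 \<le> u1" "l2 \<le> u2" using lu[of "(1,0)"] lu[of "(0,1)"] by (auto simp: l u Basis_prod_def)
    define L where "L = (vector [l1, l2] :: real^2)"
    define V where "V = (vector [u1, u2] :: real^2)"
    have LV: "L $ 1 = l1" "L $ 2 = l2" "V $ 1 = u1" "V $ 2 = u2" by (auto simp: L_def V_def)
    have bx: "(y \<in> box L V) \<longleftrightarrow> l1 < y $ 1 \<and> y $ 1 < u1 \<and> l2 < y $ 2 \<and> y $ 2 < u2" for y
      by (auto simp: mem_box_cart forall_2 LV)
    have pre: "(\<lambda>x. (\<nu> \<bullet> (x - c), \<tau> \<bullet> (x - c))) -` box l u = (+) c ` (f ` box L V)"
    proof (intro equalityI subsetI)
      fix x assume "x \<in> (\<lambda>x. (\<nu> \<bullet> (x - c), \<tau> \<bullet> (x - c))) -` box l u"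
      then have b: "l1 < \<nu> \<bullet> (x - c)" "\<nu> \<bullet> (x - c) < u1" "l2 < \<tau> \<bullet> (x - c)" "\<tau> \<bullet> (x - c) < u2"
        by (auto simp: l u box_def Basis_prod_def)
      define y where "y = (vector [\<nu> \<bullet> (x - c), \<tau> \<bullet> (x - c)] :: real^2)"
      have "y \<in> box L V" unfolding bx using b by (simp add: y_def)
      moreover have "x = c + f y" using rep[of x] by (simp add: f_def y_def add.assoc)
      ultimately show "x \<in> (+) c ` (f ` box L V)" by blast
    next
      fix x assume "x \<in> (+) c ` (f ` box L V)"
      then obtain y where y: "y \<in> box L V" "x = c + f y" by blast
      have "\<nu> \<bullet> (x - c) = y $ 1" "\<tau> \<bullet> (x - c) = y $ 2" unfolding y by (simp_all add: f_def inner_add_right oo o)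
      then show "x \<in> (\<lambda>x. (\<nu> \<bullet> (x - c), \<tau> \<bullet> (x - c))) -` box l u"
        using y(1) unfolding bx by (auto simp: l u box_def Basis_prod_def)
    qed
    have bm: "box L V \<in> lmeasurable" by (rule lmeasurable_box)
    have "measure lebesgue ((+) c ` (f ` box L V)) = measure lebesgue (box L V)"
      using measure_orthogonal_image[OF orth bm] by (simp add: measure_translation)
    also have "\<dots> = (u1 - l1) * (u2 - l2)"
    proof -
      have "measure lebesgue (box L V) = measure lborel (cbox L V)"
        by (simp add: measure_lborel_box_eq measure_lborel_cbox_eq)
      moreover have "cbox L V \<noteq> {}" using le by (simp add: interval_ne_empty_cart forall_2 LV)
      ultimately show ?thesis by (simp add: content_cbox_cart UNIV_2 LV)
    qed
    finally have ms: "measure lebesgue ((+) c ` (f ` box L V)) = (u1 - l1) * (u2 - l2)" .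
    have lm: "(+) c ` (f ` box L V) \<in> lmeasurable"
      using measurable_orthogonal_image[OF orth bm] by (rule measurable_translation)
    have bs: "(+) c ` (f ` box L V) \<in> sets borel"
      using measurable_sets[OF m, of "box l u"] by (simp add: pre)
    have "emeasure (distr lborel borel (\<lambda>x. (\<nu> \<bullet> (x - c), \<tau> \<bullet> (x - c)))) (box l u)
      = emeasure lborel ((+) c ` (f ` box L V))"
      by (subst emeasure_distr[OF m]) (simp_all add: pre)
    also have "\<dots> = emeasure lebesgue ((+) c ` (f ` box L V))"
      using bs by simp
    also have "\<dots> = ennreal ((u1 - l1) * (u2 - l2))"
      using lm by (simp add: emeasure_eq_measure2 ms)
    also have "\<dots> = ennreal (\<Prod>b\<in>Basis. (u - l) \<bullet> b)"
      by (simp add: l u Basis_prod_def prod.union_disjoint prod.reindex inj_on_def mult.commute)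
    finally show "emeasure (distr lborel borel (\<lambda>x. (\<nu> \<bullet> (x - c), \<tau> \<bullet> (x - c)))) (box l u) =
       ennreal (\<Prod>b\<in>Basis. (u - l) \<bullet> b)" .
  qed simp
qed

lemma integral_orthonormal_frame:
  fixes c \<nu> \<tau> :: "real^2" and P :: "real^2 \<Rightarrow> real"
  assumes o: "norm \<nu> = 1" "norm \<tau> = 1" "\<nu> \<bullet> \<tau> = 0" and P: "integrable lborel P"
  shows "(\<integral>x. P x \<partial>lborel) = (\<integral>s. (\<integral>t. P (c + s *\<^sub>R \<nu> + t *\<^sub>R \<tau>) \<partial>lborel) \<partial>lborel)"
proof -
  define Q where "Q y = P (c + fst y *\<^sub>R \<nu> + snd y *\<^sub>R \<tau>)" for y
  have m: "(\<lambda>x. (\<nu> \<bullet> (x - c), \<tau> \<bullet> (x - c))) \<in> measurable lborel (borel :: (real \<times> real) measure)"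
    by (simp add: borel_measurable_continuous_onI continuous_intros)
  have Pm[measurable]: "P \<in> borel_measurable borel" using borel_measurable_integrable[OF P] by simp
  have "(\<lambda>y::real \<times> real. c + fst y *\<^sub>R \<nu> + snd y *\<^sub>R \<tau>) \<in> borel_measurable borel"
    by (intro borel_measurable_continuous_onI continuous_intros)
  then have Qm: "Q \<in> borel_measurable borel" unfolding Q_def[abs_def] using Pm by (rule measurable_compose)
  have QP: "Q (\<nu> \<bullet> (x - c), \<tau> \<bullet> (x - c)) = P x" for x
    using lborel_orthonormal_frame(2)[OF o, of x c] by (simp add: Q_def)
  have i: "integrable lborel Q"
    by (subst lborel_orthonormal_frame(1)[OF o, of c], subst integrable_distr_eq[OF m Qm]) (simp add: QP P)
  have "(\<integral>x. P x \<partial>lborel) = (\<integral>y. Q y \<partial>lborel)"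
    by (subst lborel_orthonormal_frame(1)[OF o, of c], subst integral_distr[OF m Qm]) (simp add: QP)
  also have "\<dots> = (\<integral>s. (\<integral>t. Q (s, t) \<partial>lborel) \<partial>lborel)"
    using lborel_pair.integral_fst'[of Q] i by (simp add: lborel_prod)
  finally show ?thesis by (simp add: Q_def)
qed

text \<open>The weight concentrates in a layer of thickness of order 1/n inside the half plane.
  Rescaling the normal coordinate by n turns the integral into an average, with the weight
  \<open>cutoff'\<close> (s - 1) of mass 1, of the integrals of F over the parallels at distance
  s/n, and these converge to the integral over the line itself.\<close>

lemma boundary_layer_limit:
  fixes c \<nu> \<tau> :: "real^2" and F :: "real^2 \<Rightarrow> real"
  assumes o: "norm \<nu> = 1" "norm \<tau> = 1" "\<nu> \<bullet> \<tau> = 0"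
    and Fc: "continuous_on {x. \<nu> \<bullet> (x - c) \<le> 0} F" and Fz: "\<And>x. \<rho> < dist c x \<Longrightarrow> F x = 0"
    and Fs: "\<And>x. 0 < \<nu> \<bullet> (x - c) \<Longrightarrow> F x = 0"
  shows "(\<lambda>n. \<integral>x. real (Suc n) * cutoff' (- real (Suc n) * (\<nu> \<bullet> (x - c)) - 1) * F x \<partial>lborel)
    \<longlonglongrightarrow> (\<integral>t. F (c + t *\<^sub>R \<tau>) \<partial>lborel)"
proof -
  define H where "H = cball c \<rho> \<inter> {x. \<nu> \<bullet> (x - c) \<le> 0}"
  have cH: "compact H" unfolding H_def
    by (intro compact_Int_closed compact_cball closed_Collect_le continuous_intros)
  have FH: "continuous_on H F" using Fc by (rule continuous_on_subset) (auto simp: H_def)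
  have "bounded (F ` H)" using compact_continuous_image[OF FH cH] by (rule compact_imp_bounded)
  then obtain B where B: "\<And>x. x \<in> H \<Longrightarrow> \<bar>F x\<bar> \<le> B" "B > 0" by (auto simp: bounded_pos)
  have F0: "F x = 0" if "x \<notin> H" for x using that Fz[of x] Fs[of x] by (force simp: H_def)
  have B': "\<bar>F x\<bar> \<le> B" for x using B F0[of x] by (cases "x \<in> H") auto
  have FindH: "(\<lambda>x. indicator H x *\<^sub>R F x) = F" using F0 by (auto simp: indicator_def fun_eq_iff)
  have Fm[measurable]: "F \<in> borel_measurable borel"
    using borel_measurable_continuous_on_indicator[OF borel_closed[OF compact_imp_closed[OF cH]] FH] by (simp only: FindH)
  have cm[measurable]: "cutoff' \<in> borel_measurable borel"
    by (intro borel_measurable_continuous_onI continuous_on_hp)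
  have dd: "\<bar>t\<bar> \<le> dist c (c + s *\<^sub>R \<nu> + t *\<^sub>R \<tau>)" for s t
  proof -
    have "t\<^sup>2 \<le> s\<^sup>2 + t\<^sup>2" by simp
    also have "s\<^sup>2 + t\<^sup>2 = (norm (s *\<^sub>R \<nu> + t *\<^sub>R \<tau>))\<^sup>2"
      using o unfolding power2_norm_eq_inner norm_eq_1
      by (simp add: inner_add_left inner_add_right inner_commute power2_eq_square)
    finally have "\<bar>t\<bar> \<le> norm (s *\<^sub>R \<nu> + t *\<^sub>R \<tau>)" by (metis abs_le_square_iff abs_of_nonneg norm_ge_zero)
    then show ?thesis by (simp add: dist_norm norm_minus_commute add.commute)
  qed
  have Fb: "\<bar>F (c + s *\<^sub>R \<nu> + t *\<^sub>R \<tau>)\<bar> \<le> B * indicator {-\<rho>..\<rho>} t" for s t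
  proof (cases "\<bar>t\<bar> \<le> \<rho>")
    case True
    then show ?thesis using B' by (simp add: indicator_def abs_le_iff)
  next
    case False
    then show ?thesis using Fz[of "c + s *\<^sub>R \<nu> + t *\<^sub>R \<tau>"] dd[of t s] B(2) by (simp add: less_le_trans[of \<rho>])
  qed
  have ib: "integrable lborel (\<lambda>t. B * indicator {-\<rho>..\<rho>} t)"
    by (intro integrable_mult_right integrable_real_indicator) (auto simp: emeasure_lborel_Icc_eq)
  define W where "W s = (\<integral>t. F (c + s *\<^sub>R \<nu> + t *\<^sub>R \<tau>) \<partial>lborel)" for s
  have Wm[measurable]: "W \<in> borel_measurable borel"
    unfolding W_def[abs_def] by measurable
  define A where "A = (\<integral>t. B * indicator {-\<rho>..\<rho>} t \<partial>lborel)"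
  have Wb: "\<bar>W s\<bar> \<le> A" for s
  proof -
    have "\<bar>W s\<bar> \<le> (\<integral>t. \<bar>F (c + s *\<^sub>R \<nu> + t *\<^sub>R \<tau>)\<bar> \<partial>lborel)" unfolding W_def by simp
    also have "\<dots> \<le> A" unfolding A_def
    proof (rule integral_mono[OF _ ib Fb])
      show "integrable lborel (\<lambda>t. \<bar>F (c + s *\<^sub>R \<nu> + t *\<^sub>R \<tau>)\<bar>)"
        by (rule Bochner_Integration.integrable_bound[OF ib])
          (auto intro!: AE_I2 order_trans[OF Fb] simp: abs_mult B(2) less_imp_le)
    qed
    finally show ?thesis .
  qed
  \<comment> \<open>Positive s are enough, because the weight vanishes for s \<le> 1; for them the
    parallels lie in the half plane on which F is continuous.\<close>
  have Wlim: "(\<lambda>n. W (- s / real (Suc n))) \<longlonglongrightarrow> W 0" if s: "s > 0" for s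
    unfolding W_def
  proof (rule integral_dominated_convergence[OF _ _ ib])
    show "AE t in lborel. (\<lambda>n. F (c + (- s / real (Suc n)) *\<^sub>R \<nu> + t *\<^sub>R \<tau>)) \<longlonglongrightarrow> F (c + 0 *\<^sub>R \<nu> + t *\<^sub>R \<tau>)"
    proof (rule AE_I2)
      fix t
      define x where "x n = c + (- s / real (Suc n)) *\<^sub>R \<nu> + t *\<^sub>R \<tau>" for n
      have "(\<lambda>n. c + (- s * inverse (real (Suc n))) *\<^sub>R \<nu> + t *\<^sub>R \<tau>) \<longlonglongrightarrow> c + (- s * 0) *\<^sub>R \<nu> + t *\<^sub>R \<tau>"
        by (intro tendsto_intros LIMSEQ_inverse_real_of_nat)
      then have xl: "x \<longlonglongrightarrow> c + 0 *\<^sub>R \<nu> + t *\<^sub>R \<tau>" by (simp add: x_def[abs_def] divide_inverse)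
      have "\<nu> \<bullet> (x n - c) \<le> 0" for n
        using o s by (simp add: x_def inner_add_right inner_diff_right norm_eq_1 add_nonneg_nonneg)
      then have "x n \<in> {x. \<nu> \<bullet> (x - c) \<le> 0}" for n by simp
      then show "(\<lambda>n. F (c + (- s / real (Suc n)) *\<^sub>R \<nu> + t *\<^sub>R \<tau>)) \<longlonglongrightarrow> F (c + 0 *\<^sub>R \<nu> + t *\<^sub>R \<tau>)"
        using continuous_on_tendsto_compose[OF Fc xl] o by (simp add: x_def[abs_def])
    qed
    show "AE t in lborel. norm (F (c + (- s / real (Suc n)) *\<^sub>R \<nu> + t *\<^sub>R \<tau>)) \<le> B * indicator {-\<rho>..\<rho>} t" for n
      unfolding real_norm_def by (intro AE_I2 Fb)
  qed measurable
  have J: "(\<integral>x. real (Suc n) * cutoff' (- real (Suc n) * (\<nu> \<bullet> (x - c)) - 1) * F x \<partial>lborel)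
     = (\<integral>s. cutoff' (s - 1) * W (- s / real (Suc n)) \<partial>lborel)" for n
  proof -
    define N where "N = real (Suc n)"
    have N: "N > 0" by (simp add: N_def)
    have "integrable lborel (\<lambda>x. N * cutoff' (- N * (\<nu> \<bullet> (x - c)) - 1) * F x)"
    proof (rule Bochner_Integration.integrable_bound[where f = "\<lambda>x. N * B * indicator H x"])
      show "integrable lborel (\<lambda>x. N * B * indicator H x)"
        using borel_closed[OF compact_imp_closed[OF cH]] compact_imp_bounded[OF cH]
        by (intro integrable_mult_right integrable_real_indicator emeasure_bounded_finite) auto
      show "AE x in lborel. norm (N * cutoff' (- N * (\<nu> \<bullet> (x - c)) - 1) * F x) \<le> norm (N * B * indicator H x)"
      proof (rule AE_I2)
        fix x
        show "norm (N * cutoff' (- N * (\<nu> \<bullet> (x - c)) - 1) * F x) \<le> norm (N * B * indicator H x)"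
        proof (cases "x \<in> H")
          case True
          have "N * cutoff' (- N * (\<nu> \<bullet> (x - c)) - 1) * \<bar>F x\<bar> \<le> N * 1 * B"
            using N B True cutoff'_bounds by (intro mult_mono) auto
          then show ?thesis using True N B cutoff'_bounds by (simp add: abs_mult)
        qed (simp add: F0)
      qed
    qed measurable
    from integral_orthonormal_frame[OF o this, of c]
    have "(\<integral>x. N * cutoff' (- N * (\<nu> \<bullet> (x - c)) - 1) * F x \<partial>lborel) =
      (\<integral>s. N * cutoff' (- N * s - 1) * W s \<partial>lborel)"
      using o by (simp add: W_def inner_add_right norm_eq_1 mult.assoc)
    \<comment> \<open>The substitution of - s / N for s absorbs the factor N.\<close>
    also have "\<dots> = (\<integral>s. cutoff' (s - 1) * W (- s / N) \<partial>lborel)"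
      using N by (subst lborel_integral_real_affine[where c = "- 1 / N" and t = 0]) (auto simp: field_simps)
    finally show ?thesis by (simp add: N_def)
  qed
  have "(\<lambda>n. \<integral>s. cutoff' (s - 1) * W (- s / real (Suc n)) \<partial>lborel) \<longlonglongrightarrow> (\<integral>s. cutoff' (s - 1) * W 0 \<partial>lborel)"
  proof (rule integral_dominated_convergence)
    show "integrable lborel (\<lambda>s. cutoff' (s - 1) * A)" using integral_cutoff'(1) by simp
    show "AE s in lborel. (\<lambda>n. cutoff' (s - 1) * W (- s / real (Suc n))) \<longlonglongrightarrow> cutoff' (s - 1) * W 0"
    proof (rule AE_I2)
      fix s :: real
      show "(\<lambda>n. cutoff' (s - 1) * W (- s / real (Suc n))) \<longlonglongrightarrow> cutoff' (s - 1) * W 0"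
      proof (cases "s > 0")
        case True then show ?thesis by (intro tendsto_mult tendsto_const Wlim)
      next
        case False then show ?thesis by (simp add: hp_def)
      qed
    qed
    show "AE s in lborel. norm (cutoff' (s - 1) * W (- s / real (Suc n))) \<le> cutoff' (s - 1) * A" for n
      using Wb cutoff'_bounds by (intro AE_I2) (simp add: abs_mult mult_left_mono)
  qed measurable
  moreover have "(\<integral>s. cutoff' (s - 1) * W 0 \<partial>lborel) = (\<integral>t. F (c + t *\<^sub>R \<tau>) \<partial>lborel)"
    using integral_cutoff' by (simp add: W_def)
  ultimately show ?thesis unfolding J by (simp only:)
qed

text \<open>The support of \<phi> may meet the edge, so \<phi> need not be a test function of U. Its
  product with the cut-off \<open>k n\<close> is one, as \<open>k n\<close> vanishes up to the
  distance 1 / (n + 1) from the line. The gradient of the product has the additional term \<phi>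
  grad (k n), which by \<open>boundary_layer_limit\<close> becomes the integral over the edge. Near
  c only a half disc of U enters, since \<phi> vanishes off the disc.\<close>

lemma green_edge:
  fixes U e :: "(real^2) set" and z \<phi> :: "real^2 \<Rightarrow> real"
  assumes o: "norm \<nu> = 1" "norm \<tau> = 1" "\<nu> \<bullet> \<tau> = 0" and U: "open U"
    and side: "\<And>x. x \<in> U \<Longrightarrow> \<nu> \<bullet> (x - c) < 0"
    and half: "\<And>x. dist c x \<le> \<rho> \<Longrightarrow> \<nu> \<bullet> (x - c) < 0 \<Longrightarrow> x \<in> U"
    and e: "\<And>x. dist c x \<le> \<rho> \<Longrightarrow> x \<in> e \<longleftrightarrow> \<nu> \<bullet> (x - c) = 0"
    and zc: "continuous_on (cball c \<rho> \<inter> {x. \<nu> \<bullet> (x - c) \<le> 0}) z"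
    and z: "z \<in> L2_space lebesgue U" and G: "G \<in> L2_space lebesgue U" "is_weak_grad U z G"
    and \<phi>: "\<And>k. Ck k \<phi>" "\<And>x. \<rho> \<le> dist c x \<Longrightarrow> \<phi> x = 0"
  shows "(LINT x:e|arclength. z x * \<phi> x) *\<^sub>R \<nu> = (LINT x:U|lebesgue. z x *\<^sub>R grad \<phi> x) + (LINT x:U|lebesgue. \<phi> x *\<^sub>R G x)"
    "set_integrable arclength e (\<lambda>x. z x * \<phi> x)"
proof -
  have Us: "U \<in> sets lebesgue" using U by auto
  define H where "H = cball c \<rho> \<inter> {x. \<nu> \<bullet> (x - c) \<le> 0}"
  \<comment> \<open>The value on the line itself is kept, so that F is continuous on the closed half
    plane.\<close>
  define F where "F x = (if \<nu> \<bullet> (x - c) \<le> 0 then z x * \<phi> x else 0)" for x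
  have \<phi>c: "continuous_on UNIV \<phi>" using \<phi>(1)[of 0] by simp
  have Fc: "continuous_on {x. \<nu> \<bullet> (x - c) \<le> 0} F"
  proof -
    have c1: "continuous_on H F"
    proof (rule continuous_on_eq)
      show "continuous_on H (\<lambda>x. z x * \<phi> x)"
        using zc by (intro continuous_on_mult continuous_on_subset[OF \<phi>c]) (auto simp: H_def)
    qed (auto simp: F_def H_def)
    have c2: "continuous_on ({x. \<rho> \<le> dist c x} \<inter> {x. \<nu> \<bullet> (x - c) \<le> 0}) F"
      by (rule continuous_on_eq[of _ "\<lambda>_. 0"]) (auto simp: F_def \<phi>)
    have "continuous_on (H \<union> ({x. \<rho> \<le> dist c x} \<inter> {x. \<nu> \<bullet> (x - c) \<le> 0})) F"
      by (rule continuous_on_closed_Un[OF _ _ c1 c2])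
        (auto simp: H_def intro!: closed_Int closed_Collect_le continuous_intros)
    moreover have "H \<union> ({x. \<rho> \<le> dist c x} \<inter> {x. \<nu> \<bullet> (x - c) \<le> 0}) = {x. \<nu> \<bullet> (x - c) \<le> 0}"
      by (auto simp: H_def)
    ultimately show ?thesis by simp
  qed
  have Fz: "F x = 0" if "\<rho> < dist c x" for x using \<phi>(2)[of x] that by (simp add: F_def)
  have Fs: "F x = 0" if "0 < \<nu> \<bullet> (x - c)" for x using that by (simp add: F_def)
  note lim = boundary_layer_limit[OF o Fc Fz Fs]
  have Hcl: "compact H" unfolding H_def
    by (intro compact_Int_closed compact_cball closed_Collect_le continuous_intros)
  have Fm: "F \<in> borel_measurable borel"
  proof -
    have "continuous_on H F" using Fc by (rule continuous_on_subset) (auto simp: H_def)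
    then have "(\<lambda>x. indicator H x *\<^sub>R F x) \<in> borel_measurable borel"
      by (intro borel_measurable_continuous_on_indicator borel_closed compact_imp_closed[OF Hcl])
    moreover have "indicator H x *\<^sub>R F x = F x" for x
      using Fz[of x] Fs[of x] by (cases "x \<in> H") (auto simp: H_def not_le)
    ultimately show ?thesis by (simp only:)
  qed
  have g\<phi>c: "continuous_on UNIV (grad \<phi>)"
    using \<phi>(1)[of 1] continuous_on_vec_lambda[of UNIV "\<lambda>i x. grad \<phi> x $ i"] by simp
  have g\<phi>0: "grad \<phi> x = 0" if "x \<notin> cball c \<rho>" for x
  proof -
    have "(\<phi> has_derivative (\<lambda>h. 0)) (at x)"
      by (rule has_derivative_transform_within_open[of "\<lambda>_. 0" "\<lambda>h. 0" x UNIV "- cball c \<rho>" \<phi>]) (use that \<phi>(2) in auto)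
    then have "(\<phi> has_derivative (\<lambda>h. 0 \<bullet> h)) (at x)" by simp
    then show ?thesis by (rule grad_eqI)
  qed
  have \<phi>0: "\<phi> x = 0" if "x \<notin> cball c \<rho>" for x using that \<phi>(2) by simp
  define k where "k n x = cutoff ((- real (Suc n) *\<^sub>R \<nu>) \<bullet> x + (real (Suc n) * (\<nu> \<bullet> c) - 1))" for n x
  define s where "s n x = cutoff' (- real (Suc n) * (\<nu> \<bullet> (x - c)) - 1)" for n x
  have keq: "k n x = cutoff (- real (Suc n) * (\<nu> \<bullet> (x - c)) - 1)" for n x
    by (simp add: k_def inner_diff_right algebra_simps)
  have kC: "Ck m (k n)" for m n unfolding k_def by (intro Ck_hp_comp Ck_affine)
  have kd: "grad (k n) x = - (real (Suc n) * s n x) *\<^sub>R \<nu>" for n x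
  proof -
    have "((\<lambda>x. (- real (Suc n) *\<^sub>R \<nu>) \<bullet> x + (real (Suc n) * (\<nu> \<bullet> c) - 1)) has_derivative (\<lambda>h. (- real (Suc n) *\<^sub>R \<nu>) \<bullet> h)) (at x)"
      by (auto intro!: derivative_eq_intros)
    from hp_has_derivative_comp[OF this, of 1]
    have "grad (k n) x = cutoff' ((- real (Suc n) *\<^sub>R \<nu>) \<bullet> x + (real (Suc n) * (\<nu> \<bullet> c) - 1)) *\<^sub>R (- real (Suc n) *\<^sub>R \<nu>)"
      unfolding k_def[abs_def] by (intro grad_eqI) simp
    then show ?thesis by (simp add: s_def inner_diff_right algebra_simps)
  qed
  have tf: "(\<lambda>x. \<phi> x * k n x) \<in> test_functions U" for n
  proof (rule test_functions_I)
    show "Ck m (\<lambda>x. \<phi> x * k n x)" for m using \<phi>(1) kC by (rule Ck_mult)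
    show "compact (cball c \<rho> \<inter> {x. 1 \<le> - real (Suc n) * (\<nu> \<bullet> (x - c))})"
      by (intro compact_Int_closed compact_cball closed_Collect_le continuous_intros)
    show "cball c \<rho> \<inter> {x. 1 \<le> - real (Suc n) * (\<nu> \<bullet> (x - c))} \<subseteq> U"
    proof
      fix x assume x: "x \<in> cball c \<rho> \<inter> {x. 1 \<le> - real (Suc n) * (\<nu> \<bullet> (x - c))}"
      then have "real (Suc n) * (\<nu> \<bullet> (x - c)) < 0" by (simp del: of_nat_Suc)
      then have "\<nu> \<bullet> (x - c) < 0" by (simp add: mult_less_0_iff)
      then show "x \<in> U" using half x by simp
    qed
    show "\<phi> x * k n x = 0" if "x \<notin> cball c \<rho> \<inter> {x. 1 \<le> - real (Suc n) * (\<nu> \<bullet> (x - c))}" for x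
      using that \<phi>0[of x] by (auto simp: keq hp_def)
  qed
  have diff: "\<phi> differentiable_on UNIV" "k n differentiable_on UNIV" for n
    using \<phi>(1)[of 1] kC[of 1 n] by auto
  have i1: "set_integrable lebesgue U (\<lambda>x. z x *\<^sub>R grad \<phi> x)"
    by (rule set_integrable_L2_times_test_grad[OF Us z g\<phi>c compact_cball g\<phi>0])
  have i2: "set_integrable lebesgue U (\<lambda>x. \<phi> x *\<^sub>R G x)"
    by (rule set_integrable_L2_times_test[OF Us G(1) \<phi>c compact_cball \<phi>0])
  have km: "k n \<in> borel_measurable lebesgue" for n
    using kC[of 0 n] by (intro measurable_completion) (simp add: borel_measurable_continuous_onI)
  have kl: "(\<lambda>n. k n x) \<longlonglongrightarrow> 1" if "x \<in> U" for x
  proof -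
    have p: "- (\<nu> \<bullet> (x - c)) > 0" using side[OF that] by simp
    have "filterlim (\<lambda>n. real (Suc n)) at_top sequentially"
      by (rule filterlim_compose[OF filterlim_real_sequentially filterlim_Suc])
    from filterlim_tendsto_add_at_top[OF tendsto_const[of "- 1"] filterlim_tendsto_pos_mult_at_top[OF tendsto_const p this]]
    have "filterlim (\<lambda>n. - 1 + - (\<nu> \<bullet> (x - c)) * real (Suc n)) at_top sequentially" .
    then have "filterlim (\<lambda>n. - real (Suc n) * (\<nu> \<bullet> (x - c)) - 1) at_top sequentially"
      by (simp add: algebra_simps)
    then show ?thesis unfolding keq by (rule filterlim_compose[OF cutoff_tendsto_1])
  qed
  \<comment> \<open>The cut-offs are bounded by 1 and tend to 1 in U, so they disappear from both
    volume integrals in the limit.\<close>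
  have conv: "set_integrable lebesgue U (\<lambda>x. k n x *\<^sub>R q x)"
     "(\<lambda>n. LINT x:U|lebesgue. k n x *\<^sub>R q x) \<longlonglongrightarrow> (LINT x:U|lebesgue. q x)"
    if q: "set_integrable lebesgue U q" for q :: "real^2 \<Rightarrow> real^2" and n
  proof -
    have qi: "integrable lebesgue (\<lambda>x. indicator U x *\<^sub>R q x)" using q by (simp add: set_integrable_def)
    have m: "(\<lambda>x. indicator U x *\<^sub>R (k n x *\<^sub>R q x)) \<in> borel_measurable lebesgue" for n
      using borel_measurable_scaleR[OF km borel_measurable_integrable[OF qi], of n] by (simp add: mult.commute)
    have b: "norm (indicator U x *\<^sub>R (k n x *\<^sub>R q x)) \<le> norm (indicator U x *\<^sub>R q x)" for n x
      using cutoff_bounds by (auto simp: keq indicator_def intro!: mult_left_le_one_le)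
    show "set_integrable lebesgue U (\<lambda>x. k n x *\<^sub>R q x)"
      unfolding set_integrable_def using b m by (intro Bochner_Integration.integrable_bound[OF qi]) auto
    show "(\<lambda>n. LINT x:U|lebesgue. k n x *\<^sub>R q x) \<longlonglongrightarrow> (LINT x:U|lebesgue. q x)"
      unfolding set_lebesgue_integral_def
    proof (rule integral_dominated_convergence[OF borel_measurable_integrable[OF qi] m integrable_norm[OF qi]])
      show "AE x in lebesgue. (\<lambda>n. indicator U x *\<^sub>R (k n x *\<^sub>R q x)) \<longlonglongrightarrow> indicator U x *\<^sub>R q x"
      proof (rule AE_I2)
        fix x
        show "(\<lambda>n. indicator U x *\<^sub>R (k n x *\<^sub>R q x)) \<longlonglongrightarrow> indicator U x *\<^sub>R q x"
          using tendsto_scaleR[OF kl tendsto_const[of "q x"], of x] by (cases "x \<in> U") auto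
      qed
    qed (use b in auto)
  qed
  define J where "J n = (\<integral>x. real (Suc n) * cutoff' (- real (Suc n) * (\<nu> \<bullet> (x - c)) - 1) * F x \<partial>lborel)" for n
  have eqn: "J n *\<^sub>R \<nu> = (LINT x:U|lebesgue. k n x *\<^sub>R (z x *\<^sub>R grad \<phi> x)) + (LINT x:U|lebesgue. k n x *\<^sub>R (\<phi> x *\<^sub>R G x))" for n
  proof -
    have g: "z x *\<^sub>R grad (\<lambda>x. \<phi> x * k n x) x = k n x *\<^sub>R (z x *\<^sub>R grad \<phi> x) - (real (Suc n) * s n x * (z x * \<phi> x)) *\<^sub>R \<nu>" for x
      unfolding grad_mult[OF diff] kd by (simp add: algebra_simps)
    have a1: "set_integrable lebesgue U (\<lambda>x. z x *\<^sub>R grad (\<lambda>x. \<phi> x * k n x) x)"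
    proof -
      obtain S where S: "compact S" "\<And>x. x \<notin> S \<Longrightarrow> grad (\<lambda>x. \<phi> x * k n x) x = 0" "continuous_on UNIV (grad (\<lambda>x. \<phi> x * k n x))"
        by (rule test_functionD[OF tf[of n]]) blast
      show ?thesis by (rule set_integrable_L2_times_test_grad[OF Us z S(3,1,2)])
    qed
    have a2: "set_integrable lebesgue U (\<lambda>x. k n x *\<^sub>R (z x *\<^sub>R grad \<phi> x))" by (rule conv(1)[OF i1])
    have a3: "set_integrable lebesgue U (\<lambda>x. (real (Suc n) * s n x * (z x * \<phi> x)) *\<^sub>R \<nu>)"
      using set_integral_diff(1)[OF a2 a1] by (simp add: g)
    have eqp: "indicator U x *\<^sub>R (real (Suc n) * s n x * (z x * \<phi> x)) *\<^sub>R \<nu> = (real (Suc n) * s n x * F x) *\<^sub>R \<nu>" for x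
    proof -
      consider "x \<in> U" | "x \<notin> U" "\<rho> < dist c x" | "x \<notin> U" "0 \<le> \<nu> \<bullet> (x - c)" using half[of x] by fastforce
      then show ?thesis
      proof cases
        case 1 then show ?thesis using side[of x] by (simp add: F_def)
      next
        case 2 then show ?thesis using Fz by simp
      next
        case 3
        then have "0 \<le> real (Suc n) * (\<nu> \<bullet> (x - c))" by simp
        then have "s n x = 0" unfolding s_def hp_def by (simp del: of_nat_Suc)
        then show ?thesis by simp
      qed
    qed
    \<comment> \<open>The scalar integrand is recovered from the vector-valued one by the inner
      product with the unit vector \<nu>.\<close>
    have "integrable lebesgue (\<lambda>x. ((real (Suc n) * s n x * F x) *\<^sub>R \<nu>) \<bullet> \<nu>)"
      using a3 unfolding set_integrable_def eqp by (rule integrable_inner_left)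
    then have i3: "integrable lebesgue (\<lambda>x. real (Suc n) * s n x * F x)"
      using o(1) by (cases "\<nu> = 0") (simp_all add: norm_eq_1 del: of_nat_Suc)
    have "(LINT x:U|lebesgue. (real (Suc n) * s n x * (z x * \<phi> x)) *\<^sub>R \<nu>) =
        (\<integral>x. real (Suc n) * s n x * F x \<partial>lebesgue) *\<^sub>R \<nu>"
      unfolding set_lebesgue_integral_def eqp by (rule integral_scaleR_left) (rule i3)
    also have "(\<integral>x. real (Suc n) * s n x * F x \<partial>lebesgue) = J n"
    proof -
      have "cutoff' \<in> borel_measurable borel"
        by (intro borel_measurable_continuous_onI continuous_on_hp)
      then have "(\<lambda>x. real (Suc n) * s n x * F x) \<in> borel_measurable lborel"
        unfolding s_def using Fm by measurable
      then show ?thesis unfolding J_def s_def by (rule integral_completion)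
    qed
    finally have a4: "(LINT x:U|lebesgue. (real (Suc n) * s n x * (z x * \<phi> x)) *\<^sub>R \<nu>) = J n *\<^sub>R \<nu>" .
    have "(LINT x:U|lebesgue. z x *\<^sub>R grad (\<lambda>x. \<phi> x * k n x) x) = - (LINT x:U|lebesgue. (\<phi> x * k n x) *\<^sub>R G x)"
      using G(2) tf[of n] unfolding is_weak_grad_def by (rule bspec)
    moreover have "(LINT x:U|lebesgue. z x *\<^sub>R grad (\<lambda>x. \<phi> x * k n x) x) =
      (LINT x:U|lebesgue. k n x *\<^sub>R (z x *\<^sub>R grad \<phi> x)) - J n *\<^sub>R \<nu>"
      unfolding g using set_integral_diff(2)[OF a2 a3] a4 by simp
    moreover have "(LINT x:U|lebesgue. (\<phi> x * k n x) *\<^sub>R G x) = (LINT x:U|lebesgue. k n x *\<^sub>R (\<phi> x *\<^sub>R G x))"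
      by (simp add: mult.commute)
    moreover have "d = p + q" if "a = - b" "a = p - d" "b = q" for a b d p q :: "real^2"
      using that by (metis add.commute diff_add_cancel diff_minus_eq_add)
    ultimately show ?thesis by blast
  qed
  have "(\<lambda>n. J n *\<^sub>R \<nu>) \<longlonglongrightarrow> (LINT x:U|lebesgue. z x *\<^sub>R grad \<phi> x) + (LINT x:U|lebesgue. \<phi> x *\<^sub>R G x)"
    unfolding eqn by (intro tendsto_add conv(2) i1 i2)
  moreover have "(\<lambda>n. J n *\<^sub>R \<nu>) \<longlonglongrightarrow> (\<integral>t. F (c + t *\<^sub>R \<tau>) \<partial>lborel) *\<^sub>R \<nu>"
    unfolding J_def by (intro tendsto_scaleR lim tendsto_const)
  ultimately have main: "(\<integral>t. F (c + t *\<^sub>R \<tau>) \<partial>lborel) *\<^sub>R \<nu> = (LINT x:U|lebesgue. z x *\<^sub>R grad \<phi> x) + (LINT x:U|lebesgue. \<phi> x *\<^sub>R G x)"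
    using LIMSEQ_unique by blast
  \<comment> \<open>The integrand on the edge as a Borel function on the plane: inside the disc the
    edge coincides with the line, and outside it \<phi> vanishes.\<close>
  define E where "E x = indicator (cball c \<rho> \<inter> {x. \<nu> \<bullet> (x - c) = 0}) x *\<^sub>R F x" for x
  have Em: "E \<in> borel_measurable borel" unfolding E_def
    by (intro borel_measurable_scaleR borel_measurable_indicator Fm)
      (auto intro!: borel_closed closed_Int closed_Collect_eq continuous_intros)
  have Eeq: "E x = indicator e x *\<^sub>R (z x * \<phi> x)" for x
    using e[of x] \<phi>(2)[of x] by (cases "dist c x \<le> \<rho>") (auto simp: E_def F_def indicator_def)
  have Er: "E x = 0" if "x \<notin> range (\<lambda>t. c + t *\<^sub>R \<tau>)" for x
  proof (rule ccontr)
    assume "E x \<noteq> 0"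
    then have "\<nu> \<bullet> (x - c) = 0" by (auto simp: E_def indicator_def split: if_splits)
    then have "x = c + (\<tau> \<bullet> (x - c)) *\<^sub>R \<tau>" using lborel_orthonormal_frame(2)[OF o, of x c] by simp
    then show False using that by blast
  qed
  have El: "E (c + t *\<^sub>R \<tau>) = F (c + t *\<^sub>R \<tau>)" for t
    using Fz[of "c + t *\<^sub>R \<tau>"] o by (auto simp: E_def indicator_def not_le)
  have "(\<integral>x. E x \<partial>arclength) = (\<integral>t. F (c + t *\<^sub>R \<tau>) \<partial>lborel)"
    using integral_arclength_line(1)[OF o(2) Em Er] by (simp add: El)
  then show "(LINT x:e|arclength. z x * \<phi> x) *\<^sub>R \<nu> = (LINT x:U|lebesgue. z x *\<^sub>R grad \<phi> x) + (LINT x:U|lebesgue. \<phi> x *\<^sub>R G x)"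
    using main unfolding set_lebesgue_integral_def Eeq by simp
  have "integrable lborel (\<lambda>t. F (c + t *\<^sub>R \<tau>))"
  proof (rule continuous_compact_support_integrable)
    show "continuous_on UNIV (\<lambda>t. F (c + t *\<^sub>R \<tau>))"
      using o by (intro continuous_on_compose2[OF Fc] continuous_intros) auto
    show "compact {-\<rho>..\<rho>}" by simp
    show "F (c + t *\<^sub>R \<tau>) = 0" if "t \<notin> {-\<rho>..\<rho>}" for t
      using that o by (intro Fz) (auto simp: dist_norm)
  qed
  then show "set_integrable arclength e (\<lambda>x. z x * \<phi> x)"
    using integral_arclength_line(2)[OF o(2) Em Er] unfolding set_integrable_def Eeq[symmetric] by (simp add: El)
qed


section \<open>Uniqueness of the trace on straight edges\<close>

lemma H1_norm_ge:
  assumes U: "open U" and z: "z \<in> H1 U"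
  shows "L2_norm lebesgue U z \<le> H1_norm U z" "L2_norm lebesgue U (weak_grad U z) \<le> H1_norm U z"
proof -
  have U': "U \<inter> space lebesgue \<in> sets lebesgue" using U by auto
  have i: "set_integrable lebesgue U (\<lambda>x. (norm (weak_grad U z x))\<^sup>2)" "set_integrable lebesgue U (\<lambda>x. (z x)\<^sup>2)"
    using weak_grad_H1(1)[OF z] z by (auto simp: L2_space_iff[OF U'] H1_def)
  have "(LINT x:U|lebesgue. (norm (weak_grad U z x))\<^sup>2 + (z x)\<^sup>2) =
     (LINT x:U|lebesgue. (norm (weak_grad U z x))\<^sup>2) + (LINT x:U|lebesgue. (z x)\<^sup>2)"
    using i by (rule set_integral_add)
  moreover have "0 \<le> (LINT x:U|lebesgue. (norm (weak_grad U z x))\<^sup>2)" "0 \<le> (LINT x:U|lebesgue. (z x)\<^sup>2)"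
    by (simp_all add: set_lebesgue_integral_def)
  ultimately show "L2_norm lebesgue U z \<le> H1_norm U z" "L2_norm lebesgue U (weak_grad U z) \<le> H1_norm U z"
    by (auto simp: L2_norm_def H1_norm_def)
qed

lemma H1_diff:
  assumes U: "open U" and v: "v \<in> H1 U" and w: "w \<in> H1 U"
  shows "(\<lambda>x. v x - w x) \<in> H1 U" "is_weak_grad U (\<lambda>x. v x - w x) (\<lambda>x. weak_grad U v x - weak_grad U w x)"
    "(\<lambda>x. weak_grad U v x - weak_grad U w x) \<in> L2_space lebesgue U"
proof -
  have Us: "U \<in> sets lebesgue" using U by auto
  then have U': "U \<inter> space lebesgue \<in> sets lebesgue" by auto
  have vL: "v \<in> L2_space lebesgue U" and wL: "w \<in> L2_space lebesgue U" using v w by (auto simp: H1_def)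
  note gv = weak_grad_H1[OF v] and gw = weak_grad_H1[OF w]
  have mw: "(\<lambda>x. - 1 * w x) \<in> L2_space lebesgue U" using L2_space_scaleR[OF U' wL, of "-1"] by simp
  have g: "is_weak_grad U (\<lambda>x. v x + - 1 * w x) (\<lambda>x. weak_grad U v x + - 1 *\<^sub>R weak_grad U w x)"
    by (rule is_weak_grad_add[OF Us vL gv mw L2_space_scaleR[OF U' gw(1)] is_weak_grad_scaleR[OF gw(2)]])
  then show g': "is_weak_grad U (\<lambda>x. v x - w x) (\<lambda>x. weak_grad U v x - weak_grad U w x)" by simp
  show L: "(\<lambda>x. weak_grad U v x - weak_grad U w x) \<in> L2_space lebesgue U"
    by (rule L2_space_diff[OF U' gv(1) gw(1)])
  show "(\<lambda>x. v x - w x) \<in> H1 U"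
    unfolding H1_def using L2_space_diff[OF U' vL wL] g' L by blast
qed


lemma L2_space_norm:
  assumes S: "S \<inter> space M \<in> sets M" and f: "f \<in> L2_space M S"
  shows "(\<lambda>x. norm (f x)) \<in> L2_space M S"
proof -
  have m: "(\<lambda>x. indicator S x *\<^sub>R f x) \<in> borel_measurable M"
    using f by (simp add: L2_space_iff[OF S] set_borel_measurable_def)
  have "(\<lambda>x. norm (indicator S x *\<^sub>R f x)) = (\<lambda>x. indicator S x *\<^sub>R norm (f x))"
    by (auto simp: indicator_def)
  then show ?thesis
    using f measurable_compose[OF m borel_measurable_norm] by (simp add: L2_space_iff[OF S] set_borel_measurable_def)
qed

lemma set_integral_scaleR_le:
  fixes f :: "'a \<Rightarrow> real" and g :: "'a \<Rightarrow> 'b::euclidean_space"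
  assumes S: "S \<inter> space M \<in> sets M" and f: "f \<in> L2_space M S" and g: "g \<in> L2_space M S"
  shows "set_integrable M S (\<lambda>x. f x *\<^sub>R g x)"
    "norm (LINT x:S|M. f x *\<^sub>R g x) \<le> L2_norm M S f * L2_norm M S g"
proof -
  have m: "(\<lambda>x. indicator S x *\<^sub>R f x) \<in> borel_measurable M" "(\<lambda>x. indicator S x *\<^sub>R g x) \<in> borel_measurable M"
    using f g by (simp_all add: L2_space_iff[OF S] set_borel_measurable_def)
  note cs = set_cauchy_schwarz[OF S L2_space_norm[OF S f] L2_space_norm[OF S g]]
  have m2: "(\<lambda>x. (indicator S x *\<^sub>R f x) *\<^sub>R (indicator S x *\<^sub>R g x)) \<in> borel_measurable M"
    using m by (rule borel_measurable_scaleR)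
  have e: "(\<lambda>x. (indicator S x *\<^sub>R f x) *\<^sub>R (indicator S x *\<^sub>R g x)) = (\<lambda>x. indicator S x *\<^sub>R (f x *\<^sub>R g x))"
    by (auto simp: indicator_def)
  have "integrable M (\<lambda>x. indicator S x *\<^sub>R (f x *\<^sub>R g x))"
  proof (rule Bochner_Integration.integrable_bound)
    show "integrable M (\<lambda>x. indicator S x *\<^sub>R (norm (f x) \<bullet> norm (g x)))"
      using cs(1) by (simp add: set_integrable_def)
    show "(\<lambda>x. indicator S x *\<^sub>R (f x *\<^sub>R g x)) \<in> borel_measurable M" using m2 unfolding e .
  qed (auto simp: indicator_def)
  then show i: "set_integrable M S (\<lambda>x. f x *\<^sub>R g x)" by (simp add: set_integrable_def)
  have "norm (LINT x:S|M. f x *\<^sub>R g x) \<le> (LINT x:S|M. norm (f x *\<^sub>R g x))"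
    by (rule set_integral_norm_bound[OF i])
  also have "\<dots> = (LINT x:S|M. norm (f x) \<bullet> norm (g x))" by simp
  also have "\<dots> \<le> L2_norm M S (\<lambda>x. norm (f x)) * L2_norm M S (\<lambda>x. norm (g x))"
    using cs(3) by (rule order_trans[OF abs_ge_self])
  finally show "norm (LINT x:S|M. f x *\<^sub>R g x) \<le> L2_norm M S f * L2_norm M S g" by (simp add: L2_norm_def)
qed

lemma L2_space_compact_support:
  fixes q :: "real^2 \<Rightarrow> 'b::euclidean_space"
  assumes U: "U \<in> sets lebesgue" and q: "continuous_on UNIV q" and S: "compact S" "\<And>x. x \<notin> S \<Longrightarrow> q x = 0"
  shows "q \<in> L2_space lebesgue U"
proof -
  have U': "U \<inter> space lebesgue \<in> sets lebesgue" using U by auto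
  have qm: "q \<in> borel_measurable lebesgue" using q by (intro measurable_completion) (simp add: borel_measurable_continuous_onI)
  have "integrable lborel (\<lambda>x. (norm (q x))\<^sup>2)"
    using q S by (intro continuous_compact_support_integrable[of _ S] continuous_intros) auto
  then have "integrable lebesgue (\<lambda>x. (norm (q x))\<^sup>2)" by (simp add: integrable_completion)
  then show ?thesis using integrable_mult_indicator[OF U] borel_measurable_scaleR[OF borel_measurable_indicator[OF U] qm]
    unfolding L2_space_iff[OF U'] set_borel_measurable_def set_integrable_def by blast
qed

lemma L2_space_continuous_arclength:
  fixes q :: "real^2 \<Rightarrow> real"
  assumes S: "compact S" "emeasure arclength S < \<infinity>" and q: "continuous_on S q"
  shows "q \<in> L2_space arclength S"
proof -
  have Ss: "S \<in> sets arclength" using S(1) by (intro closed_sets_arclength compact_imp_closed)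
  have "bounded (q ` S)" using compact_continuous_image[OF q S(1)] compact_imp_bounded by blast
  then obtain B where B: "\<And>x. x \<in> S \<Longrightarrow> norm (q x) \<le> B" by (auto simp: bounded_iff)
  show ?thesis
  proof (rule L2_space_bounded[OF Ss S(2)])
    show "set_borel_measurable arclength S q"
      unfolding set_borel_measurable_def
      by (intro measurable_arclength borel_measurable_continuous_on_indicator q borel_closed compact_imp_closed S(1))
    show "AE x in arclength. x \<in> S \<longrightarrow> norm (q x) \<le> B" using B by auto
  qed
qed

text \<open>Any trace w is the limit of continuous functions \<open>s n\<close> on the frontier. For
  z = s n - v, Green's formula bounds the integral of z \<phi> over e by the H1 norm of z, which
  tends to 0, while the same integral tends to that of (w - v) \<phi>. Here V is the domain whose
  trace is considered, and U is a part of it on one side of the line, later the interior of an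
  element.\<close>

lemma trace_unique_near:
  fixes V U e :: "(real^2) set"
  assumes o: "norm \<nu> = 1" "norm \<tau> = 1" "\<nu> \<bullet> \<tau> = 0" and V: "open V" "bounded V" and U: "open U" "U \<subseteq> V" and r: "\<rho> > 0"
    and side: "\<And>x. x \<in> U \<Longrightarrow> \<nu> \<bullet> (x - c) < 0"
    and half: "\<And>x. dist c x \<le> \<rho> \<Longrightarrow> \<nu> \<bullet> (x - c) < 0 \<Longrightarrow> x \<in> U"
    and e: "\<And>x. dist c x \<le> \<rho> \<Longrightarrow> x \<in> e \<longleftrightarrow> \<nu> \<bullet> (x - c) = 0"
    and eV: "e \<subseteq> frontier V" "closed e" and Vfin: "emeasure arclength (frontier V) < \<infinity>"
    and v: "v \<in> H1 V" "continuous_on (closure V) v" and w: "is_trace V v w"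
  shows "AE x in arclength. x \<in> e \<longrightarrow> dist c x < \<rho> \<longrightarrow> w x = v x"
proof -
  obtain s where s: "\<And>n. s n \<in> H1 V" "\<And>n. continuous_on (closure V) (s n)"
    "(\<lambda>n. H1_norm V (\<lambda>x. s n x - v x)) \<longlonglongrightarrow> 0"
    "(\<lambda>n. L2_norm arclength (frontier V) (\<lambda>x. s n x - w x)) \<longlonglongrightarrow> 0"
    and wL: "w \<in> L2_space arclength (frontier V)"
    using w unfolding is_trace_def by blast
  have es: "e \<in> sets arclength" and Vs: "frontier V \<in> sets arclength"
    using eV by (auto intro: closed_sets_arclength)
  have es': "e \<inter> space arclength \<in> sets arclength" and Vs': "frontier V \<inter> space arclength \<in> sets arclength"
    using es Vs by simp_all
  have Us: "U \<in> sets lebesgue" "V \<in> sets lebesgue" using U V by auto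
  then have Us': "U \<inter> space lebesgue \<in> sets lebesgue" by auto
  have fcl: "frontier V \<subseteq> closure V" by (auto simp: frontier_def)
  have fcomp: "compact (frontier V)" using V(2) by (rule compact_frontier_bounded)
  have ecl: "e \<subseteq> closure V" using eV(1) fcl by blast
  have ecomp: "compact e" using fcomp eV by (metis compact_Int_closed inf.absorb_iff2)
  have "emeasure arclength e \<le> emeasure arclength (frontier V)" using eV(1) Vs by (rule emeasure_mono)
  then have efin: "emeasure arclength e < \<infinity>" using Vfin by (rule le_less_trans)
  have wLe: "w \<in> L2_space arclength e" by (rule L2_space_mono[OF es Vs eV(1) wL])
  have vLe: "v \<in> L2_space arclength e"
    by (rule L2_space_continuous_arclength[OF ecomp efin continuous_on_subset[OF v(2) ecl]])
  have dLe: "(\<lambda>x. w x - v x) \<in> L2_space arclength e"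
    by (rule L2_space_diff[OF es' wLe vLe])
  have main: "(LINT x:e|arclength. (w x - v x) * \<phi> x) = 0" "set_integrable arclength e (\<lambda>x. (w x - v x) * \<phi> x)"
    if \<phi>: "\<And>k. Ck k \<phi>" "\<And>x. \<rho> \<le> dist c x \<Longrightarrow> \<phi> x = 0" for \<phi>
  proof -
    have \<phi>c: "continuous_on UNIV \<phi>" using \<phi>(1)[of 0] by simp
    have \<phi>e: "\<phi> \<in> L2_space arclength e"
      by (rule L2_space_continuous_arclength[OF ecomp efin continuous_on_subset[OF \<phi>c]]) simp
    have dint: "set_integrable arclength e (\<lambda>x. (w x - v x) * \<phi> x)"
      using set_cauchy_schwarz(1)[OF es' dLe \<phi>e] by simp
    then show "set_integrable arclength e (\<lambda>x. (w x - v x) * \<phi> x)" .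
    have tf: "\<phi> \<in> test_functions UNIV"
      by (rule test_functions_I[OF \<phi>(1), of "cball c \<rho>"]) (use \<phi>(2) in auto)
    then obtain S where S: "compact S" "\<And>x. x \<notin> S \<Longrightarrow> \<phi> x = 0" "\<And>x. x \<notin> S \<Longrightarrow> grad \<phi> x = 0" "continuous_on UNIV (grad \<phi>)"
      by (rule test_functionD) blast
    define M where "M = L2_norm lebesgue U (grad \<phi>) + L2_norm lebesgue U \<phi>"
    define z where "z n x = s n x - v x" for n x
    have zH: "z n \<in> H1 V" for n unfolding z_def by (rule H1_diff(1)[OF V(1) s(1) v(1)])
    have zLV: "z n \<in> L2_space lebesgue V" for n using zH[of n] by (simp add: H1_def)
    have zL: "z n \<in> L2_space lebesgue U" for n by (rule L2_space_mono[OF Us U(2) zLV])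
    have GL: "weak_grad V (z n) \<in> L2_space lebesgue U" for n
      by (rule L2_space_mono[OF Us U(2) weak_grad_H1(1)[OF zH]])
    have Gw: "is_weak_grad U (z n) (weak_grad V (z n))" for n
      by (rule is_weak_grad_subset[OF weak_grad_H1(2)[OF zH] U(2)])
    have ballcl: "cball c \<rho> \<inter> {x. \<nu> \<bullet> (x - c) \<le> 0} \<subseteq> closure V"
    proof
      fix x assume x: "x \<in> cball c \<rho> \<inter> {x. \<nu> \<bullet> (x - c) \<le> 0}"
      show "x \<in> closure V"
      proof (cases "\<nu> \<bullet> (x - c) < 0")
        case True then show ?thesis using half[of x] x U(2) closure_subset[of V] by auto
      next
        case False then have "x \<in> e" using e[of x] x by auto
        then show ?thesis using ecl by blast
      qed
    qed
    have zc: "continuous_on (cball c \<rho> \<inter> {x. \<nu> \<bullet> (x - c) \<le> 0}) (z n)" for n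
      unfolding z_def by (intro continuous_on_diff continuous_on_subset[OF s(2) ballcl] continuous_on_subset[OF v(2) ballcl])
    note gr = green_edge[OF o U(1) side half e zc zL GL Gw \<phi>]
    have bnd: "\<bar>LINT x:e|arclength. z n x * \<phi> x\<bar> \<le> H1_norm V (z n) * M" for n
    proof -
      define I where "I = (LINT x:e|arclength. z n x * \<phi> x)"
      have "I = (I *\<^sub>R \<nu>) \<bullet> \<nu>" using o by (simp add: norm_eq_1)
      also have "\<dots> = (LINT x:U|lebesgue. z n x *\<^sub>R grad \<phi> x) \<bullet> \<nu> + (LINT x:U|lebesgue. \<phi> x *\<^sub>R weak_grad V (z n) x) \<bullet> \<nu>"
        using gr(1)[of n] by (simp add: I_def inner_add_left)
      finally have "\<bar>I\<bar> \<le> norm (LINT x:U|lebesgue. z n x *\<^sub>R grad \<phi> x) + norm (LINT x:U|lebesgue. \<phi> x *\<^sub>R weak_grad V (z n) x)"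
        using Cauchy_Schwarz_ineq2[of "LINT x:U|lebesgue. z n x *\<^sub>R grad \<phi> x" \<nu>]
          Cauchy_Schwarz_ineq2[of "LINT x:U|lebesgue. \<phi> x *\<^sub>R weak_grad V (z n) x" \<nu>] o by simp
      also have "\<dots> \<le> L2_norm lebesgue U (z n) * L2_norm lebesgue U (grad \<phi>) + L2_norm lebesgue U \<phi> * L2_norm lebesgue U (weak_grad V (z n))"
        by (intro add_mono set_integral_scaleR_le(2)[OF Us'] zL GL
            L2_space_compact_support[OF Us(1) S(4) S(1,3)] L2_space_compact_support[OF Us(1) \<phi>c S(1,2)])
      also have "\<dots> \<le> H1_norm V (z n) * L2_norm lebesgue U (grad \<phi>) + L2_norm lebesgue U \<phi> * H1_norm V (z n)"
        by (intro add_mono mult_left_mono mult_right_mono L2_norm_nonneg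
          order_trans[OF L2_norm_mono[OF Us U(2) zLV] H1_norm_ge(1)[OF V(1) zH]]
          order_trans[OF L2_norm_mono[OF Us U(2) weak_grad_H1(1)[OF zH]] H1_norm_ge(2)[OF V(1) zH]])
      finally show ?thesis by (simp add: I_def M_def algebra_simps)
    qed
    have sLV: "s n \<in> L2_space arclength (frontier V)" for n
      by (rule L2_space_continuous_arclength[OF fcomp Vfin continuous_on_subset[OF s(2) fcl]])
    have swLV: "(\<lambda>x. s n x - w x) \<in> L2_space arclength (frontier V)" for n
      by (rule L2_space_diff[OF Vs' sLV wL])
    have swL: "(\<lambda>x. s n x - w x) \<in> L2_space arclength e" for n
      by (rule L2_space_mono[OF es Vs eV(1) swLV])
    have diffb: "\<bar>(LINT x:e|arclength. z n x * \<phi> x) - (LINT x:e|arclength. (w x - v x) * \<phi> x)\<bar>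
      \<le> L2_norm arclength (frontier V) (\<lambda>x. s n x - w x) * L2_norm arclength e \<phi>" for n
    proof -
      have "(LINT x:e|arclength. z n x * \<phi> x) - (LINT x:e|arclength. (w x - v x) * \<phi> x)
         = (LINT x:e|arclength. z n x * \<phi> x - (w x - v x) * \<phi> x)"
        by (rule set_integral_diff(2)[OF gr(2) dint, symmetric])
      also have "\<dots> = (LINT x:e|arclength. (s n x - w x) *\<^sub>R \<phi> x)" by (simp add: z_def algebra_simps)
      finally have "\<bar>(LINT x:e|arclength. z n x * \<phi> x) - (LINT x:e|arclength. (w x - v x) * \<phi> x)\<bar>
         \<le> L2_norm arclength e (\<lambda>x. s n x - w x) * L2_norm arclength e \<phi>"
        using set_integral_scaleR_le(2)[OF es' swL \<phi>e] by simp
      also have "\<dots> \<le> L2_norm arclength (frontier V) (\<lambda>x. s n x - w x) * L2_norm arclength e \<phi>"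
        by (intro mult_right_mono L2_norm_mono[OF es Vs eV(1) swLV] L2_norm_nonneg)
      finally show ?thesis .
    qed
    have "\<bar>LINT x:e|arclength. (w x - v x) * \<phi> x\<bar> \<le> H1_norm V (z n) * M + L2_norm arclength (frontier V) (\<lambda>x. s n x - w x) * L2_norm arclength e \<phi>" for n
      using bnd[of n] diffb[of n] by linarith
    moreover have "(\<lambda>n. H1_norm V (z n) * M + L2_norm arclength (frontier V) (\<lambda>x. s n x - w x) * L2_norm arclength e \<phi>) \<longlonglongrightarrow> 0 * M + 0 * L2_norm arclength e \<phi>"
      using s(3) unfolding z_def[symmetric] by (intro tendsto_add tendsto_mult tendsto_const s(4))
    ultimately have "\<bar>LINT x:e|arclength. (w x - v x) * \<phi> x\<bar> \<le> 0 * M + 0 * L2_norm arclength e \<phi>"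
      by (intro LIMSEQ_le_const[where X = "\<lambda>n. H1_norm V (z n) * M + L2_norm arclength (frontier V) (\<lambda>x. s n x - w x) * L2_norm arclength e \<phi>"]) auto
    then show "(LINT x:e|arclength. (w x - v x) * \<phi> x) = 0" by simp
  qed
  \<comment> \<open>The products of \<open>box_cutoff\<close> with the bump are admissible \<phi>.
    In the limit the integrals of (w - v) times the bump over all boxes vanish, and the bump is
    positive in the open disc.\<close>
  have "AE x in arclength. x \<in> e \<longrightarrow> (w x - v x) * bump c \<rho> x = 0"
  proof (rule AE_arclength_zero[OF es efin main(2)])
    show "Ck k (bump c \<rho>)" for k by (rule Ck_bump)
    show "bump c \<rho> x = 0" if "\<rho> \<le> dist c x" for x by (rule bump_eq_0[OF r that])
    fix a b :: "real^2"
    have "(\<lambda>n. LINT x:e|arclength. (w x - v x) * (box_cutoff a b n x * bump c \<rho> x)) \<longlonglongrightarrow>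
        (LINT x:e|arclength. indicator (box a b) x * ((w x - v x) * bump c \<rho> x))"
      unfolding set_lebesgue_integral_def
    proof (rule integral_dominated_convergence)
      have int: "integrable arclength (\<lambda>x. indicator e x *\<^sub>R ((w x - v x) * (q x)))"
        if "\<And>k. Ck k q" "\<And>x. \<rho> \<le> dist c x \<Longrightarrow> q x = 0" for q
        using main(2)[OF that] by (simp add: set_integrable_def)
      have i: "integrable arclength (\<lambda>x. indicator e x *\<^sub>R ((w x - v x) * bump c \<rho> x))"
        by (rule int[OF Ck_bump bump_eq_0[OF r]])
      show "integrable arclength (\<lambda>x. norm (indicator e x *\<^sub>R ((w x - v x) * bump c \<rho> x)))"
        using i by (rule integrable_norm)
      show "(\<lambda>x. indicator e x *\<^sub>R ((w x - v x) * (box_cutoff a b n x * bump c \<rho> x))) \<in> borel_measurable arclength" for n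
        by (rule borel_measurable_integrable[OF int]) (auto intro: Ck_mult Ck_box_cutoff Ck_bump simp: bump_eq_0[OF r] simp del: Ck.simps)
      have "(\<lambda>x. indicator (box a b) x *\<^sub>R (indicator e x *\<^sub>R ((w x - v x) * bump c \<rho> x))) \<in> borel_measurable arclength"
        by (rule borel_measurable_scaleR[OF borel_measurable_indicator[OF borel_arclength[OF borel_open[OF open_box]]] borel_measurable_integrable[OF i]])
      then show "(\<lambda>x. indicator e x *\<^sub>R (indicator (box a b) x * ((w x - v x) * bump c \<rho> x))) \<in> borel_measurable arclength"
        by (simp add: mult.left_commute)
      show "AE x in arclength. (\<lambda>n. indicator e x *\<^sub>R ((w x - v x) * (box_cutoff a b n x * bump c \<rho> x)))
           \<longlonglongrightarrow> indicator e x *\<^sub>R (indicator (box a b) x * ((w x - v x) * bump c \<rho> x))"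
      proof (rule AE_I2)
        fix x
        have "(\<lambda>n. indicator e x *\<^sub>R ((w x - v x) * (box_cutoff a b n x * bump c \<rho> x)))
           \<longlonglongrightarrow> indicator e x *\<^sub>R ((w x - v x) * (indicator (box a b) x * bump c \<rho> x))"
          by (intro tendsto_scaleR tendsto_mult tendsto_const box_cutoff_tendsto)
        then show "(\<lambda>n. indicator e x *\<^sub>R ((w x - v x) * (box_cutoff a b n x * bump c \<rho> x)))
           \<longlonglongrightarrow> indicator e x *\<^sub>R (indicator (box a b) x * ((w x - v x) * bump c \<rho> x))"
          by (simp add: mult.left_commute)
      qed
      show "AE x in arclength. norm (indicator e x *\<^sub>R ((w x - v x) * (box_cutoff a b n x * bump c \<rho> x)))
         \<le> norm (indicator e x *\<^sub>R ((w x - v x) * bump c \<rho> x))" for n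
      proof (rule AE_I2)
        fix x
        have "\<bar>box_cutoff a b n x\<bar> * \<bar>bump c \<rho> x\<bar> \<le> \<bar>bump c \<rho> x\<bar>"
          using box_cutoff_bounds[of a b n x] by (intro mult_left_le_one_le) auto
        then show "norm (indicator e x *\<^sub>R ((w x - v x) * (box_cutoff a b n x * bump c \<rho> x)))
         \<le> norm (indicator e x *\<^sub>R ((w x - v x) * bump c \<rho> x))"
          by (simp add: abs_mult mult_left_mono)
      qed
    qed
    moreover have "(LINT x:e|arclength. (w x - v x) * (box_cutoff a b n x * bump c \<rho> x)) = 0" for n
      by (rule main(1)) (auto intro: Ck_mult Ck_box_cutoff Ck_bump simp: bump_eq_0[OF r] simp del: Ck.simps)
    ultimately show "(LINT x:e|arclength. indicator (box a b) x * ((w x - v x) * bump c \<rho> x)) = 0"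
      using LIMSEQ_unique[of "\<lambda>_. 0::real"] by simp
  qed
  then show ?thesis
  proof eventually_elim
    case (elim x)
    show ?case
    proof (intro impI)
      assume x: "x \<in> e" "dist c x < \<rho>"
      have "(norm (x - c))\<^sup>2 < \<rho>\<^sup>2" using x(2) by (intro power_strict_mono) (auto simp: dist_norm norm_minus_commute)
      then have "0 < 1 - ((x - c) \<bullet> (x - c)) / \<rho>\<^sup>2"
        using r by (simp add: power2_norm_eq_inner field_simps)
      then have "bump c \<rho> x \<noteq> 0" by (simp add: bump_def hp_def)
      then show "w x = v x" using elim x by simp
    qed
  qed
qed

section \<open>Triangles\<close>

text \<open>Twice the signed area of the triangle spanned by u and v. For a point x, the values of
  \<open>cross\<close> along the three sides are its barycentric coordinates multiplied by
  \<open>cross (b - a) (p - a)\<close>.\<close>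

definition cross :: "real^2 \<Rightarrow> real^2 \<Rightarrow> real" where
  "cross u v = u $ 1 * v $ 2 - u $ 2 * v $ 1"

text \<open>The vertices are in counterclockwise order, so that the barycentric coordinates of inner
  points stay positive when multiplied by \<open>cross\<close>, and \<open>nrml a b\<close> points
  outwards. A rotation of the vertices preserves this, so it suffices to treat the side from a to
  b.\<close>

definition tri :: "real^2 \<Rightarrow> real^2 \<Rightarrow> real^2 \<Rightarrow> bool" where
  "tri a b p \<longleftrightarrow> 0 < cross (b - a) (p - a)"

lemma cross_lagrange: "(cross u v)\<^sup>2 + (u \<bullet> v)\<^sup>2 = (u \<bullet> u) * (v \<bullet> v)"
  by (simp add: cross_def inner_vec_def sum_2 power2_eq_square algebra_simps)

lemma abs_cross_le: "\<bar>cross u v\<bar> \<le> norm u * norm v"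
proof -
  have "(cross u v)\<^sup>2 \<le> (norm u * norm v)\<^sup>2"
    using cross_lagrange[of u v] zero_le_power2[of "u \<bullet> v"]
    unfolding power_mult_distrib power2_norm_eq_inner by linarith
  then show ?thesis using abs_le_square_iff[of "cross u v" "norm u * norm v"] by simp
qed

lemma cross_sum: "cross (b - a) (x - a) + cross (p - b) (x - b) + cross (a - p) (x - p) = cross (b - a) (p - a)"
  by (simp add: cross_def algebra_simps)

text \<open>Cramer's rule for the barycentric coordinates of x, kept free of division so that it is
  a polynomial identity.\<close>

lemma cross_rep:
  "cross (b - a) (p - a) *\<^sub>R x = cross (p - b) (x - b) *\<^sub>R a + cross (a - p) (x - p) *\<^sub>R b + cross (b - a) (x - a) *\<^sub>R p"
  by (simp add: vec_eq_iff forall_2 cross_def algebra_simps)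

lemma cross_combination:
  assumes "u + v + w = 1"
  shows "cross (b - a) ((u *\<^sub>R a + v *\<^sub>R b + w *\<^sub>R p) - a) = w * cross (b - a) (p - a)"
    "cross (p - b) ((u *\<^sub>R a + v *\<^sub>R b + w *\<^sub>R p) - b) = u * cross (b - a) (p - a)"
    "cross (a - p) ((u *\<^sub>R a + v *\<^sub>R b + w *\<^sub>R p) - p) = v * cross (b - a) (p - a)"
proof -
  have u: "u = 1 - v - w" using assms by simp
  show "cross (b - a) ((u *\<^sub>R a + v *\<^sub>R b + w *\<^sub>R p) - a) = w * cross (b - a) (p - a)"
    "cross (p - b) ((u *\<^sub>R a + v *\<^sub>R b + w *\<^sub>R p) - b) = u * cross (b - a) (p - a)"
    "cross (a - p) ((u *\<^sub>R a + v *\<^sub>R b + w *\<^sub>R p) - p) = v * cross (b - a) (p - a)"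
    unfolding u by (simp_all add: cross_def algebra_simps)
qed

lemma collinear_cross:
  assumes "cross (b - a) (p - a) = 0" shows "collinear {a, b, p}"
proof (cases "b = a")
  case False
  define d where "d = b - a"
  have d: "d $ 1 \<noteq> 0 \<or> d $ 2 \<noteq> 0" using False by (auto simp: d_def vec_eq_iff forall_2)
  have c: "d $ 1 * (p - a) $ 2 = d $ 2 * (p - a) $ 1" using assms by (simp add: cross_def d_def)
  have "\<exists>k. p - a = k *\<^sub>R d"
  proof (cases "d $ 1 = 0")
    case True
    then show ?thesis using d c by (intro exI[of _ "(p - a) $ 2 / d $ 2"]) (auto simp: vec_eq_iff forall_2)
  next
    case False
    then show ?thesis using d c by (intro exI[of _ "(p - a) $ 1 / d $ 1"]) (auto simp: vec_eq_iff forall_2 field_simps)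
  qed
  then obtain k where "p - a = k *\<^sub>R d" ..
  then have "p = (1 - k) *\<^sub>R a + (1 - (1 - k)) *\<^sub>R b" by (simp add: d_def algebra_simps)
  then have "collinear {a, p, b}" unfolding collinear_3_expand by blast
  then show ?thesis by (simp add: insert_commute)
qed simp

lemma tri_hull:
  assumes t: "tri a b p"
  shows "x \<in> convex hull {a, b, p} \<longleftrightarrow>
    0 \<le> cross (b - a) (x - a) \<and> 0 \<le> cross (p - b) (x - b) \<and> 0 \<le> cross (a - p) (x - p)"
proof
  define D where "D = cross (b - a) (p - a)"
  have D: "D > 0" using t by (simp add: tri_def D_def)
  assume "x \<in> convex hull {a, b, p}"
  then obtain u v w where x: "x = u *\<^sub>R a + v *\<^sub>R b + w *\<^sub>R p" "0 \<le> u" "0 \<le> v" "0 \<le> w" "u + v + w = 1"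
    by (auto simp: convex_hull_3)
  show "0 \<le> cross (b - a) (x - a) \<and> 0 \<le> cross (p - b) (x - b) \<and> 0 \<le> cross (a - p) (x - p)"
    unfolding x(1) cross_combination[OF x(5)] using x D by (simp add: D_def[symmetric])
next
  define D where "D = cross (b - a) (p - a)"
  have D: "D > 0" using t by (simp add: tri_def D_def)
  assume a: "0 \<le> cross (b - a) (x - a) \<and> 0 \<le> cross (p - b) (x - b) \<and> 0 \<le> cross (a - p) (x - p)"
  have "x = (1 / D) *\<^sub>R (D *\<^sub>R x)" using D by simp
  also have "\<dots> = (cross (p - b) (x - b) / D) *\<^sub>R a + (cross (a - p) (x - p) / D) *\<^sub>R b + (cross (b - a) (x - a) / D) *\<^sub>R p"
    unfolding D_def cross_rep[of b a p x] by (simp add: scaleR_add_right)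
  finally have "x = (cross (p - b) (x - b) / D) *\<^sub>R a + (cross (a - p) (x - p) / D) *\<^sub>R b + (cross (b - a) (x - a) / D) *\<^sub>R p" .
  moreover have "cross (p - b) (x - b) / D + cross (a - p) (x - p) / D + cross (b - a) (x - a) / D = 1"
    using cross_sum[of b a x p] D by (simp add: D_def[symmetric] add_divide_distrib[symmetric] algebra_simps)
  ultimately show "x \<in> convex hull {a, b, p}"
    using a D unfolding convex_hull_3 by (intro CollectI exI conjI) auto
qed

lemma tri_distinct: "tri a b p \<Longrightarrow> a \<noteq> b \<and> b \<noteq> p \<and> p \<noteq> a"
  by (auto simp: tri_def cross_def algebra_simps)

lemma tri_rotate: "tri a b p \<Longrightarrow> tri b p a"
  by (simp add: tri_def cross_def algebra_simps)

lemma tri_interior: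
  assumes t: "tri a b p"
  shows "x \<in> interior (convex hull {a, b, p}) \<longleftrightarrow>
    0 < cross (b - a) (x - a) \<and> 0 < cross (p - b) (x - b) \<and> 0 < cross (a - p) (x - p)"
proof
  assume x: "x \<in> interior (convex hull {a, b, p})"
  have pos: "0 < cross (s - q) (x - q)" if nonneg: "\<And>y. y \<in> convex hull {a, b, p} \<Longrightarrow> 0 \<le> cross (s - q) (y - q)" and sq: "s \<noteq> q" for s q
  proof (rule ccontr)
    assume "\<not> 0 < cross (s - q) (x - q)"
    moreover have "0 \<le> cross (s - q) (x - q)" using nonneg x interior_subset by blast
    ultimately have z: "cross (s - q) (x - q) = 0" by simp
    obtain e where e: "e > 0" "ball x e \<subseteq> convex hull {a, b, p}" using x by (meson mem_interior)
    \<comment> \<open>The vector s - q turned clockwise. A small step in this direction lowers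
      \<open>cross (s - q)\<close> strictly below 0, out of the triangle.\<close>
    define n where "n = (vector [(s - q) $ 2, - (s - q) $ 1] :: real^2)"
    have n0: "n \<noteq> 0" using sq by (auto simp: n_def vec_eq_iff forall_2)
    define k where "k = e / 2 / norm n"
    define y where "y = x + k *\<^sub>R n"
    have "y \<in> ball x e" using e n0 by (simp add: y_def k_def dist_norm)
    then have "0 \<le> cross (s - q) (y - q)" using nonneg e by blast
    moreover have "cross (s - q) (y - q) = cross (s - q) (x - q) + k * cross (s - q) n"
      by (simp add: y_def cross_def algebra_simps)
    moreover have "cross (s - q) n = - ((s - q) \<bullet> (s - q))"
      by (simp add: n_def cross_def inner_vec_def sum_2 algebra_simps)
    moreover have "k * ((s - q) \<bullet> (s - q)) > 0" using e n0 sq by (simp add: k_def)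
    ultimately show False using z by simp
  qed
  show "0 < cross (b - a) (x - a) \<and> 0 < cross (p - b) (x - b) \<and> 0 < cross (a - p) (x - p)"
    using tri_hull[OF t] tri_distinct[OF t] by (intro conjI pos) auto
next
  assume x: "0 < cross (b - a) (x - a) \<and> 0 < cross (p - b) (x - b) \<and> 0 < cross (a - p) (x - p)"
  have "open {x. 0 < cross (b - a) (x - a) \<and> 0 < cross (p - b) (x - b) \<and> 0 < cross (a - p) (x - p)}"
    unfolding cross_def by (intro open_Collect_conj open_Collect_less continuous_intros)
  moreover have "{x. 0 < cross (b - a) (x - a) \<and> 0 < cross (p - b) (x - b) \<and> 0 < cross (a - p) (x - p)} \<subseteq> convex hull {a, b, p}"
    using tri_hull[OF t] by (auto intro: less_imp_le)
  ultimately show "x \<in> interior (convex hull {a, b, p})" using x by (intro interiorI[of _ _ "convex hull {a, b, p}"]) auto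
qed

definition tang :: "real^2 \<Rightarrow> real^2 \<Rightarrow> real^2" where
  "tang a b = (b - a) /\<^sub>R norm (b - a)"

text \<open>The unit tangent turned clockwise; it is the outward normal if the triangle lies to the
  left of the direction from a to b.\<close>

definition nrml :: "real^2 \<Rightarrow> real^2 \<Rightarrow> real^2" where
  "nrml a b = vector [tang a b $ 2, - tang a b $ 1]"

lemma nrml_tang:
  assumes "a \<noteq> b"
  shows "norm (tang a b) = 1" "norm (nrml a b) = 1" "nrml a b \<bullet> tang a b = 0"
proof -
  show t: "norm (tang a b) = 1" using assms by (simp add: tang_def)
  have "nrml a b \<bullet> nrml a b = tang a b \<bullet> tang a b" by (simp add: nrml_def inner_vec_def sum_2)
  then show "norm (nrml a b) = 1" using t by (simp add: norm_eq_1)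
  show "nrml a b \<bullet> tang a b = 0" by (simp add: nrml_def inner_vec_def sum_2)
qed

lemma nrml_inner: "nrml a b \<bullet> v = - cross (b - a) v / norm (b - a)"
  by (simp add: nrml_def tang_def cross_def inner_vec_def sum_2 divide_inverse algebra_simps)

lemma nrml_swap: "nrml b a = - nrml a b"
  by (simp add: nrml_def tang_def vec_eq_iff forall_2 norm_minus_commute algebra_simps)

lemma segment_point:
  assumes "c = (1 - t) *\<^sub>R a + t *\<^sub>R b"
  shows "cross (b - a) (c - a) = 0" "cross (p - b) (c - b) = (1 - t) * cross (b - a) (p - a)"
    "cross (a - p) (c - p) = t * cross (b - a) (p - a)"
  unfolding assms by (simp_all add: cross_def algebra_simps)

text \<open>At c the barycentric coordinates that belong to the other two sides are at least
  \<delta>, and within the distance \<rho> each \<open>cross\<close> changes by at most h \<rho>. A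
  disc of this size stays clear of these sides, and only the position relative to the line through a
  and b decides whether one of its points belongs to the triangle.\<close>

lemma tri_near_edge:
  assumes t: "tri a b p" and c: "c = (1 - s) *\<^sub>R a + s *\<^sub>R b" and s: "\<delta> \<le> s" "s \<le> 1 - \<delta>"
    and h: "norm (p - b) \<le> h" "norm (a - p) \<le> h" and r: "h * \<rho> < \<delta> * cross (b - a) (p - a)" and x: "dist c x \<le> \<rho>"
  shows "0 < cross (p - b) (x - b)" "0 < cross (a - p) (x - p)"
    "nrml a b \<bullet> (x - c) = - cross (b - a) (x - a) / norm (b - a)"
proof -
  define D where "D = cross (b - a) (p - a)"
  have D: "D > 0" using t by (simp add: D_def tri_def)
  have nx: "norm (x - c) \<le> \<rho>" using x by (simp add: dist_norm norm_minus_commute)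
  have h0: "0 \<le> h" using h norm_ge_zero order_trans by blast
  have e1: "cross (p - b) (x - b) = (1 - s) * D + cross (p - b) (x - c)"
    using segment_point(2)[OF c, of p] by (simp add: D_def cross_def algebra_simps)
  have "\<bar>cross (p - b) (x - c)\<bar> \<le> h * \<rho>"
    using abs_cross_le[of "p - b" "x - c"] mult_mono[OF h(1) nx] h0 by simp
  moreover have "\<delta> * D \<le> (1 - s) * D" using s D by (intro mult_right_mono) auto
  ultimately show "0 < cross (p - b) (x - b)" using r[folded D_def] e1 by linarith
  have e2: "cross (a - p) (x - p) = s * D + cross (a - p) (x - c)"
    using segment_point(3)[OF c, of p] by (simp add: D_def cross_def algebra_simps)
  have "\<bar>cross (a - p) (x - c)\<bar> \<le> h * \<rho>"
    using abs_cross_le[of "a - p" "x - c"] mult_mono[OF h(2) nx] h0 by simp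
  moreover have "\<delta> * D \<le> s * D" using s D by (intro mult_right_mono) auto
  ultimately show "0 < cross (a - p) (x - p)" using r[folded D_def] e2 by linarith
  have "cross (b - a) (x - c) = cross (b - a) (x - a)"
    using segment_point(1)[OF c] by (simp add: cross_def algebra_simps)
  then show "nrml a b \<bullet> (x - c) = - cross (b - a) (x - a) / norm (b - a)" by (simp add: nrml_inner)
qed

section \<open>Diameter, angles and area\<close>

lemma tri_diameter:
  assumes "norm (b - a) \<le> L" "norm (p - b) \<le> L" "norm (a - p) \<le> L"
  shows "diameter (convex hull {a, b, p}) \<le> L"
proof -
  have L: "0 \<le> L" using assms norm_ge_zero order_trans by blast
  \<comment> \<open>The discs of radius L about the vertices contain the triangle. Hence the discs
    about its points contain the vertices, and with them the triangle.\<close>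
  have v: "convex hull {a, b, p} \<subseteq> cball v L" if "v \<in> {a, b, p}" for v
    by (rule hull_minimal) (use that assms L in \<open>auto simp: dist_norm norm_minus_commute\<close>)
  have "convex hull {a, b, p} \<subseteq> cball x L" if "x \<in> convex hull {a, b, p}" for x
    by (rule hull_minimal) (use that v in \<open>auto simp: dist_commute subset_iff\<close>)
  then have "norm (x - y) \<le> L" if "x \<in> convex hull {a, b, p}" "y \<in> convex hull {a, b, p}" for x y
    using that by (fastforce simp: dist_norm)
  then show ?thesis using L by (intro diameter_le) auto
qed

lemma bounded_tri: "bounded (convex hull {a, b, p :: real^2})"
  by (simp add: bounded_convex_hull)

lemma tri_side_le_diameter:
  "norm (b - a) \<le> diameter (convex hull {a, b, p :: real^2})"
  "norm (p - b) \<le> diameter (convex hull {a, b, p :: real^2})" "norm (a - p) \<le> diameter (convex hull {a, b, p :: real^2})"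
proof -
  have "dist x y \<le> diameter (convex hull {a, b, p})" if "x \<in> {a, b, p}" "y \<in> {a, b, p}" for x y
    by (rule diameter_bounded_bound[OF bounded_tri]) (use that in \<open>auto intro: hull_inc\<close>)
  then show "norm (b - a) \<le> diameter (convex hull {a, b, p})" "norm (p - b) \<le> diameter (convex hull {a, b, p})"
     "norm (a - p) \<le> diameter (convex hull {a, b, p})"
    by (auto simp: dist_norm)
qed

text \<open>The modulus of \<open>cross\<close> is the product of the two lengths with the sine of
  the angle at q. A lower bound on the angle bounds the sine from below only up to the right angle;
  the assumption \<open>le\<close> excludes obtuse angles, because the side opposite to one is the
  longest.\<close>

lemma vertex_angle_cross:
  assumes le: "norm (s - r) \<le> norm (r - q)" and ne: "s \<noteq> q" "r \<noteq> q" and \<theta>: "0 < \<theta>" "\<theta> \<le> vertex_angle q r s"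
  shows "0 < sin \<theta>" "sin \<theta> * (norm (r - q) * norm (s - q)) \<le> \<bar>cross (r - q) (s - q)\<bar>"
proof -
  define N where "N = norm (r - q) * norm (s - q)"
  have N: "N > 0" using ne by (simp add: N_def)
  define k where "k = ((r - q) \<bullet> (s - q)) / N"
  have "(norm (s - r))\<^sup>2 \<le> (norm (r - q))\<^sup>2" using le by (intro power_mono) auto
  moreover have "(norm (s - r))\<^sup>2 = (norm (s - q))\<^sup>2 + (norm (r - q))\<^sup>2 - 2 * ((r - q) \<bullet> (s - q))"
    unfolding power2_norm_eq_inner by (simp add: algebra_simps inner_commute)
  ultimately have "0 \<le> (r - q) \<bullet> (s - q)" using zero_le_power2[of "norm (s - q)"] by linarith
  then have k0: "0 \<le> k" using N by (simp add: k_def)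
  have "\<bar>(r - q) \<bullet> (s - q)\<bar> \<le> N" unfolding N_def by (rule Cauchy_Schwarz_ineq2)
  then have k1: "k \<le> 1" using N by (simp add: k_def field_simps)
  have \<theta>2: "\<theta> \<le> arccos k" using \<theta> by (simp add: vertex_angle_def k_def N_def)
  have ap: "arccos k \<le> pi / 2" using k0 k1 arccos_le_pi2 by blast
  then have thpi: "\<theta> \<le> pi / 2" using \<theta>2 by linarith
  then show sp: "0 < sin \<theta>" using \<theta>(1) by (intro sin_gt_zero) (auto intro: le_less_trans)
  have "cos (arccos k) \<le> cos \<theta>" using \<theta> \<theta>2 ap by (subst cos_mono_le_eq) auto
  then have kc: "k \<le> cos \<theta>" using k0 k1 by simp
  have "k\<^sup>2 \<le> (cos \<theta>)\<^sup>2" using kc k0 by (rule power_mono)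
  then have s2: "(sin \<theta>)\<^sup>2 \<le> 1 - k\<^sup>2" using sin_cos_squared_add[of \<theta>] by linarith
  have "(cross (r - q) (s - q))\<^sup>2 = N\<^sup>2 - ((r - q) \<bullet> (s - q))\<^sup>2"
    using cross_lagrange[of "r - q" "s - q"] by (simp add: N_def power_mult_distrib power2_norm_eq_inner)
  also have "\<dots> = N\<^sup>2 * (1 - k\<^sup>2)" using N by (simp add: k_def field_simps)
  also have "\<dots> \<ge> N\<^sup>2 * (sin \<theta>)\<^sup>2" using s2 by (intro mult_left_mono) auto
  finally have "(sin \<theta> * N)\<^sup>2 \<le> (cross (r - q) (s - q))\<^sup>2" by (simp add: power_mult_distrib mult.commute)
  then show "sin \<theta> * (norm (r - q) * norm (s - q)) \<le> \<bar>cross (r - q) (s - q)\<bar>"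
    unfolding N_def[symmetric] using abs_le_square_iff[of "sin \<theta> * N" "cross (r - q) (s - q)"] sp N by simp
qed

text \<open>The side from a to b is the longest and bounds the diameter. One of the other sides has
  at least half its length by the triangle inequality, and the angle between this side and the
  longest one is not obtuse. This is the origin of the factor sin \<theta> / 2.\<close>

lemma tri_area_aux:
  assumes t: "tri a b p" and l: "norm (p - b) \<le> norm (b - a)" "norm (a - p) \<le> norm (b - a)"
    and \<theta>: "0 < \<theta>" "\<theta> \<le> vertex_angle a b p" "\<theta> \<le> vertex_angle b a p"
  shows "0 < sin \<theta>" "sin \<theta> / 2 * (diameter (convex hull {a, b, p}))\<^sup>2 \<le> cross (b - a) (p - a)"
proof -
  note d = tri_distinct[OF t]
  have D: "cross (b - a) (p - a) > 0" using t by (simp add: tri_def)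
  have c2: "\<bar>cross (a - b) (p - b)\<bar> = cross (b - a) (p - a)" using D by (simp add: cross_def algebra_simps)
  note A = vertex_angle_cross[of p b a, OF l(1) _ _ \<theta>(1,2)]
  have l2: "norm (p - a) \<le> norm (a - b)" using l(2) by (simp add: norm_minus_commute)
  note B = vertex_angle_cross[of p a b, OF l2 _ _ \<theta>(1,3)]
  show sp: "0 < sin \<theta>" using A(1) d by auto
  have dm: "diameter (convex hull {a, b, p}) \<le> norm (b - a)" using l by (intro tri_diameter) auto
  have d0: "0 \<le> diameter (convex hull {a, b, p})" by (rule diameter_ge_0[OF bounded_tri])
  have "(diameter (convex hull {a, b, p}))\<^sup>2 \<le> (norm (b - a))\<^sup>2" using dm d0 by (rule power_mono)
  then have "sin \<theta> / 2 * (diameter (convex hull {a, b, p}))\<^sup>2 \<le> sin \<theta> / 2 * (norm (b - a))\<^sup>2"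
    using sp by (intro mult_left_mono) auto
  also have "\<dots> = sin \<theta> * (norm (b - a) * (norm (b - a) / 2))" by (simp add: power2_eq_square)
  also have "\<dots> \<le> cross (b - a) (p - a)"
  proof (cases "norm (p - a) \<ge> norm (b - a) / 2")
    case True
    have "sin \<theta> * (norm (b - a) * (norm (b - a) / 2)) \<le> sin \<theta> * (norm (b - a) * norm (p - a))"
      using True sp by (intro mult_left_mono) auto
    also have "\<dots> \<le> cross (b - a) (p - a)" using A(2) d D by auto
    finally show ?thesis .
  next
    case False
    have "norm (b - a) \<le> norm (p - a) + norm (p - b)"
      using norm_triangle_ineq4[of "p - a" "p - b"] by simp
    then have "norm (b - a) / 2 \<le> norm (p - b)" using False by simp
    then have "sin \<theta> * (norm (b - a) * (norm (b - a) / 2)) \<le> sin \<theta> * (norm (b - a) * norm (p - b))"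
      using sp by (intro mult_left_mono) auto
    also have "\<dots> \<le> cross (b - a) (p - a)" using B(2) d c2 by (auto simp: norm_minus_commute)
    finally show ?thesis .
  qed
  finally show "sin \<theta> / 2 * (diameter (convex hull {a, b, p}))\<^sup>2 \<le> cross (b - a) (p - a)" .
qed

lemma tri_area:
  assumes t: "tri a b p" and \<theta>: "0 < \<theta>"
    and ang: "\<And>q r s. {a, b, p} = {q, r, s} \<Longrightarrow> \<theta> \<le> vertex_angle q r s"
  shows "0 < sin \<theta>" "sin \<theta> / 2 * (diameter (convex hull {a, b, p}))\<^sup>2 \<le> cross (b - a) (p - a)"
proof -
  have sets: "{b, p, a} = {a, b, p}" "{p, a, b} = {a, b, p}" by auto
  have cr: "cross (p - b) (a - b) = cross (b - a) (p - a)" "cross (a - p) (b - p) = cross (b - a) (p - a)"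
    by (simp_all add: cross_def algebra_simps)
  consider "norm (p - b) \<le> norm (b - a)" "norm (a - p) \<le> norm (b - a)"
    | "norm (a - p) \<le> norm (p - b)" "norm (b - a) \<le> norm (p - b)"
    | "norm (b - a) \<le> norm (a - p)" "norm (p - b) \<le> norm (a - p)" by linarith
  then have "0 < sin \<theta> \<and> sin \<theta> / 2 * (diameter (convex hull {a, b, p}))\<^sup>2 \<le> cross (b - a) (p - a)"
  proof cases
    case 1
    then show ?thesis using tri_area_aux[OF t 1 \<theta>] ang by blast
  next
    case 2
    have "\<theta> \<le> vertex_angle b p a" "\<theta> \<le> vertex_angle p b a" by (rule ang; auto)+
    from tri_area_aux[OF tri_rotate[OF t] 2 \<theta> this] show ?thesis by (simp add: sets cr)
  next
    case 3
    have "\<theta> \<le> vertex_angle p a b" "\<theta> \<le> vertex_angle a p b" by (rule ang; auto)+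
    from tri_area_aux[OF tri_rotate[OF tri_rotate[OF t]] 3 \<theta> this] show ?thesis by (simp add: sets cr)
  qed
  then show "0 < sin \<theta>" "sin \<theta> / 2 * (diameter (convex hull {a, b, p}))\<^sup>2 \<le> cross (b - a) (p - a)" by auto
qed

section \<open>Triangles as simplices, their sides and normals\<close>

lemma affine_independent_tri: "tri a b p \<Longrightarrow> \<not> affine_dependent {a, b, p}"
proof
  assume t: "tri a b p" and "affine_dependent {a, b, p}"
  then have "collinear {a, b, p}" by (simp add: collinear_3_eq_affine_dependent)
  then have "collinear {a, p, b}" by (simp add: insert_commute)
  then obtain u where "a = b \<or> p = u *\<^sub>R a + (1 - u) *\<^sub>R b" unfolding collinear_3_expand by blast
  then have p: "p = u *\<^sub>R a + (1 - u) *\<^sub>R b" using tri_distinct[OF t] by simp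
  have "cross (b - a) (p - a) = 0" unfolding p by (simp add: cross_def algebra_simps)
  then show False using t by (simp add: tri_def)
qed

lemma simplex2_tri:
  assumes "2 simplex K"
  obtains a b p where "tri a b p" "K = convex hull {a, b, p}"
proof -
  obtain C where C: "\<not> affine_dependent C" "int (card C) = 2 + 1" "K = convex hull C"
    using assms by (auto simp: simplex_def)
  have "card C = 3" using C(2) by simp
  then obtain a b p where abp: "C = {a, b, p}" "a \<noteq> b" "b \<noteq> p" "a \<noteq> p" by (auto simp: card_3_iff)
  have "\<not> collinear {a, b, p}" using C(1) abp by (simp add: collinear_3_eq_affine_dependent)
  then have "cross (b - a) (p - a) \<noteq> 0" using collinear_cross by blast
  then consider "tri a b p" | "tri b a p" by (fastforce simp: tri_def cross_def algebra_simps)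
  then show ?thesis
  proof cases
    case 1 then show ?thesis using that abp C by blast
  next
    case 2
    have "{a, b, p} = {b, a, p}" by auto
    then show ?thesis using that[OF 2] abp C by simp
  qed
qed

lemma vertices_tri: "tri a b p \<Longrightarrow> vertices (convex hull {a, b, p}) = {a, b, p}"
  using extreme_point_of_convex_hull_affine_independent[OF affine_independent_tri] by (auto simp: vertices_def)

lemma side_tri:
  assumes K: "2 simplex K" and e: "e \<in> sides K"
  obtains a b p where "tri a b p" "K = convex hull {a, b, p}" "e = closed_segment a b"
proof -
  obtain a b p where t: "tri a b p" "K = convex hull {a, b, p}" using simplex2_tri[OF K] by blast
  have "e face_of K" "aff_dim e = 1" using e by (auto simp: sides_def edge_of_def)
  then obtain c where c: "c \<subseteq> {a, b, p}" "e = convex hull c"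
    using face_of_convex_hull_affine_independent[OF affine_independent_tri[OF t(1)]] t(2) by blast
  have "\<not> affine_dependent c" using c(1) affine_independent_tri[OF t(1)] affine_dependent_subset by blast
  then have "int (card c) = aff_dim c + 1" by (rule aff_dim_affine_independent)
  then have "card c = 2" using c(2) \<open>aff_dim e = 1\<close> by (simp add: aff_dim_convex_hull)
  then obtain x y where xy: "c = {x, y}" "x \<noteq> y" by (auto simp: card_2_iff)
  have e': "e = closed_segment x y" using c(2) xy by (simp add: segment_convex_hull)
  have sets: "{b, p, a} = {a, b, p}" "{p, a, b} = {a, b, p}" by auto
  have "x \<in> {a, b, p}" "y \<in> {a, b, p}" using c(1) xy by auto
  then consider "e = closed_segment a b" | "e = closed_segment b p" | "e = closed_segment p a"
    using xy(2) e' closed_segment_commute by auto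
  then show ?thesis
  proof cases
    case 1 then show ?thesis using that t by blast
  next
    case 2 then show ?thesis using that[OF tri_rotate[OF t(1)]] t by (simp add: sets)
  next
    case 3 then show ?thesis using that[OF tri_rotate[OF tri_rotate[OF t(1)]]] t by (simp add: sets)
  qed
qed

lemma segment_in_sides:
  assumes t: "tri a b p"
  shows "closed_segment a b \<in> sides (convex hull {a, b, p})"
proof -
  have "closed_segment a b face_of convex hull {a, b, p}"
    using face_of_convex_hull_affine_independent[OF affine_independent_tri[OF t], of "closed_segment a b"]
    by (auto simp: segment_convex_hull intro: exI[of _ "{a, b}"])
  moreover have "aff_dim (closed_segment a b) = 1"
    using tri_distinct[OF t] by (simp add: segment_convex_hull aff_dim_convex_hull)
  ultimately show ?thesis by (simp add: sides_def edge_of_def)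
qed

lemma tri_side_iff:
  assumes t: "tri a b p" and x: "x \<in> convex hull {a, b, p}"
  shows "x \<in> closed_segment a b \<longleftrightarrow> cross (b - a) (x - a) = 0"
proof
  assume "x \<in> closed_segment a b"
  then obtain u where "x = (1 - u) *\<^sub>R a + u *\<^sub>R b" by (auto simp: closed_segment_def)
  then show "cross (b - a) (x - a) = 0" by (rule segment_point(1))
next
  assume z: "cross (b - a) (x - a) = 0"
  obtain u v w where w: "x = u *\<^sub>R a + v *\<^sub>R b + w *\<^sub>R p" "0 \<le> u" "0 \<le> v" "0 \<le> w" "u + v + w = 1"
    using x by (auto simp: convex_hull_3)
  have "w * cross (b - a) (p - a) = 0" using z cross_combination(1)[OF w(5)] w(1) by metis
  then have "w = 0" using t by (simp add: tri_def)
  moreover from this have u: "u = 1 - v" using w(5) by simp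
  ultimately have "x = (1 - v) *\<^sub>R a + v *\<^sub>R b" "v \<le> 1" using w(1,2) by simp_all
  then show "x \<in> closed_segment a b" using w(3) unfolding closed_segment_def by blast
qed

lemma normal_tri:
  assumes t: "tri a b p"
  shows "normal (convex hull {a, b, p}) (closed_segment a b) = nrml a b"
  unfolding normal_def
proof (rule the_equality)
  note d = tri_distinct[OF t] and D = t[unfolded tri_def]
  have nb: "norm (b - a) > 0" using d by auto
  show "norm (nrml a b) = 1 \<and> (\<forall>x\<in>closed_segment a b. \<forall>y\<in>convex hull {a, b, p}. nrml a b \<bullet> (y - x) \<le> 0)"
  proof (intro conjI ballI)
    fix x y assume x: "x \<in> closed_segment a b" and y: "y \<in> convex hull {a, b, p}"
    then obtain u where "x = (1 - u) *\<^sub>R a + u *\<^sub>R b" by (auto simp: closed_segment_def)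
    then have "cross (b - a) (x - a) = 0" by (rule segment_point(1))
    then have "cross (b - a) (y - x) = cross (b - a) (y - a)" by (simp add: cross_def algebra_simps)
    moreover have "0 \<le> cross (b - a) (y - a)" using tri_hull[OF t] y by blast
    ultimately show "nrml a b \<bullet> (y - x) \<le> 0" using nb by (simp add: nrml_inner)
  qed (use nrml_tang d in auto)
  fix \<mu> assume m: "norm \<mu> = 1 \<and> (\<forall>x\<in>closed_segment a b. \<forall>y\<in>convex hull {a, b, p}. \<mu> \<bullet> (y - x) \<le> 0)"
  have v: "a \<in> convex hull {a, b, p}" "b \<in> convex hull {a, b, p}" "p \<in> convex hull {a, b, p}" by (auto intro: hull_inc)
  \<comment> \<open>Taking a and b in turn as the point of the edge makes \<mu> orthogonal to the
    edge, hence a multiple of \<open>nrml a b\<close>; the vertex p then fixes the sign.\<close>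
  have "\<mu> \<bullet> (b - a) \<le> 0" "\<mu> \<bullet> (a - b) \<le> 0" and mp: "\<mu> \<bullet> (p - a) \<le> 0" using m v by auto
  then have "\<mu> \<bullet> (b - a) = 0" by (simp add: inner_diff_right)
  then have "tang a b \<bullet> \<mu> = 0" by (simp add: tang_def inner_commute)
  then have rep: "\<mu> = (nrml a b \<bullet> \<mu>) *\<^sub>R nrml a b"
    using lborel_orthonormal_frame(2)[OF nrml_tang(2,1,3)[of a b], of \<mu> 0] d by simp
  have "norm ((nrml a b \<bullet> \<mu>) *\<^sub>R nrml a b) = 1" using rep m by simp
  then have "\<bar>nrml a b \<bullet> \<mu>\<bar> = 1" using nrml_tang(2)[of a b] d by simp
  moreover have "nrml a b \<bullet> \<mu> \<noteq> -1"
  proof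
    assume "nrml a b \<bullet> \<mu> = -1"
    then have "\<mu> = - nrml a b" using rep by simp
    then have "\<mu> \<bullet> (p - a) = cross (b - a) (p - a) / norm (b - a)" by (simp add: nrml_inner)
    then show False using mp D nb by (simp add: divide_le_0_iff)
  qed
  ultimately have "nrml a b \<bullet> \<mu> = 1" by linarith
  then show "\<mu> = nrml a b" using rep by simp
qed

section \<open>Meshes\<close>

text \<open>A Lipschitz domain lies on one side of its boundary: just below the graph there are open
  sets that miss \<Omega>, so a frontier point cannot be interior to the closure. As the mesh is
  given as a cover of the closure, this is what places the interiors of its elements inside
  \<Omega>.\<close>

lemma lipschitz_boundary_interior_closure:
  assumes O: "open \<Omega>" and L: "lipschitz_boundary \<Omega>"
  shows "interior (closure \<Omega>) = \<Omega>"
proof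
  show "\<Omega> \<subseteq> interior (closure \<Omega>)" using O closure_subset by (rule interior_maximal[rotated])
  show "interior (closure \<Omega>) \<subseteq> \<Omega>"
  proof (rule subsetI, rule ccontr)
    fix x assume x: "x \<in> interior (closure \<Omega>)" "x \<notin> \<Omega>"
    then have "x \<in> frontier \<Omega>" using O interior_subset by (auto simp: frontier_def interior_open)
    then obtain r R \<gamma> M where r: "r > 0" and R: "orthogonal_transformation (R :: real^2 \<Rightarrow> real^2)"
      and \<gamma>: "M-lipschitz_on UNIV (\<gamma> :: real \<Rightarrow> real)"
      and g: "\<And>y. y \<in> ball x r \<Longrightarrow> y \<in> \<Omega> \<longleftrightarrow> \<gamma> (R y $ 1) < R y $ 2"
      using L unfolding lipschitz_boundary_def by blast
    obtain s where s: "s > 0" "ball x s \<subseteq> closure \<Omega>" using x(1) by (meson mem_interior)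
    define W where "W = ball x r \<inter> {y. R y $ 2 < \<gamma> (R y $ 1)}"
    have Rc: "continuous_on UNIV R"
      using orthogonal_transformation_linear[OF R] by (intro linear_continuous_on) (simp add: linear_conv_bounded_linear)
    have \<gamma>c: "continuous_on UNIV \<gamma>" using \<gamma> by (rule lipschitz_on_continuous_on)
    have "open {y. R y $ 2 < \<gamma> (R y $ 1)}"
      by (intro open_Collect_less continuous_on_component Rc continuous_on_compose2[OF \<gamma>c]) auto
    then have Wo: "open W" by (simp add: W_def open_Int)
    have W0: "W \<inter> \<Omega> = {}" using g by (auto simp: W_def)
    then have Wc: "W \<inter> closure \<Omega> = {}" using Wo by (simp add: open_Int_closure_eq_empty)
    \<comment> \<open>The direction that is vertical in the local coordinates; a small step against
      it leads from x to a point below the graph.\<close>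
    obtain u where u: "R u = axis 2 1" using orthogonal_transformation_surj[OF R] by (metis surjD)
    have nu: "norm u = 1" using R u by (metis orthogonal_transformation_norm norm_axis_1)
    define \<epsilon> where "\<epsilon> = min r s / 2"
    have \<epsilon>: "\<epsilon> > 0" "\<epsilon> < r" "\<epsilon> < s" using r s by (auto simp: \<epsilon>_def)
    define y where "y = x - \<epsilon> *\<^sub>R u"
    have dy: "dist x y = \<epsilon>" using \<epsilon> nu by (simp add: y_def dist_norm)
    have Ry: "R y = R x - \<epsilon> *\<^sub>R axis 2 1"
      using linear_diff[OF orthogonal_transformation_linear[OF R]] linear_scale[OF orthogonal_transformation_linear[OF R]] u
      by (simp add: y_def)
    have "R x $ 2 \<le> \<gamma> (R x $ 1)" using g[of x] x(2) r by simp
    then have "R y $ 2 < \<gamma> (R y $ 1)" using \<epsilon> by (simp add: Ry axis_def)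
    then have "y \<in> W" using dy \<epsilon> by (simp add: W_def)
    moreover have "y \<in> closure \<Omega>" using s dy \<epsilon> by (auto simp: subset_iff)
    ultimately show False using Wc by blast
  qed
qed

lemma tri_half_ball:
  assumes t: "tri a b p" and c: "c = (1 - s) *\<^sub>R a + s *\<^sub>R b" and s: "\<delta> \<le> s" "s \<le> 1 - \<delta>"
    and r: "diameter (convex hull {a, b, p}) * \<rho> < \<delta> * cross (b - a) (p - a)" and x: "dist c x \<le> \<rho>"
  shows "x \<in> convex hull {a, b, p} \<longleftrightarrow> nrml a b \<bullet> (x - c) \<le> 0"
    "x \<in> interior (convex hull {a, b, p}) \<longleftrightarrow> nrml a b \<bullet> (x - c) < 0"
    "x \<in> closed_segment a b \<longleftrightarrow> nrml a b \<bullet> (x - c) = 0"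
proof -
  note n = tri_near_edge[OF t c s tri_side_le_diameter(2,3) r x]
  have ab: "norm (b - a) > 0" using tri_distinct[OF t] by auto
  have sg: "nrml a b \<bullet> (x - c) \<le> 0 \<longleftrightarrow> 0 \<le> cross (b - a) (x - a)"
    "nrml a b \<bullet> (x - c) < 0 \<longleftrightarrow> 0 < cross (b - a) (x - a)" "nrml a b \<bullet> (x - c) = 0 \<longleftrightarrow> cross (b - a) (x - a) = 0"
    using ab by (auto simp: n(3) field_simps)
  show 1: "x \<in> convex hull {a, b, p} \<longleftrightarrow> nrml a b \<bullet> (x - c) \<le> 0"
    using tri_hull[OF t] n sg by (auto intro: less_imp_le)
  show "x \<in> interior (convex hull {a, b, p}) \<longleftrightarrow> nrml a b \<bullet> (x - c) < 0"
    using tri_interior[OF t] n sg by auto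
  have "closed_segment a b \<subseteq> convex hull {a, b, p}"
    unfolding segment_convex_hull by (rule hull_mono) auto
  then show "x \<in> closed_segment a b \<longleftrightarrow> nrml a b \<bullet> (x - c) = 0"
    using tri_side_iff[OF t, of x] 1 sg by auto
qed

lemma exists_near_radius:
  assumes t: "tri a b p" and c: "c \<in> open_segment a b"
  obtains s \<rho> where "0 < s" "s < 1" "c = (1 - s) *\<^sub>R a + s *\<^sub>R b" "\<rho> > 0"
     "\<And>\<rho>'. \<rho>' \<le> \<rho> \<Longrightarrow> diameter (convex hull {a, b, p}) * \<rho>' < min s (1 - s) * cross (b - a) (p - a)"
proof -
  obtain s where s: "0 < s" "s < 1" "c = (1 - s) *\<^sub>R a + s *\<^sub>R b" using c by (auto simp: in_segment)
  define h where "h = diameter (convex hull {a, b, p})"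
  have h: "0 \<le> h" unfolding h_def by (rule diameter_ge_0[OF bounded_tri])
  define m where "m = min s (1 - s) * cross (b - a) (p - a)"
  have m: "m > 0" using s t by (simp add: m_def tri_def)
  \<comment> \<open>Dividing by h + 1 instead of h gives a strict inequality, also for h =
    0.\<close>
  have "h * \<rho>' < m" if "\<rho>' \<le> m / (h + 1)" for \<rho>'
  proof -
    have "h * \<rho>' \<le> h * (m / (h + 1))" using that h by (rule mult_left_mono)
    also have "\<dots> < m" using h m by (simp add: field_simps)
    finally show ?thesis .
  qed
  then show ?thesis using that[OF s, of "m / (h + 1)"] m h by (simp add: h_def m_def)
qed

locale mesh =
  fixes \<Omega> \<Gamma>1 :: "(real^2) set" and T :: "(real^2) set set"
  assumes O: "open \<Omega>" "bounded \<Omega>" "lipschitz_boundary \<Omega>"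
    and G1: "closedin (top_of_set (frontier \<Omega>)) \<Gamma>1" and adm: "admissible_mesh \<Omega> \<Gamma>1 T"
begin

lemma fin: "finite T" and simplex: "K \<in> T \<Longrightarrow> 2 simplex K" and union: "\<Union>T = closure \<Omega>"
  and face: "K \<in> T \<Longrightarrow> K' \<in> T \<Longrightarrow> (K \<inter> K') face_of K"
  using adm by (auto simp: admissible_mesh_def triangulation_def)

lemma elem_tri: "K \<in> T \<Longrightarrow> \<exists>a b p. tri a b p \<and> K = convex hull {a, b, p}"
  by (meson simplex simplex2_tri)

lemma elem_closed: "K \<in> T \<Longrightarrow> closed K" and elem_convex: "K \<in> T \<Longrightarrow> convex K"
  and elem_compact: "K \<in> T \<Longrightarrow> compact K"
  using elem_tri by (fastforce intro: compact_imp_closed finite_imp_compact_convex_hull convex_convex_hull)+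

lemma elem_sub: "K \<in> T \<Longrightarrow> K \<subseteq> closure \<Omega>"
  using union by blast

lemma interior_elem_sub: "K \<in> T \<Longrightarrow> interior K \<subseteq> \<Omega>"
  using interior_mono[OF elem_sub] lipschitz_boundary_interior_closure[OF O(1,3)] by blast

lemma inter_proper:
  assumes K: "K \<in> T" "K' \<in> T" "K \<noteq> K'"
  shows "K \<inter> K' \<noteq> K" "aff_dim (K \<inter> K') \<le> 1" "interior K \<inter> K' = {}"
proof -
  have d: "aff_dim K = 2" "aff_dim K' = 2" using aff_dim_simplex[OF simplex[OF K(1)]] aff_dim_simplex[OF simplex[OF K(2)]] by auto
  show ne: "K \<inter> K' \<noteq> K"
  proof
    assume "K \<inter> K' = K"
    then have "K face_of K'" using face[OF K(2,1)] by (simp add: Int_commute)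
    then have "aff_dim K < aff_dim K'" using face_of_aff_dim_lt[OF elem_convex[OF K(2)]] K(3) by blast
    then show False using d by simp
  qed
  show "aff_dim (K \<inter> K') \<le> 1" using face_of_aff_dim_lt[OF elem_convex[OF K(1)] face[OF K(1,2)] ne] d by simp
  show "interior K \<inter> K' = {}" using face_of_disjoint_interior[OF face[OF K(1,2)] ne] interior_subset by blast
qed

text \<open>A face contains a relatively interior point of a side only together with the whole side.
  The common face of K and K' has dimension at most 1, so it is no larger than the side.\<close>

lemma shared_point:
  assumes K: "K \<in> T" "K' \<in> T" "K \<noteq> K'" and e: "e \<in> sides K" and c: "c \<in> rel_interior e" "c \<in> K'"
  shows "e \<in> sides K'" "K \<inter> K' = e"
proof -
  have ef: "e face_of K" and e1: "aff_dim e = 1" using e by (auto simp: sides_def edge_of_def)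
  have eK: "e \<subseteq> K" using ef by (rule face_of_imp_subset)
  have "c \<in> (K \<inter> K') \<inter> rel_interior e" using c eK rel_interior_subset by blast
  then have sub: "e \<subseteq> K \<inter> K'" using subset_of_face_of[OF face[OF K(1,2)] eK] by blast
  have ef2: "e face_of (K \<inter> K')" using face_of_subset[OF ef sub] by blast
  have cv: "convex (K \<inter> K')" using elem_convex K by (simp add: convex_Int)
  show eq: "K \<inter> K' = e"
  proof (rule ccontr)
    assume "K \<inter> K' \<noteq> e"
    then have "aff_dim e < aff_dim (K \<inter> K')" using face_of_aff_dim_lt[OF cv ef2] by blast
    then show False using inter_proper(2)[OF K] e1 by simp
  qed
  then have "e face_of K'" using face[OF K(2,1)] by (simp add: Int_commute)
  then show "e \<in> sides K'" using e1 by (simp add: sides_def edge_of_def)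
qed

text \<open>If both elements lay on the same side of their common edge, they would share small half
  discs at its midpoint, although the interior of one element does not meet another element.\<close>

lemma opposite:
  assumes K: "K \<in> T" "K' \<in> T" "K \<noteq> K'" and t: "tri a b p" "K = convex hull {a, b, p}" and e: "closed_segment a b \<in> sides K'"
  shows "\<exists>p'. tri b a p' \<and> K' = convex hull {b, a, p'}"
proof -
  obtain x y p' where xy: "tri x y p'" "K' = convex hull {x, y, p'}" "closed_segment a b = closed_segment x y"
    using side_tri[OF simplex[OF K(2)] e] by metis
  have "{a, b} = {x, y}" using xy(3) by (simp add: closed_segment_eq)
  then consider "x = a" "y = b" | "x = b" "y = a" by (auto simp: doubleton_eq_iff)
  then show ?thesis
  proof cases
    case 2 then show ?thesis using xy by blast
  next
    case 1
    note t' = xy(1)[unfolded 1] xy(2)[unfolded 1]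
    define c where "c = midpoint a b"
    have co: "c \<in> open_segment a b" using tri_distinct[OF t(1)] by (simp add: c_def)
    obtain s \<rho> where 1: "0 < s" "s < 1" "c = (1 - s) *\<^sub>R a + s *\<^sub>R b" "\<rho> > 0"
     "\<And>\<rho>'. \<rho>' \<le> \<rho> \<Longrightarrow> diameter (convex hull {a, b, p}) * \<rho>' < min s (1 - s) * cross (b - a) (p - a)"
      by (rule exists_near_radius[OF t(1) co]) blast
    obtain s' \<rho>2 where 2: "0 < s'" "s' < 1" "c = (1 - s') *\<^sub>R a + s' *\<^sub>R b" "\<rho>2 > 0"
     "\<And>\<rho>'. \<rho>' \<le> \<rho>2 \<Longrightarrow> diameter (convex hull {a, b, p'}) * \<rho>' < min s' (1 - s') * cross (b - a) (p' - a)"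
      by (rule exists_near_radius[OF t'(1) co]) blast
    define r where "r = min \<rho> \<rho>2"
    have r: "r > 0" "r \<le> \<rho>" "r \<le> \<rho>2" using 1 2 by (auto simp: r_def)
    define x where "x = c - r *\<^sub>R nrml a b"
    have nn: "norm (nrml a b) = 1" using nrml_tang(2) tri_distinct[OF t(1)] by blast
    have dx: "dist c x \<le> r" using r nn by (simp add: x_def dist_norm)
    have nx: "nrml a b \<bullet> (x - c) < 0" using r nn by (simp add: x_def norm_eq_1)
    have "x \<in> interior K" unfolding t(2)
      using tri_half_ball(2)[OF t(1) 1(3) _ _ 1(5)[OF r(2)] dx] nx by simp
    moreover have "x \<in> K'" unfolding t'(2)
      using tri_half_ball(1)[OF t'(1) 2(3) _ _ 2(5)[OF r(3)] dx] nx by simp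
    ultimately show ?thesis using inter_proper(3)[OF K] by blast
  qed
qed

text \<open>A third element at the edge would lie opposite to K and opposite to K', that is on both
  sides of the edge.\<close>

lemma elems_at_two:
  assumes K: "K \<in> T" "K' \<in> T" "K \<noteq> K'" and e: "e \<in> sides K" "e \<in> sides K'"
  shows "elems_at T e = {K, K'}"
proof -
  obtain a b p where t: "tri a b p" "K = convex hull {a, b, p}" "e = closed_segment a b"
    using side_tri[OF simplex[OF K(1)] e(1)] by blast
  obtain p' where t': "tri b a p'" "K' = convex hull {b, a, p'}" using opposite[OF K t(1,2)] e(2) t(3) by blast
  have "K'' = K'" if K'': "K'' \<in> T" "e \<in> sides K''" "K'' \<noteq> K" for K''
  proof (rule ccontr)
    assume ne: "K'' \<noteq> K'"
    obtain p'' where t'': "tri b a p''" "K'' = convex hull {b, a, p''}"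
      using opposite[OF K(1) K''(1) _ t(1,2)] K'' t(3) by blast
    have e2: "closed_segment b a \<in> sides K''" using K''(2) t(3) by (simp add: closed_segment_commute)
    obtain q where q: "tri a b q" "K'' = convex hull {a, b, q}"
      using opposite[OF K(2) K''(1) _ t' e2] ne by blast
    have "vertices K'' = {b, a, p''}" "vertices K'' = {a, b, q}"
      using vertices_tri[OF t''(1)] vertices_tri[OF q(1)] t''(2) q(2) by auto
    then have "q = p''" using tri_distinct[OF q(1)] tri_distinct[OF t''(1)] by (auto simp: doubleton_eq_iff insert_eq_iff)
    then show False using q(1) t''(1) by (simp add: tri_def cross_def algebra_simps)
  qed
  then have "elems_at T e \<subseteq> {K, K'}" unfolding elems_at_def by blast
  moreover have "{K, K'} \<subseteq> elems_at T e" using K e unfolding elems_at_def by blast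
  ultimately show ?thesis by (rule subset_antisym)
qed

lemma side_elems:
  assumes K: "K \<in> T" and e: "e \<in> sides K"
  shows "e \<in> edges T" "e \<in> boundary_edges T \<longleftrightarrow> elems_at T e = {K}"
    "e \<in> interior_edges T \<longleftrightarrow> (\<exists>K'\<in>T. K' \<noteq> K \<and> elems_at T e = {K, K'})"
proof -
  show ed: "e \<in> edges T" using assms by (auto simp: edges_def)
  have KE: "K \<in> elems_at T e" using assms by (simp add: elems_at_def)
  have or: "elems_at T e = {K} \<or> (\<exists>K'\<in>T. K' \<noteq> K \<and> elems_at T e = {K, K'})"
  proof (cases "elems_at T e = {K}")
    case False
    then obtain K' where "K' \<in> T" "e \<in> sides K'" "K' \<noteq> K" using KE by (auto simp: elems_at_def)
    then show ?thesis using elems_at_two[OF K, of K' e] e by blast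
  qed simp
  have c2: "card {K, K'} = 2" if "K' \<noteq> K" for K' using that by simp
  show "e \<in> boundary_edges T \<longleftrightarrow> elems_at T e = {K}" "e \<in> interior_edges T \<longleftrightarrow> (\<exists>K'\<in>T. K' \<noteq> K \<and> elems_at T e = {K, K'})"
  proof -
    have i: "e \<in> interior_edges T \<longleftrightarrow> card (elems_at T e) = 2" and b: "e \<in> boundary_edges T \<longleftrightarrow> card (elems_at T e) \<noteq> 2"
      using ed by (auto simp: boundary_edges_def interior_edges_def)
    from or consider "elems_at T e = {K}" | K' where "K' \<in> T" "K' \<noteq> K" "elems_at T e = {K, K'}" by blast
    then have "(e \<in> boundary_edges T \<longleftrightarrow> elems_at T e = {K}) \<and> (e \<in> interior_edges T \<longleftrightarrow> (\<exists>K'\<in>T. K' \<noteq> K \<and> elems_at T e = {K, K'}))"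
    proof cases
      case 1
      have "{K} \<noteq> {K, K'}" if "K' \<noteq> K" for K' using that by blast
      then show ?thesis unfolding i b 1 by auto
    next
      case 2
      then have "{K, K'} \<noteq> {K}" by blast
      then show ?thesis unfolding i b 2(3) using 2(1,2) c2[OF 2(2)] by simp blast
    qed
    then show "e \<in> boundary_edges T \<longleftrightarrow> elems_at T e = {K}" "e \<in> interior_edges T \<longleftrightarrow> (\<exists>K'\<in>T. K' \<noteq> K \<and> elems_at T e = {K, K'})"
      by simp_all
  qed
qed

lemma interior_edge_elems:
  assumes K: "K \<in> T" and e: "e \<in> sides K" "e \<in> interior_edges T"
  obtains a b p K' p' where "tri a b p" "K = convex hull {a, b, p}" "e = closed_segment a b"
    "K' \<in> T" "K' \<noteq> K" "elems_at T e = {K, K'}" "tri b a p'" "K' = convex hull {b, a, p'}"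
proof -
  obtain a b p where t: "tri a b p" "K = convex hull {a, b, p}" "e = closed_segment a b"
    using side_tri[OF simplex[OF K(1)] e(1)] by blast
  obtain K' where K': "K' \<in> T" "K' \<noteq> K" "elems_at T e = {K, K'}" using side_elems(3)[OF K e(1)] e(2) by blast
  then have "e \<in> sides K'" by (auto simp: elems_at_def)
  then obtain p' where "tri b a p'" "K' = convex hull {b, a, p'}" using opposite[OF K K'(1) _ t(1,2)] K'(2) t(3) by blast
  then show ?thesis by (rule that[OF t K'])
qed

lemma two_sides_ball:
  assumes t: "tri a b p" "convex hull {a, b, p} \<in> T" and t': "tri b a p'" "convex hull {b, a, p'} \<in> T"
    and c: "c = (1 - s) *\<^sub>R a + s *\<^sub>R b" and s: "\<delta> \<le> s" "s \<le> 1 - \<delta>"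
    and r: "diameter (convex hull {a, b, p}) * \<rho> < \<delta> * cross (b - a) (p - a)"
      "diameter (convex hull {b, a, p'}) * \<rho> < \<delta> * cross (a - b) (p' - b)"
  shows "cball c \<rho> \<subseteq> convex hull {a, b, p} \<union> convex hull {b, a, p'}" "ball c \<rho> \<subseteq> \<Omega>"
proof -
  show sub: "cball c \<rho> \<subseteq> convex hull {a, b, p} \<union> convex hull {b, a, p'}"
  proof
    fix x assume "x \<in> cball c \<rho>"
    then have x: "dist c x \<le> \<rho>" by simp
    have c': "c = (1 - (1 - s)) *\<^sub>R b + (1 - s) *\<^sub>R a" using c by simp
    have s': "\<delta> \<le> 1 - s" "1 - s \<le> 1 - \<delta>" using s by auto
    show "x \<in> convex hull {a, b, p} \<union> convex hull {b, a, p'}"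
      using tri_half_ball(1)[OF t(1) c s r(1) x] tri_half_ball(1)[OF t'(1) c' s' r(2) x] by (auto simp: nrml_swap[of b a])
  qed
  have "ball c \<rho> \<subseteq> interior (closure \<Omega>)"
    using sub elem_sub[OF t(2)] elem_sub[OF t'(2)] ball_subset_cball[of c \<rho>]
    by (intro interior_maximal open_ball) (meson Un_least order_trans)
  then show "ball c \<rho> \<subseteq> \<Omega>" using lipschitz_boundary_interior_closure[OF O(1,3)] by simp
qed

lemma interior_edge_sub:
  assumes K: "K \<in> T" and e: "e \<in> sides K" "e \<in> interior_edges T"
  shows "rel_interior e \<subseteq> \<Omega>"
proof
  fix c assume c: "c \<in> rel_interior e"
  obtain a b p K' p' where t: "tri a b p" "K = convex hull {a, b, p}" "e = closed_segment a b"
    "K' \<in> T" "K' \<noteq> K" "elems_at T e = {K, K'}" "tri b a p'" "K' = convex hull {b, a, p'}"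
    by (rule interior_edge_elems[OF K e])
  have co: "c \<in> open_segment a b" "c \<in> open_segment b a"
    using c t(3) tri_distinct[OF t(1)] by (auto simp: rel_interior_closed_segment open_segment_commute)
  obtain s \<rho> where 1: "0 < s" "s < 1" "c = (1 - s) *\<^sub>R a + s *\<^sub>R b" "\<rho> > 0"
     "\<And>\<rho>'. \<rho>' \<le> \<rho> \<Longrightarrow> diameter (convex hull {a, b, p}) * \<rho>' < min s (1 - s) * cross (b - a) (p - a)"
    by (rule exists_near_radius[OF t(1) co(1)]) blast
  obtain s' \<rho>2 where 2: "0 < s'" "s' < 1" "c = (1 - s') *\<^sub>R b + s' *\<^sub>R a" "\<rho>2 > 0"
     "\<And>\<rho>'. \<rho>' \<le> \<rho>2 \<Longrightarrow> diameter (convex hull {b, a, p'}) * \<rho>' < min s' (1 - s') * cross (a - b) (p' - b)"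
    by (rule exists_near_radius[OF t(7) co(2)]) blast
  \<comment> \<open>The two triangles run through the common edge in opposite directions, so the
    parameters of c add up to 1.\<close>
  have "(s + s' - 1) *\<^sub>R (a - b) = 0" using 1(3) 2(3) by (simp add: algebra_simps)
  then have s': "s' = 1 - s" using tri_distinct[OF t(1)] by simp
  define r where "r = min \<rho> \<rho>2"
  have r: "r > 0" "r \<le> \<rho>" "r \<le> \<rho>2" using 1 2 by (auto simp: r_def)
  have "ball c r \<subseteq> \<Omega>"
    using two_sides_ball(2)[OF t(1) _ t(7) _ 1(3) _ _ 1(5)[OF r(2)]] 2(5)[OF r(3)] t(2,4,8) K s' by (simp add: min.commute)
  then show "c \<in> \<Omega>" using r by auto
qed

lemma boundary_edge_only:
  assumes K: "K \<in> T" and e: "e \<in> sides K" "e \<in> boundary_edges T" and c: "c \<in> rel_interior e" "c \<in> K'" "K' \<in> T"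
  shows "K' = K"
proof (rule ccontr)
  assume "K' \<noteq> K"
  then have "e \<in> sides K'" using shared_point(1)[OF K c(3) _ e(1) c(1,2)] by blast
  then have "K' \<in> elems_at T e" using c(3) by (simp add: elems_at_def)
  then show False using side_elems(2)[OF K e(1)] e(2) \<open>K' \<noteq> K\<close> by blast
qed

text \<open>The finitely many other elements form a closed set that misses c.\<close>

lemma boundary_edge_near:
  assumes K: "K \<in> T" and e: "e \<in> sides K" "e \<in> boundary_edges T" and c: "c \<in> rel_interior e"
  obtains r where "r > 0" "ball c r \<inter> closure \<Omega> \<subseteq> K"
proof -
  have "closed (\<Union>(T - {K}))" using fin elem_closed by (intro closed_Union) auto
  moreover have "c \<notin> \<Union>(T - {K})" using boundary_edge_only[OF K e c] by blast
  ultimately obtain r where "r > 0" "ball c r \<subseteq> - \<Union>(T - {K})"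
    by (metis ComplI open_Compl open_contains_ball)
  then show ?thesis using that union by blast
qed

lemma boundary_edge_frontier:
  assumes K: "K \<in> T" and e: "e \<in> sides K" "e \<in> boundary_edges T"
  shows "e \<subseteq> frontier \<Omega>"
proof -
  obtain a b p where t: "tri a b p" "K = convex hull {a, b, p}" "e = closed_segment a b"
    using side_tri[OF simplex[OF K(1)] e(1)] by blast
  have "rel_interior e \<subseteq> frontier \<Omega>"
  proof
    fix c assume c: "c \<in> rel_interior e"
    obtain r where r: "r > 0" "ball c r \<inter> closure \<Omega> \<subseteq> K" by (rule boundary_edge_near[OF K e c])
    have ce: "c \<in> e" using c rel_interior_subset by blast
    have cK: "c \<in> K" using ce e(1) by (auto simp: sides_def dest: edge_of_imp_subset)
    have "c \<notin> \<Omega>"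
    proof
      assume "c \<in> \<Omega>"
      then obtain r' where r': "r' > 0" "ball c r' \<subseteq> \<Omega>" using O(1) open_contains_ball by blast
      have "ball c (min r r') \<subseteq> K" using r r' closure_subset[of \<Omega>] by fastforce
      then have "c \<in> interior K" using r r' by (meson centre_in_ball interiorI min_less_iff_conj open_ball)
      then have "0 < cross (b - a) (c - a)" unfolding t(2) using tri_interior[OF t(1)] by blast
      moreover have "cross (b - a) (c - a) = 0" using tri_side_iff[OF t(1)] cK t(2,3) ce by blast
      ultimately show False by simp
    qed
    moreover have "c \<in> closure \<Omega>" using elem_sub[OF K] cK by blast
    ultimately show "c \<in> frontier \<Omega>" using O(1) by (simp add: frontier_def interior_open)
  qed
  then have "closure (rel_interior e) \<subseteq> frontier \<Omega>" by (simp add: closure_minimal)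
  moreover have "closure (rel_interior e) = e" using t(3) by (simp add: convex_closure_rel_interior)
  ultimately show ?thesis by simp
qed

lemma elem_boundary_sides:
  assumes K: "K \<in> T" and x: "x \<in> K" "x \<notin> interior K"
  shows "\<exists>e\<in>sides K. x \<in> e"
proof -
  obtain a b p where t: "tri a b p" "K = convex hull {a, b, p}" using elem_tri[OF K] by blast
  have s: "{b, p, a} = {a, b, p}" "{p, a, b} = {a, b, p}" by auto
  note t2 = tri_rotate[OF t(1)] and t3 = tri_rotate[OF tri_rotate[OF t(1)]]
  consider "cross (b - a) (x - a) = 0" | "cross (p - b) (x - b) = 0" | "cross (a - p) (x - p) = 0"
    using tri_hull[OF t(1)] tri_interior[OF t(1)] x t(2) by fastforce
  then show ?thesis
  proof cases
    case 1 then show ?thesis using tri_side_iff[OF t(1)] segment_in_sides[OF t(1)] x t(2) by blast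
  next
    case 2 then show ?thesis using tri_side_iff[OF t2] segment_in_sides[OF t2] x t(2) by (auto simp: s)
  next
    case 3 then show ?thesis using tri_side_iff[OF t3] segment_in_sides[OF t3] x t(2) by (auto simp: s)
  qed
qed

lemma finite_sides: "K \<in> T \<Longrightarrow> finite (sides K)" and finite_vertices: "K \<in> T \<Longrightarrow> finite (vertices K)"
proof -
  assume K: "K \<in> T"
  obtain a b p where t: "tri a b p" "K = convex hull {a, b, p}" using elem_tri[OF K] by blast
  show "finite (vertices K)" using vertices_tri[OF t(1)] t(2) by simp
  have "sides K \<subseteq> (\<lambda>(x, y). closed_segment x y) ` ({a, b, p} \<times> {a, b, p})"
  proof
    fix e assume "e \<in> sides K"
    then obtain x y q where xy: "tri x y q" "K = convex hull {x, y, q}" "e = closed_segment x y"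
      using side_tri[OF simplex[OF K]] by blast
    have "{x, y, q} = {a, b, p}" using vertices_tri[OF xy(1)] vertices_tri[OF t(1)] xy(2) t(2) by simp
    then show "e \<in> (\<lambda>(x, y). closed_segment x y) ` ({a, b, p} \<times> {a, b, p})" using xy(3) by (intro image_eqI[of _ _ "(x, y)"]) auto
  qed
  then show "finite (sides K)" by (rule finite_subset) auto
qed

lemma finite_edges: "finite (edges T)"
  using fin finite_sides by (auto simp: edges_def)

text \<open>Every frontier point lies on a side; a side that is no boundary edge has its relative
  interior in \<Omega>, so of such a side only vertices remain. Hence almost every frontier point
  lies on a boundary edge, where traces are known.\<close>

lemma frontier_sub: "frontier \<Omega> \<subseteq> \<Union>(boundary_edges T) \<union> (\<Union>K\<in>T. vertices K)"
proof
  fix x assume x: "x \<in> frontier \<Omega>"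
  then have "x \<in> \<Union>T" "x \<notin> \<Omega>" using O(1) union by (auto simp: frontier_def interior_open)
  then obtain K where K: "K \<in> T" "x \<in> K" by blast
  have "x \<notin> interior K" using interior_elem_sub[OF K(1)] \<open>x \<notin> \<Omega>\<close> by blast
  then obtain e where e: "e \<in> sides K" "x \<in> e" using elem_boundary_sides K by blast
  show "x \<in> \<Union>(boundary_edges T) \<union> (\<Union>K\<in>T. vertices K)"
  proof (cases "e \<in> boundary_edges T")
    case True then show ?thesis using e by blast
  next
    case False
    then have "e \<in> interior_edges T" using side_elems(1)[OF K(1) e(1)] by (simp add: boundary_edges_def)
    then have "x \<notin> rel_interior e" using interior_edge_sub[OF K(1) e(1)] \<open>x \<notin> \<Omega>\<close> by blast
    moreover obtain a b p where t: "tri a b p" "K = convex hull {a, b, p}" "e = closed_segment a b"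
      using side_tri[OF simplex[OF K(1)] e(1)] by blast
    ultimately have "x \<in> {a, b}" using e(2) tri_distinct[OF t(1)] by (auto simp: rel_interior_closed_segment open_segment_def)
    then show ?thesis using vertices_tri[OF t(1)] t(2) K(1) by auto
  qed
qed

lemma edge_segment: "e \<in> edges T \<Longrightarrow> \<exists>a b. a \<noteq> b \<and> e = closed_segment a b"
  using side_tri[OF simplex] tri_distinct unfolding edges_def by (metis UN_E)

lemma edge_measure: "e \<in> edges T \<Longrightarrow> emeasure arclength e < \<infinity>" "e \<in> edges T \<Longrightarrow> e \<in> sets arclength" "e \<in> edges T \<Longrightarrow> closed e"
  by (auto dest!: edge_segment simp: emeasure_arclength_segment sets_arclength_segment)

lemma null_vertices: "(\<Union>K\<in>T. vertices K) \<in> null_sets arclength"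
proof -
  have "finite (\<Union>K\<in>T. vertices K)" using fin finite_vertices by auto
  then have "countable (\<Union>K\<in>T. vertices K)" by (rule countable_finite)
  then have "(\<Union>x\<in>(\<Union>K\<in>T. vertices K). {x}) \<in> null_sets arclength"
    by (rule null_sets_UN') (rule arclength_singleton)
  then show ?thesis by simp
qed

lemma frontier_measure: "emeasure arclength (frontier \<Omega>) < \<infinity>"
proof -
  have be: "boundary_edges T \<subseteq> edges T" by (auto simp: boundary_edges_def)
  have fb: "finite (boundary_edges T)" using finite_edges be finite_subset by blast
  have m: "\<Union>(boundary_edges T) \<in> sets arclength" using fb edge_measure(2) be by (intro sets.finite_Union) auto
  have "emeasure arclength (frontier \<Omega>) \<le> emeasure arclength (\<Union>(boundary_edges T) \<union> (\<Union>K\<in>T. vertices K))"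
    using frontier_sub m null_vertices by (intro emeasure_mono) auto
  also have "\<dots> = emeasure arclength (\<Union>e\<in>boundary_edges T. e)"
    using m null_vertices by (simp add: emeasure_Un_null_set)
  also have "\<dots> \<le> (\<Sum>e\<in>boundary_edges T. emeasure arclength e)"
    using fb edge_measure(2) be by (intro emeasure_subadditive_finite) auto
  also have "\<dots> < \<infinity>" using fb edge_measure(1) be by (auto simp: subset_iff)
  finally show ?thesis .
qed

text \<open>The mesh condition is a disjunction, and an edge in the closure of \<open>Gamma2\<close>
  could a priori satisfy only the part about \<Gamma>1. But \<Gamma>1 is closed, and near the
  midpoint of a boundary edge the frontier of \<Omega> lies on the edge. If the edge were contained
  in \<Gamma>1, no point of \<open>Gamma2\<close> could come close to its midpoint.\<close>

lemma edges2_null: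
  assumes K: "K \<in> T" and e: "e \<in> sides K" "e \<in> edges2 \<Omega> \<Gamma>1 T"
  shows "e - Gamma2 \<Omega> \<Gamma>1 \<in> null_sets arclength"
proof (rule ccontr)
  assume n: "e - Gamma2 \<Omega> \<Gamma>1 \<notin> null_sets arclength"
  have eb: "e \<in> boundary_edges T" and e2: "e \<subseteq> closure (Gamma2 \<Omega> \<Gamma>1)" using e by (auto simp: edges2_def)
  then have "e \<subseteq> closure \<Gamma>1" using n adm by (auto simp: admissible_mesh_def)
  moreover have "closed \<Gamma>1" using G1 closedin_closed_trans frontier_closed by blast
  ultimately have e1: "e \<subseteq> \<Gamma>1" by simp
  obtain a b p where t: "tri a b p" "K = convex hull {a, b, p}" "e = closed_segment a b"
    using side_tri[OF simplex[OF K(1)] e(1)] by blast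
  define c where "c = midpoint a b"
  have co: "c \<in> open_segment a b" using tri_distinct[OF t(1)] by (simp add: c_def)
  then have cr: "c \<in> rel_interior e" using t(3) tri_distinct[OF t(1)] by (simp add: rel_interior_closed_segment)
  obtain s \<rho> where 1: "0 < s" "s < 1" "c = (1 - s) *\<^sub>R a + s *\<^sub>R b" "\<rho> > 0"
     "\<And>\<rho>'. \<rho>' \<le> \<rho> \<Longrightarrow> diameter (convex hull {a, b, p}) * \<rho>' < min s (1 - s) * cross (b - a) (p - a)"
    by (rule exists_near_radius[OF t(1) co]) blast
  obtain r where r: "r > 0" "ball c r \<inter> closure \<Omega> \<subseteq> K" by (rule boundary_edge_near[OF K e(1) eb cr])
  have "c \<in> closure (Gamma2 \<Omega> \<Gamma>1)" using e2 cr rel_interior_subset by blast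
  then obtain x where x: "x \<in> Gamma2 \<Omega> \<Gamma>1" "dist x c < min r \<rho>"
    using closure_approachable[of c "Gamma2 \<Omega> \<Gamma>1"] r(1) 1(4) by (metis min_less_iff_conj)
  then have xd: "dist c x \<le> \<rho>" "x \<in> ball c r" by (auto simp: dist_commute)
  have xf: "x \<in> frontier \<Omega>" using x by blast
  then have xK: "x \<in> K" using xd r by (auto simp: frontier_def)
  have "x \<notin> interior K" using interior_elem_sub[OF K] xf O(1) by (auto simp: frontier_def interior_open)
  then have "nrml a b \<bullet> (x - c) = 0"
    using tri_half_ball(1,2)[OF t(1) 1(3) _ _ 1(5)[OF order_refl] xd(1)] xK t(2) by auto
  then have "x \<in> e" using tri_half_ball(3)[OF t(1) 1(3) _ _ 1(5)[OF order_refl] xd(1)] t(3) by auto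
  then show False using e1 x by blast
qed

lemma normals:
  assumes "tri a b p"
  shows "normal (convex hull {a, b, p}) (closed_segment a b) = nrml a b"
    "normal (convex hull {a, b, p}) (closed_segment b a) = nrml a b"
  using normal_tri[OF assms] by (simp_all add: closed_segment_commute)

end

section \<open>Changes on null sets, and traces on whole edges\<close>

lemma complete_measure_lebesgue: "complete_measure (lebesgue :: 'a::euclidean_space measure)"
  by (rule completion.complete_measure_axioms)

text \<open>Integrals pass between triangles and their interiors, and between selected
  representatives of gradients or traces and explicit ones. Completeness makes the measurability of
  the new integrand a conclusion instead of a premise.\<close>

lemma set_integral_change_set:
  fixes f :: "'a \<Rightarrow> 'b::{banach, second_countable_topology}"
  assumes M: "complete_measure M" and f: "set_borel_measurable M A f"
    and AB: "AE x in M. indicator A x *\<^sub>R f x = (indicator B x *\<^sub>R g x :: 'b)"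
  shows "set_borel_measurable M B g" "(LINT x:A|M. f x) = (LINT x:B|M. g x)" "set_integrable M A f \<longleftrightarrow> set_integrable M B g"
proof -
  have fm: "(\<lambda>x. indicator A x *\<^sub>R f x) \<in> borel_measurable M" using f by (simp add: set_borel_measurable_def)
  have gm: "(\<lambda>x. indicator B x *\<^sub>R g x) \<in> borel_measurable M" by (rule measurable_complete_AE_eq[OF M fm AB])
  then show "set_borel_measurable M B g" by (simp add: set_borel_measurable_def)
  show "(LINT x:A|M. f x) = (LINT x:B|M. g x)" unfolding set_lebesgue_integral_def
    by (rule integral_cong_AE[OF fm gm AB])
  show "set_integrable M A f \<longleftrightarrow> set_integrable M B g" unfolding set_integrable_def
    by (rule integrable_cong_AE[OF fm gm AB])
qed

lemma L2_change_set:
  fixes f g :: "'a \<Rightarrow> 'b::euclidean_space"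
  assumes M: "complete_measure M" and A: "A \<in> sets M" and B: "B \<in> sets M" and f: "f \<in> L2_space M A"
    and AB: "AE x in M. indicator A x *\<^sub>R f x = indicator B x *\<^sub>R g x"
  shows "g \<in> L2_space M B" "L2_norm M A f = L2_norm M B g"
proof -
  have A': "A \<inter> space M \<in> sets M" and B': "B \<inter> space M \<in> sets M" using A B by auto
  have fm: "set_borel_measurable M A f" and fi: "set_integrable M A (\<lambda>x. (norm (f x))\<^sup>2)" using f by (auto simp: L2_space_iff[OF A'])
  have AB2: "AE x in M. indicator A x *\<^sub>R (norm (f x))\<^sup>2 = indicator B x *\<^sub>R (norm (g x))\<^sup>2"
    using AB by eventually_elim (simp only: norm_indicator_sq[symmetric])
  have m2: "set_borel_measurable M A (\<lambda>x. (norm (f x))\<^sup>2)"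
    using fi by (auto simp: set_borel_measurable_def set_integrable_def)
  note 1 = set_integral_change_set(1)[OF M fm AB] and 2 = set_integral_change_set(2,3)[OF M m2 AB2]
  show "g \<in> L2_space M B" using 1 2(2) fi by (simp add: L2_space_iff[OF B'])
  show "L2_norm M A f = L2_norm M B g" using 2(1) by (simp add: L2_norm_def)
qed

lemma L2_space_Un:
  fixes f :: "'a \<Rightarrow> 'b::euclidean_space"
  assumes A: "A \<in> sets M" "f \<in> L2_space M A" and B: "B \<in> sets M" "f \<in> L2_space M B"
  shows "f \<in> L2_space M (A \<union> B)"
proof -
  have s: "A \<inter> space M \<in> sets M" "B \<inter> space M \<in> sets M" "(A \<union> B) \<inter> space M \<in> sets M" using A B by auto
  have m: "(\<lambda>x. if x \<in> A then indicator A x *\<^sub>R f x else indicator B x *\<^sub>R f x) \<in> borel_measurable M"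
    by (intro measurable_If_set) (use A B s in \<open>auto simp: L2_space_iff set_borel_measurable_def\<close>)
  have "(\<lambda>x. if x \<in> A then indicator A x *\<^sub>R f x else indicator B x *\<^sub>R f x) = (\<lambda>x. indicator (A \<union> B) x *\<^sub>R f x)"
    by (auto simp: indicator_def)
  moreover have "set_integrable M (A \<union> B) (\<lambda>x. (norm (f x))\<^sup>2)"
    using A B s by (intro set_integrable_Un) (auto simp: L2_space_iff)
  ultimately show ?thesis using m by (simp add: L2_space_iff[OF s(3)] set_borel_measurable_def)
qed

lemma L2_space_UN:
  fixes f :: "'a \<Rightarrow> 'b::euclidean_space"
  assumes "finite I" "\<And>i. i \<in> I \<Longrightarrow> A i \<in> sets M" "\<And>i. i \<in> I \<Longrightarrow> f \<in> L2_space M (A i)"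
  shows "f \<in> L2_space M (\<Union>i\<in>I. A i)"
  using assms
proof (induction I rule: finite_induct)
  case empty
  then show ?case by (simp add: L2_space_iff set_borel_measurable_def set_integrable_def)
next
  case (insert i I)
  then show ?case by (auto intro!: L2_space_Un)
qed

lemma H1_norm_zero:
  assumes U: "open U"
  shows "H1_norm U (\<lambda>x. 0) = 0"
proof -
  have Us: "U \<in> sets lebesgue" using U by auto
  then have Us': "U \<inter> space lebesgue \<in> sets lebesgue" by auto
  have z: "(\<lambda>x. 0 :: real^2) \<in> L2_space lebesgue U"
    by (simp add: L2_space_iff[OF Us'] set_borel_measurable_def set_integrable_def)
  have w: "is_weak_grad U (\<lambda>x. 0) (\<lambda>x. 0)" by (simp add: is_weak_grad_def set_lebesgue_integral_def)
  have ae: "AE x in lebesgue. x \<in> U \<longrightarrow> weak_grad U (\<lambda>x. 0) x = 0" by (rule weak_grad_eq_AE[OF U z w])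
  have "L2_norm lebesgue U (weak_grad U (\<lambda>x. 0)) = L2_norm lebesgue U (\<lambda>x. 0 :: real^2)"
    by (rule L2_norm_cong_AE[OF Us weak_grad_someI(1)[OF z w] z ae])
  then show ?thesis by (simp add: H1_norm_def L2_norm_def set_lebesgue_integral_def)
qed

text \<open>The constant sequence shows that v is a trace of itself. The operator \<open>tr\<close>
  selects some trace, possibly another one, so the two still have to be compared.\<close>

lemma is_trace_continuous:
  assumes V: "open V" "bounded V" and fin: "emeasure arclength (frontier V) < \<infinity>"
    and v: "v \<in> H1 V" "continuous_on (closure V) v"
  shows "is_trace V v v" "is_trace V v (tr V v)"
proof -
  have "frontier V \<subseteq> closure V" by (auto simp: frontier_def)
  then have "v \<in> L2_space arclength (frontier V)"
    using v(2) V(2) fin by (intro L2_space_continuous_arclength compact_frontier_bounded) (auto intro: continuous_on_subset)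
  then show t: "is_trace V v v" unfolding is_trace_def using v
    by (intro conjI exI[of _ "\<lambda>_. v"]) (simp_all add: H1_norm_zero[OF V(1)] L2_norm_def set_lebesgue_integral_def)
  then show "is_trace V v (tr V v)" unfolding tr_def by (rule someI[of "is_trace V v"])
qed

text \<open>The discs of \<open>trace_unique_near\<close> shrink towards the end points of the edge.
  Countably many of them cover the open segment by Lindelof's theorem, and the end points are null
  sets.\<close>

lemma trace_AE_edge:
  assumes V: "open V" "bounded V" and fin: "emeasure arclength (frontier V) < \<infinity>"
    and t: "tri a b p" and sub: "interior (convex hull {a, b, p}) \<subseteq> V" and e: "closed_segment a b \<subseteq> frontier V"
    and v: "v \<in> H1 V" "continuous_on (closure V) v" and w: "is_trace V v w"
  shows "AE x in arclength. x \<in> closed_segment a b \<longrightarrow> w x = v x"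
proof -
  have ab: "a \<noteq> b" using tri_distinct[OF t] by blast
  have "\<exists>r>0. AE x in arclength. x \<in> closed_segment a b \<longrightarrow> dist c x < r \<longrightarrow> w x = v x" if c: "c \<in> open_segment a b" for c
  proof -
    obtain s \<rho> where s: "0 < s" "s < 1" "c = (1 - s) *\<^sub>R a + s *\<^sub>R b" "\<rho> > 0"
     "\<And>\<rho>'. \<rho>' \<le> \<rho> \<Longrightarrow> diameter (convex hull {a, b, p}) * \<rho>' < min s (1 - s) * cross (b - a) (p - a)"
      by (rule exists_near_radius[OF t c]) blast
    have m: "min s (1 - s) \<le> s" "s \<le> 1 - min s (1 - s)" by auto
    note hb = tri_half_ball[OF t s(3) m s(5)[OF order_refl]]
    have side: "nrml a b \<bullet> (x - c) < 0" if "x \<in> interior (convex hull {a, b, p})" for x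
    proof -
      have "0 < cross (b - a) (x - a)" using tri_interior[OF t] that by blast
      moreover have "cross (b - a) (x - c) = cross (b - a) (x - a)"
        using segment_point(1)[OF s(3)] by (simp add: cross_def algebra_simps)
      ultimately show ?thesis using ab by (simp add: nrml_inner)
    qed
    show ?thesis
    proof (intro exI conjI)
      show "\<rho> > 0" by (rule s(4))
      show "AE x in arclength. x \<in> closed_segment a b \<longrightarrow> dist c x < \<rho> \<longrightarrow> w x = v x"
        by (rule trace_unique_near[OF nrml_tang(2,1,3)[OF ab] V open_interior sub s(4) side _ _ e closed_segment fin v w])
          (use hb in auto)
    qed
  qed
  then have "\<forall>c\<in>open_segment a b. \<exists>r>0. AE x in arclength. x \<in> closed_segment a b \<longrightarrow> dist c x < r \<longrightarrow> w x = v x" by blast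
  from bchoice[OF this] obtain r where r: "\<And>c. c \<in> open_segment a b \<Longrightarrow> r c > 0"
    "\<And>c. c \<in> open_segment a b \<Longrightarrow> AE x in arclength. x \<in> closed_segment a b \<longrightarrow> dist c x < r c \<longrightarrow> w x = v x"
    by blast
  obtain F where F: "F \<subseteq> (\<lambda>c. ball c (r c)) ` open_segment a b" "countable F" "\<Union>F = \<Union>((\<lambda>c. ball c (r c)) ` open_segment a b)"
    by (rule Lindelof[of "(\<lambda>c. ball c (r c)) ` open_segment a b"]) auto
  have "AE x in arclength. \<forall>B\<in>F. x \<in> closed_segment a b \<longrightarrow> x \<in> B \<longrightarrow> w x = v x"
    unfolding AE_ball_countable[OF F(2)] using F(1) r(2) by fastforce
  moreover have "AE x in arclength. x \<notin> {a}" "AE x in arclength. x \<notin> {b}"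
    by (rule AE_not_in[OF arclength_singleton])+
  ultimately show ?thesis
  proof eventually_elim
    case (elim x)
    show ?case
    proof
      assume x: "x \<in> closed_segment a b"
      then have "x \<in> open_segment a b" using elim(2,3) by (simp add: open_segment_def)
      then have "x \<in> \<Union>F" unfolding F(3) using r(1) by (auto intro!: bexI[of _ x])
      then show "w x = v x" using elim(1) x by blast
    qed
  qed
qed

section \<open>Norms and integrals of bumps\<close>

lemma measure_cball_le: "0 \<le> r \<Longrightarrow> measure lebesgue (cball (c :: real^2) r) \<le> (2 * r)\<^sup>2"
proof -
  assume r: "0 \<le> r"
  define R where "R = (\<chi> i::2. r)"
  have sub: "cball c r \<subseteq> cbox (c - R) (c + R)"
  proof
    fix x assume "x \<in> cball c r"
    then have "\<bar>(x - c) $ i\<bar> \<le> r" for i using component_le_norm_cart[of "x - c" i] by (auto simp: dist_norm norm_minus_commute)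
    then show "x \<in> cbox (c - R) (c + R)" by (auto simp: mem_box_cart R_def abs_le_iff algebra_simps)
  qed
  have "measure lebesgue (cball c r) \<le> measure lebesgue (cbox (c - R) (c + R))"
    by (rule measure_mono_fmeasurable[OF sub]) auto
  also have "\<dots> = measure lborel (cbox (c - R) (c + R))" by simp
  also have "\<dots> = (2 * r)\<^sup>2"
  proof -
    have "cbox (c - R) (c + R) \<noteq> {}" using r by (simp add: interval_ne_empty_cart R_def)
    then show ?thesis by (simp add: content_cbox_cart UNIV_2 R_def power2_eq_square)
  qed
  finally show ?thesis .
qed

lemma measure_cball_ge: "0 \<le> r \<Longrightarrow> r\<^sup>2 \<le> measure lebesgue (cball (c :: real^2) r)"
proof -
  assume r: "0 \<le> r"
  define R where "R = (\<chi> i::2. r / 2)"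
  have sub: "cbox (c - R) (c + R) \<subseteq> cball c r"
  proof
    fix x assume "x \<in> cbox (c - R) (c + R)"
    then have "c $ i - r / 2 \<le> x $ i \<and> x $ i \<le> c $ i + r / 2" for i by (auto simp: mem_box_cart R_def)
    then have i: "\<bar>(x - c) $ i\<bar> \<le> r / 2" for i by (smt (verit, best) vector_minus_component)
    have "norm (x - c) \<le> \<bar>(x - c) $ 1\<bar> + \<bar>(x - c) $ 2\<bar>" using norm_le_l1_cart[of "x - c"] by (simp add: UNIV_2)
    then show "x \<in> cball c r" using i[of 1] i[of 2] by (simp add: dist_norm norm_minus_commute)
  qed
  have "r\<^sup>2 = measure lborel (cbox (c - R) (c + R))"
  proof -
    have "cbox (c - R) (c + R) \<noteq> {}" using r by (simp add: interval_ne_empty_cart R_def)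
    then show ?thesis by (simp add: content_cbox_cart UNIV_2 R_def power2_eq_square)
  qed
  also have "\<dots> = measure lebesgue (cbox (c - R) (c + R))" by simp
  also have "\<dots> \<le> measure lebesgue (cball c r)"
    by (rule measure_mono_fmeasurable[OF sub]) auto
  finally show ?thesis .
qed

lemma L2_norm_ball_support:
  fixes q :: "real^2 \<Rightarrow> 'b::euclidean_space"
  assumes U: "U \<in> sets lebesgue" and q: "continuous_on UNIV q" and r: "0 \<le> r" "\<And>x. r < dist c x \<Longrightarrow> q x = 0"
    and B: "\<And>x. norm (q x) \<le> B"
  shows "L2_norm lebesgue U q \<le> B * (2 * r)" "q \<in> L2_space lebesgue U"
proof -
  have B0: "0 \<le> B" using B[of c] norm_ge_zero order_trans by blast
  have L: "q \<in> L2_space lebesgue V" if "V \<in> sets lebesgue" for V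
    by (rule L2_space_compact_support[OF that q compact_cball[of c r]]) (use r in auto)
  then show "q \<in> L2_space lebesgue U" using U .
  have "L2_norm lebesgue U q \<le> L2_norm lebesgue UNIV q" by (rule L2_norm_mono[OF U _ _ L]) auto
  also have "L2_norm lebesgue UNIV q = L2_norm lebesgue (cball c r) q"
    by (rule L2_change_set(2)[OF complete_measure_lebesgue _ _ L]) (use r in \<open>auto intro!: AE_I2 simp: indicator_def not_le\<close>)
  also have "\<dots> \<le> B * sqrt (measure lebesgue (cball c r))"
  proof (rule L2_norm_bounded[OF _ _ B B0])
    show "emeasure lebesgue (cball c r) < \<infinity>" using emeasure_bounded_finite[OF bounded_cball, of c r] by simp
  qed simp
  also have "sqrt (measure lebesgue (cball c r)) \<le> sqrt ((2 * r)\<^sup>2)"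
    using measure_cball_le[OF r(1)] by (rule real_sqrt_le_mono)
  also have "\<dots> = 2 * r" using r(1) by (simp only: real_sqrt_abs)
  finally show "L2_norm lebesgue U q \<le> B * (2 * r)" using B0 by (simp add: mult_left_mono)
qed

text \<open>Both norm bounds are a bound for the values, 1 and 2 / r, times the square root of the
  area of the disc, estimated by the square of side 2 r. The bound for the gradient is therefore
  independent of r.\<close>

lemma bump_props:
  assumes r: "0 < r" and U: "U \<in> sets lebesgue"
  shows "(bump c r has_derivative (\<lambda>h. grad (bump c r) x \<bullet> h)) (at x)" "continuous_on UNIV (bump c r)" "continuous_on UNIV (grad (bump c r))"
    "bump c r \<in> L2_space lebesgue U" "grad (bump c r) \<in> L2_space lebesgue U"
    "L2_norm lebesgue U (bump c r) \<le> 2 * r" "L2_norm lebesgue U (grad (bump c r)) \<le> 4"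
proof -
  have C: "Ck k (bump c r)" for k by (rule Ck_bump)
  show "(bump c r has_derivative (\<lambda>h. grad (bump c r) x \<bullet> h)) (at x)"
    using C[of 1] by (simp add: differentiable_on_UNIV_grad)
  show c: "continuous_on UNIV (bump c r)" using C[of 0] by simp
  show g: "continuous_on UNIV (grad (bump c r))"
    using C[of 1] continuous_on_vec_lambda[of UNIV "\<lambda>i x. grad (bump c r) x $ i"] by simp
  have "norm (bump c r x) \<le> 1" for x using bump_bounds[of c r x] by simp
  note 1 = L2_norm_ball_support[OF U c less_imp_le[OF r] bump_eq_0[OF r less_imp_le] this]
  note 2 = L2_norm_ball_support[OF U g less_imp_le[OF r] grad_bump_eq_0[OF r less_imp_le] norm_grad_bump[OF r]]
  show "bump c r \<in> L2_space lebesgue U" "L2_norm lebesgue U (bump c r) \<le> 2 * r" using 1 by auto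
  show "grad (bump c r) \<in> L2_space lebesgue U" "L2_norm lebesgue U (grad (bump c r)) \<le> 4" using 2 r by auto
qed

lemma bump_integral_ge:
  assumes r: "0 < r" and U: "U \<in> sets lebesgue" "cball c r \<subseteq> U" and m: "0 \<le> m" "\<And>x. x \<in> cball c r \<Longrightarrow> m \<le> q x"
    and i: "set_integrable lebesgue U (\<lambda>x. q x * bump c r x)"
  shows "m * r\<^sup>2 / 32 \<le> (LINT x:U|lebesgue. q x * bump c r x)"
proof -
  \<comment> \<open>On the disc of radius r/2 the bump is at least 1/8, and this disc contains a
    square of area r^2 / 4; hence the 32.\<close>
  have "m * r\<^sup>2 / 32 \<le> m / 8 * measure lebesgue (cball c (r / 2))"
    using mult_left_mono[OF measure_cball_ge[of "r / 2" c], of "m / 8"] r m by (simp add: power_divide)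
  also have "\<dots> = (LINT x:cball c (r / 2)|lebesgue. m / 8)"
    by (simp add: set_lebesgue_integral_def)
  also have "\<dots> \<le> (LINT x:U|lebesgue. q x * bump c r x)"
    unfolding set_lebesgue_integral_def
  proof (rule integral_mono)
    show "integrable lebesgue (\<lambda>x. indicator (cball c (r / 2)) x *\<^sub>R (m / 8))"
      using emeasure_bounded_finite[OF bounded_cball, of c "r / 2"]
      by (intro integrable_scaleR_left integrable_real_indicator) simp_all
    show "integrable lebesgue (\<lambda>x. indicator U x *\<^sub>R (q x * bump c r x))" using i by (simp add: set_integrable_def)
    fix x
    consider "x \<in> cball c (r / 2)" | "x \<in> cball c r" "x \<notin> cball c (r / 2)" | "x \<notin> cball c r" by blast
    then show "indicator (cball c (r / 2)) x *\<^sub>R (m / 8) \<le> indicator U x *\<^sub>R (q x * bump c r x)"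
    proof cases
      case 1
      then have xr: "x \<in> cball c r" using r by auto
      have "m * (1 / 8) \<le> q x * bump c r x"
        by (rule mult_mono) (use 1 xr m bump_ge[OF r, of c x] order_trans[OF m(1) m(2)[OF xr]] in auto)
      then show ?thesis using 1 xr U(2) by (auto simp: indicator_def)
    next
      case 2
      then show ?thesis using U(2) m order_trans[OF m(1) m(2)[of x]] bump_bounds[of c r x] by (auto simp: indicator_def)
    next
      case 3
      then show ?thesis using bump_eq_0[OF r, of c x] r by (auto simp: indicator_def)
    qed
  qed
  finally show ?thesis .
qed

section \<open>Nodal functions and averaged data\<close>

lemma P1_iff_cross:
  assumes t: "tri a b p" and f: "f \<in> P1"
  shows "f x = (cross (p - b) (x - b) * f a + cross (a - p) (x - p) * f b + cross (b - a) (x - a) * f p) / cross (b - a) (p - a)"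
proof -
  define D where "D = cross (b - a) (p - a)"
  have D: "D \<noteq> 0" using t by (simp add: tri_def D_def)
  obtain \<alpha> \<beta> where f: "f = (\<lambda>x. \<alpha> \<bullet> x + \<beta>)" using f by (auto simp: P1_def)
  have "D * (\<alpha> \<bullet> x) = \<alpha> \<bullet> (D *\<^sub>R x)" by simp
  also have "\<dots> = cross (p - b) (x - b) * (\<alpha> \<bullet> a) + cross (a - p) (x - p) * (\<alpha> \<bullet> b) + cross (b - a) (x - a) * (\<alpha> \<bullet> p)"
    unfolding D_def cross_rep[of b a p x] by (simp add: inner_add_right)
  finally have e1: "D * (\<alpha> \<bullet> x) = cross (p - b) (x - b) * (\<alpha> \<bullet> a) + cross (a - p) (x - p) * (\<alpha> \<bullet> b) + cross (b - a) (x - a) * (\<alpha> \<bullet> p)" .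
  have "D * f x = cross (p - b) (x - b) * f a + cross (a - p) (x - p) * f b + cross (b - a) (x - a) * f p"
  proof -
    have "D * \<beta> = (cross (b - a) (x - a) + cross (p - b) (x - b) + cross (a - p) (x - p)) * \<beta>"
      by (simp add: cross_sum D_def)
    then show ?thesis using e1 by (simp add: f algebra_simps)
  qed
  then show ?thesis using D by (simp add: D_def[symmetric] field_simps)
qed

text \<open>The nodal function of p is the barycentric coordinate of p. An affine function is
  determined by its values at the vertices, which justifies the definite description.\<close>

lemma nodal_P1:
  assumes t: "tri a b p"
  shows "nodal (convex hull {a, b, p}) p \<in> P1"
proof -
  define D where "D = cross (b - a) (p - a)"
  have D: "D \<noteq> 0" using t by (simp add: tri_def D_def)
  define \<phi> where "\<phi> x = cross (b - a) (x - a) / D" for x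
  have vs: "vertices (convex hull {a, b, p}) - {p} = {a, b}" using vertices_tri[OF t] tri_distinct[OF t] by auto
  have "\<phi> = (\<lambda>x. (vector [- ((b - a) $ 2) / D, (b - a) $ 1 / D] :: real^2) \<bullet> x + - cross (b - a) a / D)"
    by (auto simp: \<phi>_def fun_eq_iff cross_def inner_vec_def sum_2 algebra_simps add_divide_distrib diff_divide_distrib)
  then have "\<phi> \<in> P1" unfolding P1_def by blast
  moreover have "\<phi> p = 1" "\<phi> a = 0" "\<phi> b = 0" using D by (simp_all add: \<phi>_def D_def cross_def algebra_simps)
  ultimately have ex: "\<phi> \<in> P1 \<and> \<phi> p = 1 \<and> (\<forall>q\<in>vertices (convex hull {a, b, p}) - {p}. \<phi> q = 0)" unfolding vs by simp
  have "nodal (convex hull {a, b, p}) p = \<phi>"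
    unfolding nodal_def
  proof (rule the_equality[of "\<lambda>\<phi>. \<phi> \<in> P1 \<and> \<phi> p = 1 \<and> (\<forall>q\<in>vertices (convex hull {a, b, p}) - {p}. \<phi> q = 0)", OF ex])
    fix \<psi> assume \<psi>: "\<psi> \<in> P1 \<and> \<psi> p = 1 \<and> (\<forall>q\<in>vertices (convex hull {a, b, p}) - {p}. \<psi> q = 0)"
    then have "\<psi> p = 1" "\<psi> a = 0" "\<psi> b = 0" unfolding vs by auto
    then have "\<psi> x = \<phi> x" for x unfolding P1_iff_cross[OF t conjunct1[OF \<psi>], of x] by (simp add: \<phi>_def D_def)
    then show "\<psi> = \<phi>" by (rule ext)
  qed
  then show ?thesis using ex by simp
qed

lemma data_avg_on_affine:
  assumes t: "tri a b p"
  shows "\<exists>\<alpha> \<beta>. \<forall>x. data_avg_on f (convex hull {a, b, p}) x = \<alpha> \<bullet> x + \<beta>"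
proof -
  define K where "K = convex hull {a, b, p}"
  have s: "{b, p, a} = {a, b, p}" "{p, a, b} = {a, b, p}" by auto
  have "nodal K q \<in> P1" if "q \<in> {a, b, p}" for q
    using that nodal_P1[OF t] nodal_P1[OF tri_rotate[OF t]] nodal_P1[OF tri_rotate[OF tri_rotate[OF t]]] by (auto simp: K_def s)
  then have "\<forall>q\<in>{a, b, p}. \<exists>A B. \<forall>x. nodal K q x = A \<bullet> x + B" unfolding P1_def by (auto simp: fun_eq_iff)
  then obtain A B where AB: "\<And>q x. q \<in> {a, b, p} \<Longrightarrow> nodal K q x = A q \<bullet> x + B q" by metis
  define k where "k q = L2_inner K f (nodal K q) / L2_inner K (\<lambda>_. 1) (nodal K q)" for q
  have "data_avg_on f K x = (\<Sum>q\<in>{a, b, p}. k q *\<^sub>R A q) \<bullet> x + (\<Sum>q\<in>{a, b, p}. k q * B q)" for x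
    unfolding data_avg_on_def k_def[symmetric] using vertices_tri[OF t]
    by (simp add: K_def[symmetric] AB inner_sum_left sum.distrib[symmetric] distrib_left del: sum.insert)
  then show ?thesis unfolding K_def by blast
qed

section \<open>Residual equations\<close>

lemma integral_gradient_bump_ball:
  assumes r: "0 < r" and U: "cball c r \<subseteq> U"
  shows "(LINT x:U|lebesgue. grad (bump c r) x) = 0"
proof -
  have "(LINT x:U|lebesgue. grad (bump c r) x) = (\<integral>x. grad (bump c r) x \<partial>lebesgue)"
    by (rule set_integral_support) (use U grad_bump_eq_0[OF r, of c] in force)
  also have "\<dots> = 0"
    by (rule integral_gradient_zero(1)[OF bump_props(1)[OF r] bump_props(3)[OF r] compact_cball[of c r]])
      (use bump_eq_0[OF r, of c] in auto)
  finally show ?thesis .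
qed

text \<open>From x0 one moves by r/2 along the gradient, in the direction in which the modulus of
  the function grows; this gains r/2 times the norm of \<alpha>. Inside the disc of radius r/4 at
  most half of this gain is lost.\<close>

lemma affine_large_on_ball:
  fixes \<alpha> :: "'a::euclidean_space"
  assumes r: "0 < r"
  obtains c \<sigma> where "dist x0 c \<le> r / 2" "\<sigma> = 1 \<or> \<sigma> = -1"
    "\<And>x. dist c x \<le> r / 4 \<Longrightarrow> \<bar>\<alpha> \<bullet> x0 + \<beta>\<bar> + norm \<alpha> * r / 4 \<le> \<sigma> * (\<alpha> \<bullet> x + \<beta>)"
proof -
  define A where "A = \<alpha> \<bullet> x0 + \<beta>"
  define \<sigma> where "\<sigma> = (if A \<ge> 0 then 1 else -1 :: real)"
  define c where "c = x0 + (\<sigma> * (r / 2)) *\<^sub>R (\<alpha> /\<^sub>R norm \<alpha>)"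
  have s: "\<sigma> = 1 \<or> \<sigma> = -1" "\<sigma> * \<sigma> = 1" "\<sigma> * A = \<bar>A\<bar>" "\<bar>\<sigma>\<bar> = 1" by (auto simp: \<sigma>_def)
  have "dist x0 c \<le> r / 2" using r s by (cases "\<alpha> = 0") (simp_all add: c_def dist_norm abs_mult)
  moreover have "\<bar>A\<bar> + norm \<alpha> * r / 4 \<le> \<sigma> * (\<alpha> \<bullet> x + \<beta>)" if x: "dist c x \<le> r / 4" for x
  proof -
    have "\<alpha> \<bullet> x + \<beta> = A + \<alpha> \<bullet> (c - x0) + \<alpha> \<bullet> (x - c)" by (simp add: A_def inner_diff_right)
    also have "\<alpha> \<bullet> (c - x0) = \<sigma> * (r / 2) * norm \<alpha>"
      by (cases "\<alpha> = 0") (simp_all add: c_def dot_square_norm power2_eq_square)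
    finally have e: "\<alpha> \<bullet> x + \<beta> = A + \<sigma> * (r / 2) * norm \<alpha> + \<alpha> \<bullet> (x - c)" .
    have "\<sigma> * (\<alpha> \<bullet> x + \<beta>) = \<sigma> * A + (\<sigma> * \<sigma>) * (r / 2) * norm \<alpha> + \<sigma> * (\<alpha> \<bullet> (x - c))"
      unfolding e by (simp only: distrib_left mult.assoc)
    moreover have "\<bar>\<sigma> * (\<alpha> \<bullet> (x - c))\<bar> \<le> norm \<alpha> * (r / 4)"
      using Cauchy_Schwarz_ineq2[of \<alpha> "x - c"] x s(4) mult_left_mono[of "norm (x - c)" "r / 4" "norm \<alpha>"]
      by (simp add: abs_mult dist_norm norm_minus_commute)
    ultimately show ?thesis unfolding s(2,3) A_def[symmetric] by (simp add: mult.commute)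
  qed
  ultimately show ?thesis using that[of c \<sigma>] s(1) by (simp add: A_def)
qed

locale ldg_mesh = mesh +
  fixes \<theta> g :: real and f u lam uh lamh :: "real^2 \<Rightarrow> real"
  assumes \<theta>: "0 < \<theta>" "minimal_angle \<theta> T" and g: "0 < g" and f: "f \<in> L2_space lebesgue \<Omega>"
    and u: "u \<in> H1 \<Omega>" and lam: "contact_multiplier \<Omega> \<Gamma>1 g f u lam"
    and uh: "uh \<in> Vh \<Omega> T" and lamh: "lamh \<in> Linf_space arclength (Gamma2 \<Omega> \<Gamma>1)"
begin

text \<open>By \<open>tri_area\<close> twice the area of an element is at least \<open>kap\<close>
  h^2, where h is its diameter. All radii of bumps below are multiples of \<open>kap\<close> times a
  diameter or an edge length.\<close>

definition kap :: real where "kap = sin \<theta> / 2"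
definition Hd :: real where "Hd = diameter (closure \<Omega>)"
text \<open>The constant gradient of \<open>uh\<close> on an element.\<close>

definition al :: "(real^2) set \<Rightarrow> real^2" where "al K = (SOME a. \<exists>b. \<forall>x\<in>interior K. uh x = a \<bullet> x + b)"
definition Gu :: "real^2 \<Rightarrow> real^2" where "Gu = weak_grad \<Omega> u"
definition err :: "real^2 \<Rightarrow> real" where "err x = u x - uh x"
text \<open>The norm of the element residual, since the Laplacian of \<open>uh\<close> vanishes
  inside an element.\<close>

definition R :: "(real^2) set \<Rightarrow> real" where "R K = L2_norm lebesgue (interior K) (\<lambda>x. f x - uh x)"

lemma Os: "\<Omega> \<in> sets lebesgue" "\<Omega> \<inter> space lebesgue \<in> sets lebesgue"
  using O(1) by auto

lemma Ks: "interior K \<in> sets lebesgue" "interior K \<inter> space lebesgue \<in> sets lebesgue"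
  by auto

lemma shape:
  assumes K: "K \<in> T" and t: "tri a b p" "K = convex hull {a, b, p}"
  shows "0 < kap" "kap < 1" "kap * (diameter K)\<^sup>2 \<le> cross (b - a) (p - a)" "0 < diameter K" "diameter K \<le> Hd"
    "kap * diameter K \<le> norm (b - a)" "norm (b - a) \<le> diameter K"
proof -
  have v: "vertices K = {a, b, p}" using vertices_tri[OF t(1)] t(2) by simp
  have "\<theta> \<le> vertex_angle q r s" if "{a, b, p} = {q, r, s}" for q r s
    using \<theta>(2) K v that unfolding minimal_angle_def by simp
  note A = tri_area[OF t(1) \<theta>(1) this]
  show k: "0 < kap" using A(1) by (simp add: kap_def)
  show "kap < 1" unfolding kap_def using sin_le_one[of \<theta>] by linarith
  show D: "kap * (diameter K)\<^sup>2 \<le> cross (b - a) (p - a)" using A(2) t(2) by (simp add: kap_def)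
  show ab: "norm (b - a) \<le> diameter K" using tri_side_le_diameter(1) t(2) by blast
  show d: "0 < diameter K"
  proof -
    have "0 < norm (b - a)" using tri_distinct[OF t(1)] by auto
    then show ?thesis using ab by linarith
  qed
  have "norm (p - a) \<le> diameter K" using tri_side_le_diameter(3)[of a p b] t(2) by (simp add: norm_minus_commute)
  \<comment> \<open>Twice the area is at most the length of one side times the diameter, so no side
    is shorter than \<open>kap\<close> times the diameter.\<close>
  then have "norm (b - a) * norm (p - a) \<le> norm (b - a) * diameter K" by (intro mult_left_mono) auto
  then have "kap * diameter K * diameter K \<le> norm (b - a) * diameter K"
    using D abs_cross_le[of "b - a" "p - a"] by (simp add: power2_eq_square mult.assoc)
  then show "kap * diameter K \<le> norm (b - a)" using d by simp
  show "diameter K \<le> Hd" unfolding Hd_def by (rule diameter_subset[OF elem_sub[OF K] bounded_closure[OF O(2)]])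
qed

lemma shape_elem:
  assumes K: "K \<in> T"
  shows "0 < kap" "kap < 1" "0 < diameter K" "diameter K \<le> Hd"
  using elem_tri[OF K] shape[OF K] by blast+

lemma uh_affine:
  assumes K: "K \<in> T"
  obtains b where "\<And>x. x \<in> interior K \<Longrightarrow> uh x = al K \<bullet> x + b"
proof -
  obtain q where q: "q \<in> P1" "\<And>x. x \<in> interior K \<Longrightarrow> uh x = q x" using uh K by (auto simp: Vh_def)
  then have "\<exists>a b. \<forall>x\<in>interior K. uh x = a \<bullet> x + b" by (auto simp: P1_def)
  then have "\<exists>b. \<forall>x\<in>interior K. uh x = al K \<bullet> x + b" unfolding al_def by (rule someI_ex)
  then show ?thesis using that by blast
qed

lemma uh_grad:
  assumes K: "K \<in> T" and x: "x \<in> interior K"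
  shows "grad uh x = al K" "laplacian uh x = 0"
proof -
  obtain b where b: "\<And>x. x \<in> interior K \<Longrightarrow> uh x = al K \<bullet> x + b" by (rule uh_affine[OF K]) blast
  have g: "grad uh y = al K" if y: "y \<in> interior K" for y
  proof -
    have "((\<lambda>x. al K \<bullet> x + b) has_derivative (\<lambda>h. al K \<bullet> h)) (at y)" by (auto intro!: derivative_eq_intros)
    then have "(uh has_derivative (\<lambda>h. al K \<bullet> h)) (at y)"
      by (rule has_derivative_transform_within_open[OF _ open_interior y]) (simp add: b)
    then show ?thesis by (rule grad_eqI)
  qed
  then show "grad uh x = al K" using x .
  have "grad (\<lambda>y. grad uh y $ i) x = 0" for i
  proof -
    have "((\<lambda>_. al K $ i) has_derivative (\<lambda>h. 0 \<bullet> h)) (at x)" by simp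
    then have "((\<lambda>y. grad uh y $ i) has_derivative (\<lambda>h. 0 \<bullet> h)) (at x)"
      by (rule has_derivative_transform_within_open[OF _ open_interior x]) (simp add: g)
    then show ?thesis by (rule grad_eqI)
  qed
  then show "laplacian uh x = 0" by (simp add: laplacian_def)
qed

lemma inner_limit_grad:
  assumes K: "K \<in> T" and x: "x \<in> K"
  shows "inner_limit K (grad uh) x = al K"
proof -
  obtain a b p where t: "tri a b p" "K = convex hull {a, b, p}" using elem_tri[OF K] by blast
  define c where "c = (1/3) *\<^sub>R a + (1/3) *\<^sub>R b + (1/3) *\<^sub>R p"
  have D: "0 < cross (b - a) (p - a)" using t(1) by (simp add: tri_def)
  have s1: "1/3 + 1/3 + (1/3 :: real) = 1" by simp
  have "c \<in> interior K" unfolding t(2) tri_interior[OF t(1)] c_def cross_combination[OF s1] using D by simp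
  then have "interior K \<noteq> {}" by blast
  then have cl: "closure (interior K) = K" using convex_closure_interior[OF elem_convex[OF K]] elem_closed[OF K] by simp
  \<comment> \<open>\<open>inner_limit\<close> is a limit along a filter that is trivial unless x is
    a limit point of the interior; only for a nontrivial filter is the value of \<open>Lim\<close>
    determined by convergence.\<close>
  have lim: "x islimpt interior K"
  proof (cases "x \<in> interior K")
    case True
    then have "x islimpt UNIV" "open (interior K)" by auto
    then show ?thesis using True by (metis inf_top.left_neutral islimpt_Int_eventually eventually_at_in_open' eventually_mono)
  next
    case False then show ?thesis using x cl by (auto simp: closure_def)
  qed
  have "(grad uh \<longlongrightarrow> al K) (at x within interior K)"
    by (rule Lim_transform_eventually[OF tendsto_const]) (auto simp: eventually_at_filter uh_grad[OF K])
  then show ?thesis unfolding inner_limit_def using lim by (intro tendsto_Lim) (simp_all add: trivial_limit_within)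
qed

lemma int_fin: "K \<in> T \<Longrightarrow> emeasure lebesgue (interior K) < \<infinity>"
  using emeasure_bounded_finite[of "interior K"] elem_compact[of K] bounded_interior[of K] compact_imp_bounded[of K] by simp

lemma const_L2: "K \<in> T \<Longrightarrow> (\<lambda>x. c :: 'b::euclidean_space) \<in> L2_space lebesgue (interior K)"
  by (rule L2_space_bounded[OF Ks(1) int_fin, where B = "norm c"])
    (auto simp: set_borel_measurable_def intro!: borel_measurable_scaleR borel_measurable_indicator)

lemma to_elem_L2: "K \<in> T \<Longrightarrow> q \<in> L2_space lebesgue \<Omega> \<Longrightarrow> q \<in> L2_space lebesgue (interior K)"
  by (rule L2_space_mono[OF Ks(1) Os(1) interior_elem_sub])

lemma L2_facts:
  assumes K: "K \<in> T"
  shows "uh \<in> L2_space lebesgue (interior K)" "f \<in> L2_space lebesgue (interior K)" "u \<in> L2_space lebesgue (interior K)"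
    "Gu \<in> L2_space lebesgue (interior K)" "err \<in> L2_space lebesgue (interior K)"
    "(\<lambda>x. Gu x - al K) \<in> L2_space lebesgue (interior K)" "(\<lambda>x. f x - uh x) \<in> L2_space lebesgue (interior K)"
    "is_weak_grad (interior K) err (\<lambda>x. Gu x - al K)"
proof -
  have uL: "u \<in> L2_space lebesgue \<Omega>" and uhL: "uh \<in> L2_space lebesgue \<Omega>" using u uh by (auto simp: H1_def Vh_def)
  show 1: "uh \<in> L2_space lebesgue (interior K)" "f \<in> L2_space lebesgue (interior K)"
    using to_elem_L2[OF K] uhL f by auto
  show 2: "u \<in> L2_space lebesgue (interior K)" "Gu \<in> L2_space lebesgue (interior K)"
    using to_elem_L2[OF K] uL weak_grad_H1(1)[OF u] by (auto simp: Gu_def)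
  show "err \<in> L2_space lebesgue (interior K)" unfolding err_def[abs_def] by (rule L2_space_diff[OF Ks(2) 2(1) 1(1)])
  show "(\<lambda>x. Gu x - al K) \<in> L2_space lebesgue (interior K)" by (rule L2_space_diff[OF Ks(2) 2(2) const_L2[OF K]])
  show "(\<lambda>x. f x - uh x) \<in> L2_space lebesgue (interior K)" by (rule L2_space_diff[OF Ks(2) 1(2,1)])
  obtain b where b: "\<And>x. x \<in> interior K \<Longrightarrow> uh x = al K \<bullet> x + b" by (rule uh_affine[OF K]) blast
  have "is_weak_grad (interior K) (\<lambda>x. al K \<bullet> x + b) (\<lambda>_. al K)"
    by (rule is_weak_grad_smooth) (auto intro!: derivative_eq_intros)
  then have wh: "is_weak_grad (interior K) uh (\<lambda>_. al K)" using b by (simp cong: is_weak_grad_cong)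
  have wu: "is_weak_grad (interior K) u Gu" unfolding Gu_def
    by (rule is_weak_grad_subset[OF weak_grad_H1(2)[OF u] interior_elem_sub[OF K]])
  have "is_weak_grad (interior K) (\<lambda>x. u x + -1 * uh x) (\<lambda>x. Gu x + -1 *\<^sub>R al K)"
    by (rule is_weak_grad_add[OF Ks(1) 2 wu _ _ is_weak_grad_scaleR[OF wh]])
      (use L2_space_scaleR[OF Ks(2) 1(1), of "-1"] const_L2[OF K, of "- al K"] in simp_all)
  then show "is_weak_grad (interior K) err (\<lambda>x. Gu x - al K)" by (simp add: err_def[abs_def])
qed

lemma AE_interior: "AE x in lebesgue. \<forall>K\<in>T. x \<in> K \<longrightarrow> x \<in> interior K"
proof -
  have "AE x in lebesgue. \<forall>K\<in>T. x \<notin> frontier K"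
    unfolding AE_ball_countable[OF countable_finite[OF fin]]
    by (intro ballI AE_not_in) (simp add: negligible_iff_null_sets[symmetric] negligible_convex_frontier[OF elem_convex])
  then show ?thesis by eventually_elim (use elem_closed in \<open>auto simp: frontier_def\<close>)
qed

text \<open>\<open>norm1h\<close> integrates a selected gradient over the closed triangle; its
  contribution is that of any weak gradient on the interior.\<close>

lemma norm1h_term:
  assumes K: "K \<in> T" "K \<subseteq> \<omega>" and v: "v \<in> L2_space lebesgue (interior K)" "G \<in> L2_space lebesgue (interior K)" "is_weak_grad (interior K) v G"
  shows "(LINT x:\<omega> \<inter> K|lebesgue. (norm (weak_grad (interior (K \<inter> \<omega>)) v x))\<^sup>2 + (v x)\<^sup>2)
    = (L2_norm lebesgue (interior K) G)\<^sup>2 + (L2_norm lebesgue (interior K) v)\<^sup>2"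
proof -
  have eq: "K \<inter> \<omega> = K" "\<omega> \<inter> K = K" using K(2) by auto
  have i: "set_integrable lebesgue (interior K) (\<lambda>x. (norm (G x))\<^sup>2)" "set_integrable lebesgue (interior K) (\<lambda>x. (norm (v x))\<^sup>2)"
    using v by (auto simp: L2_space_iff)
  have m: "set_borel_measurable lebesgue (interior K) (\<lambda>x. (norm (G x))\<^sup>2 + (norm (v x))\<^sup>2)"
    using set_integral_add(1)[OF i] by (auto simp: set_integrable_def set_borel_measurable_def)
  have "(L2_norm lebesgue (interior K) G)\<^sup>2 + (L2_norm lebesgue (interior K) v)\<^sup>2
    = (LINT x:interior K|lebesgue. (norm (G x))\<^sup>2) + (LINT x:interior K|lebesgue. (norm (v x))\<^sup>2)"
    by (simp add: L2_norm_def set_lebesgue_integral_def)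
  also have "\<dots> = (LINT x:interior K|lebesgue. (norm (G x))\<^sup>2 + (norm (v x))\<^sup>2)"
    using set_integral_add(2)[OF i] by simp
  also have "\<dots> = (LINT x:K|lebesgue. (norm (weak_grad (interior K) v x))\<^sup>2 + (v x)\<^sup>2)"
  proof (rule set_integral_change_set(2)[OF complete_measure_lebesgue m])
    show "AE x in lebesgue. indicator (interior K) x *\<^sub>R ((norm (G x))\<^sup>2 + (norm (v x))\<^sup>2) =
       indicator K x *\<^sub>R ((norm (weak_grad (interior K) v x))\<^sup>2 + (v x)\<^sup>2)"
      using weak_grad_eq_AE[OF open_interior v(2,3)] AE_interior
    proof eventually_elim
      case (elim x)
      then show ?case using K(1) interior_subset[of K] by (auto simp: indicator_def)
    qed
  qed
  finally show ?thesis unfolding eq by simp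
qed

lemma norm1h_ge:
  assumes K: "K \<in> T" "K \<subseteq> \<omega>"
  shows "L2_norm lebesgue (interior K) err \<le> norm1h T \<omega> err" "L2_norm lebesgue (interior K) (\<lambda>x. Gu x - al K) \<le> norm1h T \<omega> err"
proof -
  note L = L2_facts[OF K(1)]
  define q where "q K' = (LINT x:\<omega> \<inter> K'|lebesgue. (norm (weak_grad (interior (K' \<inter> \<omega>)) err x))\<^sup>2 + (err x)\<^sup>2)" for K'
  have "0 \<le> q K'" for K' by (simp add: q_def set_lebesgue_integral_def)
  then have "q K \<le> sum q T" using fin K(1) by (intro member_le_sum) auto
  then have "(L2_norm lebesgue (interior K) (\<lambda>x. Gu x - al K))\<^sup>2 + (L2_norm lebesgue (interior K) err)\<^sup>2 \<le> sum q T"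
    using norm1h_term[OF K L(5,6,8)] by (simp add: q_def)
  moreover have "norm1h T \<omega> err = sqrt (sum q T)" by (simp add: norm1h_def q_def)
  ultimately show "L2_norm lebesgue (interior K) err \<le> norm1h T \<omega> err" "L2_norm lebesgue (interior K) (\<lambda>x. Gu x - al K) \<le> norm1h T \<omega> err"
    by (auto intro!: real_le_rsqrt) (smt (verit) zero_le_power2)+
qed

text \<open>Almost every point of an element is interior to it, and the interiors of different
  elements are disjoint.\<close>

lemma integral_split:
  fixes F :: "real^2 \<Rightarrow> 'b::{banach, second_countable_topology}"
  assumes P: "P \<subseteq> T" and F: "set_integrable lebesgue \<Omega> F" and z: "\<And>x. x \<in> \<Omega> \<Longrightarrow> x \<notin> \<Union>P \<Longrightarrow> F x = 0"
  shows "(LINT x:\<Omega>|lebesgue. F x) = (\<Sum>K\<in>P. LINT x:interior K|lebesgue. F x)"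
proof -
  have finP: "finite P" using P fin by (rule finite_subset)
  have m: "set_borel_measurable lebesgue \<Omega> F" using F by (auto simp: set_integrable_def set_borel_measurable_def)
  have "(LINT x:\<Omega>|lebesgue. F x) = (LINT x:(\<Union>K\<in>P. interior K)|lebesgue. F x)"
  proof (rule set_integral_change_set(2)[OF complete_measure_lebesgue m])
    show "AE x in lebesgue. indicator \<Omega> x *\<^sub>R F x = indicator (\<Union>K\<in>P. interior K) x *\<^sub>R F x"
      using AE_interior
    proof eventually_elim
      case (elim x)
      consider "x \<in> (\<Union>K\<in>P. interior K)" | "x \<notin> (\<Union>K\<in>P. interior K)" "x \<in> \<Omega>" | "x \<notin> (\<Union>K\<in>P. interior K)" "x \<notin> \<Omega>" by blast
      then show ?case
      proof cases
        case 1 then have "x \<in> \<Omega>" using interior_elem_sub P by blast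
        then show ?thesis using 1 by simp
      next
        case 2 then have "x \<notin> \<Union>P" using elim P by blast
        then show ?thesis using z 2 by simp
      qed simp
    qed
  qed
  also have "\<dots> = (\<Sum>K\<in>P. LINT x:interior K|lebesgue. F x)"
  proof (rule set_integral_finite_Union[OF finP])
    show "disjoint_family_on interior P" unfolding disjoint_family_on_def
    proof (intro ballI impI)
      fix K K' assume K: "K \<in> P" "K' \<in> P" "K \<noteq> K'"
      have "interior K \<inter> K' = {}" using inter_proper(3)[of K K'] K P by blast
      then show "interior K \<inter> interior K' = {}" using interior_subset[of K'] by blast
    qed
    show "set_integrable lebesgue (interior K) F" if "K \<in> P" for K
      by (rule set_integrable_subset[OF F]) (use interior_elem_sub P that in auto)
  qed auto
  finally show ?thesis .
qed

text \<open>The weak equation for u, tested with the bump cut off to S and written on the elements P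
  that carry it. Subtracting the contribution of \<open>uh\<close> leaves the error on the left and
  f - uh on the right, and the constant gradient \<open>al K\<close> enters only through the
  integral of the gradient of the bump, which later becomes an edge term. The choice S = UNIV serves
  elements and interior edges, S = K serves friction edges; \<open>fr\<close> keeps the disc away
  from the frontier of S inside \<Omega>.\<close>

lemma residual_eq:
  assumes P: "P \<subseteq> T" "\<And>K. K \<in> P \<Longrightarrow> interior K \<subseteq> S" and S: "closed S" and r: "0 < \<rho>"
    and fr: "\<And>x. x \<in> \<Omega> \<Longrightarrow> x \<in> frontier S \<Longrightarrow> \<rho> < dist c x"
    and supp: "\<And>x. x \<in> \<Omega> \<Longrightarrow> x \<in> S \<Longrightarrow> dist c x < \<rho> \<Longrightarrow> x \<in> \<Union>P"
    and vc: "continuous_on (closure \<Omega>) (\<lambda>x. indicator S x * bump c \<rho> x)"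
    and v1: "AE x in arclength. x \<in> \<Gamma>1 \<longrightarrow> indicator S x * bump c \<rho> x = 0"
  shows "(\<Sum>K\<in>P. (LINT x:interior K|lebesgue. (Gu x - al K) \<bullet> grad (bump c \<rho>) x) + (LINT x:interior K|lebesgue. err x * bump c \<rho> x)
      + al K \<bullet> (LINT x:interior K|lebesgue. grad (bump c \<rho>) x))
     + (LINT x:Gamma2 \<Omega> \<Gamma>1|arclength. g * lam x * (indicator S x * bump c \<rho> x))
     = (\<Sum>K\<in>P. LINT x:interior K|lebesgue. (f x - uh x) * bump c \<rho> x)"
proof -
  define b where "b = bump c \<rho>"
  define v where "v x = indicator S x * b x" for x
  define Gv where "Gv x = indicator S x *\<^sub>R grad b x" for x
  note bp = bump_props[OF r, of _ c, folded b_def]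
  have Ss: "S \<in> sets lebesgue" using S by auto
  have w: "is_weak_grad \<Omega> v Gv" unfolding v_def Gv_def
  proof (rule is_weak_grad_indicator[OF S bp(1)[OF Os(1)] bp(3)[OF Os(1)]])
    fix x assume "x \<in> \<Omega>" "x \<in> frontier S"
    then have "x \<in> - cball c \<rho>" using fr by force
    moreover have "b y = 0 \<and> grad b y = 0" if "y \<in> - cball c \<rho>" for y
      using that bump_eq_0[OF r, of c y] grad_bump_eq_0[OF r, of c y] by (simp add: b_def)
    ultimately show "\<exists>W. open W \<and> x \<in> W \<and> (\<forall>y\<in>W. b y = 0 \<and> grad b y = 0)"
      by (intro exI[of _ "- cball c \<rho>"]) auto
  qed
  have OS: "\<Omega> \<inter> S \<in> sets lebesgue" using Os Ss by auto
  have vL: "v \<in> L2_space lebesgue \<Omega>"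
    by (rule L2_change_set(1)[OF complete_measure_lebesgue OS Os(1) bp(4)[OF OS]]) (auto simp: v_def indicator_def)
  have GvL: "Gv \<in> L2_space lebesgue \<Omega>"
    by (rule L2_change_set(1)[OF complete_measure_lebesgue OS Os(1) bp(5)[OF OS]]) (auto simp: Gv_def indicator_def)
  have vH: "v \<in> H1 \<Omega>" unfolding H1_def using vL GvL w by blast
  have vcc: "continuous_on (closure \<Omega>) v" using vc by (simp add: v_def[abs_def] b_def)
  note tr = is_trace_continuous(2)[OF O(1,2) frontier_measure vH vcc]
  have edge: "AE x in arclength. x \<in> e \<longrightarrow> tr \<Omega> v x = v x" if e: "e \<in> boundary_edges T" for e
  proof -
    obtain K where K: "K \<in> T" "e \<in> sides K" using e by (auto simp: boundary_edges_def edges_def)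
    obtain a b p where t: "tri a b p" "K = convex hull {a, b, p}" "e = closed_segment a b"
      using side_tri[OF simplex[OF K(1)] K(2)] by blast
    show ?thesis unfolding t(3)
      by (rule trace_AE_edge[OF O(1,2) frontier_measure t(1) _ _ vH vcc tr])
        (use interior_elem_sub[OF K(1)] boundary_edge_frontier[OF K e] t in auto)
  qed
  have finb: "finite (boundary_edges T)" using finite_edges by (auto simp: boundary_edges_def)
  have "AE x in arclength. \<forall>e\<in>boundary_edges T. x \<in> e \<longrightarrow> tr \<Omega> v x = v x"
    unfolding AE_ball_countable[OF countable_finite[OF finb]] using edge by blast
  moreover have "AE x in arclength. x \<notin> (\<Union>K\<in>T. vertices K)" by (rule AE_not_in[OF null_vertices])
  ultimately have trv: "AE x in arclength. x \<in> frontier \<Omega> \<longrightarrow> tr \<Omega> v x = v x"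
    by eventually_elim (use frontier_sub in blast)
  have G1f: "\<Gamma>1 \<subseteq> frontier \<Omega>" using G1 by (simp add: closedin_subset[of "top_of_set (frontier \<Omega>)", simplified])
  have "AE x in arclength. x \<in> \<Gamma>1 \<longrightarrow> tr \<Omega> v x = 0"
    using trv v1 by eventually_elim (use G1f in \<open>auto simp: v_def b_def\<close>)
  then have vV: "v \<in> V_space \<Omega> \<Gamma>1" using vH by (simp add: V_space_def)
  have id: "a_form \<Omega> u v + (LINT x:Gamma2 \<Omega> \<Gamma>1|arclength. g * lam x * tr \<Omega> v x) = L2_inner \<Omega> f v"
    using lam vV unfolding contact_multiplier_def by blast
  have Gcl: "closed \<Gamma>1" using G1 closedin_closed_trans frontier_closed by blast
  have G2s: "Gamma2 \<Omega> \<Gamma>1 \<in> sets arclength" using Gcl by (intro borel_arclength) auto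
  have bdry: "(LINT x:Gamma2 \<Omega> \<Gamma>1|arclength. g * lam x * tr \<Omega> v x) = (LINT x:Gamma2 \<Omega> \<Gamma>1|arclength. g * lam x * v x)"
  proof (rule set_integral_change_set(2)[OF complete_measure_arclength, symmetric])
    have lm: "(\<lambda>x. indicator (Gamma2 \<Omega> \<Gamma>1) x *\<^sub>R lam x) \<in> borel_measurable arclength"
      using lam G2s by (auto simp: contact_multiplier_def Linf_space_def borel_measurable_restrict_space_iff)
    have "continuous_on (frontier \<Omega>) v" using vcc by (rule continuous_on_subset) (auto simp: frontier_def)
    then have "(\<lambda>x. indicator (frontier \<Omega>) x *\<^sub>R v x) \<in> borel_measurable arclength"
      by (intro measurable_arclength borel_measurable_continuous_on_indicator) auto
    then have "(\<lambda>x. g * ((indicator (Gamma2 \<Omega> \<Gamma>1) x *\<^sub>R lam x) * (indicator (frontier \<Omega>) x *\<^sub>R v x))) \<in> borel_measurable arclength"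
      using lm by (intro borel_measurable_times borel_measurable_const)
    moreover have "(\<lambda>x. g * ((indicator (Gamma2 \<Omega> \<Gamma>1) x *\<^sub>R lam x) * (indicator (frontier \<Omega>) x *\<^sub>R v x))) =
      (\<lambda>x. indicator (Gamma2 \<Omega> \<Gamma>1) x *\<^sub>R (g * lam x * v x))" by (auto simp: indicator_def)
    ultimately show "set_borel_measurable arclength (Gamma2 \<Omega> \<Gamma>1) (\<lambda>x. g * lam x * v x)"
      by (simp only: set_borel_measurable_def)
    show "AE x in arclength. indicator (Gamma2 \<Omega> \<Gamma>1) x *\<^sub>R (g * lam x * v x) = indicator (Gamma2 \<Omega> \<Gamma>1) x *\<^sub>R (g * lam x * tr \<Omega> v x)"
      using trv by eventually_elim (auto simp: indicator_def)
  qed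
  have uL: "u \<in> L2_space lebesgue \<Omega>" using u by (simp add: H1_def)
  have GuL: "Gu \<in> L2_space lebesgue \<Omega>" unfolding Gu_def by (rule weak_grad_H1(1)[OF u])
  have wgAE: "AE x in lebesgue. x \<in> \<Omega> \<longrightarrow> weak_grad \<Omega> v x = Gv x" by (rule weak_grad_eq_AE[OF O(1) GvL w])
  note iG = set_cauchy_schwarz(1)[OF Os(2) GuL GvL] and iu = set_cauchy_schwarz(1)[OF Os(2) uL vL] and iff = set_cauchy_schwarz(1)[OF Os(2) f vL]
  \<comment> \<open>\<open>weak_grad\<close> selects some gradient of v; it equals the explicit
    \<open>Gv\<close> almost everywhere.\<close>
  have "(LINT x:\<Omega>|lebesgue. Gu x \<bullet> weak_grad \<Omega> v x) = (LINT x:\<Omega>|lebesgue. Gu x \<bullet> Gv x)"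
    by (rule set_integral_change_set(2)[OF complete_measure_lebesgue, symmetric])
      (use iG wgAE in \<open>auto simp: set_borel_measurable_def set_integrable_def indicator_def elim: eventually_mono\<close>)
  then have aform: "a_form \<Omega> u v = (LINT x:\<Omega>|lebesgue. Gu x \<bullet> Gv x) + (LINT x:\<Omega>|lebesgue. u x \<bullet> v x)"
    by (simp add: a_form_def Gu_def)
  have zb: "v x = 0" "Gv x = 0" if "x \<in> \<Omega>" "x \<notin> \<Union>P" for x
  proof -
    have "x \<notin> S \<or> \<rho> \<le> dist c x" using supp[OF that(1)] that(2) by force
    then show "v x = 0" "Gv x = 0" using bump_eq_0[OF r, of c x] grad_bump_eq_0[OF r, of c x] by (auto simp: v_def Gv_def b_def)
  qed
  have vb: "v x = b x" "Gv x = grad b x" if "K \<in> P" "x \<in> interior K" for K x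
    using subsetD[OF P(2)[OF that(1)] that(2)] by (simp_all add: v_def Gv_def)
  have split: "(LINT x:\<Omega>|lebesgue. Gu x \<bullet> Gv x) = (\<Sum>K\<in>P. LINT x:interior K|lebesgue. Gu x \<bullet> grad b x)"
    "(LINT x:\<Omega>|lebesgue. u x \<bullet> v x) = (\<Sum>K\<in>P. LINT x:interior K|lebesgue. u x * b x)"
    "(LINT x:\<Omega>|lebesgue. f x \<bullet> v x) = (\<Sum>K\<in>P. LINT x:interior K|lebesgue. f x * b x)"
  proof -
    have sp: "(LINT x:\<Omega>|lebesgue. F x) = (\<Sum>K\<in>P. LINT x:interior K|lebesgue. F' x)"
      if "set_integrable lebesgue \<Omega> F" "\<And>x. x \<in> \<Omega> \<Longrightarrow> x \<notin> \<Union>P \<Longrightarrow> F x = 0" "\<And>K x. K \<in> P \<Longrightarrow> x \<in> interior K \<Longrightarrow> F x = F' x"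
      for F F' :: "real^2 \<Rightarrow> real"
    proof -
      have "(LINT x:\<Omega>|lebesgue. F x) = (\<Sum>K\<in>P. LINT x:interior K|lebesgue. F x)"
        by (rule integral_split[OF P(1) that(1,2)])
      also have "\<dots> = (\<Sum>K\<in>P. LINT x:interior K|lebesgue. F' x)"
        by (intro sum.cong refl set_lebesgue_integral_cong Ks(1)) (use that(3) in auto)
      finally show ?thesis .
    qed
    show "(LINT x:\<Omega>|lebesgue. Gu x \<bullet> Gv x) = (\<Sum>K\<in>P. LINT x:interior K|lebesgue. Gu x \<bullet> grad b x)"
      by (rule sp[OF iG]) (simp_all add: zb vb)
    show "(LINT x:\<Omega>|lebesgue. u x \<bullet> v x) = (\<Sum>K\<in>P. LINT x:interior K|lebesgue. u x * b x)"
      by (rule sp[OF iu]) (simp_all add: zb vb)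
    show "(LINT x:\<Omega>|lebesgue. f x \<bullet> v x) = (\<Sum>K\<in>P. LINT x:interior K|lebesgue. f x * b x)"
      by (rule sp[OF iff]) (simp_all add: zb vb)
  qed
  have elem: "(LINT x:interior K|lebesgue. (Gu x - al K) \<bullet> grad b x) + (LINT x:interior K|lebesgue. err x * b x)
      + al K \<bullet> (LINT x:interior K|lebesgue. grad b x)
     = (LINT x:interior K|lebesgue. Gu x \<bullet> grad b x) + (LINT x:interior K|lebesgue. u x * b x) - (LINT x:interior K|lebesgue. uh x * b x)"
    "(LINT x:interior K|lebesgue. (f x - uh x) * b x) = (LINT x:interior K|lebesgue. f x * b x) - (LINT x:interior K|lebesgue. uh x * b x)"
    if K: "K \<in> P" for K
  proof -
    have KT: "K \<in> T" using K P by blast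
    note L = L2_facts[OF KT] and bK = bp(4)[OF Ks(1)[of K]] and gK = bp(5)[OF Ks(1)[of K]]
    note i1 = set_cauchy_schwarz(1)[OF Ks(2) L(4) gK] and i2 = set_cauchy_schwarz(1)[OF Ks(2) L(3) bK, simplified]
      and i3 = set_cauchy_schwarz(1)[OF Ks(2) L(1) bK, simplified] and i4 = set_cauchy_schwarz(1)[OF Ks(2) L(2) bK, simplified]
      and i5 = set_cauchy_schwarz(1)[OF Ks(2) const_L2[OF KT, of "al K"] gK]
    have gi: "set_integrable lebesgue (interior K) (grad b)"
      using set_integral_scaleR_le(1)[OF Ks(2) const_L2[OF KT, of "1::real"] gK] by simp
    have "(LINT x:interior K|lebesgue. (Gu x - al K) \<bullet> grad b x) = (LINT x:interior K|lebesgue. Gu x \<bullet> grad b x) - (LINT x:interior K|lebesgue. al K \<bullet> grad b x)"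
      using set_integral_diff(2)[OF i1 i5] by (simp add: inner_diff_left)
    moreover have "(LINT x:interior K|lebesgue. al K \<bullet> grad b x) = al K \<bullet> (LINT x:interior K|lebesgue. grad b x)"
      using gi integral_inner_right[of "al K" lebesgue "\<lambda>x. indicator (interior K) x *\<^sub>R grad b x"]
      by (simp add: set_lebesgue_integral_def set_integrable_def)
    moreover have "(LINT x:interior K|lebesgue. err x * b x) = (LINT x:interior K|lebesgue. u x * b x) - (LINT x:interior K|lebesgue. uh x * b x)"
      using set_integral_diff(2)[OF i2 i3] by (simp add: err_def left_diff_distrib)
    ultimately show "(LINT x:interior K|lebesgue. (Gu x - al K) \<bullet> grad b x) + (LINT x:interior K|lebesgue. err x * b x)
      + al K \<bullet> (LINT x:interior K|lebesgue. grad b x)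
     = (LINT x:interior K|lebesgue. Gu x \<bullet> grad b x) + (LINT x:interior K|lebesgue. u x * b x) - (LINT x:interior K|lebesgue. uh x * b x)"
      by simp
    show "(LINT x:interior K|lebesgue. (f x - uh x) * b x) = (LINT x:interior K|lebesgue. f x * b x) - (LINT x:interior K|lebesgue. uh x * b x)"
      using set_integral_diff(2)[OF i4 i3] by (simp add: left_diff_distrib)
  qed
  have main: "(\<Sum>K\<in>P. LINT x:interior K|lebesgue. Gu x \<bullet> grad b x) + (\<Sum>K\<in>P. LINT x:interior K|lebesgue. u x * b x)
      + (LINT x:Gamma2 \<Omega> \<Gamma>1|arclength. g * lam x * v x) = (\<Sum>K\<in>P. LINT x:interior K|lebesgue. f x * b x)"
    using id unfolding aform bdry L2_inner_def split .
  show ?thesis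
    unfolding b_def[symmetric] v_def[symmetric] using main
    by (simp add: elem sum.distrib sum_subtractf cong: sum.cong)
qed

end

section \<open>Element and edge estimates\<close>

lemma poly_lipschitz_01: "\<exists>B\<ge>0. \<forall>s\<in>{0..1}. \<forall>t\<in>{0..1}. \<bar>poly p s - poly p t\<bar> \<le> B * \<bar>s - t :: real\<bar>"
proof -
  have "bounded (poly (pderiv p) ` {0..1})"
    by (intro compact_imp_bounded compact_continuous_image continuous_intros) auto
  then obtain B where B0: "B > 0" "\<forall>y\<in>poly (pderiv p) ` {0..1}. norm y \<le> B" unfolding bounded_pos by blast
  then have B: "\<And>x. x \<in> {0..1} \<Longrightarrow> \<bar>poly (pderiv p) x\<bar> \<le> B" "B > 0" by auto
  have "norm (poly p s - poly p t) \<le> B * norm (s - t)" if "s \<in> {0..1}" "t \<in> {0..1}" for s t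
  proof (rule field_differentiable_bound[of "{0..1}" "poly p" "poly (pderiv p)"])
    show "(poly p has_field_derivative poly (pderiv p) z) (at z within {0..1})" for z
      using poly_DERIV[of p z] by (rule has_field_derivative_at_within)
  qed (use B that in auto)
  then show ?thesis using B(2) by (intro exI[of _ B]) auto
qed

text \<open>Markov's inequality with an unspecified constant, by Lagrange interpolation at \<open>m + 1\<close> nodes.\<close>

lemma poly_markov:
  "\<exists>L\<ge>1. \<forall>c M. (\<forall>t\<in>{0..1}. \<bar>\<Sum>k\<le>m. c k * t ^ k\<bar> \<le> M) \<longrightarrow>
     (\<forall>s\<in>{0..1}. \<forall>t\<in>{0..1}. \<bar>(\<Sum>k\<le>m. c k * s ^ k) - (\<Sum>k\<le>m. c k * t ^ k)\<bar> \<le> L * M * \<bar>s - t :: real\<bar>)"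
proof -
  \<comment> \<open>Any m + 1 distinct nodes in [0, 1] would serve: they determine the polynomials
    of degree at most m.\<close>
  define nd where "nd j = real j / real (Suc m)" for j :: nat
  have nd_inj: "nd i = nd j \<longleftrightarrow> i = j" for i j by (simp add: nd_def)
  have nd01: "nd j \<in> {0..1}" if "j \<le> m" for j using that by (simp add: nd_def)
  define l where "l j = (\<Prod>i\<in>{..m} - {j}. smult (1 / (nd j - nd i)) [:- nd i, 1:])" for j
  have lj: "poly (l j) (nd i) = (if i = j then 1 else 0)" if "i \<le> m" for i j
  proof (cases "i = j")
    case True
    then show ?thesis by (auto simp: l_def poly_prod nd_inj diff_divide_distrib[symmetric] intro!: prod.neutral)
  next
    case False
    then show ?thesis using that by (auto simp: l_def poly_prod intro!: prod_zero bexI[of _ i])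
  qed
  have dl: "degree (l j) \<le> m" if "j \<le> m" for j
  proof -
    have "degree (l j) \<le> (\<Sum>i\<in>{..m} - {j}. degree (smult (1 / (nd j - nd i)) [:- nd i, 1:]))"
      using degree_prod_sum_le[of "{..m} - {j}" "\<lambda>i. smult (1 / (nd j - nd i)) [:- nd i, 1:]"] by (simp add: l_def o_def)
    also have "\<dots> \<le> (\<Sum>i\<in>{..m} - {j}. 1)" by (intro sum_mono) auto
    also have "\<dots> = m" using that by simp
    finally show ?thesis .
  qed
  obtain B where B: "\<And>j. B j \<ge> 0" "\<And>j s t. s \<in> {0..1} \<Longrightarrow> t \<in> {0..1} \<Longrightarrow> \<bar>poly (l j) s - poly (l j) t\<bar> \<le> B j * \<bar>s - t\<bar>"
  proof -
    have "\<forall>j. \<exists>B. 0 \<le> B \<and> (\<forall>s\<in>{0..1}. \<forall>t\<in>{0..1}. \<bar>poly (l j) s - poly (l j) t\<bar> \<le> B * \<bar>s - t\<bar>)"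
      using poly_lipschitz_01 by blast
    from choice[OF this] show ?thesis using that by blast
  qed
  \<comment> \<open>The Lipschitz constants of the Lagrange basis depend on m alone. The summand 1
    ensures L \<ge> 1, from which the next lemma obtains \<delta> \<le> 1/8.\<close>
  define L where "L = 1 + (\<Sum>j\<le>m. B j)"
  have L1: "L \<ge> 1" using B(1) by (simp add: L_def sum_nonneg)
  have main: "\<bar>(\<Sum>k\<le>m. c k * s ^ k) - (\<Sum>k\<le>m. c k * t ^ k)\<bar> \<le> L * M * \<bar>s - t\<bar>"
    if M: "\<forall>t\<in>{0..1}. \<bar>\<Sum>k\<le>m. c k * t ^ k\<bar> \<le> M" and st: "s \<in> {0..1}" "t \<in> {0..1}" for c M s t
  proof -
    define q where "q = (\<Sum>k\<le>m. monom (c k) k)"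
    have pq: "poly q x = (\<Sum>k\<le>m. c k * x ^ k)" for x by (simp add: q_def poly_sum poly_monom)
    have M0: "0 \<le> M" using M st(1) abs_ge_zero order_trans by blast
    \<comment> \<open>Both sides have degree at most m and agree at m + 1 nodes.\<close>
    have "q = (\<Sum>j\<le>m. smult (poly q (nd j)) (l j))"
    proof (rule poly_eqI_degree[of "nd ` {..m}"])
      fix x assume "x \<in> nd ` {..m}"
      then obtain i where i: "i \<le> m" "x = nd i" by auto
      have "poly (\<Sum>j\<le>m. smult (poly q (nd j)) (l j)) x = (\<Sum>j\<le>m. poly q (nd j) * (if i = j then 1 else 0))"
        unfolding poly_sum i(2) by (intro sum.cong refl) (simp add: lj i(1))
      also have "\<dots> = poly q x" using i by (simp add: if_distrib[of "\<lambda>z. _ * z"] sum.delta' cong: if_cong)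
      finally show "poly q x = poly (\<Sum>j\<le>m. smult (poly q (nd j)) (l j)) x" by simp
    next
      have cd: "card (nd ` {..m}) = Suc m" by (subst card_image) (auto simp: inj_on_def nd_inj)
      have "degree q \<le> m" unfolding q_def by (intro degree_sum_le) (auto intro: order_trans[OF degree_monom_le])
      then show "degree q < card (nd ` {..m})" by (simp add: cd)
      have "degree (\<Sum>j\<le>m. smult (poly q (nd j)) (l j)) \<le> m"
        by (intro degree_sum_le) (auto intro: dl)
      then show "degree (\<Sum>j\<le>m. smult (poly q (nd j)) (l j)) < card (nd ` {..m})" by (simp add: cd)
    qed
    then have rep: "poly q x = (\<Sum>j\<le>m. poly q (nd j) * poly (l j) x)" for x
      by (metis (no_types, lifting) poly_smult poly_sum sum.cong)
    have "\<bar>poly q s - poly q t\<bar> = \<bar>\<Sum>j\<le>m. poly q (nd j) * (poly (l j) s - poly (l j) t)\<bar>"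
      by (subst (1 2) rep) (simp add: sum_subtractf right_diff_distrib)
    also have "\<dots> \<le> (\<Sum>j\<le>m. M * (B j * \<bar>s - t\<bar>))"
    proof (rule order_trans[OF sum_abs], rule sum_mono)
      fix j assume j: "j \<in> {..m}"
      have "\<bar>poly q (nd j)\<bar> \<le> M" using M nd01[of j] j unfolding pq by auto
      then show "\<bar>poly q (nd j) * (poly (l j) s - poly (l j) t)\<bar> \<le> M * (B j * \<bar>s - t\<bar>)"
        unfolding abs_mult using B(2)[OF st, of j] M0 by (intro mult_mono) auto
    qed
    also have "\<dots> = (\<Sum>j\<le>m. B j) * M * \<bar>s - t\<bar>" by (simp add: sum_distrib_left sum_distrib_right algebra_simps)
    also have "\<dots> \<le> L * M * \<bar>s - t\<bar>" using M0 by (intro mult_right_mono) (auto simp: L_def)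
    finally show ?thesis unfolding pq .
  qed
  show ?thesis using L1 main by blast
qed

text \<open>At a maximum point t0 of the modulus, with maximum M, the Lipschitz constant L M lets
  the polynomial keep its sign and half of M up to the distance 1 / (2 L), which exceeds 3 \<delta>
  for \<delta> = 1 / (8 L). As t0 may be an end point, the interval of radius \<delta> is centred at
  the distance 2 \<delta> from t0, shifted inwards. Since L comes from \<open>poly_markov\<close>,
  \<delta> depends on the degree m only.\<close>

lemma poly_large_on_interval:
  "\<exists>\<delta>>0. \<delta> \<le> 1/8 \<and> (\<forall>c. \<exists>M s \<sigma>. (\<forall>t\<in>{0..1}. \<bar>\<Sum>k\<le>m. c k * t ^ k\<bar> \<le> M) \<and> \<delta> \<le> s \<and> s \<le> 1 - \<delta> \<and>
     (\<sigma> = 1 \<or> \<sigma> = -1) \<and> (\<forall>t. \<bar>t - s :: real\<bar> \<le> \<delta> \<longrightarrow> M / 2 \<le> \<sigma> * (\<Sum>k\<le>m. c k * t ^ k)))"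
proof -
  obtain L where L: "L \<ge> 1" "\<And>c M s t. (\<forall>t\<in>{0..1}. \<bar>\<Sum>k\<le>m. c k * t ^ k\<bar> \<le> M) \<Longrightarrow> s \<in> {0..1} \<Longrightarrow> t \<in> {0..1} \<Longrightarrow>
     \<bar>(\<Sum>k\<le>m. c k * s ^ k) - (\<Sum>k\<le>m. c k * t ^ k)\<bar> \<le> L * M * \<bar>s - t :: real\<bar>"
    using poly_markov[of m] by blast
  define \<delta> where "\<delta> = 1 / (8 * L)"
  have \<delta>: "\<delta> > 0" "\<delta> \<le> 1/8" using L(1) by (auto simp: \<delta>_def field_simps)
  have "\<exists>M s \<sigma>. (\<forall>t\<in>{0..1}. \<bar>\<Sum>k\<le>m. c k * t ^ k\<bar> \<le> M) \<and> \<delta> \<le> s \<and> s \<le> 1 - \<delta> \<and>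
     (\<sigma> = 1 \<or> \<sigma> = -1) \<and> (\<forall>t. \<bar>t - s\<bar> \<le> \<delta> \<longrightarrow> M / 2 \<le> \<sigma> * (\<Sum>k\<le>m. c k * t ^ k))" for c :: "nat \<Rightarrow> real"
  proof -
    define q where "q t = (\<Sum>k\<le>m. c k * t ^ k)" for t
    have "continuous_on {0..1} (\<lambda>t. \<bar>q t\<bar>)" unfolding q_def by (intro continuous_intros)
    then obtain t0 where t0: "t0 \<in> {0..1}" "\<And>t. t \<in> {0..1} \<Longrightarrow> \<bar>q t\<bar> \<le> \<bar>q t0\<bar>"
      using continuous_attains_sup[of "{0..1::real}" "\<lambda>t. \<bar>q t\<bar>"] by auto
    define M where "M = \<bar>q t0\<bar>"
    have M: "\<forall>t\<in>{0..1}. \<bar>\<Sum>k\<le>m. c k * t ^ k\<bar> \<le> M" using t0(2) by (auto simp: q_def M_def)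
    have M0: "0 \<le> M" by (simp add: M_def)
    define \<sigma> where "\<sigma> = (if 0 \<le> q t0 then 1 else -1 :: real)"
    have s: "\<sigma> = 1 \<or> \<sigma> = -1" "\<bar>\<sigma>\<bar> = 1" "\<sigma> * q t0 = M" by (auto simp: \<sigma>_def M_def)
    have near: "M / 2 \<le> \<sigma> * q t" if t: "t \<in> {0..1}" "\<bar>t - t0\<bar> \<le> 3 * \<delta>" for t
    proof -
      have "\<bar>q t - q t0\<bar> \<le> L * M * \<bar>t - t0\<bar>" using L(2)[OF M t(1) t0(1)] by (simp add: q_def)
      also have "\<dots> \<le> L * M * (3 * \<delta>)" using t(2) L(1) M0 by (intro mult_left_mono) auto
      also have "\<dots> \<le> M / 2" using L(1) M0 by (simp add: \<delta>_def)
      finally have d: "\<bar>\<sigma> * (q t - q t0)\<bar> \<le> M / 2" using s(2) by (simp add: abs_mult)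
      have "\<sigma> * q t = M + \<sigma> * (q t - q t0)" using s(3) by (simp add: algebra_simps)
      then show ?thesis using d by linarith
    qed
    define s0 where "s0 = (if t0 \<le> 1/2 then t0 + 2 * \<delta> else t0 - 2 * \<delta>)"
    have s01: "\<delta> \<le> s0" "s0 \<le> 1 - \<delta>" using \<delta> t0(1) by (auto simp: s0_def)
    have "M / 2 \<le> \<sigma> * q t" if "\<bar>t - s0\<bar> \<le> \<delta>" for t
    proof (rule near)
      show "t \<in> {0..1}" using that s01 by (auto simp: abs_le_iff)
      show "\<bar>t - t0\<bar> \<le> 3 * \<delta>" using that \<delta>(1) unfolding s0_def abs_le_iff by (auto split: if_splits)
    qed
    then show ?thesis using M s01 s(1) unfolding q_def by blast
  qed
  then show ?thesis using \<delta> by blast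
qed

text \<open>The bump is at least 1/8 on the part of the edge within the distance \<rho>/2 of c, a
  segment of length \<rho>; on the rest of the edge the integrand is not negative.\<close>

lemma edge_bump_integral_ge:
  fixes a b :: "real^2"
  assumes ab: "a \<noteq> b" and c: "c = (1 - s) *\<^sub>R a + s *\<^sub>R b" and s: "\<delta> \<le> s" "s \<le> 1 - \<delta>" and r: "0 < \<rho>" "\<rho> \<le> \<delta> * norm (b - a)"
    and m: "0 \<le> m" "\<And>x. x \<in> closed_segment a b \<Longrightarrow> dist c x < \<rho> \<Longrightarrow> m \<le> q x"
    and i: "set_integrable arclength (closed_segment a b) (\<lambda>x. q x * bump c \<rho> x)"
  shows "m * \<rho> / 8 \<le> (LINT x:closed_segment a b|arclength. q x * bump c \<rho> x)"
proof -
  define l where "l = norm (b - a)"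
  have l: "l > 0" using ab by (simp add: l_def)
  \<comment> \<open>Half the length of that segment, measured in the parameter of the edge.\<close>
  define \<epsilon> where "\<epsilon> = \<rho> / 2 / l"
  have \<epsilon>: "0 < \<epsilon>" "\<epsilon> \<le> \<delta>" "\<epsilon> * l = \<rho> / 2" using r l by (auto simp: \<epsilon>_def l_def[symmetric] field_simps)
  define y where "y t = (1 - t) *\<^sub>R a + t *\<^sub>R b" for t
  have yd: "dist (y t) (y t') = \<bar>t - t'\<bar> * l" for t t'
  proof -
    have "y t - y t' = (t - t') *\<^sub>R (b - a)" by (simp add: y_def algebra_simps)
    then show ?thesis by (simp add: dist_norm l_def)
  qed
  define I where "I = closed_segment (y (s - \<epsilon>)) (y (s + \<epsilon>))"
  have cy: "c = y s" using c by (simp add: y_def)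
  have Iin: "x \<in> closed_segment a b \<and> dist c x \<le> \<rho> / 2" if xI: "x \<in> I" for x
  proof -
    have "\<exists>w. 0 \<le> w \<and> w \<le> 1 \<and> x = (1 - w) *\<^sub>R y (s - \<epsilon>) + w *\<^sub>R y (s + \<epsilon>)"
      using xI unfolding I_def in_segment(1) .
    then obtain w where w: "0 \<le> w" "w \<le> 1" "x = (1 - w) *\<^sub>R y (s - \<epsilon>) + w *\<^sub>R y (s + \<epsilon>)"
      by (elim exE conjE)
    define t where "t = s - \<epsilon> + 2 * \<epsilon> * w"
    have x: "x = y t" unfolding w(3) by (simp add: vec_eq_iff y_def t_def algebra_simps)
    have wt: "0 \<le> \<epsilon> * w" "\<epsilon> * w \<le> \<epsilon>" using w \<epsilon>(1) by (auto simp: mult_left_le)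
    have "2 * \<epsilon> * w = 2 * (\<epsilon> * w)" by simp
    then have "0 \<le> t" "t \<le> 1" "\<bar>s - t\<bar> \<le> \<epsilon>" using s \<epsilon>(1,2) wt unfolding t_def by linarith+
    then have "x \<in> closed_segment a b" unfolding x y_def closed_segment_def by blast
    moreover have "dist c x \<le> \<epsilon> * l" unfolding cy x yd using \<open>\<bar>s - t\<bar> \<le> \<epsilon>\<close> l by (intro mult_right_mono) auto
    ultimately show ?thesis using \<epsilon>(3) by simp
  qed
  have "m * \<rho> / 8 = (m / 8) * measure arclength I"
    using \<epsilon> l by (simp add: I_def measure_def emeasure_arclength_segment yd)
  also have "\<dots> = (LINT x:I|arclength. m / 8)" by (simp add: set_lebesgue_integral_def I_def sets_arclength_segment)
  also have "\<dots> \<le> (LINT x:closed_segment a b|arclength. q x * bump c \<rho> x)"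
    unfolding set_lebesgue_integral_def
  proof (rule integral_mono)
    show "integrable arclength (\<lambda>x. indicator I x *\<^sub>R (m / 8))"
      by (intro integrable_scaleR_left integrable_real_indicator) (simp_all add: I_def sets_arclength_segment emeasure_arclength_segment)
    show "integrable arclength (\<lambda>x. indicator (closed_segment a b) x *\<^sub>R (q x * bump c \<rho> x))" using i by (simp add: set_integrable_def)
    fix x
    consider "x \<in> I" | "x \<notin> I" "x \<in> closed_segment a b" "dist c x < \<rho>" | "x \<notin> I" "x \<notin> closed_segment a b \<or> \<rho> \<le> dist c x" by linarith
    then show "indicator I x *\<^sub>R (m / 8) \<le> indicator (closed_segment a b) x *\<^sub>R (q x * bump c \<rho> x)"
    proof cases
      case 1
      then have x: "x \<in> closed_segment a b" "dist c x \<le> \<rho> / 2" using Iin by auto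
      then have mq: "m \<le> q x" using m(2)[of x] r by simp
      have "m * (1 / 8) \<le> q x * bump c \<rho> x"
        using mq bump_ge[OF r(1) x(2)] m(1) by (intro mult_mono) auto
      then show ?thesis using 1 x by simp
    next
      case 2
      then have "0 \<le> q x" using m by (meson order_trans)
      then show ?thesis using 2 bump_bounds[of c \<rho> x] by simp
    next
      case 3
      then show ?thesis using bump_eq_0[OF r(1), of c x] by auto
    qed
  qed
  finally show ?thesis .
qed

lemma set_integrable_continuous_edge:
  fixes q :: "real^2 \<Rightarrow> real"
  assumes "continuous_on (closed_segment a b) q"
  shows "set_integrable arclength (closed_segment a b) q"
proof -
  have s: "closed_segment a b \<inter> space arclength \<in> sets arclength" by (simp add: sets_arclength_segment)
  have fin: "emeasure arclength (closed_segment a b) < \<infinity>" by (simp add: emeasure_arclength_segment)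
  have 1: "q \<in> L2_space arclength (closed_segment a b)" "(\<lambda>x. 1 :: real) \<in> L2_space arclength (closed_segment a b)"
    by (rule L2_space_continuous_arclength[OF compact_segment fin]; simp add: assms)+
  show ?thesis using set_cauchy_schwarz(1)[OF s 1] by simp
qed

text \<open>Green's formula for the constant function 1. As \<open>uh\<close> has a constant
  gradient on an element, this is its integration by parts against the bump.\<close>

lemma gradient_bump_half_disc:
  assumes t: "tri a b p" and c: "c = (1 - s) *\<^sub>R a + s *\<^sub>R b" and s: "\<delta> \<le> s" "s \<le> 1 - \<delta>" and r: "0 < \<rho>"
    "diameter (convex hull {a, b, p}) * \<rho> < \<delta> * cross (b - a) (p - a)"
  shows "(LINT x:interior (convex hull {a, b, p})|lebesgue. grad (bump c \<rho>) x)
    = (LINT x:closed_segment a b|arclength. bump c \<rho> x) *\<^sub>R nrml a b"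
proof -
  have ab: "a \<noteq> b" using tri_distinct[OF t] by blast
  note hb = tri_half_ball[OF t c s r(2)]
  define U where "U = interior (convex hull {a, b, p})"
  have side: "nrml a b \<bullet> (x - c) < 0" if "x \<in> U" for x
  proof -
    have "0 < cross (b - a) (x - a)" using tri_interior[OF t] that by (simp add: U_def)
    moreover have "cross (b - a) (x - c) = cross (b - a) (x - a)"
      using segment_point(1)[OF c] by (simp add: cross_def algebra_simps)
    ultimately show ?thesis using ab by (simp add: nrml_inner)
  qed
  have Us: "U \<in> sets lebesgue" by (auto simp: U_def)
  have "emeasure lebesgue U < \<infinity>"
    using emeasure_bounded_finite[OF bounded_subset[OF bounded_tri interior_subset]] by (simp add: U_def)
  then have 1: "(\<lambda>x. 1 :: real) \<in> L2_space lebesgue U"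
    by (intro L2_space_bounded[OF Us, where B = 1]) (use Us in \<open>auto simp: set_borel_measurable_def intro!: borel_measurable_indicator\<close>)
  have 0: "(\<lambda>x. 0 :: real^2) \<in> L2_space lebesgue U"
    using Us by (simp add: L2_space_iff set_borel_measurable_def set_integrable_def)
  have w: "is_weak_grad U (\<lambda>x. 1) (\<lambda>x. 0)"
    by (rule is_weak_grad_smooth) (auto intro!: derivative_eq_intros)
  have "(LINT x:closed_segment a b|arclength. 1 * bump c \<rho> x) *\<^sub>R nrml a b =
      (LINT x:U|lebesgue. 1 *\<^sub>R grad (bump c \<rho>) x) + (LINT x:U|lebesgue. bump c \<rho> x *\<^sub>R 0)"
    by (rule green_edge(1)[OF nrml_tang(2,1,3)[OF ab] _ side _ _ _ 1 0 w Ck_bump bump_eq_0[OF r(1)]])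
      (use hb in \<open>auto simp: U_def\<close>)
  then show ?thesis by (simp add: U_def set_lebesgue_integral_def)
qed

context ldg_mesh
begin

lemma elem_L2_norm_le:
  fixes q :: "real^2 \<Rightarrow> 'b::euclidean_space"
  assumes K: "K \<in> T" and B: "\<And>x. x \<in> interior K \<Longrightarrow> norm (q x) \<le> B" "0 \<le> B"
  shows "L2_norm lebesgue (interior K) q \<le> B * (2 * diameter K)"
proof -
  obtain a b p where t: "tri a b p" "K = convex hull {a, b, p}" using elem_tri[OF K] by blast
  have a: "a \<in> K" using t(2) by (simp add: hull_inc)
  have d: "0 < diameter K" using shape_elem[OF K] by simp
  have sub: "interior K \<subseteq> cball a (diameter K)"
    using diameter_bounded_bound[OF compact_imp_bounded[OF elem_compact[OF K]] a] interior_subset[of K] by auto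
  have "measure lebesgue (interior K) \<le> measure lebesgue (cball a (diameter K))"
    by (rule measure_mono_fmeasurable[OF sub]) auto
  also have "\<dots> \<le> (2 * diameter K)\<^sup>2" using measure_cball_le d by simp
  finally have "sqrt (measure lebesgue (interior K)) \<le> 2 * diameter K" using d by (intro real_le_lsqrt) auto
  then have "B * sqrt (measure lebesgue (interior K)) \<le> B * (2 * diameter K)" using B(2) by (rule mult_left_mono)
  with L2_norm_bounded[where f = q, OF Ks(1) int_fin[OF K] B] show ?thesis by linarith
qed

lemma terms_bound:
  assumes K: "K \<in> T" "K \<subseteq> \<omega>" and r: "0 < \<rho>"
  shows "\<bar>LINT x:interior K|lebesgue. (Gu x - al K) \<bullet> grad (bump c \<rho>) x\<bar> \<le> 4 * norm1h T \<omega> err"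
    "\<bar>LINT x:interior K|lebesgue. err x * bump c \<rho> x\<bar> \<le> 2 * \<rho> * norm1h T \<omega> err"
    "q \<in> L2_space lebesgue (interior K) \<Longrightarrow> \<bar>LINT x:interior K|lebesgue. q x * bump c \<rho> x\<bar> \<le> 2 * \<rho> * L2_norm lebesgue (interior K) q"
proof -
  note L = L2_facts[OF K(1)] and N = norm1h_ge[OF K] and bp = bump_props[OF r Ks(1)[of K], of c]
  have N0: "0 \<le> norm1h T \<omega> err" using N(1) L2_norm_nonneg order_trans by blast
  have "\<bar>LINT x:interior K|lebesgue. (Gu x - al K) \<bullet> grad (bump c \<rho>) x\<bar>
    \<le> L2_norm lebesgue (interior K) (\<lambda>x. Gu x - al K) * L2_norm lebesgue (interior K) (grad (bump c \<rho>))"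
    by (rule set_cauchy_schwarz(3)[OF Ks(2) L(6) bp(5)])
  also have "\<dots> \<le> norm1h T \<omega> err * 4" using N(2) bp(7) N0 by (intro mult_mono) auto
  finally show "\<bar>LINT x:interior K|lebesgue. (Gu x - al K) \<bullet> grad (bump c \<rho>) x\<bar> \<le> 4 * norm1h T \<omega> err" by simp
  have g: "\<bar>LINT x:interior K|lebesgue. q x * bump c \<rho> x\<bar> \<le> 2 * \<rho> * L2_norm lebesgue (interior K) q"
    if q: "q \<in> L2_space lebesgue (interior K)" for q
  proof -
    have "\<bar>LINT x:interior K|lebesgue. q x \<bullet> bump c \<rho> x\<bar> \<le> L2_norm lebesgue (interior K) q * L2_norm lebesgue (interior K) (bump c \<rho>)"
      by (rule set_cauchy_schwarz(3)[OF Ks(2) q bp(4)])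
    also have "\<dots> \<le> L2_norm lebesgue (interior K) q * (2 * \<rho>)" using bp(6) by (intro mult_left_mono) auto
    finally show ?thesis by (simp add: mult.commute)
  qed
  show "q \<in> L2_space lebesgue (interior K) \<Longrightarrow> \<bar>LINT x:interior K|lebesgue. q x * bump c \<rho> x\<bar> \<le> 2 * \<rho> * L2_norm lebesgue (interior K) q"
    by (rule g)
  have "2 * \<rho> * L2_norm lebesgue (interior K) err \<le> 2 * \<rho> * norm1h T \<omega> err" using N(1) r by (intro mult_left_mono) auto
  with g[OF L(5)] show "\<bar>LINT x:interior K|lebesgue. err x * bump c \<rho> x\<bar> \<le> 2 * \<rho> * norm1h T \<omega> err" by linarith
qed

lemma affine_L2:
  assumes K: "K \<in> T"
  shows "(\<lambda>x. A \<bullet> x + B) \<in> L2_space lebesgue (interior K)"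
proof -
  obtain M where M: "\<And>x. x \<in> K \<Longrightarrow> norm x \<le> M"
      using compact_imp_bounded[OF elem_compact[OF K]] bounded_iff by metis
  show "(\<lambda>x. A \<bullet> x + B) \<in> L2_space lebesgue (interior K)"
  proof (rule L2_space_bounded[OF Ks(1) int_fin[OF K]])
    have "(\<lambda>x. A \<bullet> x + B) \<in> borel_measurable lebesgue" by (intro measurable_completion) measurable
    then show "set_borel_measurable lebesgue (interior K) (\<lambda>x. A \<bullet> x + B)"
      unfolding set_borel_measurable_def by (intro borel_measurable_scaleR borel_measurable_indicator Ks(1))
    show "AE x in lebesgue. x \<in> interior K \<longrightarrow> norm (A \<bullet> x + B) \<le> norm A * M + \<bar>B\<bar>"
    proof (intro AE_I2 impI)
      fix x assume "x \<in> interior K"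
      then have "norm x \<le> M" using M interior_subset by blast
      then have "norm A * norm x \<le> norm A * M" by (intro mult_left_mono) auto
      then show "norm (A \<bullet> x + B) \<le> norm A * M + \<bar>B\<bar>" using Cauchy_Schwarz_ineq2[of A x] by simp
    qed
  qed
qed

lemma G1_sub: "\<Gamma>1 \<subseteq> frontier \<Omega>"
  using G1 by (simp add: closedin_subset[of "top_of_set (frontier \<Omega>)", simplified])

text \<open>The case S = UNIV of \<open>residual_eq\<close>: the bump of a disc inside \<Omega>
  vanishes on the frontier, and with it the boundary term.\<close>

lemma residual_interior:
  assumes P: "P \<subseteq> T" and r: "0 < \<rho>" and sub: "ball c \<rho> \<subseteq> \<Omega>" "ball c \<rho> \<subseteq> \<Union>P"
  shows "(\<Sum>K\<in>P. (LINT x:interior K|lebesgue. (Gu x - al K) \<bullet> grad (bump c \<rho>) x) + (LINT x:interior K|lebesgue. err x * bump c \<rho> x)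
      + al K \<bullet> (LINT x:interior K|lebesgue. grad (bump c \<rho>) x))
     = (\<Sum>K\<in>P. LINT x:interior K|lebesgue. (f x - uh x) * bump c \<rho> x)"
proof -
  have z: "bump c \<rho> x = 0" if "x \<in> frontier \<Omega>" for x
  proof -
    have "x \<notin> \<Omega>" using that O(1) by (simp add: frontier_def interior_open)
    then have "x \<notin> ball c \<rho>" using sub(1) by blast
    then show ?thesis using bump_eq_0[OF r, of c x] by (simp add: not_less)
  qed
  have "(LINT x:Gamma2 \<Omega> \<Gamma>1|arclength. g * lam x * (indicator UNIV x * bump c \<rho> x)) = (LINT x:Gamma2 \<Omega> \<Gamma>1|arclength. 0)"
    unfolding set_lebesgue_integral_def by (intro Bochner_Integration.integral_cong) (auto simp: indicator_def z)
  then have b0: "(LINT x:Gamma2 \<Omega> \<Gamma>1|arclength. g * lam x * (indicator UNIV x * bump c \<rho> x)) = 0"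
    by (simp add: set_lebesgue_integral_def)
  have "continuous_on (closure \<Omega>) (\<lambda>x. indicator UNIV x * bump c \<rho> x)"
    using continuous_on_subset[OF bump_props(2)[OF r Os(1), of c]] by simp
  moreover have "AE x in arclength. x \<in> \<Gamma>1 \<longrightarrow> indicator UNIV x * bump c \<rho> x = 0" using z G1_sub by auto
  ultimately show ?thesis
    using residual_eq[OF P, of UNIV \<rho> c] sub(2) r unfolding b0 by (simp add: subset_iff)
qed

text \<open>With \<rho> = \<open>kap\<close> h / 16, the bound (16 / \<open>kap\<close>) m 2 h^2 for
  h times the norm of the affine residual equals 2^18 / \<open>kap\<close>^3 times m \<rho>^2 / 32.
  The factor 4 + 2 \<open>Hd\<close> comes from the pairing with the bump, and the final 1 accounts
  for the difference between f and its affine replacement.\<close>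

definition C1 :: real where "C1 = 2 ^ 18 / kap ^ 3 * (4 + 2 * Hd) + 1"

lemma Hd_pos: "K \<in> T \<Longrightarrow> 0 < Hd"
  using shape_elem[of K] by linarith

text \<open>The residual is the sum of f - fb and the affine function fb - uh. With a suitable sign
  the latter is at least m on a disc well inside K; testing with a bump there bounds m by the error,
  and m in turn controls the affine function on all of K.\<close>

lemma element_estimate:
  assumes K: "K \<in> T" "K \<subseteq> \<omega>" and fb: "\<And>x. x \<in> interior K \<Longrightarrow> fb x = \<alpha> \<bullet> x + \<beta>"
  shows "diameter K * R K \<le> C1 * (norm1h T \<omega> err + diameter K * L2_norm lebesgue (interior K) (\<lambda>x. f x - fb x))"
proof -
  define h where "h = diameter K"
  define N where "N = norm1h T \<omega> err"
  define F where "F = L2_norm lebesgue (interior K) (\<lambda>x. f x - fb x)"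
  note L = L2_facts[OF K(1)]
  have N0: "0 \<le> N" unfolding N_def using norm1h_ge(1)[OF K] L2_norm_nonneg order_trans by blast
  have F0: "0 \<le> F" by (simp add: F_def)
  have h: "0 < h" "h \<le> Hd" "0 < kap" "kap < 1" using shape_elem[OF K(1)] by (auto simp: h_def)
  obtain a b p where t: "tri a b p" "K = convex hull {a, b, p}" using elem_tri[OF K(1)] by blast
  note D = shape(3)[OF K(1) t, folded h_def]
  have sides: "norm (b - a) \<le> h" "norm (p - b) \<le> h" "norm (a - p) \<le> h"
    unfolding h_def t(2) by (rule tri_side_le_diameter)+
  obtain \<beta>0 where u0: "\<And>x. x \<in> interior K \<Longrightarrow> uh x = al K \<bullet> x + \<beta>0" by (rule uh_affine[OF K(1)]) blast
  define A where "A = \<alpha> - al K"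
  define B where "B = \<beta> - \<beta>0"
  have pe: "fb x - uh x = A \<bullet> x + B" if "x \<in> interior K" for x using fb[OF that] u0[OF that] by (simp add: A_def B_def inner_diff_left)
  \<comment> \<open>The barycentre, where all three barycentric coordinates are 1/3; its distance to
    each side is at least a fixed multiple of \<open>kap\<close> h.\<close>
  define x0 where "x0 = (1/3) *\<^sub>R a + (1/3) *\<^sub>R b + (1/3) *\<^sub>R p"
  have s1: "1/3 + 1/3 + (1/3 :: real) = 1" by simp
  have x0c: "cross (b - a) (x0 - a) = 1/3 * cross (b - a) (p - a)" "cross (p - b) (x0 - b) = 1/3 * cross (b - a) (p - a)"
    "cross (a - p) (x0 - p) = 1/3 * cross (b - a) (p - a)"
    unfolding x0_def by (rule cross_combination[OF s1])+
  \<comment> \<open>Moving by 3 r / 4 changes each \<open>cross\<close> by at most h times 3 r / 4,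
    that is (3/16) \<open>kap\<close> h^2, which is less than the third of twice the area available
    at x0. This leaves room for a centre at the distance r / 2 and a disc of radius r / 4.\<close>
  define r where "r = kap * h / 4"
  have r: "0 < r" using h by (simp add: r_def)
  have inK: "x \<in> interior K" if x: "dist x0 x \<le> 3 * r / 4" for x
  proof -
    have "0 < cross w (x - v)" if w: "norm w \<le> h" and v: "cross w (x0 - v) = 1/3 * cross (b - a) (p - a)" for w v
    proof -
      have nx: "norm (x - x0) \<le> 3 * r / 4" using x by (simp add: dist_norm norm_minus_commute)
      have "norm w * norm (x - x0) \<le> h * (3 * r / 4)" using w nx h by (intro mult_mono) auto
      also have "\<dots> = 3 / 16 * (kap * h\<^sup>2)" by (simp add: r_def power2_eq_square)
      also have "\<dots> < 1/3 * (kap * h\<^sup>2)" using h by simp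
      finally have "\<bar>cross w (x - x0)\<bar> < 1/3 * cross (b - a) (p - a)"
        using abs_cross_le[of w "x - x0"] D by linarith
      moreover have "cross w (x - v) = cross w (x0 - v) + cross w (x - x0)" by (simp add: cross_def algebra_simps)
      ultimately show ?thesis using v by linarith
    qed
    then show ?thesis unfolding t(2) tri_interior[OF t(1)]
      using sides x0c by blast
  qed
  obtain c \<sigma> where c: "dist x0 c \<le> r / 2" "\<sigma> = 1 \<or> \<sigma> = -1"
    "\<And>x. dist c x \<le> r / 4 \<Longrightarrow> \<bar>A \<bullet> x0 + B\<bar> + norm A * r / 4 \<le> \<sigma> * (A \<bullet> x + B)"
    by (rule affine_large_on_ball[OF r, where ?x0.0 = x0 and \<alpha> = A and \<beta> = B]) blast
  define \<rho> where "\<rho> = r / 4"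
  have \<rho>: "0 < \<rho>" "\<rho> = kap * h / 16" using r by (auto simp: \<rho>_def r_def)
  have "kap * h \<le> 1 * h" using h by (intro mult_right_mono) auto
  then have \<rho>h: "\<rho> \<le> h" using \<rho>(2) h(1) by linarith
  define m where "m = \<bar>A \<bullet> x0 + B\<bar> + norm A * r / 4"
  have m0: "0 \<le> m" using r by (simp add: m_def)
  have bs: "cball c \<rho> \<subseteq> interior K"
  proof
    fix x assume "x \<in> cball c \<rho>"
    then have "dist x0 x \<le> 3 * r / 4" using c(1) dist_triangle[of x0 x c] by (simp add: \<rho>_def)
    then show "x \<in> interior K" by (rule inK)
  qed
  have fbL: "fb \<in> L2_space lebesgue (interior K)"
  proof -
    have "(\<lambda>x. uh x + (A \<bullet> x + B)) \<in> L2_space lebesgue (interior K)" by (rule L2_space_add[OF Ks(2) L(1) affine_L2[OF K(1)]])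
    then show ?thesis
      by (rule L2_change_set(1)[OF complete_measure_lebesgue Ks(1) Ks(1)]) (auto intro!: AE_I2 simp: indicator_def pe[symmetric])
  qed
  have ffL: "(\<lambda>x. f x - fb x) \<in> L2_space lebesgue (interior K)" by (rule L2_space_diff[OF Ks(2) L(2) fbL])
  have pL: "(\<lambda>x. fb x - uh x) \<in> L2_space lebesgue (interior K)" by (rule L2_space_diff[OF Ks(2) fbL L(1)])
  have bL: "bump c \<rho> \<in> L2_space lebesgue (interior K)" by (rule bump_props(4)[OF \<rho>(1) Ks(1)])
  note ip = set_cauchy_schwarz(1)[OF Ks(2) pL bL, simplified] and iq = set_cauchy_schwarz(1)[OF Ks(2) L(7) bL, simplified]
    and ir = set_cauchy_schwarz(1)[OF Ks(2) ffL bL, simplified]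
  have "m * \<rho>\<^sup>2 / 32 \<le> (LINT x:interior K|lebesgue. (\<sigma> * (fb x - uh x)) * bump c \<rho> x)"
  proof (rule bump_integral_ge[OF \<rho>(1) Ks(1) bs m0])
    show "m \<le> \<sigma> * (fb x - uh x)" if "x \<in> cball c \<rho>" for x
      using c(3)[of x] that pe[of x] bs by (auto simp: m_def \<rho>_def)
    show "set_integrable lebesgue (interior K) (\<lambda>x. \<sigma> * (fb x - uh x) * bump c \<rho> x)"
      using set_integrable_mult_right[of \<sigma> lebesgue "interior K" "\<lambda>x. (fb x - uh x) * bump c \<rho> x"] ip by (simp add: mult.assoc)
  qed
  also have "\<dots> = \<sigma> * (LINT x:interior K|lebesgue. (fb x - uh x) * bump c \<rho> x)"
    unfolding mult.assoc by (rule set_integral_mult_right)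
  also have "\<dots> \<le> \<bar>LINT x:interior K|lebesgue. (fb x - uh x) * bump c \<rho> x\<bar>" using c(2) by auto
  also have "(LINT x:interior K|lebesgue. (fb x - uh x) * bump c \<rho> x) =
     (LINT x:interior K|lebesgue. (f x - uh x) * bump c \<rho> x) - (LINT x:interior K|lebesgue. (f x - fb x) * bump c \<rho> x)"
    using set_integral_diff(2)[OF iq ir] by (simp add: algebra_simps)
  also have "(LINT x:interior K|lebesgue. (f x - uh x) * bump c \<rho> x) =
     (LINT x:interior K|lebesgue. (Gu x - al K) \<bullet> grad (bump c \<rho>) x) + (LINT x:interior K|lebesgue. err x * bump c \<rho> x)"
  proof -
    have "ball c \<rho> \<subseteq> \<Omega>" "ball c \<rho> \<subseteq> \<Union>{K}"
      using bs interior_elem_sub[OF K(1)] interior_subset[of K] ball_subset_cball[of c \<rho>] unfolding cSup_singleton Union_insert Union_empty Un_empty_right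
      by (meson order_trans)+
    from residual_interior[OF _ \<rho>(1) this] K(1) show ?thesis
      using integral_gradient_bump_ball[OF \<rho>(1) bs] by simp
  qed
  finally have "m * \<rho>\<^sup>2 / 32 \<le> 4 * N + 2 * \<rho> * N + 2 * \<rho> * F"
    using terms_bound(1,2)[OF K \<rho>(1), of c] terms_bound(3)[OF K \<rho>(1) ffL, of c] unfolding N_def F_def by linarith
  also have "\<dots> \<le> (4 + 2 * Hd) * (N + h * F)"
  proof -
    have "\<rho> * N \<le> Hd * N" using \<rho>h h N0 by (intro mult_right_mono) auto
    moreover have "\<rho> * F \<le> h * F" using \<rho>h F0 by (rule mult_right_mono)
    moreover have "0 \<le> h * F" "0 \<le> Hd * (h * F)" using h F0 by auto
    ultimately show ?thesis by (simp add: algebra_simps)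
  qed
  finally have mb: "m * \<rho>\<^sup>2 / 32 \<le> (4 + 2 * Hd) * (N + h * F)" .
  \<comment> \<open>On K the modulus of the affine function is at most its value at x0 plus |A| h,
    and |A| h is 16 / \<open>kap\<close> times the part |A| r / 4 of m.\<close>
  have pb: "norm (fb x - uh x) \<le> 16 / kap * m" if x: "x \<in> interior K" for x
  proof -
    have x0K: "x0 \<in> K" using inK[of x0] r interior_subset by auto
    have "norm (x - x0) \<le> h" unfolding h_def
      using diameter_bounded_bound[OF compact_imp_bounded[OF elem_compact[OF K(1)]], of x x0] x x0K interior_subset by (auto simp: dist_norm)
    then have "norm A * norm (x - x0) \<le> norm A * h" by (intro mult_left_mono) auto
    moreover have "A \<bullet> x + B = (A \<bullet> x0 + B) + A \<bullet> (x - x0)" by (simp add: inner_diff_right)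
    ultimately have "\<bar>A \<bullet> x + B\<bar> \<le> \<bar>A \<bullet> x0 + B\<bar> + norm A * h" using Cauchy_Schwarz_ineq2[of A "x - x0"] by linarith
    also have "\<dots> \<le> 16 / kap * m"
    proof -
      have "1 \<le> 16 / kap" using h by (simp add: field_simps)
      then have "\<bar>A \<bullet> x0 + B\<bar> \<le> 16 / kap * \<bar>A \<bullet> x0 + B\<bar>" using mult_right_mono[of 1 "16 / kap" "\<bar>A \<bullet> x0 + B\<bar>"] by simp
      moreover have "norm A * h = 16 / kap * (norm A * r / 4)" using h by (simp add: r_def)
      ultimately show ?thesis by (simp add: m_def distrib_left)
    qed
    finally show ?thesis using pe[OF x] by simp
  qed
  have "L2_norm lebesgue (interior K) (\<lambda>x. fb x - uh x) \<le> 16 / kap * m * (2 * h)"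
    unfolding h_def by (rule elem_L2_norm_le[OF K(1) pb]) (use h m0 in auto)
  then have "h * L2_norm lebesgue (interior K) (\<lambda>x. fb x - uh x) \<le> h * (16 / kap * m * (2 * h))" using h by (intro mult_left_mono) auto
  also have "\<dots> = 2 ^ 18 / kap ^ 3 * (m * \<rho>\<^sup>2 / 32)" using h by (simp add: \<rho>(2) power2_eq_square power3_eq_cube field_simps)
  also have "\<dots> \<le> 2 ^ 18 / kap ^ 3 * ((4 + 2 * Hd) * (N + h * F))" using mb h by (intro mult_left_mono) auto
  finally have hp: "h * L2_norm lebesgue (interior K) (\<lambda>x. fb x - uh x) \<le> 2 ^ 18 / kap ^ 3 * (4 + 2 * Hd) * (N + h * F)" by (simp only: mult.assoc)
  have "R K \<le> F + L2_norm lebesgue (interior K) (\<lambda>x. fb x - uh x)"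
    using L2_norm_triangle[OF Ks(2) ffL pL] by (simp add: R_def F_def)
  then have "h * R K \<le> h * F + h * L2_norm lebesgue (interior K) (\<lambda>x. fb x - uh x)"
    using h mult_left_mono[of "R K" "F + L2_norm lebesgue (interior K) (\<lambda>x. fb x - uh x)" h] by (simp add: distrib_left)
  also have "\<dots> \<le> C1 * (N + h * F)"
  proof -
    have "C1 * (N + h * F) = 2 ^ 18 / kap ^ 3 * (4 + 2 * Hd) * (N + h * F) + (N + h * F)"
      unfolding C1_def by (simp only: distrib_right[of _ 1] mult_1)
    then show ?thesis using hp N0 by linarith
  qed
  finally show ?thesis by (simp add: h_def N_def F_def)
qed

lemma patch_sub: "K' \<in> T \<Longrightarrow> K' \<inter> K \<noteq> {} \<Longrightarrow> K' \<subseteq> patch T K"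
  by (auto simp: patch_def)

lemma elem_nonempty: "K \<in> T \<Longrightarrow> K \<noteq> {}"
  using shape_elem(3)[of K] by auto

lemma C1_ge: "K \<in> T \<Longrightarrow> 1 \<le> C1"
  using shape_elem[of K] unfolding C1_def by simp

lemma data_avg_affine:
  assumes K: "K \<in> T"
  shows "\<exists>\<alpha> \<beta>. \<forall>x\<in>interior K. data_avg T f x = \<alpha> \<bullet> x + \<beta>"
proof -
  obtain a b p where t: "tri a b p" "K = convex hull {a, b, p}" using elem_tri[OF K] by blast
  obtain \<alpha> \<beta> where ab: "\<And>x. data_avg_on f K x = \<alpha> \<bullet> x + \<beta>" using data_avg_on_affine[OF t(1), of f] t(2) by blast
  have "data_avg T f x = \<alpha> \<bullet> x + \<beta>" if x: "x \<in> interior K" for x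
  proof -
    have "(THE K. K \<in> T \<and> x \<in> interior K) = K"
    proof (rule the_equality)
      show "K \<in> T \<and> x \<in> interior K" using K x by simp
      fix K' assume "K' \<in> T \<and> x \<in> interior K'"
      then show "K' = K" using inter_proper(3)[OF K, of K'] x interior_subset[of K'] by blast
    qed
    then show ?thesis by (simp add: data_avg_def ab)
  qed
  then show ?thesis by blast
qed

definition osc :: "(real^2) set \<Rightarrow> real" where
  "osc K = L2_norm lebesgue (patch T K) (\<lambda>x. f x - data_avg T f x)"

lemma data_L2:
  assumes K: "K \<in> T"
  shows "(\<lambda>x. f x - data_avg T f x) \<in> L2_space lebesgue (interior K)"
proof -
  obtain \<alpha> \<beta> where ab: "\<And>x. x \<in> interior K \<Longrightarrow> data_avg T f x = \<alpha> \<bullet> x + \<beta>" using data_avg_affine[OF K] by blast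
  have "(\<lambda>x. f x - (\<alpha> \<bullet> x + \<beta>)) \<in> L2_space lebesgue (interior K)"
    by (rule L2_space_diff[OF Ks(2) L2_facts(2)[OF K] affine_L2[OF K]])
  then show ?thesis
    by (rule L2_change_set(1)[OF complete_measure_lebesgue Ks(1) Ks(1)]) (auto intro!: AE_I2 simp: indicator_def ab)
qed

lemma osc_ge:
  assumes K: "K \<in> T" "K' \<in> T" "K' \<inter> K \<noteq> {}"
  shows "L2_norm lebesgue (interior K') (\<lambda>x. f x - data_avg T f x) \<le> osc K"
proof -
  define P where "P = {K' \<in> T. K' \<inter> K \<noteq> {}}"
  have finP: "finite P" using fin by (simp add: P_def)
  have pe: "patch T K = \<Union>P" by (simp add: patch_def P_def)
  have ps: "patch T K \<in> sets lebesgue"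
    unfolding pe using finP elem_closed by (intro sets.finite_Union) (auto simp: P_def intro!: lborelD)
  have us: "(\<Union>K\<in>P. interior K) \<in> sets lebesgue" using finP by (intro sets.finite_UN) auto
  have UL: "(\<lambda>x. f x - data_avg T f x) \<in> L2_space lebesgue (\<Union>K\<in>P. interior K)"
    by (rule L2_space_UN[OF finP Ks(1) data_L2]) (simp add: P_def)
  have "(\<lambda>x. f x - data_avg T f x) \<in> L2_space lebesgue (patch T K)"
  proof (rule L2_change_set(1)[OF complete_measure_lebesgue us ps UL])
    show "AE x in lebesgue. indicator (\<Union>K\<in>P. interior K) x *\<^sub>R (f x - data_avg T f x) = indicator (patch T K) x *\<^sub>R (f x - data_avg T f x)"
      using AE_interior
    proof eventually_elim
      case (elim x)
      have "P \<subseteq> T" by (auto simp: P_def)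
      then have "x \<in> (\<Union>K\<in>P. interior K) \<longleftrightarrow> x \<in> \<Union>P" using elim interior_subset by blast
      then have "x \<in> (\<Union>K\<in>P. interior K) \<longleftrightarrow> x \<in> patch T K" by (simp only: pe)
      then show ?case by (simp add: indicator_def)
    qed
  qed
  moreover have "interior K' \<subseteq> patch T K" using patch_sub[OF K(2,3)] interior_subset by blast
  ultimately show ?thesis unfolding osc_def by (intro L2_norm_mono[OF Ks(1) ps])
qed

abbreviation Nrm :: "(real^2) set \<Rightarrow> real" where "Nrm K \<equiv> norm1h T (patch T K) err"

lemma Nrm_nonneg: "K \<in> T \<Longrightarrow> 0 \<le> Nrm K"
  using norm1h_ge(1)[OF _ patch_sub, of K K] elem_nonempty[of K] L2_norm_nonneg order_trans by blast

lemma osc_nonneg: "0 \<le> osc K"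
  by (simp add: osc_def)

lemma elem_residual:
  assumes K: "K \<in> T" "K' \<in> T" "K' \<inter> K \<noteq> {}"
  shows "diameter K' * R K' \<le> C1 * (Nrm K + diameter K' * osc K)"
proof -
  obtain \<alpha> \<beta> where ab: "\<And>x. x \<in> interior K' \<Longrightarrow> data_avg T f x = \<alpha> \<bullet> x + \<beta>" using data_avg_affine[OF K(2)] by blast
  have "diameter K' * R K' \<le> C1 * (Nrm K + diameter K' * L2_norm lebesgue (interior K') (\<lambda>x. f x - data_avg T f x))"
    by (rule element_estimate[OF K(2) patch_sub[OF K(2,3)] ab])
  also have "\<dots> \<le> C1 * (Nrm K + diameter K' * osc K)"
    using osc_ge[OF K] C1_ge[OF K(1)] shape_elem(3)[OF K(2)] by (intro mult_left_mono add_left_mono) auto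
  finally show ?thesis .
qed

text \<open>The factor 32 / \<open>kap\<close> turns \<rho> / 8, the lower bound for the integral of
  the bump over the edge, into the edge length l, as \<rho> = \<open>kap\<close> l / 4. In the
  bracket, each of the two elements contributes 4 + 2 \<open>Hd\<close> from the error and 2
  \<open>C1\<close> / \<open>kap\<close> from its element residual.\<close>

definition C2 :: real where "C2 = 32 / kap * (2 * (4 + 2 * Hd) + 4 * C1 / kap)"

lemma L2_norm_const_edge:
  fixes a b :: "real^2"
  assumes "\<And>x. x \<in> closed_segment a b \<Longrightarrow> q x = (J :: real)"
  shows "(L2_norm arclength (closed_segment a b) q)\<^sup>2 = J\<^sup>2 * dist a b"
proof -
  have "(LINT x:closed_segment a b|arclength. (norm (q x))\<^sup>2) = (LINT x:closed_segment a b|arclength. J\<^sup>2)"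
    unfolding set_lebesgue_integral_def by (intro Bochner_Integration.integral_cong refl) (auto simp: assms indicator_def)
  also have "\<dots> = J\<^sup>2 * dist a b"
    by (simp add: set_lebesgue_integral_def measure_def emeasure_arclength_segment sets_arclength_segment)
  finally show ?thesis by (simp add: L2_norm_def)
qed

text \<open>The jump J is constant on the edge. For a bump at the midpoint, the gradients of
  \<open>uh\<close> on the two sides contribute J times the integral of the bump over the edge, the
  normals being opposite, and the element residuals are bounded already. The statement is squared
  because the estimator sums squares.\<close>

lemma interior_edge_estimate:
  assumes K: "K \<in> T" and e: "e \<in> sides K" "e \<in> interior_edges T"
  shows "edge_length e * (L2_norm arclength e (vjump T e (grad uh)))\<^sup>2 \<le> (C2 * (Nrm K + diameter K * osc K))\<^sup>2"
proof -
  obtain a b p K' p' where t: "tri a b p" "K = convex hull {a, b, p}" "e = closed_segment a b"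
    "K' \<in> T" "K' \<noteq> K" "elems_at T e = {K, K'}" "tri b a p'" "K' = convex hull {b, a, p'}"
    by (rule interior_edge_elems[OF K e])
  define l where "l = norm (b - a)"
  define N where "N = Nrm K"
  define F where "F = osc K"
  define h where "h = diameter K"
  define h' where "h' = diameter K'"
  have NF: "0 \<le> N" "0 \<le> F" using Nrm_nonneg[OF K] osc_nonneg by (auto simp: N_def F_def)
  note sh = shape[OF K t(1,2), folded h_def l_def] and sh' = shape[OF t(4,7,8), folded h'_def]
  have l': "kap * h' \<le> l" "l \<le> h'" using sh'(6,7) by (auto simp: l_def norm_minus_commute)
  have ab: "a \<noteq> b" and l0: "0 < l" using tri_distinct[OF t(1)] by (auto simp: l_def)
  have eK': "e \<subseteq> K'" unfolding t(3,8) segment_convex_hull by (rule hull_mono) auto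
  have eK: "e \<subseteq> K" unfolding t(2,3) segment_convex_hull by (rule hull_mono) auto
  have int: "K' \<inter> K \<noteq> {}" "K \<inter> K \<noteq> {}" using eK eK' t(3) elem_nonempty[OF K] by auto
  define J where "J = (al K - al K') \<bullet> nrml a b"
  have nK: "normal K e = nrml a b" using normals(1)[OF t(1)] t(2,3) by simp
  have nK': "normal K' e = - nrml a b" using normals(2)[OF t(7)] t(3,8) by (simp add: nrml_swap[of b a])
  have vj: "vjump T e (grad uh) x = J" if "x \<in> e" for x
  proof -
    have ne: "K \<noteq> K'" using t(5) by simp
    have "vjump T e (grad uh) x = al K \<bullet> normal K e + al K' \<bullet> normal K' e"
      unfolding vjump_def t(6) using ne inner_limit_grad[OF K subsetD[OF eK that]] inner_limit_grad[OF t(4) subsetD[OF eK' that]] by simp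
    then show ?thesis by (simp add: nK nK' J_def inner_diff_left)
  qed
  \<comment> \<open>Small enough for the half discs in both triangles: H \<rho> \<le>
    \<open>kap\<close> H^2 / 4 for the diameter H of either element, while the midpoint allows half
    of twice the area, which is at least \<open>kap\<close> H^2 / 2.\<close>
  define \<rho> where "\<rho> = kap * l / 4"
  have \<rho>: "0 < \<rho>" using sh(1) l0 by (simp add: \<rho>_def)
  have kl: "kap * l \<le> l" using mult_right_mono[of kap 1 l] sh(2) l0 by simp
  have \<rho>h: "\<rho> \<le> h" "\<rho> \<le> h'" "\<rho> \<le> Hd" "\<rho> \<le> 1/2 * l" using kl sh(5,7) l' l0 unfolding \<rho>_def by linarith+
  define c where "c = (1 - 1/2) *\<^sub>R a + (1/2 :: real) *\<^sub>R b"
  have c': "c = (1 - 1/2) *\<^sub>R b + (1/2 :: real) *\<^sub>R a" by (simp add: c_def add.commute)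
  have hr: "H * \<rho> < 1/2 * D" if H: "0 < H" "l \<le> H" "kap * H\<^sup>2 \<le> D" for H D
  proof -
    have "H * \<rho> = kap * (H * l) / 4" by (simp add: \<rho>_def)
    also have "\<dots> \<le> kap * (H * H) / 4" using H sh(1) by (intro divide_right_mono mult_left_mono) auto
    also have "\<dots> < 1/2 * (kap * H\<^sup>2)" using H(1) sh(1) by (simp add: power2_eq_square)
    finally show ?thesis using H(3) by simp
  qed
  have r1: "diameter (convex hull {a, b, p}) * \<rho> < 1/2 * cross (b - a) (p - a)"
    using hr[OF sh(4,7,3)] t(2) h_def by simp
  have r2: "diameter (convex hull {b, a, p'}) * \<rho> < 1/2 * cross (a - b) (p' - b)"
    using hr[OF sh'(4) l'(2) sh'(3)] t(8) h'_def by simp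
  define B where "B = (LINT x:closed_segment a b|arclength. bump c \<rho> x)"
  have g1: "(LINT x:interior K|lebesgue. grad (bump c \<rho>) x) = B *\<^sub>R nrml a b"
    unfolding t(2) B_def by (rule gradient_bump_half_disc[OF t(1) c_def _ _ \<rho> r1]) auto
  have g2: "(LINT x:interior K'|lebesgue. grad (bump c \<rho>) x) = - (B *\<^sub>R nrml a b)"
    using gradient_bump_half_disc[OF t(7) c' _ _ \<rho> r2] unfolding t(8) B_def
    by (simp add: closed_segment_commute[of b a] nrml_swap[of b a])
  have bcont: "continuous_on (closed_segment a b) (bump c \<rho>)"
    using continuous_on_subset[OF bump_props(2)[OF \<rho> Os(1)]] by simp
  have "1 * \<rho> / 8 \<le> (LINT x:closed_segment a b|arclength. 1 * bump c \<rho> x)"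
    by (rule edge_bump_integral_ge[OF ab c_def _ _ \<rho> \<rho>h(4)[unfolded l_def]])
      (use set_integrable_continuous_edge[OF bcont] in auto)
  then have Bge: "\<rho> / 8 \<le> B" by (simp add: B_def)
  have cb: "cball c \<rho> \<subseteq> K \<union> K'" "ball c \<rho> \<subseteq> \<Omega>"
    using two_sides_ball[OF t(1) _ t(7) _ c_def _ _ r1 r2] K t(2,4,8) by auto
  have "ball c \<rho> \<subseteq> \<Union>{K, K'}" using order_trans[OF ball_subset_cball cb(1)] by simp
  from residual_interior[OF _ \<rho> cb(2) this] K t(4,5)
  have id: "(LINT x:interior K|lebesgue. (Gu x - al K) \<bullet> grad (bump c \<rho>) x) + (LINT x:interior K|lebesgue. err x * bump c \<rho> x)
      + al K \<bullet> (B *\<^sub>R nrml a b) + ((LINT x:interior K'|lebesgue. (Gu x - al K') \<bullet> grad (bump c \<rho>) x)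
      + (LINT x:interior K'|lebesgue. err x * bump c \<rho> x) + al K' \<bullet> (- (B *\<^sub>R nrml a b)))
     = (LINT x:interior K|lebesgue. (f x - uh x) * bump c \<rho> x) + (LINT x:interior K'|lebesgue. (f x - uh x) * bump c \<rho> x)"
    by (simp add: g1 g2)
  have JB: "J * B = al K \<bullet> (B *\<^sub>R nrml a b) + al K' \<bullet> (- (B *\<^sub>R nrml a b))"
    by (simp add: J_def inner_diff_left algebra_simps)
  note tb = terms_bound(1,2)[OF K patch_sub[OF K int(2)] \<rho>, of c, folded N_def]
  note tb' = terms_bound(1,2)[OF t(4) patch_sub[OF t(4) int(1)] \<rho>, of c, folded N_def]
  have fK: "\<bar>LINT x:interior K|lebesgue. (f x - uh x) * bump c \<rho> x\<bar> \<le> 2 * \<rho> * R K"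
    unfolding R_def by (rule terms_bound(3)[OF K patch_sub[OF K int(2)] \<rho> L2_facts(7)[OF K]])
  have fK': "\<bar>LINT x:interior K'|lebesgue. (f x - uh x) * bump c \<rho> x\<bar> \<le> 2 * \<rho> * R K'"
    unfolding R_def by (rule terms_bound(3)[OF t(4) patch_sub[OF t(4) int(1)] \<rho> L2_facts(7)[OF t(4)]])
  have JB2: "\<bar>J * B\<bar> \<le> 2 * (4 * N + 2 * \<rho> * N) + 2 * \<rho> * R K + 2 * \<rho> * R K'"
  proof -
    have *: "\<bar>j\<bar> \<le> 2 * (A + B) + D + D'"
      if "x1 + x2 + y + (x3 + x4 + z) = f1 + f2" "j = y + z" "\<bar>x1\<bar> \<le> A" "\<bar>x2\<bar> \<le> B" "\<bar>x3\<bar> \<le> A" "\<bar>x4\<bar> \<le> B" "\<bar>f1\<bar> \<le> D" "\<bar>f2\<bar> \<le> D'"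
      for j A B D D' x1 x2 x3 x4 y z f1 f2 :: real
      using that by (simp add: distrib_left)
    show ?thesis by (rule *[OF id JB tb tb' fK fK'])
  qed
  have C: "1 \<le> C1" by (rule C1_ge[OF K])
  have R0: "0 \<le> R K" "0 \<le> R K'" by (auto simp: R_def)
  have q1: "\<rho> * R K \<le> C1 * (N + h * F)"
    using elem_residual[OF K K int(2)] mult_right_mono[OF \<rho>h(1) R0(1)] unfolding N_def F_def h_def by linarith
  have q1': "C1 * (N + h * F) \<le> C1 / kap * (N + h * F)"
  proof (rule mult_right_mono)
    show "C1 \<le> C1 / kap" using C sh(1,2) by (simp add: field_simps mult_left_le)
    show "0 \<le> N + h * F" using NF sh(4) by simp
  qed
  have q2: "\<rho> * R K' \<le> C1 * (N + h' * F)"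
    using elem_residual[OF K t(4) int(1)] mult_right_mono[OF \<rho>h(2) R0(2)] unfolding N_def F_def h'_def by linarith
  \<comment> \<open>The diameter of the neighbour is compared through the common edge:
    \<open>kap\<close> h' \<le> l \<le> h. This is the origin of the division by
    \<open>kap\<close>.\<close>
  have q2': "C1 * (N + h' * F) \<le> C1 / kap * (N + h * F)"
  proof -
    have "kap * h' \<le> h" using l'(1) sh(7) by linarith
    then have "kap * (h' * F) \<le> h * F" using NF(2) by (simp add: mult.assoc[symmetric] mult_right_mono)
    moreover have "kap * N \<le> N" using mult_right_mono[of kap 1 N] sh(2) NF by simp
    ultimately have "kap * (N + h' * F) \<le> N + h * F" by (simp add: distrib_left)
    then have "N + h' * F \<le> (N + h * F) / kap" using sh(1) by (simp add: pos_le_divide_eq mult.commute)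
    then have "C1 * (N + h' * F) \<le> C1 * ((N + h * F) / kap)" using C by (intro mult_left_mono) auto
    then show ?thesis by simp
  qed
  have q3: "\<rho> * N \<le> Hd * N" using \<rho>h(3) NF(1) by (rule mult_right_mono)
  have "\<rho> / 8 * \<bar>J\<bar> \<le> B * \<bar>J\<bar>" using Bge by (intro mult_right_mono) auto
  also have "\<dots> = \<bar>J * B\<bar>" using Bge \<rho> by (simp add: abs_mult)
  also have "\<dots> \<le> 2 * (4 + 2 * Hd) * N + 4 * (C1 / kap * (N + h * F))"
  proof -
    define X where "X = C1 / kap * (N + h * F)"
    have "\<bar>J * B\<bar> \<le> 8 * N + 4 * (\<rho> * N) + 2 * (\<rho> * R K) + 2 * (\<rho> * R K')" using JB2 by (simp add: algebra_simps)
    moreover have "\<rho> * R K \<le> X" "\<rho> * R K' \<le> X" using q1 q1' q2 q2' unfolding X_def by (meson order_trans)+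
    ultimately have "\<bar>J * B\<bar> \<le> 8 * N + 4 * (Hd * N) + 4 * X" using q3 by linarith
    then have "\<bar>J * B\<bar> \<le> 2 * (4 + 2 * Hd) * N + 4 * X" by (simp add: algebra_simps)
    then show ?thesis unfolding X_def .
  qed
  also have "\<dots> \<le> (2 * (4 + 2 * Hd) + 4 * C1 / kap) * (N + h * F)"
  proof -
    have "0 < Hd" by (rule Hd_pos[OF K])
    then have "2 * (4 + 2 * Hd) * N \<le> 2 * (4 + 2 * Hd) * (N + h * F)" using NF sh(4) by (intro mult_left_mono) auto
    then show ?thesis by (simp add: distrib_right)
  qed
  finally have "\<rho> / 8 * \<bar>J\<bar> \<le> (2 * (4 + 2 * Hd) + 4 * C1 / kap) * (N + h * F)" .
  then have "32 / kap * (\<rho> / 8 * \<bar>J\<bar>) \<le> 32 / kap * ((2 * (4 + 2 * Hd) + 4 * C1 / kap) * (N + h * F))"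
    using sh(1) by (intro mult_left_mono) auto
  moreover have "32 / kap * (\<rho> / 8 * \<bar>J\<bar>) = l * \<bar>J\<bar>" using sh(1) by (simp add: \<rho>_def)
  ultimately have lJ: "l * \<bar>J\<bar> \<le> C2 * (N + h * F)" by (simp only: C2_def mult.assoc)
  have "edge_length e * (L2_norm arclength e (vjump T e (grad uh)))\<^sup>2 = (l * \<bar>J\<bar>)\<^sup>2"
    unfolding t(3) edge_length_segment using L2_norm_const_edge[of a b "vjump T (closed_segment a b) (grad uh)" J] vj t(3)
    by (simp add: l_def dist_norm norm_minus_commute power_mult_distrib power2_eq_square)
  also have "\<dots> \<le> (C2 * (N + h * F))\<^sup>2" using lJ l0 by (intro power_mono) auto
  finally show ?thesis by (simp add: N_def F_def h_def)
qed

text \<open>Counting ordered pairs of vertices gives the crude bound 9, whose square root is the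
  factor 3 in \<open>estimator_bound\<close>.\<close>

lemma card_sides: "K \<in> T \<Longrightarrow> card (sides K) \<le> 9"
proof -
  assume K: "K \<in> T"
  obtain a b p where t: "tri a b p" "K = convex hull {a, b, p}" using elem_tri[OF K] by blast
  have "sides K \<subseteq> (\<lambda>(x, y). closed_segment x y) ` ({a, b, p} \<times> {a, b, p})"
  proof
    fix e assume "e \<in> sides K"
    then obtain x y q where xy: "tri x y q" "K = convex hull {x, y, q}" "e = closed_segment x y"
      using side_tri[OF simplex[OF K]] by blast
    have "{x, y, q} = {a, b, p}" using vertices_tri[OF xy(1)] vertices_tri[OF t(1)] xy(2) t(2) by simp
    then show "e \<in> (\<lambda>(x, y). closed_segment x y) ` ({a, b, p} \<times> {a, b, p})" using xy(3) by (intro image_eqI[of _ _ "(x, y)"]) auto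
  qed
  then have "card (sides K) \<le> card ((\<lambda>(x, y). closed_segment x y) ` ({a, b, p} \<times> {a, b, p}))"
    by (intro card_mono) auto
  also have "\<dots> \<le> card ({a, b, p} \<times> {a, b, p})" by (rule card_image_le) auto
  also have "\<dots> = card {a, b, p} * card {a, b, p}" by (rule card_cartesian_product)
  also have "\<dots> \<le> 3 * 3"
    using card_insert_le_m1[of 3 "{b, p}" a] card_insert_le_m1[of 2 "{p}" b] by (intro mult_le_mono) auto
  finally show ?thesis by simp
qed

text \<open>The case S = K of \<open>residual_eq\<close>. Within the disc, the points of K outside
  its interior are relatively interior points of the edge and belong to no other element. The
  cut-off bump therefore drops to 0 only across the edge, and its restriction to the closure of
  \<Omega> is continuous even if the disc reaches other elements beyond a gap.\<close>

lemma residual_boundary: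
  assumes K: "K \<in> T" and t: "tri a b p" "K = convex hull {a, b, p}" and e: "closed_segment a b \<in> edges2 \<Omega> \<Gamma>1 T"
    and c: "c = (1 - s) *\<^sub>R a + s *\<^sub>R b" and s: "\<delta> \<le> s" "s \<le> 1 - \<delta>"
    and r: "0 < \<rho>" "diameter (convex hull {a, b, p}) * \<rho> < \<delta> * cross (b - a) (p - a)"
  shows "(LINT x:interior K|lebesgue. (Gu x - al K) \<bullet> grad (bump c \<rho>) x) + (LINT x:interior K|lebesgue. err x * bump c \<rho> x)
      + (al K \<bullet> nrml a b) * (LINT x:closed_segment a b|arclength. bump c \<rho> x)
     + (LINT x:closed_segment a b|arclength. g * lam x * bump c \<rho> x)
     = (LINT x:interior K|lebesgue. (f x - uh x) * bump c \<rho> x)"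
proof -
  define e where "e = closed_segment a b"
  have es: "e \<in> sides K" unfolding e_def t(2) by (rule segment_in_sides[OF t(1)])
  have e2: "e \<in> edges2 \<Omega> \<Gamma>1 T" and eb: "e \<in> boundary_edges T" using assms(4) by (auto simp: e_def edges2_def)
  have ef: "e \<subseteq> frontier \<Omega>" by (rule boundary_edge_frontier[OF K es eb])
  note en = edges2_null[OF K es e2]
  note hb = tri_half_ball[OF t(1) c s r(2), folded t(2) e_def] and near = tri_near_edge[OF t(1) c s tri_side_le_diameter(2,3) r(2)]
  have on_e: "x \<in> e" if "x \<in> K" "x \<notin> interior K" "dist c x \<le> \<rho>" for x
    using hb(1)[OF that(3)] hb(2)[OF that(3)] hb(3)[OF that(3)] that by auto
  have rel: "x \<in> rel_interior e" if x: "x \<in> e" "dist c x \<le> \<rho>" for x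
  proof -
    have "x \<noteq> a" "x \<noteq> b" using near(1,2)[OF x(2)] by (auto simp: cross_def)
    then show ?thesis using x(1) tri_distinct[OF t(1)] by (simp add: e_def rel_interior_closed_segment open_segment_def)
  qed
  have bz: "bump c \<rho> x = 0" if "\<not> dist c x \<le> \<rho>" for x using bump_eq_0[OF r(1), of c x] that by simp
  have notO: "x \<notin> \<Omega>" if "x \<in> frontier \<Omega>" for x using that O(1) by (simp add: frontier_def interior_open)
  have fr: "\<rho> < dist c x" if x: "x \<in> \<Omega>" "x \<in> frontier K" for x
  proof (rule ccontr)
    assume "\<not> \<rho> < dist c x"
    moreover have "x \<in> K" "x \<notin> interior K" using x(2) elem_closed[OF K] by (auto simp: frontier_def)
    ultimately have "x \<in> e" using on_e by simp
    then show False using ef notO x(1) by blast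
  qed
  \<comment> \<open>On the frontier of \<Omega> the test function is the bump restricted to the
    edge, so the boundary integral becomes one over the edge.\<close>
  have vf: "indicator K x * bump c \<rho> x = indicator e x * bump c \<rho> x" if x: "x \<in> frontier \<Omega>" for x
  proof (cases "dist c x \<le> \<rho>")
    case True
    have "x \<notin> interior K" using interior_elem_sub[OF K] notO[OF x] by blast
    then have "x \<in> K \<longleftrightarrow> x \<in> e" using on_e[of x] True es by (auto simp: sides_def dest: edge_of_imp_subset)
    then show ?thesis by (simp add: indicator_def)
  qed (simp add: bz)
  have vc: "continuous_on (closure \<Omega>) (\<lambda>x. indicator K x * bump c \<rho> x)"
  proof -
    have 1: "continuous_on K (\<lambda>x. indicator K x * bump c \<rho> x)"
      by (rule continuous_on_eq[OF continuous_on_subset[OF bump_props(2)[OF r(1) Os(1)]]]) auto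
    have 2: "continuous_on (\<Union>(T - {K})) (\<lambda>x. indicator K x * bump c \<rho> x)"
    proof (rule continuous_on_eq[of _ "\<lambda>_. 0"])
      fix x assume "x \<in> \<Union>(T - {K})"
      then obtain K' where K': "K' \<in> T" "K' \<noteq> K" "x \<in> K'" by blast
      show "0 = indicator K x * bump c \<rho> x"
      proof (cases "x \<in> K \<and> dist c x \<le> \<rho>")
        case True
        have "x \<notin> interior K" using inter_proper(3)[OF K K'(1)] K' by blast
        then have "x \<in> rel_interior e" using on_e rel True by blast
        then show ?thesis using boundary_edge_only[OF K es eb _ K'(3,1)] K'(2) by blast
      qed (auto simp: bz)
    qed auto
    have "continuous_on (K \<union> \<Union>(T - {K})) (\<lambda>x. indicator K x * bump c \<rho> x)"
      by (rule continuous_on_closed_Un[OF elem_closed[OF K] _ 1 2]) (use fin elem_closed in \<open>auto intro: closed_Union\<close>)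
    moreover have "K \<union> \<Union>(T - {K}) = closure \<Omega>" using union K by blast
    ultimately show ?thesis by simp
  qed
  \<comment> \<open>\<Gamma>1 meets the edge in a null set only, so the test function is admissible
    even if it is not zero at those points.\<close>
  have v1: "AE x in arclength. x \<in> \<Gamma>1 \<longrightarrow> indicator K x * bump c \<rho> x = 0"
    using AE_not_in[OF en]
  proof eventually_elim
    case (elim x)
    have "indicator K x * bump c \<rho> x = 0" if x: "x \<in> \<Gamma>1"
    proof -
      have "x \<notin> e" using elim x by auto
      then show ?thesis using vf[of x] G1_sub x by (auto simp: subset_iff)
    qed
    then show ?case by blast
  qed
  have bd: "(LINT x:Gamma2 \<Omega> \<Gamma>1|arclength. g * lam x * (indicator K x * bump c \<rho> x)) = (LINT x:e|arclength. g * lam x * bump c \<rho> x)"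
  proof (rule set_integral_change_set(2)[OF complete_measure_arclength])
    have Gcl: "closed \<Gamma>1" using G1 closedin_closed_trans frontier_closed by blast
    have G2s: "Gamma2 \<Omega> \<Gamma>1 \<in> sets arclength" using Gcl by (intro borel_arclength) auto
    have lm: "(\<lambda>x. indicator (Gamma2 \<Omega> \<Gamma>1) x *\<^sub>R lam x) \<in> borel_measurable arclength"
      using lam G2s by (auto simp: contact_multiplier_def Linf_space_def borel_measurable_restrict_space_iff)
    have "(\<lambda>x. indicator K x *\<^sub>R bump c \<rho> x) \<in> borel_measurable borel"
      using elem_closed[OF K] by (intro borel_measurable_continuous_on_indicator continuous_on_subset[OF bump_props(2)[OF r(1) Os(1)]]) auto
    note kb = measurable_arclength[OF this]
    have "(\<lambda>x. g * ((indicator (Gamma2 \<Omega> \<Gamma>1) x *\<^sub>R lam x) * (indicator K x *\<^sub>R bump c \<rho> x))) \<in> borel_measurable arclength"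
      by (rule borel_measurable_times[OF borel_measurable_const borel_measurable_times[OF lm kb]])
    moreover have "(\<lambda>x. g * ((indicator (Gamma2 \<Omega> \<Gamma>1) x *\<^sub>R lam x) * (indicator K x *\<^sub>R bump c \<rho> x))) =
      (\<lambda>x. indicator (Gamma2 \<Omega> \<Gamma>1) x *\<^sub>R (g * lam x * (indicator K x * bump c \<rho> x)))" by (auto simp: indicator_def)
    ultimately show "set_borel_measurable arclength (Gamma2 \<Omega> \<Gamma>1) (\<lambda>x. g * lam x * (indicator K x * bump c \<rho> x))"
      by (simp only: set_borel_measurable_def)
    show "AE x in arclength. indicator (Gamma2 \<Omega> \<Gamma>1) x *\<^sub>R (g * lam x * (indicator K x * bump c \<rho> x)) = indicator e x *\<^sub>R (g * lam x * bump c \<rho> x)"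
      using AE_not_in[OF en]
    proof eventually_elim
      case (elim x)
      show ?case
      proof (cases "x \<in> Gamma2 \<Omega> \<Gamma>1")
        case True then show ?thesis using vf[of x] by (simp add: indicator_def)
      next
        case False then have "x \<notin> e" using elim by blast
        then show ?thesis using False by simp
      qed
    qed
  qed
  have gh: "(LINT x:interior K|lebesgue. grad (bump c \<rho>) x) = (LINT x:e|arclength. bump c \<rho> x) *\<^sub>R nrml a b"
    unfolding t(2) e_def by (rule gradient_bump_half_disc[OF t(1) c s r])
  have "{K} \<subseteq> T" using K by simp
  from residual_eq[OF this _ elem_closed[OF K] r(1) fr _ vc v1]
  show ?thesis unfolding bd e_def[symmetric] using interior_subset[of K] by (simp add: gh mult.commute)
qed

text \<open>Functions of \<open>Linf_space\<close> are controlled on \<open>Gamma2\<close> only; by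
  \<open>edges2_null\<close> the edge belongs to it up to a null set.\<close>

lemma Linf_edge:
  assumes K: "K \<in> T" and e: "e \<in> sides K" "e \<in> edges2 \<Omega> \<Gamma>1 T" and \<mu>: "\<mu> \<in> Linf_space arclength (Gamma2 \<Omega> \<Gamma>1)"
  shows "\<mu> \<in> L2_space arclength e"
proof -
  have ee: "e \<in> edges T" using side_elems(1)[OF K e(1)] .
  have Gcl: "closed \<Gamma>1" using G1 closedin_closed_trans frontier_closed by blast
  have G2s: "Gamma2 \<Omega> \<Gamma>1 \<in> sets arclength" using Gcl by (intro borel_arclength) auto
  have es: "e \<in> sets arclength" by (rule edge_measure(2)[OF ee])
  then have ies: "e \<inter> Gamma2 \<Omega> \<Gamma>1 \<in> sets arclength" using G2s by auto
  have "emeasure arclength (e \<inter> Gamma2 \<Omega> \<Gamma>1) \<le> emeasure arclength e" using es by (intro emeasure_mono) auto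
  then have fin: "emeasure arclength (e \<inter> Gamma2 \<Omega> \<Gamma>1) < \<infinity>" using edge_measure(1)[OF ee] by (rule le_less_trans)
  obtain B where B: "AE x in arclength. x \<in> Gamma2 \<Omega> \<Gamma>1 \<longrightarrow> \<bar>\<mu> x\<bar> \<le> B" using \<mu> by (auto simp: Linf_space_def)
  have m: "(\<lambda>x. indicator (Gamma2 \<Omega> \<Gamma>1) x *\<^sub>R \<mu> x) \<in> borel_measurable arclength"
    using \<mu> G2s by (auto simp: Linf_space_def borel_measurable_restrict_space_iff)
  have "\<mu> \<in> L2_space arclength (e \<inter> Gamma2 \<Omega> \<Gamma>1)"
  proof (rule L2_space_bounded[OF ies fin])
    have "(\<lambda>x. indicator e x *\<^sub>R (indicator (Gamma2 \<Omega> \<Gamma>1) x *\<^sub>R \<mu> x)) \<in> borel_measurable arclength"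
      by (rule borel_measurable_scaleR[OF borel_measurable_indicator[OF es] m])
    moreover have "(\<lambda>x. indicator e x *\<^sub>R (indicator (Gamma2 \<Omega> \<Gamma>1) x *\<^sub>R \<mu> x)) = (\<lambda>x. indicator (e \<inter> Gamma2 \<Omega> \<Gamma>1) x *\<^sub>R \<mu> x)"
      by (auto simp: indicator_def)
    ultimately show "set_borel_measurable arclength (e \<inter> Gamma2 \<Omega> \<Gamma>1) \<mu>" by (simp only: set_borel_measurable_def)
    show "AE x in arclength. x \<in> e \<inter> Gamma2 \<Omega> \<Gamma>1 \<longrightarrow> norm (\<mu> x) \<le> B" using B by eventually_elim auto
  qed
  then show ?thesis
  proof (rule L2_change_set(1)[OF complete_measure_arclength ies es])
    show "AE x in arclength. indicator (e \<inter> Gamma2 \<Omega> \<Gamma>1) x *\<^sub>R \<mu> x = indicator e x *\<^sub>R \<mu> x"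
      using AE_not_in[OF edges2_null[OF K e]] by eventually_elim (auto simp: indicator_def)
  qed
qed

text \<open>The other elements meet K in null sets, so a single term of the broken norm
  remains.\<close>

lemma norm1h_elem:
  assumes K: "K \<in> T" and v: "v \<in> L2_space lebesgue (interior K)" "G \<in> L2_space lebesgue (interior K)" "is_weak_grad (interior K) v G"
  shows "norm1h T K v = sqrt ((L2_norm lebesgue (interior K) G)\<^sup>2 + (L2_norm lebesgue (interior K) v)\<^sup>2)"
proof -
  define q where "q K' = (LINT x:K \<inter> K'|lebesgue. (norm (weak_grad (interior (K' \<inter> K)) v x))\<^sup>2 + (v x)\<^sup>2)" for K'
  have "q K' = 0" if K': "K' \<in> T - {K}" for K'
    unfolding q_def set_lebesgue_integral_def
  proof (rule integral_eq_zero_AE)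
    show "AE x in lebesgue. indicator (K \<inter> K') x *\<^sub>R ((norm (weak_grad (interior (K' \<inter> K)) v x))\<^sup>2 + (v x)\<^sup>2) = 0"
      using AE_interior
    proof eventually_elim
      case (elim x)
      have "interior K \<inter> K' = {}" using inter_proper(3)[OF K] K' by blast
      then have "x \<notin> K \<inter> K'" using elim K by blast
      then show ?case by simp
    qed
  qed
  then have "sum q T = q K" using fin K by (simp add: sum.remove[of T K])
  then show ?thesis using norm1h_term[OF K order_refl v] by (simp add: norm1h_def q_def)
qed

text \<open>The bump divided by its broken norm n2 \<le> 4 + 2 \<rho> is a competitor in the
  supremum, and its trace on the edge is almost everywhere the scaled bump itself.\<close>

lemma dual_norm_bump:
  assumes K: "K \<in> T" and t: "tri a b p" "K = convex hull {a, b, p}" and e: "closed_segment a b \<in> edges2 \<Omega> \<Gamma>1 T"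
    and c: "c = (1 - s) *\<^sub>R a + s *\<^sub>R b" and s: "\<delta> \<le> s" "s \<le> 1 - \<delta>"
    and r: "0 < \<rho>" "diameter (convex hull {a, b, p}) * \<rho> < \<delta> * cross (b - a) (p - a)" "\<rho> \<le> \<delta> * norm (b - a)"
    and \<mu>: "\<mu> \<in> L2_space arclength (closed_segment a b)"
  shows "0 \<le> dual_norm T g (closed_segment a b) \<mu>"
    "dual_norm T g (closed_segment a b) \<mu> \<noteq> \<infinity> \<Longrightarrow>
      \<bar>LINT x:closed_segment a b|arclength. g * \<mu> x * bump c \<rho> x\<bar> \<le> (4 + 2 * \<rho>) * real_of_ereal (dual_norm T g (closed_segment a b) \<mu>)"
proof -
  define e where "e = closed_segment a b"
  define b1 where "b1 = bump c \<rho>"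
  have es: "e \<in> sides K" unfolding e_def t(2) by (rule segment_in_sides[OF t(1)])
  have eb: "e \<in> boundary_edges T" using e by (auto simp: e_def edges2_def)
  have ab: "a \<noteq> b" using tri_distinct[OF t(1)] by blast
  have "elems_at T e = {K}" using side_elems(2)[OF K es] eb by blast
  then have ee: "edge_elem T e = K" by (simp add: edge_elem_def)
  note bp = bump_props[OF r(1) Ks(1)[of K], of c, folded b1_def]
  define n2 where "n2 = sqrt ((L2_norm lebesgue (interior K) (grad b1))\<^sup>2 + (L2_norm lebesgue (interior K) b1)\<^sup>2)"
  have n2le: "n2 \<le> 4 + 2 * \<rho>"
    unfolding n2_def using bp(6,7) by (intro order_trans[OF sqrt_sum_squares_le_sum]) auto
  have bcont: "continuous_on (closed_segment a b) b1" using continuous_on_subset[OF bp(2)] by simp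
  have "1 * \<rho> / 8 \<le> (LINT x:closed_segment a b|arclength. 1 * bump c \<rho> x)"
    by (rule edge_bump_integral_ge[OF ab c s r(1,3)])
      (use set_integrable_continuous_edge[OF bcont] in \<open>auto simp: b1_def\<close>)
  then have Bpos: "0 < (LINT x:e|arclength. b1 x)" using r(1) by (simp add: b1_def e_def)
  \<comment> \<open>A vanishing norm would make the integral of the gradient 0, but by Green's
    formula this integral is a positive multiple of the normal.\<close>
  have n2pos: "0 < n2"
  proof -
    have gh: "(LINT x:interior K|lebesgue. grad b1 x) = (LINT x:e|arclength. b1 x) *\<^sub>R nrml a b"
      unfolding t(2) e_def b1_def by (rule gradient_bump_half_disc[OF t(1) c s r(1,2)])
    have "norm (LINT x:interior K|lebesgue. (1::real) *\<^sub>R grad b1 x) \<le> L2_norm lebesgue (interior K) (\<lambda>_. 1 :: real) * L2_norm lebesgue (interior K) (grad b1)"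
      by (rule set_integral_scaleR_le(2)[OF Ks(2) const_L2[OF K] bp(5)])
    moreover have "0 < norm (LINT x:interior K|lebesgue. (1::real) *\<^sub>R grad b1 x)"
      using gh Bpos nrml_tang(2)[OF ab] by simp
    ultimately have "L2_norm lebesgue (interior K) (grad b1) \<noteq> 0" by auto
    then show ?thesis unfolding n2_def by (intro real_sqrt_gt_zero add_pos_nonneg) auto
  qed
  define I where "I = (LINT x:e|arclength. g * \<mu> x * b1 x)"
  \<comment> \<open>Both signs compete, in order to bound the modulus of I.\<close>
  have key: "ereal (\<sigma> / n2 * I) \<le> dual_norm T g e \<mu>" if \<sigma>: "\<bar>\<sigma>\<bar> = 1" for \<sigma>
  proof -
    define k where "k = \<sigma> / n2"
    have k: "\<bar>k\<bar> = 1 / n2" using \<sigma> n2pos by (simp add: k_def)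
    define w where "w x = k * b1 x" for x
    define Gw where "Gw x = k *\<^sub>R grad b1 x" for x
    have wL: "w \<in> L2_space lebesgue (interior K)" using L2_space_scaleR[OF Ks(2) bp(4), of k] by (simp add: w_def[abs_def])
    have GL: "Gw \<in> L2_space lebesgue (interior K)" using L2_space_scaleR[OF Ks(2) bp(5), of k] by (simp add: Gw_def[abs_def])
    have ww: "is_weak_grad V w Gw" for V
      unfolding w_def[abs_def] Gw_def[abs_def] by (rule is_weak_grad_scaleR[OF is_weak_grad_smooth[OF bp(1,3)]])
    have n1: "L2_norm lebesgue (interior K) w = \<bar>k\<bar> * L2_norm lebesgue (interior K) b1"
      unfolding L2_norm_def w_def by (simp add: power_mult_distrib real_sqrt_mult)
    have nG: "L2_norm lebesgue (interior K) Gw = \<bar>k\<bar> * L2_norm lebesgue (interior K) (grad b1)"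
      unfolding L2_norm_def Gw_def by (simp add: power_mult_distrib real_sqrt_mult)
    have "norm1h T K w = sqrt (\<bar>k\<bar>\<^sup>2 * n2\<^sup>2)"
      unfolding norm1h_elem[OF K wL GL ww] n1 nG n2_def by (simp add: power_mult_distrib distrib_left)
    also have "\<dots> = 1" using k n2pos by (simp add: power_divide)
    finally have norm1: "norm1h T K w = 1" .
    have all: "w \<in> L2_space lebesgue V \<and> Gw \<in> L2_space lebesgue V" if "V \<in> sets lebesgue" for V
      using that L2_space_scaleR[OF _ bump_props(4)[OF r(1) that, of c], of k] L2_space_scaleR[OF _ bump_props(5)[OF r(1) that, of c], of k]
      by (simp add: w_def[abs_def] Gw_def[abs_def] b1_def)
    have wH: "w \<in> H1 V" if "open V" for V
      unfolding H1_def using all[of V] ww[of V] that by auto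
    have "K \<in> sets lebesgue" using elem_closed[OF K] by auto
    then have wHh: "w \<in> H1h T K" unfolding H1h_def using all[of K] by (intro CollectI conjI ballI wH open_interior) auto
    have Kfr: "frontier (interior K) \<subseteq> \<Union>(sides K)"
      using elem_boundary_sides[OF K] frontier_interior_subset[of K] elem_closed[OF K] by (auto simp: frontier_def)
    have sm: "x \<in> sides K \<Longrightarrow> x \<in> sets arclength \<and> emeasure arclength x < \<infinity>" for x
      using side_elems(1)[OF K] edge_measure by blast
    have "emeasure arclength (frontier (interior K)) \<le> emeasure arclength (\<Union>x\<in>sides K. x)"
      using Kfr sm finite_sides[OF K] by (intro emeasure_mono sets.finite_UN) auto
    also have "\<dots> \<le> (\<Sum>x\<in>sides K. emeasure arclength x)"
      using sm finite_sides[OF K] by (intro emeasure_subadditive_finite) auto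
    also have "\<dots> < \<infinity>" using sm finite_sides[OF K] by auto
    finally have ffin: "emeasure arclength (frontier (interior K)) < \<infinity>" .
    have clK: "closure (interior K) = K"
    proof -
      have "interior K \<noteq> {}"
      proof
        assume "interior K = {}"
        then show False using n2pos by (simp add: n2_def L2_norm_def set_lebesgue_integral_def)
      qed
      then show ?thesis using convex_closure_interior[OF elem_convex[OF K]] elem_closed[OF K] by simp
    qed
    have efr: "closed_segment a b \<subseteq> frontier (interior K)"
    proof
      fix x assume x: "x \<in> closed_segment a b"
      then have xK: "x \<in> K" using es by (auto simp: e_def sides_def dest: edge_of_imp_subset)
      then have "cross (b - a) (x - a) = 0" using tri_side_iff[OF t(1)] x t(2) by blast
      then have "x \<notin> interior K" using tri_interior[OF t(1), of x] t(2) by auto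
      then show "x \<in> frontier (interior K)" using xK clK by (simp add: frontier_def)
    qed
    have bK: "bounded (interior K)" using compact_imp_bounded[OF elem_compact[OF K]] by (rule bounded_interior)
    have wcl: "continuous_on (closure (interior K)) w"
      unfolding w_def by (intro continuous_on_mult continuous_on_const continuous_on_subset[OF bp(2)]) auto
    have trw: "AE x in arclength. x \<in> closed_segment a b \<longrightarrow> tr (interior K) w x = w x"
      by (rule trace_AE_edge[OF open_interior bK ffin t(1) _ efr wH[OF open_interior] wcl
            is_trace_continuous(2)[OF open_interior bK ffin wH[OF open_interior] wcl]]) (simp add: t(2))
    have "\<sigma> / n2 * I = (LINT x:e|arclength. g * \<mu> x * w x)"
    proof -
      have "(\<lambda>x. g * \<mu> x * (k * b1 x)) = (\<lambda>x. k * (g * \<mu> x * b1 x))" by (simp add: mult.left_commute)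
      then show ?thesis unfolding I_def w_def k_def[symmetric] by (simp only: set_integral_mult_right)
    qed
    also have "\<dots> = (LINT x:e|arclength. g * \<mu> x * tr (interior K) w x)"
    proof (rule set_integral_change_set(2)[OF complete_measure_arclength])
      have wLe: "w \<in> L2_space arclength e" unfolding e_def
        by (rule L2_space_continuous_arclength) (use bcont in \<open>auto simp: emeasure_arclength_segment w_def intro!: continuous_intros\<close>)
      have esp: "e \<inter> space arclength \<in> sets arclength" by (simp add: e_def sets_arclength_segment)
      have "set_integrable arclength e (\<lambda>x. \<mu> x \<bullet> w x)" by (rule set_cauchy_schwarz(1)[OF esp _ wLe]) (use \<mu> in \<open>simp add: e_def\<close>)
      then have "set_integrable arclength e (\<lambda>x. g * (\<mu> x \<bullet> w x))" by (intro set_integrable_mult_right) simp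
      then show "set_borel_measurable arclength e (\<lambda>x. g * \<mu> x * w x)"
        by (auto simp: set_integrable_def set_borel_measurable_def mult.assoc)
      show "AE x in arclength. indicator e x *\<^sub>R (g * \<mu> x * w x) = indicator e x *\<^sub>R (g * \<mu> x * tr (interior K) w x)"
        using trw by eventually_elim (auto simp: e_def indicator_def)
    qed
    finally have I: "\<sigma> / n2 * I = (LINT x:e|arclength. g * \<mu> x * tr (interior K) w x)" .
    show ?thesis unfolding I dual_norm_def ee
      by (rule SUP_upper) (use wHh norm1 in simp)
  qed
  have "ereal (\<bar>I\<bar> / n2) \<le> dual_norm T g e \<mu>"
    using key[of 1] key[of "-1"] by (cases "0 \<le> I") simp_all
  then show "0 \<le> dual_norm T g (closed_segment a b) \<mu>"
    using n2pos order_trans[of 0 "ereal (\<bar>I\<bar> / n2)"] by (simp add: e_def)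
  \<comment> \<open>\<open>real_of_ereal\<close> sends \<infinity> to 0, so the real bound is
    claimed for finite values only; an infinite one makes the final estimate trivial.\<close>
  assume fin: "dual_norm T g (closed_segment a b) \<mu> \<noteq> \<infinity>"
  then obtain d where d: "dual_norm T g e \<mu> = ereal d"
    using \<open>ereal (\<bar>I\<bar> / n2) \<le> dual_norm T g e \<mu>\<close> by (cases "dual_norm T g e \<mu>") (auto simp: e_def)
  then have "\<bar>I\<bar> / n2 \<le> d" using \<open>ereal (\<bar>I\<bar> / n2) \<le> dual_norm T g e \<mu>\<close> by simp
  then have "\<bar>I\<bar> \<le> n2 * d" using n2pos by (simp add: field_simps)
  moreover have "0 \<le> d" using \<open>\<bar>I\<bar> / n2 \<le> d\<close> n2pos by (meson abs_ge_zero divide_nonneg_pos order_trans)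
  ultimately have "\<bar>I\<bar> \<le> (4 + 2 * \<rho>) * d" using mult_right_mono[OF n2le] by (meson order_trans)
  then show "\<bar>LINT x:closed_segment a b|arclength. g * \<mu> x * bump c \<rho> x\<bar> \<le> (4 + 2 * \<rho>) * real_of_ereal (dual_norm T g (closed_segment a b) \<mu>)"
    using d by (simp add: I_def e_def b1_def)
qed

text \<open>With \<rho> = \<open>kap\<close> \<delta> l / 2, the factor 32 / (\<open>kap\<close>
  \<delta>) turns M \<rho> / 16 into M l. The bracket collects the error and the dual norm, the
  element residual, and the deviation of \<open>lamh\<close> from its polynomial. This deviation
  enters once more, as the last g, when the polynomial is compared with the residual itself.\<close>

definition C3 :: "real \<Rightarrow> real" where "C3 \<delta> = 32 / (kap * \<delta>) * (4 + 2 * Hd + 2 * C1 + g) + g"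

text \<open>On the edge the residual differs from the polynomial q by g times \<open>lamh\<close> -
  \<open>lb\<close>. The integral of q times the bump is read off from
  \<open>residual_boundary\<close>, in which \<open>lam\<close> is the sum of \<open>lam\<close> -
  \<open>lamh\<close>, \<open>lamh\<close> - \<open>lb\<close> and \<open>lb\<close>.\<close>

lemma friction_edge_estimate:
  assumes K: "K \<in> T" and e: "e \<in> sides K" "e \<in> edges2 \<Omega> \<Gamma>1 T" and lb: "edge_poly m e lb"
    and \<delta>: "0 < \<delta>" "\<delta> \<le> 1/8"
    and large: "\<And>c. \<exists>M s \<sigma>. (\<forall>t\<in>{0..1}. \<bar>\<Sum>k\<le>m. c k * t ^ k\<bar> \<le> M) \<and> \<delta> \<le> s \<and> s \<le> 1 - \<delta> \<and>
     (\<sigma> = 1 \<or> \<sigma> = -1) \<and> (\<forall>t. \<bar>t - s :: real\<bar> \<le> \<delta> \<longrightarrow> M / 2 \<le> \<sigma> * (\<Sum>k\<le>m. c k * t ^ k))"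
  shows "0 \<le> dual_norm T g e (\<lambda>x. lam x - lamh x)"
    "dual_norm T g e (\<lambda>x. lam x - lamh x) \<noteq> \<infinity> \<Longrightarrow>
      sqrt (edge_length e) * L2_norm arclength e (res_friction T g uh lamh e) \<le>
      C3 \<delta> * (Nrm K + real_of_ereal (dual_norm T g e (\<lambda>x. lam x - lamh x)) + diameter K * osc K
        + sqrt (edge_length e) * L2_norm arclength e (\<lambda>x. lamh x - lb x))"
proof -
  obtain a b p where t: "tri a b p" "K = convex hull {a, b, p}" "e = closed_segment a b"
    by (rule side_tri[OF simplex[OF K] e(1)])
  obtain a' b' cf where ab': "e = closed_segment a' b'"
    and lbc: "\<And>t. t \<in> {0..1} \<Longrightarrow> lb (a' + t *\<^sub>R (b' - a')) = (\<Sum>k\<le>m. cf k * t ^ k)"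
    using lb unfolding edge_poly_def by blast
  \<comment> \<open>The parametrisation in \<open>edge_poly\<close> may run through the edge in
    either direction.\<close>
  have sw: "{a', b'} = {a, b}" using ab' t(3) by (simp add: closed_segment_eq)
  define l where "l = norm (b - a)"
  define h where "h = diameter K"
  define N where "N = Nrm K"
  define F where "F = osc K"
  define \<Lambda> where "\<Lambda> = L2_norm arclength e (\<lambda>x. lamh x - lb x)"
  define dn where "dn = dual_norm T g e (\<lambda>x. lam x - lamh x)"
  note sh = shape[OF K t(1,2), folded h_def l_def]
  have ab: "a \<noteq> b" using tri_distinct[OF t(1)] by blast
  have l0: "0 < l" using ab by (simp add: l_def)
  have l': "norm (b' - a') = l" using sw by (auto simp: l_def doubleton_eq_iff norm_minus_commute)
  have el: "edge_length e = l" by (simp add: t(3) edge_length_segment l_def dist_norm norm_minus_commute)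
  define \<gamma> where "\<gamma> = al K \<bullet> nrml a b"
  define q where "q x = \<gamma> + g * lb x" for x
  \<comment> \<open>Adding the constant normal derivative \<gamma> changes the coefficient of degree
    0 only, so q stays in the polynomial space of degree m.\<close>
  define c' where "c' k = g * cf k + (if k = 0 then \<gamma> else 0)" for k :: nat
  have qc: "q (a' + t *\<^sub>R (b' - a')) = (\<Sum>k\<le>m. c' k * t ^ k)" if "t \<in> {0..1}" for t
  proof -
    have "(\<Sum>k\<le>m. c' k * t ^ k) = (\<Sum>k\<le>m. g * (cf k * t ^ k)) + (\<Sum>k\<le>m. if k = 0 then \<gamma> else 0)"
      unfolding sum.distrib[symmetric] by (intro sum.cong refl) (auto simp: c'_def algebra_simps)
    also have "\<dots> = g * (\<Sum>k\<le>m. cf k * t ^ k) + \<gamma>" by (simp add: sum_distrib_left)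
    finally show ?thesis by (simp add: q_def lbc[OF that])
  qed
  have seg: "\<exists>t\<in>{0..1}. x = a' + t *\<^sub>R (b' - a')" if x: "x \<in> e" for x
  proof -
    obtain t where "0 \<le> t" "t \<le> 1" "x = (1 - t) *\<^sub>R a' + t *\<^sub>R b'" using x unfolding ab' in_segment by blast
    then show ?thesis by (intro bexI[of _ t]) (auto simp: algebra_simps)
  qed
  obtain M s \<sigma> where big: "(\<forall>t\<in>{0..1}. \<bar>\<Sum>k\<le>m. c' k * t ^ k\<bar> \<le> M) \<and> \<delta> \<le> s \<and> s \<le> 1 - \<delta> \<and>
     (\<sigma> = 1 \<or> \<sigma> = -1) \<and> (\<forall>t. \<bar>t - s\<bar> \<le> \<delta> \<longrightarrow> M / 2 \<le> \<sigma> * (\<Sum>k\<le>m. c' k * t ^ k))"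
    using large[of c'] by (elim exE) (rule that)
  have s: "\<delta> \<le> s" "s \<le> 1 - \<delta>" and \<sigma>: "\<sigma> = 1 \<or> \<sigma> = -1" using big by (simp_all only:)
  have M: "\<bar>\<Sum>k\<le>m. c' k * t ^ k\<bar> \<le> M" if "t \<in> {0..1}" for t by (rule bspec[OF conjunct1[OF big] that])
  have Ms: "M / 2 \<le> \<sigma> * (\<Sum>k\<le>m. c' k * t ^ k)" if "\<bar>t - s\<bar> \<le> \<delta>" for t
    by (rule mp[OF spec[OF conjunct2[OF conjunct2[OF conjunct2[OF conjunct2[OF big]]]]] that])
  have M0: "0 \<le> M" using M[of 0] by (simp del: power_0_left)
  have qM: "norm (q x) \<le> M" if "x \<in> e" for x using seg[OF that] qc M by auto
  define c where "c = a' + s *\<^sub>R (b' - a')"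
  have "\<exists>s2. c = (1 - s2) *\<^sub>R a + s2 *\<^sub>R b \<and> \<delta> \<le> s2 \<and> s2 \<le> 1 - \<delta>"
  proof (cases "a' = a \<and> b' = b")
    case True
    then show ?thesis using s by (intro exI[of _ s]) (simp add: c_def algebra_simps)
  next
    case False
    then have "a' = b" "b' = a" using sw by (auto simp: doubleton_eq_iff)
    then show ?thesis using s by (intro exI[of _ "1 - s"]) (simp add: c_def algebra_simps)
  qed
  then obtain s2 where c: "c = (1 - s2) *\<^sub>R a + s2 *\<^sub>R b" and s2: "\<delta> \<le> s2" "s2 \<le> 1 - \<delta>" by blast
  \<comment> \<open>The factor \<delta> l confines the disc to the part of the edge where q is
    large, and \<open>kap\<close> keeps it away from the other two sides.\<close>
  define \<rho> where "\<rho> = kap * \<delta> * l / 2"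
  have \<rho>0: "0 < \<rho>" using sh(1) \<delta> l0 by (simp add: \<rho>_def)
  have kl: "kap * (\<delta> * l) \<le> 1 * (\<delta> * l)" using sh(2) \<delta> l0 by (intro mult_right_mono) auto
  have dl: "\<delta> * l \<le> 1 * l" using \<delta> l0 by (intro mult_right_mono) auto
  have \<rho>2: "2 * \<rho> = kap * (\<delta> * l)" by (simp add: \<rho>_def)
  have \<rho>: "\<rho> \<le> \<delta> * l" "\<rho> \<le> h" "\<rho> \<le> Hd" using kl dl \<rho>2 \<rho>0 sh(5,7) by linarith+
  have r: "diameter (convex hull {a, b, p}) * \<rho> < \<delta> * cross (b - a) (p - a)"
  proof -
    have "h * \<rho> = kap * \<delta> / 2 * (h * l)" by (simp add: \<rho>_def)
    also have "\<dots> \<le> kap * \<delta> / 2 * (h * h)" using sh(1,4,7) \<delta> by (intro mult_left_mono) auto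
    also have "\<dots> < \<delta> * (kap * h\<^sup>2)" using sh(1,4) \<delta> by (simp add: power2_eq_square)
    also have "\<dots> \<le> \<delta> * cross (b - a) (p - a)" using sh(3) \<delta> by (intro mult_left_mono) auto
    finally show ?thesis by (simp add: h_def t(2))
  qed
  have e2: "closed_segment a b \<in> edges2 \<Omega> \<Gamma>1 T" using e(2) t(3) by simp
  have esM: "e \<in> sets arclength" by (simp add: t(3) sets_arclength_segment)
  have es: "e \<inter> space arclength \<in> sets arclength" using esM by simp
  have efin: "emeasure arclength e < \<infinity>" by (simp add: t(3) emeasure_arclength_segment)
  have lamL: "lam \<in> L2_space arclength e"
    by (rule Linf_edge[OF K e]) (use lam in \<open>simp add: contact_multiplier_def\<close>)
  have lamhL: "lamh \<in> L2_space arclength e" by (rule Linf_edge[OF K e lamh])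
  have dL: "(\<lambda>x. lam x - lamh x) \<in> L2_space arclength e" by (rule L2_space_diff[OF es lamL lamhL])
  note db = dual_norm_bump[OF K t(1,2) e2 c s2 \<rho>0 r \<rho>(1)[unfolded l_def] dL[unfolded t(3)], folded t(3), folded dn_def]
  show "0 \<le> dual_norm T g e (\<lambda>x. lam x - lamh x)" using db(1) by (simp add: dn_def)
  assume fin: "dual_norm T g e (\<lambda>x. lam x - lamh x) \<noteq> \<infinity>"
  define d where "d = real_of_ereal dn"
  have d0: "0 \<le> d" using db(1) by (simp add: d_def real_of_ereal_pos)
  define b1 where "b1 = bump c \<rho>"
  have bcont: "continuous_on e b1" unfolding b1_def by (rule continuous_on_subset[OF bump_props(2)[OF \<rho>0 Os(1)]]) simp
  \<comment> \<open>\<open>lb\<close> is prescribed along the parametrisation; projecting onto the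
    edge recovers the parameter continuously from the point.\<close>
  have lbcont: "continuous_on e lb"
  proof (rule continuous_on_eq)
    show "continuous_on e (\<lambda>x. \<Sum>k\<le>m. cf k * (((x - a') \<bullet> (b' - a')) / l\<^sup>2) ^ k)" using l0 by (intro continuous_intros) auto
    fix x assume "x \<in> e"
    then obtain t where tx: "t \<in> {0..1}" "x = a' + t *\<^sub>R (b' - a')" using seg by blast
    have "((x - a') \<bullet> (b' - a')) / l\<^sup>2 = t" using l0 by (simp add: tx(2) l'[symmetric] dot_square_norm)
    then show "(\<Sum>k\<le>m. cf k * (((x - a') \<bullet> (b' - a')) / l\<^sup>2) ^ k) = lb x" using lbc[OF tx(1)] tx(2) by simp
  qed
  have qcont: "continuous_on e q" unfolding q_def by (intro continuous_intros lbcont)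
  have L2c: "w \<in> L2_space arclength e" if "continuous_on e w" for w :: "real^2 \<Rightarrow> real"
    using L2_space_continuous_arclength[of e w] efin that by (simp add: t(3))
  have bL: "b1 \<in> L2_space arclength e" and lbL: "lb \<in> L2_space arclength e" and qL: "q \<in> L2_space arclength e"
    using L2c bcont lbcont qcont by auto
  have hL: "(\<lambda>x. lamh x - lb x) \<in> L2_space arclength e" by (rule L2_space_diff[OF es lamhL lbL])
  have meas: "measure arclength e = l" using el by (simp add: edge_length_def)
  have bn: "L2_norm arclength e b1 \<le> sqrt l"
    using L2_norm_bounded[OF esM efin, of b1 1] bump_bounds[of c \<rho>] by (simp add: b1_def meas)
  define I where "I \<mu> = (LINT x:e|arclength. \<mu> x * b1 x)" for \<mu> :: "real^2 \<Rightarrow> real"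
  have int: "set_integrable arclength e (\<lambda>x. \<mu> x * b1 x)" if "\<mu> \<in> L2_space arclength e" for \<mu> :: "real^2 \<Rightarrow> real"
    using set_cauchy_schwarz(1)[OF es that bL] by simp
  have Ig: "(LINT x:e|arclength. g * \<mu> x * b1 x) = g * I \<mu>" for \<mu>
    by (simp add: I_def mult.assoc)
  have I1: "I lam = I (\<lambda>x. lam x - lamh x) + I lamh"
    using set_integral_add(2)[OF int[OF dL] int[OF lamhL]] by (simp add: I_def left_diff_distrib)
  have I2: "I lamh = I (\<lambda>x. lamh x - lb x) + I lb"
    using set_integral_add(2)[OF int[OF hL] int[OF lbL]] by (simp add: I_def left_diff_distrib)
  have I3: "I q = \<gamma> * (LINT x:e|arclength. b1 x) + g * I lb"
  proof -
    have "set_integrable arclength e b1" using set_integrable_continuous_edge[of a b b1] bcont by (simp add: t(3))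
    then have "set_integrable arclength e (\<lambda>x. \<gamma> * b1 x)" by (intro set_integrable_mult_right) simp
    moreover have "set_integrable arclength e (\<lambda>x. g * (lb x * b1 x))" using int[OF lbL] by (intro set_integrable_mult_right) simp
    ultimately have "(LINT x:e|arclength. \<gamma> * b1 x + g * (lb x * b1 x)) =
      (LINT x:e|arclength. \<gamma> * b1 x) + (LINT x:e|arclength. g * (lb x * b1 x))" by (rule set_integral_add(2))
    then show ?thesis by (simp add: I_def q_def distrib_right mult.assoc)
  qed
  have C: "1 \<le> C1" by (rule C1_ge[OF K])
  have Hd0: "0 < Hd" by (rule Hd_pos[OF K])
  have Kp: "K \<subseteq> patch T K" by (rule patch_sub[OF K]) (use elem_nonempty[OF K] in simp)
  note tb = terms_bound(1,2)[OF K Kp \<rho>0, of c, folded N_def b1_def]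
  have fK: "\<bar>LINT x:interior K|lebesgue. (f x - uh x) * b1 x\<bar> \<le> 2 * \<rho> * R K"
    unfolding R_def b1_def by (rule terms_bound(3)[OF K Kp \<rho>0 L2_facts(7)[OF K]])
  have rb: "(LINT x:interior K|lebesgue. (Gu x - al K) \<bullet> grad b1 x) + (LINT x:interior K|lebesgue. err x * b1 x)
      + \<gamma> * (LINT x:e|arclength. b1 x) + g * I lam = (LINT x:interior K|lebesgue. (f x - uh x) * b1 x)"
    using residual_boundary[OF K t(1,2) e2 c s2 \<rho>0 r, folded t(3), folded b1_def \<gamma>_def] unfolding Ig .
  have q1: "\<bar>g * I (\<lambda>x. lam x - lamh x)\<bar> \<le> (4 + 2 * \<rho>) * d"
    using db(2) fin Ig[of "\<lambda>x. lam x - lamh x"] by (simp add: dn_def d_def b1_def)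
  have q2: "\<bar>g * I (\<lambda>x. lamh x - lb x)\<bar> \<le> g * (sqrt l * \<Lambda>)"
  proof -
    have "\<bar>I (\<lambda>x. lamh x - lb x)\<bar> \<le> \<Lambda> * L2_norm arclength e b1"
      using set_cauchy_schwarz(3)[OF es hL bL] by (simp add: I_def \<Lambda>_def)
    also have "\<dots> \<le> \<Lambda> * sqrt l" using bn by (intro mult_left_mono) (simp_all add: \<Lambda>_def)
    finally show ?thesis using g by (simp add: abs_mult mult.commute)
  qed
  have NF: "0 \<le> N" "0 \<le> F" "0 \<le> \<Lambda>" using Nrm_nonneg[OF K] osc_nonneg by (auto simp: N_def F_def \<Lambda>_def)
  have hF: "0 \<le> h * F" using NF sh(4) by simp
  have sL: "0 \<le> sqrt l * \<Lambda>" using NF l0 by simp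
  define X where "X = N + d + h * F + sqrt l * \<Lambda>"
  have X: "N + d \<le> X" "N + h * F \<le> X" "sqrt l * \<Lambda> \<le> X" "0 \<le> X" using NF hF sL d0 by (simp_all add: X_def)
  have q3: "\<rho> * R K \<le> C1 * X"
  proof -
    have "\<rho> * R K \<le> h * R K" using \<rho>(2) by (rule mult_right_mono) (simp add: R_def)
    also have "\<dots> \<le> C1 * (N + h * F)"
      using elem_residual[OF K K] elem_nonempty[OF K] by (simp add: h_def N_def F_def)
    also have "\<dots> \<le> C1 * X" using C X(2) by (intro mult_left_mono) auto
    finally show ?thesis .
  qed
  have q4: "(4 + 2 * \<rho>) * (N + d) \<le> (4 + 2 * Hd) * X"
    using X(1) \<rho>(3) Hd0 NF d0 by (intro mult_mono) auto
  have q5: "g * (sqrt l * \<Lambda>) \<le> g * X" using X(3) g by (intro mult_left_mono) auto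
  have Iq: "\<bar>I q\<bar> \<le> (4 + 2 * Hd + 2 * C1 + g) * X"
  proof -
    have e1: "g * I lam = g * I (\<lambda>x. lam x - lamh x) + (g * I (\<lambda>x. lamh x - lb x) + g * I lb)"
      unfolding I1 I2 by (simp add: distrib_left)
    \<comment> \<open>By \<open>rb\<close>, \<open>I3\<close> and \<open>e1\<close> the integral
      \<open>I q\<close> is the pairing of the element residual minus the two error terms and the
      two multiplier terms; the parts 4 N + 2 \<rho> N and (4 + 2 \<rho>) d share their
      factor.\<close>
    have "\<bar>I q\<bar> \<le> 2 * (\<rho> * R K) + (4 + 2 * \<rho>) * (N + d) + g * (sqrt l * \<Lambda>)"
      using rb I3 e1 fK tb q1 q2 by (simp add: distrib_left distrib_right)
    also have "\<dots> \<le> 2 * (C1 * X) + (4 + 2 * Hd) * X + g * X" using q3 q4 q5 by linarith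
    finally show ?thesis by (simp add: algebra_simps)
  qed
  have "M / 2 * \<rho> / 8 \<le> (LINT x:closed_segment a b|arclength. (\<sigma> * q x) * bump c \<rho> x)"
  proof (rule edge_bump_integral_ge[OF ab c s2 \<rho>0 \<rho>(1)[unfolded l_def]])
    show "0 \<le> M / 2" using M0 by simp
    show "set_integrable arclength (closed_segment a b) (\<lambda>x. \<sigma> * q x * bump c \<rho> x)"
      using set_integrable_mult_right[OF int[OF qL], of \<sigma>] by (simp add: mult.assoc t(3) b1_def)
    fix x assume x: "x \<in> closed_segment a b" "dist c x < \<rho>"
    obtain t where tx: "t \<in> {0..1}" "x = a' + t *\<^sub>R (b' - a')" using seg[of x] x(1) t(3) by blast
    have "c - x = (s - t) *\<^sub>R (b' - a')" by (simp add: c_def tx(2) algebra_simps)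
    then have "dist c x = \<bar>t - s\<bar> * l" by (simp add: dist_norm l' abs_minus_commute)
    then have "\<bar>t - s\<bar> * l < \<delta> * l" using x(2) \<rho>(1) by linarith
    then have "\<bar>t - s\<bar> \<le> \<delta>" using l0 by simp
    then show "M / 2 \<le> \<sigma> * q x" using Ms qc[OF tx(1)] tx(2) by simp
  qed
  also have "\<dots> = \<sigma> * I q" by (simp add: I_def t(3) b1_def mult.assoc)
  also have "\<dots> \<le> \<bar>I q\<bar>" using \<sigma> by auto
  finally have "M * \<rho> / 16 \<le> (4 + 2 * Hd + 2 * C1 + g) * X" using Iq by simp
  then have "32 / (kap * \<delta>) * (M * \<rho> / 16) \<le> 32 / (kap * \<delta>) * ((4 + 2 * Hd + 2 * C1 + g) * X)"
    using sh(1) \<delta> by (intro mult_left_mono) auto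
  moreover have "32 / (kap * \<delta>) * (M * \<rho> / 16) = M * l" using sh(1) \<delta> by (simp add: \<rho>_def)
  ultimately have Ml: "M * l \<le> 32 / (kap * \<delta>) * (4 + 2 * Hd + 2 * C1 + g) * X" by (simp only: mult.assoc)
  have ee: "edge_elem T e = K"
  proof -
    have "elems_at T e = {K}" using side_elems(2)[OF K e(1)] e(2) by (simp add: edges2_def)
    then show ?thesis by (simp add: edge_elem_def)
  qed
  have eK: "e \<subseteq> K" unfolding t(2,3) segment_convex_hull by (rule hull_mono) auto
  have nK: "normal K e = nrml a b" using normals(1)[OF t(1)] t(2,3) by simp
  have rf: "res_friction T g uh lamh e x = q x + g * (lamh x - lb x)" if "x \<in> e" for x
    using inner_limit_grad[OF K subsetD[OF eK that]]
    by (simp add: res_friction_def ee nK q_def \<gamma>_def algebra_simps)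
  have ghL: "(\<lambda>x. g * (lamh x - lb x)) \<in> L2_space arclength e" using L2_space_scaleR[OF es hL, of g] by simp
  have "L2_norm arclength e (res_friction T g uh lamh e) = L2_norm arclength e (\<lambda>x. q x + g * (lamh x - lb x))"
    by (rule L2_change_set(2)[OF complete_measure_arclength esM esM L2_space_add[OF es qL ghL], symmetric])
      (auto intro!: AE_I2 simp: indicator_def rf)
  also have "\<dots> \<le> L2_norm arclength e q + L2_norm arclength e (\<lambda>x. g * (lamh x - lb x))" by (rule L2_norm_triangle[OF es qL ghL])
  also have "L2_norm arclength e (\<lambda>x. g * (lamh x - lb x)) = g * \<Lambda>"
    using g unfolding L2_norm_def \<Lambda>_def by (simp add: power_mult_distrib real_sqrt_mult)
  also have "L2_norm arclength e q \<le> M * sqrt l" using L2_norm_bounded[where f = q, OF esM efin qM M0] by (simp add: meas)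
  finally have "sqrt l * L2_norm arclength e (res_friction T g uh lamh e) \<le> sqrt l * (M * sqrt l + g * \<Lambda>)"
    using l0 by (intro mult_left_mono) auto
  also have "\<dots> = M * l + g * (sqrt l * \<Lambda>)" using l0 by (simp add: distrib_left mult.left_commute)
  also have "\<dots> \<le> C3 \<delta> * X" using Ml q5 by (simp add: C3_def distrib_right)
  finally show "sqrt (edge_length e) * L2_norm arclength e (res_friction T g uh lamh e) \<le>
      C3 \<delta> * (Nrm K + real_of_ereal (dual_norm T g e (\<lambda>x. lam x - lamh x)) + diameter K * osc K
        + sqrt (edge_length e) * L2_norm arclength e (\<lambda>x. lamh x - lb x))"
    by (simp add: el X_def N_def d_def dn_def h_def F_def \<Lambda>_def)
qed

text \<open>The sum of the squared parts is at most the square of their sum, with 9 = 3^2 bounding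
  the number of sides. If one of the dual norms is infinite, so is the right-hand side, because C is
  positive and no summand is negative; otherwise the estimate is one between real numbers.\<close>

lemma estimator_bound:
  assumes K: "K \<in> T" and lb: "\<And>e. e \<in> edges2 \<Omega> \<Gamma>1 T \<Longrightarrow> edge_poly m e (lamb e)"
    and \<delta>: "0 < \<delta>" "\<delta> \<le> 1/8"
    and large: "\<And>c. \<exists>M s \<sigma>. (\<forall>t\<in>{0..1}. \<bar>\<Sum>k\<le>m. c k * t ^ k\<bar> \<le> M) \<and> \<delta> \<le> s \<and> s \<le> 1 - \<delta> \<and>
     (\<sigma> = 1 \<or> \<sigma> = -1) \<and> (\<forall>t. \<bar>t - s :: real\<bar> \<le> \<delta> \<longrightarrow> M / 2 \<le> \<sigma> * (\<Sum>k\<le>m. c k * t ^ k))"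
    and C: "C1 + 3 * C2 + 3 * C3 \<delta> \<le> C"
  shows "ereal (estimator \<Omega> \<Gamma>1 T g f uh lamh K) \<le>
         ereal C *
          (ereal (Nrm K)
           + (\<Sum>e\<in>sides K \<inter> edges2 \<Omega> \<Gamma>1 T. dual_norm T g e (\<lambda>x. lam x - lamh x))
           + ereal (diameter K * osc K)
           + ereal (\<Sum>e\<in>sides K \<inter> edges2 \<Omega> \<Gamma>1 T.
               sqrt (edge_length e) * L2_norm arclength e (\<lambda>x. lamh x - lamb e x)))"
proof -
  define S where "S = sides K \<inter> edges2 \<Omega> \<Gamma>1 T"
  define D where "D e = dual_norm T g e (\<lambda>x. lam x - lamh x)" for e
  define \<Lambda> where "\<Lambda> e = sqrt (edge_length e) * L2_norm arclength e (\<lambda>x. lamh x - lamb e x)" for e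
  define h where "h = diameter K"
  note fe = friction_edge_estimate[OF K _ _ lb \<delta> large, folded D_def \<Lambda>_def]
  have Sfin: "finite S" using finite_sides[OF K] by (simp add: S_def)
  have D0: "0 \<le> D e" if "e \<in> S" for e using that fe(1) by (simp add: S_def)
  have h0: "0 < h" using shape_elem(3)[OF K] by (simp add: h_def)
  have k0: "0 < kap" using shape_elem[OF K] by simp
  have Hd0: "0 < Hd" by (rule Hd_pos[OF K])
  have c1: "1 \<le> C1" by (rule C1_ge[OF K])
  have c2: "0 \<le> C2" using k0 Hd0 c1 by (simp add: C2_def)
  have c3: "0 \<le> C3 \<delta>" using k0 Hd0 c1 g \<delta> by (simp add: C3_def)
  have C0: "0 < C" using C c1 c2 c3 by linarith
  have hF: "0 \<le> h * osc K" using h0 osc_nonneg by simp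
  have \<Lambda>0: "0 \<le> \<Lambda> e" for e by (simp add: \<Lambda>_def edge_length_def)
  have "ereal (estimator \<Omega> \<Gamma>1 T g f uh lamh K) \<le>
         ereal C * (ereal (Nrm K) + (\<Sum>e\<in>S. D e) + ereal (h * osc K) + ereal (\<Sum>e\<in>S. \<Lambda> e))"
  proof (cases "\<exists>e\<in>S. D e = \<infinity>")
    case True
    then have "(\<Sum>e\<in>S. D e) = \<infinity>" using Sfin by (simp add: sum_Pinfty)
    then show ?thesis using C0 by simp
  next
    case False
    define d where "d e = real_of_ereal (D e)" for e
    have Dd: "D e = ereal (d e)" if "e \<in> S" for e using D0[OF that] False that by (cases "D e") (auto simp: d_def)
    have d0: "0 \<le> d e" if "e \<in> S" for e using D0[OF that] by (simp add: d_def real_of_ereal_pos)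
    define X where "X = Nrm K + (\<Sum>e\<in>S. d e) + h * osc K + (\<Sum>e\<in>S. \<Lambda> e)"
    have sd: "0 \<le> (\<Sum>e\<in>S. d e)" "0 \<le> (\<Sum>e\<in>S. \<Lambda> e)" using d0 \<Lambda>0 by (auto intro!: sum_nonneg)
    have N0: "0 \<le> Nrm K" by (rule Nrm_nonneg[OF K])
    have X0: "0 \<le> X" and XN: "Nrm K + h * osc K \<le> X" using N0 sd hF by (auto simp: X_def)
    \<comment> \<open>The estimator integrates over the closed triangle, where the values of
      \<open>uh\<close> on the sides are arbitrary; almost every point is interior, and there the
      Laplacian vanishes.\<close>
    have rK: "L2_norm lebesgue K (res_elem f uh) = R K" unfolding R_def
    proof (rule L2_change_set(2)[OF complete_measure_lebesgue Ks(1) _ L2_facts(7)[OF K], symmetric])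
      show "K \<in> sets lebesgue" using elem_closed[OF K] by auto
      show "AE x in lebesgue. indicator (interior K) x *\<^sub>R (f x - uh x) = indicator K x *\<^sub>R res_elem f uh x"
        using AE_interior
      proof eventually_elim
        case (elim x)
        then have "x \<in> K \<longleftrightarrow> x \<in> interior K" using K interior_subset by blast
        then show ?case using uh_grad(2)[OF K, of x] by (simp add: indicator_def res_elem_def)
      qed
    qed
    have hR: "h * R K \<le> C1 * X"
    proof -
      have "h * R K \<le> C1 * (Nrm K + h * osc K)" using elem_residual[OF K K] elem_nonempty[OF K] by (simp add: h_def)
      also have "\<dots> \<le> C1 * X" using c1 XN by (intro mult_left_mono) auto
      finally show ?thesis .
    qed
    have t1: "h\<^sup>2 * (L2_norm lebesgue K (res_elem f uh))\<^sup>2 \<le> (C1 * X)\<^sup>2"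
      unfolding rK power_mult_distrib[symmetric] using hR h0 by (intro power_mono) (simp_all add: R_def)
    have cd: "real (card A) \<le> 9" if "A \<subseteq> sides K" for A
      using card_mono[OF finite_sides[OF K] that] card_sides[OF K] by linarith
    have t2: "(\<Sum>e\<in>sides K \<inter> interior_edges T. edge_length e * (L2_norm arclength e (vjump T e (grad uh)))\<^sup>2) \<le> (3 * C2 * X)\<^sup>2"
    proof -
      have "(\<Sum>e\<in>sides K \<inter> interior_edges T. edge_length e * (L2_norm arclength e (vjump T e (grad uh)))\<^sup>2)
        \<le> real (card (sides K \<inter> interior_edges T)) * (C2 * X)\<^sup>2"
      proof (rule sum_bounded_above)
        fix e assume "e \<in> sides K \<inter> interior_edges T"
        then have "edge_length e * (L2_norm arclength e (vjump T e (grad uh)))\<^sup>2 \<le> (C2 * (Nrm K + h * osc K))\<^sup>2"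
          using interior_edge_estimate[OF K] by (simp add: h_def)
        also have "\<dots> \<le> (C2 * X)\<^sup>2" using c2 XN N0 hF by (intro power_mono mult_left_mono) auto
        finally show "edge_length e * (L2_norm arclength e (vjump T e (grad uh)))\<^sup>2 \<le> (C2 * X)\<^sup>2" .
      qed
      also have "\<dots> \<le> 9 * (C2 * X)\<^sup>2" using cd[of "sides K \<inter> interior_edges T"] by (intro mult_right_mono) auto
      finally show ?thesis by (simp add: power_mult_distrib)
    qed
    have t3: "(\<Sum>e\<in>S. edge_length e * (L2_norm arclength e (res_friction T g uh lamh e))\<^sup>2) \<le> (3 * C3 \<delta> * X)\<^sup>2"
    proof -
      have "(\<Sum>e\<in>S. edge_length e * (L2_norm arclength e (res_friction T g uh lamh e))\<^sup>2) \<le> real (card S) * (C3 \<delta> * X)\<^sup>2"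
      proof (rule sum_bounded_above)
        fix e assume eS: "e \<in> S"
        have le: "d e \<le> (\<Sum>e\<in>S. d e)" "\<Lambda> e \<le> (\<Sum>e\<in>S. \<Lambda> e)"
          using eS Sfin d0 \<Lambda>0 by (auto intro: member_le_sum)
        have "sqrt (edge_length e) * L2_norm arclength e (res_friction T g uh lamh e) \<le> C3 \<delta> * (Nrm K + d e + h * osc K + \<Lambda> e)"
          using fe(2)[of e] eS Dd[OF eS] by (simp add: S_def h_def)
        also have "\<dots> \<le> C3 \<delta> * X" using c3 le by (intro mult_left_mono) (auto simp: X_def)
        finally have "(sqrt (edge_length e) * L2_norm arclength e (res_friction T g uh lamh e))\<^sup>2 \<le> (C3 \<delta> * X)\<^sup>2"
          by (intro power_mono) (auto simp: edge_length_def)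
        then show "edge_length e * (L2_norm arclength e (res_friction T g uh lamh e))\<^sup>2 \<le> (C3 \<delta> * X)\<^sup>2"
          by (simp add: power_mult_distrib edge_length_def)
      qed
      also have "\<dots> \<le> 9 * (C3 \<delta> * X)\<^sup>2" using cd[of S] by (intro mult_right_mono) (auto simp: S_def)
      finally show ?thesis by (simp add: power_mult_distrib)
    qed
    have sq: "x\<^sup>2 + 1/2 * y2 + z\<^sup>2 \<le> (x + y + z)\<^sup>2" if "0 \<le> x" "0 \<le> y" "0 \<le> z" "y2 \<le> y\<^sup>2" for x y z y2 :: real
    proof -
      have "0 \<le> x * y" "0 \<le> x * z" "0 \<le> y * z" "0 \<le> y\<^sup>2" using that by auto
      moreover have "(x + y + z)\<^sup>2 = x\<^sup>2 + y\<^sup>2 + z\<^sup>2 + 2 * (x * y) + 2 * (x * z) + 2 * (y * z)"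
        by (simp add: power2_eq_square algebra_simps)
      ultimately show ?thesis using that(4) by linarith
    qed
    have "h\<^sup>2 * (L2_norm lebesgue K (res_elem f uh))\<^sup>2
      + 1/2 * (\<Sum>e\<in>sides K \<inter> interior_edges T. edge_length e * (L2_norm arclength e (vjump T e (grad uh)))\<^sup>2)
      + (\<Sum>e\<in>S. edge_length e * (L2_norm arclength e (res_friction T g uh lamh e))\<^sup>2)
      \<le> (C1 * X + 3 * C2 * X + 3 * C3 \<delta> * X)\<^sup>2"
      using t1 t3 sq[OF _ _ _ t2, of "C1 * X" "3 * C3 \<delta> * X"] c1 c2 c3 X0 by simp
    also have "\<dots> \<le> (C * X)\<^sup>2"
    proof (rule power_mono)
      have "(C1 + 3 * C2 + 3 * C3 \<delta>) * X \<le> C * X" using C X0 by (rule mult_right_mono)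
      then show "C1 * X + 3 * C2 * X + 3 * C3 \<delta> * X \<le> C * X" by (simp add: distrib_right)
      show "0 \<le> C1 * X + 3 * C2 * X + 3 * C3 \<delta> * X" using c1 c2 c3 X0 by simp
    qed
    finally have "estimator \<Omega> \<Gamma>1 T g f uh lamh K \<le> C * X"
      unfolding estimator_def S_def h_def using C0 X0 by (intro real_le_lsqrt) auto
    moreover have "(\<Sum>e\<in>S. D e) = ereal (\<Sum>e\<in>S. d e)" unfolding sum_ereal[symmetric] by (intro sum.cong refl Dd)
    ultimately show ?thesis by (simp add: X_def)
  qed
  then show ?thesis by (simp only: S_def D_def \<Lambda>_def h_def)
qed

end

theorem theorem4p2:
  fixes \<Omega> \<Gamma>1 :: "(real^2) set" and g \<theta> :: real and m :: nat
  assumes "open \<Omega>" and "connected \<Omega>" and "\<Omega> \<noteq> {}" and "bounded \<Omega>" and "lipschitz_boundary \<Omega>"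
    and "closedin (top_of_set (frontier \<Omega>)) \<Gamma>1"
    and "g > 0" and "\<theta> > 0"
  shows "\<exists>C>0. \<forall>T \<beta> \<eta> f u lam uh lamh lamb.
      admissible_mesh \<Omega> \<Gamma>1 T \<longrightarrow> minimal_angle \<theta> T \<longrightarrow>
      (\<forall>e\<in>edges0 \<Omega> \<Gamma>1 T. \<eta> e > 0) \<longrightarrow>
      f \<in> L2_space lebesgue \<Omega> \<longrightarrow>
      contact_solution \<Omega> \<Gamma>1 g f u \<longrightarrow>
      contact_multiplier \<Omega> \<Gamma>1 g f u lam \<longrightarrow>
      ldg_solution \<Omega> \<Gamma>1 T \<beta> \<eta> g f uh \<longrightarrow>
      ldg_multiplier \<Omega> \<Gamma>1 T \<beta> \<eta> g f uh lamh \<longrightarrow>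
      (\<forall>e\<in>edges2 \<Omega> \<Gamma>1 T. edge_poly m e (lamb e)) \<longrightarrow>
      (\<forall>K\<in>T.
         ereal (estimator \<Omega> \<Gamma>1 T g f uh lamh K) \<le>
         ereal C *
          (ereal (norm1h T (patch T K) (\<lambda>x. u x - uh x))
           + (\<Sum>e\<in>sides K \<inter> edges2 \<Omega> \<Gamma>1 T. dual_norm T g e (\<lambda>x. lam x - lamh x))
           + ereal (diameter K * L2_norm lebesgue (patch T K) (\<lambda>x. f x - data_avg T f x))
           + ereal (\<Sum>e\<in>sides K \<inter> edges2 \<Omega> \<Gamma>1 T.
               sqrt (edge_length e) * L2_norm arclength e (\<lambda>x. lamh x - lamb e x))))"
proof -
  obtain \<delta> :: real where \<delta>: "0 < \<delta>" "\<delta> \<le> 1/8"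
    and large: "\<forall>c. \<exists>M s \<sigma>. (\<forall>t\<in>{0..1}. \<bar>\<Sum>k\<le>m. c k * t ^ k\<bar> \<le> M) \<and> \<delta> \<le> s \<and> s \<le> 1 - \<delta> \<and>
     (\<sigma> = 1 \<or> \<sigma> = -1) \<and> (\<forall>t. \<bar>t - s\<bar> \<le> \<delta> \<longrightarrow> M / 2 \<le> \<sigma> * (\<Sum>k\<le>m. c k * t ^ k))"
    using poly_large_on_interval[of m] by (elim exE conjE) (rule that)
  \<comment> \<open>Outside their locale the constants have only \<Omega>, \<theta>, g and \<delta>
    as parameters, none of which involves the mesh, so that C can be fixed before T.\<close>
  define C0 where "C0 = ldg_mesh.C1 \<Omega> \<theta> + 3 * ldg_mesh.C2 \<Omega> \<theta> + 3 * ldg_mesh.C3 \<Omega> \<theta> g \<delta>"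
  \<comment> \<open>The signs of the constants are derived from an element of a mesh, and none is
    given yet; the modulus makes C positive beforehand.\<close>
  have "0 < 1 + \<bar>C0\<bar>" by simp
  then show ?thesis
  proof (intro exI[of _ "1 + \<bar>C0\<bar>"] conjI allI impI ballI)
    fix T \<beta> \<eta> f u lam uh lamh lamb K
    assume *: "admissible_mesh \<Omega> \<Gamma>1 T" "minimal_angle \<theta> T" "f \<in> L2_space lebesgue \<Omega>"
      "contact_solution \<Omega> \<Gamma>1 g f u" "contact_multiplier \<Omega> \<Gamma>1 g f u lam" "ldg_solution \<Omega> \<Gamma>1 T \<beta> \<eta> g f uh"
      "ldg_multiplier \<Omega> \<Gamma>1 T \<beta> \<eta> g f uh lamh" "\<forall>e\<in>edges2 \<Omega> \<Gamma>1 T. edge_poly m e (lamb e)" "K \<in> T"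
    interpret ldg_mesh \<Omega> \<Gamma>1 T \<theta> g f u lam uh lamh
      by unfold_locales (use assms * in \<open>auto simp: contact_solution_def V_space_def ldg_solution_def ldg_multiplier_def\<close>)
    show "ereal (estimator \<Omega> \<Gamma>1 T g f uh lamh K) \<le>
         ereal (1 + \<bar>C0\<bar>) *
          (ereal (norm1h T (patch T K) (\<lambda>x. u x - uh x))
           + (\<Sum>e\<in>sides K \<inter> edges2 \<Omega> \<Gamma>1 T. dual_norm T g e (\<lambda>x. lam x - lamh x))
           + ereal (diameter K * L2_norm lebesgue (patch T K) (\<lambda>x. f x - data_avg T f x))
           + ereal (\<Sum>e\<in>sides K \<inter> edges2 \<Omega> \<Gamma>1 T.
               sqrt (edge_length e) * L2_norm arclength e (\<lambda>x. lamh x - lamb e x)))"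
      unfolding err_def[abs_def, symmetric] osc_def[symmetric]
      by (rule estimator_bound[OF *(9) _ \<delta> spec[OF large]]) (use *(8) in \<open>auto simp: C0_def\<close>)
  qed
qed

end
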